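(* Let $q\ge1$ be squarefree, $f\in S_2(\Gamma_0(q))$ nonzero, $\alpha=\Re(f(z)dz)$, $\langle r\rangle=2\pi i\int_{i\infty}^r\alpha$ for $r\in\mathbb Q$, and $C_f=-16\pi^2\|f\|^2/\mathrm{vol}(\Gamma_0(q)\backslash\mathbb H)$. Let $d\mid q$, let $I\subseteq\mathbb R/\mathbb Z$ be an interval of positive length, and let $Q_d=\{a/c\in\mathbb Q/\mathbb Z:\ c\ge1,\ (a,c)=1,\ (c,q)=d\}$. Then for every $-\infty\le a_0\le b_0\le\infty$, $$\frac{\#\{a/c\in Q_d\cap I:\ c\le M,\ \langle a/c\rangle/(C_f\log c)^{1/2}\in[a_0,b_0]\}}{\#\{a/c\in Q_d\cap I:\ c\le M\}}\longrightarrow\frac1{\sqrt{2\pi}}\int_{a_0}^{b_0}e^{-t^2/2}\,dt\qquad(M\to\infty).$$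
   Context: $\|f\|^2=\int_{\Gamma_0(q)\backslash\mathbb H}y^2|f(z)|^2\,d\mu(z)$ with $d\mu=dx\,dy/y^2$, and $\mathrm{vol}$ is hyperbolic area. Since $\langle r\rangle\in i\mathbb R$ and $C_f<0$, the ratio $\langle a/c\rangle/(C_f\log c)^{1/2}$ is real (take $(C_f\log c)^{1/2}=i(|C_f|\log c)^{1/2}$). For $f$ a normalized newform, $C_f=-\frac6{\pi^2}\prod_{p\mid q}(1+p^{-1})^{-1}L(\mathrm{sym}^2f,1)$. *)

theory Defs
  imports "HOL-Analysis.Analysis" "HOL-Computational_Algebra.Squarefree"
begin

definition UHP :: "complex set" where
  "UHP = {z. Im z > 0}"

definition SL2Z :: "(int \<times> int \<times> int \<times> int) set" where
  "SL2Z = {(a,b,c,d). a*d - b*c = 1}"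

definition Gamma0 :: "nat \<Rightarrow> (int \<times> int \<times> int \<times> int) set" where
  "Gamma0 q = {(a,b,c,d). (a,b,c,d) \<in> SL2Z \<and> int q dvd c}"

definition moeb :: "int \<times> int \<times> int \<times> int \<Rightarrow> complex \<Rightarrow> complex" where
  "moeb g z = (case g of (a,b,c,d) \<Rightarrow> (of_int a * z + of_int b) / (of_int c * z + of_int d))"

definition jfac :: "int \<times> int \<times> int \<times> int \<Rightarrow> complex \<Rightarrow> complex" where
  "jfac g z = (case g of (a,b,c,d) \<Rightarrow> of_int c * z + of_int d)"

definition cusp_form2 :: "nat \<Rightarrow> (complex \<Rightarrow> complex) \<Rightarrow> bool" where
  "cusp_form2 q f \<longleftrightarrow>
     f holomorphic_on UHP \<and>
     (\<forall>g\<in>Gamma0 q. \<forall>z\<in>UHP. f (moeb g z) = (jfac g z)^2 * f z) \<and>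
     (\<forall>g\<in>SL2Z. \<forall>\<epsilon>>0. \<exists>Y. \<forall>z. Im z > Y \<longrightarrow> norm (f (moeb g z) / (jfac g z)^2) < \<epsilon>)"

definition fund_domain :: "nat \<Rightarrow> complex set \<Rightarrow> bool" where
  "fund_domain q D \<longleftrightarrow>
     D \<subseteq> UHP \<and> D \<in> sets lborel \<and>
     (AE z in lborel. z \<in> UHP \<longrightarrow> (\<exists>g\<in>Gamma0 q. moeb g z \<in> D)) \<and>
     (\<forall>g\<in>Gamma0 q. g \<noteq> (1,0,0,1) \<and> g \<noteq> (-1,0,0,-1) \<longrightarrow> D \<inter> moeb g ` D \<in> null_sets lborel)"

text \<open>Petersson norm squared: integral over D of y^2 |f|^2 d\<mu>, d\<mu> = dx dy / y^2.\<close>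
definition petersson_sq :: "complex set \<Rightarrow> (complex \<Rightarrow> complex) \<Rightarrow> real" where
  "petersson_sq D f = (LINT z:D|lborel. (Im z)^2 * (norm (f z))^2 / (Im z)^2)"

definition hyp_vol :: "complex set \<Rightarrow> real" where
  "hyp_vol D = (LINT z:D|lborel. 1 / (Im z)^2)"

definition C_const :: "complex set \<Rightarrow> (complex \<Rightarrow> complex) \<Rightarrow> real" where
  "C_const D f = - 16 * pi^2 * petersson_sq D f / hyp_vol D"

text \<open>Modular symbol <r> = 2 \<pi> i \<integral>_{i\<infinity>}^r Re(f(z) dz), integrated along the vertical
  path z = r + i t, t from \<infinity> down to 0 (path-independent since f(z)dz is closed).
  On this path Re(f(z)dz) = Re(i f(r+it)) dt = - Im f(r+it) dt, whence
  \<integral>_{\<infinity>}^0 (- Im f(r+it)) dt = \<integral>_0^\<infinity> Im f(r+it) dt.\<close>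
definition modsym :: "(complex \<Rightarrow> complex) \<Rightarrow> real \<Rightarrow> complex" where
  "modsym f r = 2 * pi * \<i> * complex_of_real (LINT t:{0<..}|lborel. Im (f (complex_of_real r + \<i> * complex_of_real t)))"

text \<open>The real number <a/c>/(C_f log c)^(1/2), with (C_f log c)^(1/2) = i (|C_f| log c)^(1/2).\<close>
definition normalized_symbol :: "real \<Rightarrow> (complex \<Rightarrow> complex) \<Rightarrow> real \<Rightarrow> int \<Rightarrow> real" where
  "normalized_symbol C f r c =
     Re (modsym f r / (\<i> * complex_of_real (sqrt (\<bar>C\<bar> * ln (real_of_int c)))))"

text \<open>Q_d \<inter> I with c \<le> M: reduced fractions a/c in Q/Z, represented by 0 \<le> a < c,
  with gcd(c,q) = d and a/c lying in the arc I = J + Z.\<close>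
definition QdI :: "nat \<Rightarrow> nat \<Rightarrow> real set \<Rightarrow> nat \<Rightarrow> (int \<times> int) set" where
  "QdI q d J M = {(a,c). 1 \<le> c \<and> c \<le> int M \<and> 0 \<le> a \<and> a < c \<and> gcd a c = 1 \<and>
       gcd c (int q) = int d \<and> (\<exists>n::int. real_of_int a / real_of_int c + real_of_int n \<in> J)}"

end

theory Submission
  imports Defs "HOL-Probability.Probability" "HOL-Complex_Analysis.Complex_Analysis"
    "HOL-Real_Asymp.Real_Asymp" "HOL-Number_Theory.Cong"
begin

text \<open>
The real symbol of \<open>a/c\<close> is the boundary value at \<open>a/c\<close> of the harmonic function \<open>F = 2 \<pi> Re G\<close>, where
\<open>G' = f\<close> and \<open>G(i\<infinity>) = 0\<close>, and \<open>y |f|\<close> is bounded. For \<open>u = exp(i \<xi> F)\<close> and a smooth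
weight \<open>\<psi>\<close> the horocycle average \<open>\<Phi>(y) = \<integral>\<psi>(x) u(x + iy) dx\<close> satisfies \<open>y\<^sup>2 \<Phi>'' =
- 4 \<pi>\<^sup>2 \<xi>\<^sup>2 \<integral>\<psi> y\<^sup>2|f|\<^sup>2 u\<close> up to a harmless term. Since \<open>u\<close> varies slowly when
\<open>\<xi>\<close> is small, the invariant function \<open>y\<^sup>2|f|\<^sup>2\<close> may be replaced by its mean \<open>V\<close> over the
fundamental domain, whence \<open>\<Phi>(y)\<close> is close to \<open>y\<close> to the power \<open>4 \<pi>\<^sup>2 \<xi>\<^sup>2 V\<close> times
\<open>\<integral>\<psi>\<close>. At height \<open>y = R/M\<^sup>2\<close> nearly every point \<open>x\<close> is within \<open>y\<close> of the
expected number of reduced fractions with denominator at most \<open>M\<close>, and there \<open>F(x + iy)\<close> differs from the symbol by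
\<open>O(1)\<close>. With \<open>\<xi> = t / sqrt(log M)\<close> this gives the characteristic function of the normal law, and Levy's continuity
theorem applies.
\<close>

section \<open>The modular group\<close>

type_synonym mat2 = "int \<times> int \<times> int \<times> int"

fun mat2_mult :: "mat2 => mat2 => mat2" where
 "mat2_mult (a,b,c,d) (a',b',c',d') = (a*a'+b*c', a*b'+b*d', c*a'+d*c', c*b'+d*d')"

fun mat2_inv :: "mat2 => mat2" where
 "mat2_inv (a,b,c,d) = (d,-b,-c,a)"

fun mat2_neg :: "mat2 => mat2" where
 "mat2_neg (a,b,c,d) = (-a,-b,-c,-d)"

lemma mem_SL2Z: "(a,b,c,d) : SL2Z \<longleftrightarrow> a * d - b * c = 1"
 by (simp add: SL2Z_def)

lemma SL2Z_det_of_int: "(a,b,c,d) : SL2Z ==> of_int a * of_int d - of_int b * of_int c = (1 :: 'a::ring_1)"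
 by (metis mem_SL2Z of_int_1 of_int_diff of_int_mult)

lemma SL2Z_one: "(1,0,0,1) : SL2Z" and SL2Z_translation: "(1,n,0,1) : SL2Z" and SL2Z_inversion: "(0,-1,1,0) : SL2Z"
 by (simp_all add: mem_SL2Z)

lemma SL2Z_mult:
 assumes "g : SL2Z" "h : SL2Z"
 shows "mat2_mult g h : SL2Z"
proof (cases g; cases h)
 fix a b c d a' b' c' d'
 assume eq: "g = (a,b,c,d)" "h = (a',b',c',d')"
 have "(a*a'+b*c') * (c*b'+d*d') - (a*b'+b*d') * (c*a'+d*c') = (a*d-b*c)*(a'*d'-b'*c')"
  by (simp add: algebra_simps)
 thus ?thesis using assms by (simp add: eq mem_SL2Z)
qed

lemma SL2Z_inv: "g : SL2Z ==> mat2_inv g : SL2Z" and SL2Z_neg: "g : SL2Z ==> mat2_neg g : SL2Z"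
 by (cases g; simp add: mem_SL2Z algebra_simps)+

lemma SL2Z_of_Gamma0: "g : Gamma0 q ==> g : SL2Z"
 by (auto simp: Gamma0_def)

lemma Gamma0_mult: "g : Gamma0 q ==> h : Gamma0 q ==> mat2_mult g h : Gamma0 q"
 using SL2Z_mult[of g h] by (cases g; cases h) (auto simp: Gamma0_def)

lemma Gamma0_inv: "g : Gamma0 q ==> mat2_inv g : Gamma0 q" and Gamma0_neg: "g : Gamma0 q ==> mat2_neg g : Gamma0 q"
 using SL2Z_inv[of g] SL2Z_neg[of g] by (cases g; auto simp: Gamma0_def)+

lemma mat2_inv_inv [simp]: "mat2_inv (mat2_inv g) = g" and mat2_neg_neg [simp]: "mat2_neg (mat2_neg g) = g"
 by (cases g; simp)+

lemma mat2_neg_neq: "g : SL2Z ==> mat2_neg g ~= g"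
 by (cases g) (auto simp: mem_SL2Z)

lemma mat2_mult_assoc: "mat2_mult (mat2_mult g h) k = mat2_mult g (mat2_mult h k)"
 by (cases g; cases h; cases k) (simp add: algebra_simps)

lemma mat2_mult_one [simp]: "mat2_mult (1,0,0,1) g = g" "mat2_mult g (1,0,0,1) = g"
 by (cases g; simp)+

lemma mat2_mult_inv: "g : SL2Z ==> mat2_mult g (mat2_inv g) = (1,0,0,1)" "g : SL2Z ==> mat2_mult (mat2_inv g) g = (1,0,0,1)"
 by (cases g; simp add: mem_SL2Z algebra_simps)+

lemma bij_betw_mat2_inv: "bij_betw mat2_inv (Gamma0 q) (Gamma0 q)"
 by (rule bij_betwI[where g=mat2_inv]) (auto intro: Gamma0_inv)

lemma same_bottom_row:
 assumes "(a,b,c,d) : SL2Z" "(a',b',c,d) : SL2Z"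
 obtains n where "(a',b',c,d) = mat2_mult (1,n,0,1) (a,b,c,d)"
proof -
 have det: "a*d - b*c = 1" "a'*d - b'*c = 1" using assms by (auto simp: mem_SL2Z)
 define n where "n = a * b' - b * a'"
 have "n * c = a' - a" "n * d = b' - b" using det unfolding n_def by algebra+
 thus ?thesis by (intro that[of n]) simp
qed

lemma jfac_nonzero:
 assumes "g : SL2Z" "z : UHP"
 shows "jfac g z ~= 0"
proof (cases g)
 case (fields a b c d)
 show ?thesis
 proof
  assume "jfac g z = 0"
  hence "Im (of_int c * z + of_int d) = 0" "Re (of_int c * z + of_int d) = 0" by (simp_all add: jfac_def fields)
  hence "c = 0" "d = 0" using assms by (auto simp: UHP_def)
  thus False using assms by (simp add: mem_SL2Z fields)
 qed
qed

lemma moeb_jfac: "moeb (a,b,c,d) z = (of_int a * z + of_int b) / jfac (a,b,c,d) z"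
 by (simp add: moeb_def jfac_def)

lemma jfac_translation [simp]: "jfac (1,n,0,1) z = 1" and jfac_inversion: "jfac (0,-1,1,0) z = z"
 and moeb_translation: "moeb (1,n,0,1) z = z + of_int n" and moeb_one [simp]: "moeb (1,0,0,1) z = z"
 by (simp_all add: jfac_def moeb_def)

lemma moeb_diff:
 assumes "g : SL2Z" "z : UHP" "w : UHP"
 shows "moeb g z - moeb g w = (z - w) / (jfac g z * jfac g w)"
proof (cases g)
 case (fields a b c d)
 have "(of_int a * z + of_int b) * (of_int c * w + of_int d) - (of_int a * w + of_int b) * (of_int c * z + of_int d)
  = (of_int a * of_int d - of_int b * of_int c) * (z - w)"
  by (simp add: algebra_simps)
 also have "... = z - w" using assms(1) SL2Z_det_of_int[of a b c d, where ?'a=complex] by (simp add: fields)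
 finally show ?thesis using assms(2,3) jfac_nonzero[OF assms(1)] by (simp add: moeb_def jfac_def fields divide_simps)
qed

lemma Im_moeb:
 assumes "g : SL2Z" "z : UHP"
 shows "Im (moeb g z) = Im z / (norm (jfac g z))^2"
proof (cases g)
 case (fields a b c d)
 have "Im (moeb g z) = (of_int a * Im z * (of_int c * Re z + of_int d) - (of_int a * Re z + of_int b) * (of_int c * Im z)) / (norm (jfac g z))^2"
  by (simp add: fields moeb_def jfac_def Im_divide cmod_power2)
 also have "of_int a * Im z * (of_int c * Re z + of_int d) - (of_int a * Re z + of_int b) * (of_int c * Im z)
  = (of_int a * of_int d - of_int b * of_int c) * Im z"
  by (simp add: algebra_simps)
 finally show ?thesis using SL2Z_det_of_int[of a b c d, where ?'a=real] assms(1) by (simp add: fields)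
qed

lemma moeb_in_UHP: "g : SL2Z ==> z : UHP ==> moeb g z : UHP"
 using Im_moeb[of g z] jfac_nonzero[of g z] by (simp add: UHP_def)

lemma jfac_mult:
 assumes "h : SL2Z" "z : UHP"
 shows "jfac (mat2_mult g h) z = jfac g (moeb h z) * jfac h z"
 using jfac_nonzero[OF assms] by (cases g; cases h) (simp add: jfac_def moeb_def field_simps)

lemma moeb_mult:
 assumes "g : SL2Z" "h : SL2Z" "z : UHP"
 shows "moeb (mat2_mult g h) z = moeb g (moeb h z)"
proof -
 have nonzero: "jfac h z ~= 0" "jfac g (moeb h z) ~= 0"
  using jfac_nonzero assms moeb_in_UHP by blast+
 obtain a b c d a' b' c' d' where gh: "g = (a,b,c,d)" "h = (a',b',c',d')" by (cases g; cases h) auto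
 have "moeb g (moeb h z) = (of_int a * moeb h z + of_int b) * jfac h z / (jfac g (moeb h z) * jfac h z)"
  using nonzero by (simp add: gh moeb_jfac)
 also have "(of_int a * moeb h z + of_int b) * jfac h z = of_int a * (of_int a' * z + of_int b') + of_int b * jfac h z"
  using nonzero by (simp add: gh moeb_jfac field_simps)
 also have "... = of_int (a*a'+b*c') * z + of_int (a*b'+b*d')"
  by (simp add: gh jfac_def algebra_simps)
 also have "jfac g (moeb h z) * jfac h z = jfac (mat2_mult g h) z"
  by (rule jfac_mult[symmetric]) fact+
 finally show ?thesis by (simp add: gh moeb_jfac)
qed

lemma moeb_inv [simp]:
 assumes "g : SL2Z" "z : UHP"
 shows "moeb g (moeb (mat2_inv g) z) = z" "moeb (mat2_inv g) (moeb g z) = z"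
 using assms moeb_mult[of g "mat2_inv g" z] moeb_mult[of "mat2_inv g" g z] by (simp_all add: SL2Z_inv mat2_mult_inv)

lemma moeb_neg: "moeb (mat2_neg g) z = moeb g z"
proof (cases g)
 case (fields a b c d)
 have "moeb (mat2_neg g) z = (- (of_int a * z + of_int b)) / (- (of_int c * z + of_int d))"
  by (simp add: moeb_def fields add.commute)
 thus ?thesis by (simp only: minus_divide_divide) (simp add: moeb_def fields)
qed

text \<open>For \<open>z\<close> in the upper half plane, this is the hyperbolic ball about \<open>z\<close> of radius \<open>arcosh (1 + \<rho>/2)\<close>.\<close>
definition hyp_ball :: "real => complex => complex set" where
 "hyp_ball \<rho> z = {w. (norm (z - w))^2 < \<rho> * Im z * Im w}"

lemma hyp_ball_sym: "w : hyp_ball \<rho> z \<longleftrightarrow> z : hyp_ball \<rho> w"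
 by (simp add: hyp_ball_def norm_minus_commute mult_ac)

lemma hyp_ball_moeb:
 assumes "g : SL2Z" "z : UHP" "w : UHP"
 shows "moeb g w : hyp_ball \<rho> (moeb g z) \<longleftrightarrow> w : hyp_ball \<rho> z"
proof -
 define j where "j = (norm (jfac g z))^2 * (norm (jfac g w))^2"
 have "j > 0" using jfac_nonzero assms by (simp add: j_def)
 moreover have "(norm (moeb g z - moeb g w))^2 = (norm (z - w))^2 / j"
  by (simp add: moeb_diff[OF assms] norm_divide norm_mult power_divide power_mult_distrib j_def)
 moreover have "\<rho> * Im (moeb g z) * Im (moeb g w) = \<rho> * Im z * Im w / j"
  by (simp add: Im_moeb assms j_def)
 ultimately show ?thesis by (simp add: hyp_ball_def divide_less_cancel)
qed

lemma hyp_ball_bounds: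
 assumes "w : hyp_ball \<rho> z" "z : UHP" "w : UHP" "\<rho> > 0"
 shows "Im w < (2 + \<rho>) * Im z" "Im z < (2 + \<rho>) * Im w" "abs (Re z - Re w) <= (2 + \<rho>) * Im z"
  "norm (z - w) <= (2 + \<rho>) * Im z"
proof -
 have pos: "Im z > 0" "Im w > 0" using assms by (auto simp: UHP_def)
 have near: "(norm (z - w))^2 < \<rho> * Im z * Im w" using assms(1) by (simp add: hyp_ball_def)
 hence "(Im z - Im w)^2 < \<rho> * Im z * Im w"
  using power_mono[OF abs_Im_le_cmod[of "z - w"], of 2] by simp
 hence "Im w * Im w < (2 + \<rho>) * Im z * Im w" "Im z * Im z < (2 + \<rho>) * Im w * Im z"
  using pos by (simp_all add: power2_eq_square algebra_simps) (smt (verit) mult_pos_pos)+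
 thus w_lt: "Im w < (2 + \<rho>) * Im z" and "Im z < (2 + \<rho>) * Im w" using pos by simp_all
 have "(norm (z - w))^2 <= \<rho> * Im z * Im w" using near by simp
 also have "... <= \<rho> * Im z * ((2 + \<rho>) * Im z)" using w_lt pos assms(4) by (intro mult_left_mono) auto
 also have "... <= ((2 + \<rho>) * Im z)^2" using pos assms(4)
  by (simp add: power2_eq_square algebra_simps)
 finally show n: "norm (z - w) <= (2 + \<rho>) * Im z"
  using pos assms(4) by - (rule power2_le_imp_le, auto)
 thus "abs (Re z - Re w) <= (2 + \<rho>) * Im z"
  using abs_Re_le_cmod[of "z - w"] by simp
qed

section \<open>Reduction and orbit counting\<close>

lemma int_between_eq: "{n::int. a <= of_int n & of_int n <= b} = {\<lceil>a\<rceil>..\<lfloor>b\<rfloor>}" for a b :: real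
 by (auto simp: ceiling_le_iff le_floor_iff)

lemma finite_int_between: "finite {n::int. a <= of_int n & of_int n <= b}" for a b :: real
 by (simp add: int_between_eq)

lemma card_int_between_le: "a <= b + 1 ==> real (card {n::int. a <= of_int n & of_int n <= b}) <= b - a + 1" for a b :: real
 using of_int_floor_le[of b] le_of_int_ceiling[of a] by (simp add: int_between_eq) linarith

lemma card_int_between_ge: "b - a - 1 <= real (card {n::int. a <= of_int n & of_int n <= b})" for a b :: real
 using floor_correct[of b] ceiling_correct[of a] by (simp add: int_between_eq) linarith

lemma finite_int_between_restrict:
 fixes a b :: real
 shows "finite {n::int. P n & a <= of_int n & of_int n <= b}" "finite {n::int. P n & a < of_int n & of_int n < b}"
 by (rule finite_subset[OF _ finite_int_between[of a b]], force)+

lemma card_int_between_restrict_le: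
 fixes a b :: real
 assumes "a <= b + 1"
 shows "real (card {n::int. P n & a <= of_int n & of_int n <= b}) <= b - a + 1"
proof -
 have "card {n::int. P n & a <= of_int n & of_int n <= b} <= card {n::int. a <= of_int n & of_int n <= b}"
  by (rule card_mono[OF finite_int_between]) auto
 also have "real ... <= b - a + 1" using assms by (rule card_int_between_le)
 finally show ?thesis by simp
qed

lemma abs_bottom_row_le:
 assumes "norm (of_int c * z + of_int d) <= R" "z : UHP"
 shows "abs (real_of_int c) <= R / Im z"
proof -
 have "abs (Im (of_int c * z + of_int d)) <= R" using assms(1) abs_Im_le_cmod order_trans by blast
 thus ?thesis using assms(2) by (simp add: abs_mult UHP_def field_simps)
qed

lemma finite_lattice_disc:
 assumes "z : UHP"
 shows "finite {(c::int,d::int). norm (of_int c * z + of_int d) <= R}"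
proof -
 let ?box = "%r. {n::int. - r <= of_int n & of_int n <= r}"
 have "{(c::int,d::int). norm (of_int c * z + of_int d) <= R} <= ?box (R / Im z) \<times> ?box (R + R / Im z * norm z)"
 proof
  fix p assume "p : {(c::int,d::int). norm (of_int c * z + of_int d) <= R}"
  then obtain c d where p: "p = (c,d)" and bound: "norm (of_int c * z + of_int d) <= R" by auto
  note c = abs_bottom_row_le[OF bound assms]
  have "norm (of_int d :: complex) <= norm (of_int c * z + of_int d) + norm (of_int c * z)"
   by (metis add_diff_cancel_left' norm_triangle_ineq4)
  also have "... <= R + R / Im z * norm z"
   using bound mult_right_mono[OF c norm_ge_zero[of z]] by (simp add: norm_mult)
  finally show "p : ?box (R / Im z) \<times> ?box (R + R / Im z * norm z)" using c p by (auto simp: abs_le_iff)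
 qed
 thus ?thesis using finite_int_between by (meson finite_SigmaI finite_subset)
qed

lemma minimal_jfac_exists:
 assumes "z : UHP"
 obtains g where "g : SL2Z" "!!h. h : SL2Z ==> norm (jfac g z) <= norm (jfac h z)"
proof -
 define N where "N = {norm (jfac g z) | g. g : SL2Z & norm (jfac g z) <= 1}"
 have "N <= (%(c,d). norm (of_int c * z + of_int d)) ` {(c::int,d::int). norm (of_int c * z + of_int d) <= 1}"
  by (auto simp: N_def jfac_def)
 hence fin: "finite N" using finite_lattice_disc[OF assms, of 1] finite_surj by blast
 have "1 : N" using SL2Z_one by (force simp: N_def)
 hence "Min N : N" using fin Min_in by blast
 then obtain g where g: "g : SL2Z" "norm (jfac g z) <= 1" "norm (jfac g z) = Min N" by (auto simp: N_def)
 have "norm (jfac g z) <= norm (jfac h z)" if "h : SL2Z" for h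
 proof (cases "norm (jfac h z) <= 1")
  case True
  hence "norm (jfac h z) : N" using that unfolding N_def by blast
  thus ?thesis using g(3) fin by simp
 qed (use g(2) in simp)
 thus ?thesis using that g(1) by blast
qed

lemma reduction:
 assumes z: "z : UHP"
 obtains g where "g : SL2Z" "abs (Re (moeb g z)) <= 1/2" "Im (moeb g z) >= 1/2"
proof -
 obtain g where g: "g : SL2Z" and minimal: "!!h. h : SL2Z ==> norm (jfac g z) <= norm (jfac h z)"
  using minimal_jfac_exists[OF z] by blast
 define n where "n = - round (Re (moeb g z))"
 define h where "h = mat2_mult (1,n,0,1) g"
 have h: "h : SL2Z" using SL2Z_mult[OF SL2Z_translation g] by (simp add: h_def)
 have "moeb h z = moeb g z + of_int n"
  using moeb_mult[OF SL2Z_translation g z] by (simp add: h_def moeb_translation)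
 hence Re: "abs (Re (moeb h z)) <= 1/2"
  using of_int_round_abs_le[of "Re (moeb g z)"] by (simp add: n_def abs_minus_commute)
 have "norm (jfac h z) <= norm (jfac (mat2_mult (0,-1,1,0) h) z)"
  using minimal[OF SL2Z_mult[OF SL2Z_inversion h]] jfac_mult[OF g z, of "(1,n,0,1)"] by (simp add: h_def)
 also have "... = norm (moeb h z) * norm (jfac h z)"
  by (simp add: jfac_mult[OF h z] jfac_inversion norm_mult)
 finally have "norm (moeb h z) >= 1" using jfac_nonzero[OF h z] by simp
 hence "1 <= (Re (moeb h z))^2 + (Im (moeb h z))^2"
  by (metis cmod_power2 one_le_power)
 moreover have "(Re (moeb h z))^2 <= (1/2)^2" using Re by (metis abs_le_square_iff abs_numeral abs_divide abs_one)
 ultimately have "(1/2)^2 <= (Im (moeb h z))^2" by (simp add: power2_eq_square)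
 hence "Im (moeb h z) >= 1/2" using moeb_in_UHP[OF h z] by - (rule power2_le_imp_le, auto simp: UHP_def)
 thus ?thesis using that h Re by blast
qed

definition strip :: "real => real => real => complex set" where
 "strip X0 X1 Y = {z. X0 <= Re z & Re z <= X1 & Y <= Im z}"

definition bottom_row :: "mat2 => int \<times> int" where
 "bottom_row g = (case g of (a,b,c,d) => (c,d))"

lemma bottom_row_of_high_point:
 assumes g: "(a,b,c,d) : SL2Z" and z: "z : UHP" and Y: "Y > 0" and high: "Im (moeb (a,b,c,d) z) >= Y"
 shows "norm (of_int c * z + of_int d) <= sqrt (Im z / Y)"
proof -
 have "Im z / (norm (jfac (a,b,c,d) z))^2 >= Y" using high Im_moeb[OF g z] by simp
 hence "(norm (jfac (a,b,c,d) z))^2 <= Im z / Y" using jfac_nonzero[OF g z] Y by (simp add: field_simps)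
 thus ?thesis by (simp add: jfac_def real_le_rsqrt)
qed

lemma card_nonzero_lattice_points_le:
 assumes y: "y >= 1/2" and Y: "0 < Y" and r: "r > 0" "r^2 = y / Y"
  and rows: "!!c. finite (B c)" "!!c. real (card (B c)) <= 2 * r + 1"
 shows "finite (SIGMA c : {c::int. - (r/y) <= of_int c & of_int c <= r/y} - {0}. B c)" (is "finite (Sigma ?C B)")
  and "real (card (SIGMA c : {c::int. - (r/y) <= of_int c & of_int c <= r/y} - {0}. B c)) <= 12 / Y"
proof -
 have fin: "finite ?C" using finite_int_between by simp
 thus "finite (Sigma ?C B)" using rows(1) by blast
 show "real (card (Sigma ?C B)) <= 12 / Y"
 proof (cases "?C = {}")
  case False
  then obtain c where c: "c : ?C" by blast
  hence "1 <= abs (real_of_int c)" by auto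
  hence r_div_y: "r / y >= 1" using c by (auto simp: abs_if split: if_splits)
  hence two_r: "1 <= 2 * r" using y by (simp add: field_simps)
  have "card ?C <= card {c::int. -(r/y) <= of_int c & of_int c <= r/y}"
   by (intro card_mono finite_int_between) auto
  hence card_C: "real (card ?C) <= 3 * (r / y)"
   using card_int_between_le[of "-(r/y)" "r/y"] r_div_y by linarith
  have "real (card (Sigma ?C B)) <= real (card ?C) * (2 * r + 1)"
   using fin rows unfolding card_SigmaI[OF fin ballI[OF rows(1)]] of_nat_sum by (intro sum_bounded_above)
  also have "... <= (3 * (r / y)) * (4 * r)"
   using card_C two_r y r by (intro mult_mono) auto
  also have "... = 12 * r^2 / y" by (simp add: power2_eq_square)
  also have "... = 12 / Y" using r y by (simp add: field_simps)
  finally show ?thesis .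
 next
  case True
  show ?thesis unfolding True using Y by simp
 qed
qed

lemma bottom_rows_of_high_points:
 assumes z: "Im z >= 1/2" and Y: "0 < Y" "Y <= 1"
 obtains P where "finite P" "real (card P) <= 14 / Y" "!!g. g : SL2Z ==> Y <= Im (moeb g z) ==> bottom_row g : P"
proof -
 have z_UHP: "z : UHP" using z by (simp add: UHP_def)
 define r where "r = sqrt (Im z / Y)"
 have r: "r > 0" "r^2 = Im z / Y" using z Y by (auto simp: r_def)
 define B where "B = (%c::int. {d::int. - r - of_int c * Re z <= of_int d & of_int d <= r - of_int c * Re z})"
 define N where "N = (SIGMA c : {c::int. - (r / Im z) <= of_int c & of_int c <= r / Im z} - {0}. B c)"
 have B: "finite (B c)" "real (card (B c)) <= 2 * r + 1" for c
  using finite_int_between card_int_between_le[of "- r - of_int c * Re z" "r - of_int c * Re z"] r by (simp_all add: B_def)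
 note N = card_nonzero_lattice_points_le[where B=B, OF z Y(1) r B, folded N_def]
 show ?thesis
 proof (rule that[of "{(0,1),(0,-1)} \<union> N"])
  have "real (card ({(0,1),(0,-1)} \<union> N)) <= 2 + 12 / Y"
   using card_Un_le[of "{(0,1),(0,-1)}" N] N(2) by (simp add: card_insert_if)
  thus "real (card ({(0,1),(0,-1)} \<union> N)) <= 14 / Y" using Y by (simp add: field_simps)
  fix g assume g: "g : SL2Z" "Y <= Im (moeb g z)"
  obtain a b c d where f: "g = (a,b,c,d)" by (cases g)
  have j: "norm (of_int c * z + of_int d) <= r"
   unfolding r_def by (rule bottom_row_of_high_point[OF _ z_UHP Y(1)]) (use g f in auto)
  have d: "abs (of_int c * Re z + of_int d) <= r"
   using j abs_Re_le_cmod[of "of_int c * z + of_int d"] by simp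
  show "bottom_row g : {(0,1),(0,-1)} \<union> N"
  proof (cases "c = 0")
   case True
   hence "a * d = 1" using g by (simp add: mem_SL2Z f)
   hence "d = 1 \<or> d = -1" by (metis mult.commute zmult_eq_1_iff)
   thus ?thesis using True by (auto simp: bottom_row_def f)
  next
   case False
   thus ?thesis using abs_bottom_row_le[OF j z_UHP] d by (auto simp: bottom_row_def f N_def B_def abs_le_iff)
  qed
 qed (use N(1) in simp)
qed

lemma same_bottom_row_orbit_count:
 assumes z: "z : UHP" and X: "X0 <= X1"
 shows "finite {g\<in>SL2Z. moeb g z : strip X0 X1 Y & bottom_row g = p}" (is "finite ?A")
  and "real (card {g\<in>SL2Z. moeb g z : strip X0 X1 Y & bottom_row g = p}) <= X1 - X0 + 1"
proof -
 have "finite ?A & real (card ?A) <= X1 - X0 + 1"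
 proof (cases "?A = {}")
  case False
  then obtain h where h: "h : ?A" by blast
  obtain a0 b0 c d where f: "h = (a0,b0,c,d)" by (cases h)
  let ?x = "Re (moeb h z)"
  let ?N = "{n::int. X0 - ?x <= of_int n & of_int n <= X1 - ?x}"
  have "?A <= (%n. mat2_mult (1,n,0,1) h) ` ?N"
  proof
   fix g assume g: "g : ?A"
   obtain a b where fg: "g = (a,b,c,d)" using g h f by (cases g) (auto simp: bottom_row_def)
   have "(a0,b0,c,d) : SL2Z" "(a,b,c,d) : SL2Z" using g h f fg by auto
   then obtain n where n: "g = mat2_mult (1,n,0,1) h" using same_bottom_row unfolding f fg by metis
   have "moeb g z = moeb h z + of_int n"
    unfolding n using moeb_mult[OF SL2Z_translation _ z, of h] h by (simp add: moeb_translation)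
   hence "n : ?N" using g by (auto simp: strip_def)
   thus "g : (%n. mat2_mult (1,n,0,1) h) ` ?N" using n by blast
  qed
  hence "finite ?A" "card ?A <= card ?N"
   using finite_int_between finite_surj surj_card_le by blast+
  moreover have "real (card ?N) <= X1 - X0 + 1" using card_int_between_le[of "X0 - ?x" "X1 - ?x"] X by simp
  ultimately show ?thesis by simp
 next
  case True
  show ?thesis unfolding True using X by simp
 qed
 thus "finite ?A" "real (card ?A) <= X1 - X0 + 1" by blast+
qed

lemma orbit_count_reduced:
 assumes z: "Im z >= 1/2" and Y: "0 < Y" "Y <= 1" and X: "X0 <= X1"
 shows "finite {g\<in>SL2Z. moeb g z : strip X0 X1 Y}" (is "finite ?A")
  and "real (card {g\<in>SL2Z. moeb g z : strip X0 X1 Y}) <= 14 * (X1 - X0 + 1) / Y"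
proof -
 have z_UHP: "z : UHP" using z by (simp add: UHP_def)
 obtain P where P: "finite P" "real (card P) <= 14 / Y" "!!g. g : SL2Z ==> Y <= Im (moeb g z) ==> bottom_row g : P"
  using bottom_rows_of_high_points[OF z Y] by blast
 define fib where "fib = (%p. {g\<in>SL2Z. moeb g z : strip X0 X1 Y & bottom_row g = p})"
 have fibre_card: "finite (fib p)" "real (card (fib p)) <= X1 - X0 + 1" for p
  unfolding fib_def by (rule same_bottom_row_orbit_count[OF z_UHP X])+
 have A: "?A = (\<Union>p\<in>P. fib p)" using P(3) by (auto simp: fib_def strip_def)
 show "finite ?A" unfolding A using P(1) fibre_card(1) by blast
 have "card ?A <= (\<Sum>p\<in>P. card (fib p))" unfolding A by (rule card_UN_le[OF P(1)])
 hence "real (card ?A) <= (\<Sum>p\<in>P. real (card (fib p)))" by (simp flip: of_nat_sum)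
 also have "... <= real (card P) * (X1 - X0 + 1)" by (rule sum_bounded_above) (rule fibre_card(2))
 also have "... <= 14 / Y * (X1 - X0 + 1)" using P(2) X by (intro mult_right_mono) auto
 finally show "real (card ?A) <= 14 * (X1 - X0 + 1) / Y" by simp
qed

lemma orbit_count:
 assumes z: "z : UHP" and Y: "0 < Y" "Y <= 1" and X: "X0 <= X1"
 shows "finite {g\<in>SL2Z. moeb g z : strip X0 X1 Y}"
  and "real (card {g\<in>SL2Z. moeb g z : strip X0 X1 Y}) <= 14 * (X1 - X0 + 1) / Y"
proof -
 obtain s where s: "s : SL2Z" "Im (moeb s z) >= 1/2" using reduction[OF z] by blast
 define w where "w = moeb s z"
 let ?A = "%z. {g\<in>SL2Z. moeb g z : strip X0 X1 Y}"
 have sub: "?A z <= (%g. mat2_mult g s) ` ?A w"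
 proof
  fix g assume g: "g : ?A z"
  have "g = mat2_mult (mat2_mult g (mat2_inv s)) s" using s by (simp add: mat2_mult_assoc mat2_mult_inv)
  moreover have "mat2_mult g (mat2_inv s) : ?A w"
   using g s z moeb_mult[of g "mat2_inv s" w] moeb_in_UHP SL2Z_inv SL2Z_mult by (simp add: w_def)
  ultimately show "g : (%g. mat2_mult g s) ` ?A w" by blast
 qed
 note count = orbit_count_reduced[OF s(2) Y X, folded w_def]
 show "finite (?A z)" using finite_surj[OF count(1) sub] .
 show "real (card (?A z)) <= 14 * (X1 - X0 + 1) / Y" using surj_card_le[OF count(1) sub] count(2) by linarith
qed

definition bottom_row_mod :: "nat => mat2 => int \<times> int" where
 "bottom_row_mod q g = (case g of (a,b,c,d) => (c mod int q, d mod int q))"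

lemma bottom_row_mod_eq_imp_coset:
 assumes "g : SL2Z" "h : SL2Z" "bottom_row_mod q g = bottom_row_mod q h"
 shows "mat2_mult g (mat2_inv h) : Gamma0 q"
proof -
 obtain a b c d a' b' c' d' where gh: "g = (a,b,c,d)" "h = (a',b',c',d')" by (cases g; cases h) auto
 have "c mod int q = c' mod int q" "d mod int q = d' mod int q" using assms(3) by (auto simp: bottom_row_mod_def gh)
 hence "int q dvd c - c'" "int q dvd d - d'" by (metis mod_eq_dvd_iff)+
 hence "int q dvd (c - c') * d' - (d - d') * c'" by simp
 also have "(c - c') * d' - (d - d') * c' = c*d' - d*c'" by (simp add: algebra_simps)
 finally show ?thesis using SL2Z_mult[OF assms(1) SL2Z_inv[OF assms(2)]] by (simp add: gh Gamma0_def)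
qed

lemma finite_coset_reps:
 assumes "q >= 1"
 obtains R where "finite R" "R <= SL2Z" "!!g. g : SL2Z ==> EX r:R. mat2_mult g (mat2_inv r) : Gamma0 q"
proof -
 let ?rows = "bottom_row_mod q ` SL2Z"
 have "?rows <= {0..<int q} \<times> {0..<int q}" using assms by (auto simp: bottom_row_mod_def)
 hence fin: "finite ?rows" by (rule finite_subset) simp
 define rep where "rep = inv_into SL2Z (bottom_row_mod q)"
 have rep: "rep k : SL2Z" "bottom_row_mod q (rep k) = k" if "k : ?rows" for k
  using inv_into_into[OF that] f_inv_into_f[OF that] by (simp_all add: rep_def)
 show ?thesis
 proof (rule that[of "rep ` ?rows"])
  fix g assume "g : SL2Z"
  thus "EX r:rep ` ?rows. mat2_mult g (mat2_inv r) : Gamma0 q"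
   using rep by (intro bexI[of _ "rep (bottom_row_mod q g)"] bottom_row_mod_eq_imp_coset) auto
 qed (use fin rep in blast)+
qed

section \<open>Hyperbolic measure\<close>

definition hyp_measure :: "complex measure" where
 "hyp_measure = density lborel (%z. indicator UHP z * ennreal (1 / (Im z)^2))"

lemma UHP_borel [measurable]: "UHP : sets borel"
 by (simp add: UHP_def borel_open open_halfspace_Im_gt)

lemma strip_borel [measurable]: "strip X0 X1 Y : sets borel"
 unfolding strip_def by (intro borel_closed closed_Collect_conj closed_Collect_le continuous_intros)

lemma hyp_ball_borel [measurable]: "hyp_ball \<rho> z : sets borel"
 unfolding hyp_ball_def by (intro borel_open open_Collect_less continuous_intros)

lemma sets_hyp_measure [simp, measurable_cong]: "sets hyp_measure = sets borel" and space_hyp_measure [simp]: "space hyp_measure = UNIV"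
 by (simp_all add: hyp_measure_def)

lemma nn_integral_hyp_lborel:
 "P : borel_measurable borel ==> nn_integral hyp_measure P = (\<integral>\<^sup>+z. indicator UHP z * ennreal (1 / (Im z)^2) * P z \<partial>lborel)"
 unfolding hyp_measure_def by (rule nn_integral_density) simp_all

lemma AE_hyp_UHP: "AE z in hyp_measure. z : UHP"
 unfolding hyp_measure_def by (subst AE_density) (auto simp: indicator_def)

lemma nn_integral_hyp_cong: "(!!z. z : UHP ==> P z = Q z) ==> nn_integral hyp_measure P = nn_integral hyp_measure Q"
 and nn_integral_hyp_mono: "(!!z. z : UHP ==> P z <= Q z) ==> nn_integral hyp_measure P <= nn_integral hyp_measure Q"
 by (auto intro!: nn_integral_cong_AE nn_integral_mono_AE eventually_mono[OF AE_hyp_UHP])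

lemma lborel_complex: "distr (lborel \<Otimes>\<^sub>M lborel) borel (%(x,y). Complex x y) = lborel"
proof (rule lborel_eqI[symmetric])
 have [measurable]: "(%(x,y). Complex x y) : borel_measurable (lborel \<Otimes>\<^sub>M lborel)"
  unfolding Complex_eq by measurable
 fix l u :: complex assume lu: "!!b. b : Basis ==> l \<bullet> b <= u \<bullet> b"
 have l_le_u: "Re l <= Re u" "Im l <= Im u" using lu[of 1] lu[of \<i>] by (auto simp: Basis_complex_def)
 have preimage: "(%(x,y). Complex x y) -` box l u \<inter> space (lborel \<Otimes>\<^sub>M lborel) = {Re l<..<Re u} \<times> {Im l<..<Im u}"
  by (auto simp: in_box_complex_iff space_pair_measure)
 have "emeasure (distr (lborel \<Otimes>\<^sub>M lborel) borel (%(x,y). Complex x y)) (box l u)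
   = emeasure (lborel \<Otimes>\<^sub>M lborel) ({Re l<..<Re u} \<times> {Im l<..<Im u})"
  by (subst emeasure_distr) (simp_all add: preimage)
 also have "... = ennreal (Re u - Re l) * ennreal (Im u - Im l)"
  using l_le_u by (subst lborel.emeasure_pair_measure_Times) auto
 also have "... = ennreal (\<Prod>b\<in>Basis. (u - l) \<bullet> b)"
  using l_le_u by (simp add: Basis_complex_def ennreal_mult)
 finally show "emeasure (distr (lborel \<Otimes>\<^sub>M lborel) borel (%(x,y). Complex x y)) (box l u) = ennreal (\<Prod>b\<in>Basis. (u - l) \<bullet> b)" .
qed simp

lemma Complex_measurable [measurable (raw)]:
 assumes [measurable]: "f : borel_measurable M" "g : borel_measurable M"
 shows "(%x. Complex (f x) (g x)) : borel_measurable M"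
 unfolding Complex_eq by measurable

lemma nn_integral_lborel_complex:
 assumes [measurable]: "P : borel_measurable borel"
 shows "nn_integral lborel P = (\<integral>\<^sup>+y. \<integral>\<^sup>+x. P (Complex x y) \<partial>lborel \<partial>lborel)"
proof -
 have "nn_integral lborel P = (\<integral>\<^sup>+p. P (case p of (x,y) => Complex x y) \<partial>(lborel \<Otimes>\<^sub>M lborel))"
  by (subst lborel_complex[symmetric], rule nn_integral_distr) measurable
 also have "... = (\<integral>\<^sup>+y. \<integral>\<^sup>+x. P (case (x,y) of (x,y) => Complex x y) \<partial>lborel \<partial>lborel)"
  by (rule lborel_pair.nn_integral_snd[symmetric]) measurable
 finally show ?thesis by simp
qed

lemma integral_lborel_complex:
 fixes k :: "complex => real"
 assumes int: "integrable lborel k"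
 shows "(LBINT z. k z) = (LBINT y. LBINT x. k (Complex x y))"
proof -
 have [measurable]: "k : borel_measurable borel" using borel_measurable_integrable[OF int] by simp
 have "integrable (distr (lborel \<Otimes>\<^sub>M lborel) borel (%(x,y). Complex x y)) k" using int by (simp add: lborel_complex)
 hence "integrable (lborel \<Otimes>\<^sub>M lborel) (%(x,y). k (Complex x y))"
  by (subst (asm) integrable_distr_eq) (auto simp: case_prod_unfold)
 moreover have "(LBINT z. k z) = (LINT p|(lborel \<Otimes>\<^sub>M lborel). k (case p of (x,y) => Complex x y))"
  by (subst lborel_complex[symmetric], rule integral_distr) measurable
 ultimately show ?thesis using lborel_pair.integral_snd[of "%x y. k (Complex x y)"] by (simp add: case_prod_unfold)
qed

lemma nn_integral_hyp:
 assumes [measurable]: "P : borel_measurable borel"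
 shows "nn_integral hyp_measure P = (\<integral>\<^sup>+y. indicator {0<..} y * ennreal (1 / y^2) * (\<integral>\<^sup>+x. P (Complex x y) \<partial>lborel) \<partial>lborel)"
proof -
 have "nn_integral hyp_measure P = (\<integral>\<^sup>+y. \<integral>\<^sup>+x. indicator UHP (Complex x y) * ennreal (1 / (Im (Complex x y))^2) * P (Complex x y) \<partial>lborel \<partial>lborel)"
  by (subst nn_integral_hyp_lborel, simp, rule nn_integral_lborel_complex) measurable
 also have "... = (\<integral>\<^sup>+y. \<integral>\<^sup>+x. indicator {0<..} y * ennreal (1 / y^2) * P (Complex x y) \<partial>lborel \<partial>lborel)"
  by (intro nn_integral_cong) (simp add: UHP_def indicator_def)
 finally show ?thesis by (simp add: nn_integral_cmult)
qed

lemma nn_integral_incseq_indicator: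
 assumes "f : borel_measurable M" "incseq A" "range A <= sets M"
 shows "(\<integral>\<^sup>+x. f x * indicator (\<Union>n. A n) x \<partial>M) = (SUP n. \<integral>\<^sup>+x. f x * indicator (A n) x \<partial>M)"
 using SUP_emeasure_incseq[of A "density M f"] assms by (simp add: emeasure_density image_subset_iff)

lemma nn_integral_exp:
 fixes h :: "real => ennreal"
 assumes [measurable]: "h : borel_measurable borel"
 shows "(\<integral>\<^sup>+y. indicator {0<..} y * ennreal (1 / y) * h y \<partial>lborel) = (\<integral>\<^sup>+l. h (exp l) \<partial>lborel)"
proof -
 define A where "A = (%n. {- real (Suc n)..real (Suc n)})"
 define E where "E = (%n. {exp (- real (Suc n))..exp (real (Suc n))})"
 have UN_A: "(\<Union>n. A n) = UNIV"
 proof -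
  have "x : (\<Union>n. A n)" for x
  proof -
   obtain n where "abs x <= real n" using real_arch_simple by blast
   hence "x : A n" unfolding A_def by auto
   thus ?thesis by blast
  qed
  thus ?thesis by blast
 qed
 have UN_E: "(\<Union>n. E n) = {0<..}"
 proof (intro equalityI subsetI)
  fix y :: real assume y: "y : {0<..}"
  obtain n where "ln y : A n" using UN_A by blast
  hence "- real (Suc n) <= ln y" "ln y <= real (Suc n)" by (simp_all add: A_def)
  hence "exp (- real (Suc n)) <= y" "y <= exp (real (Suc n))" using y by (metis exp_le_cancel_iff exp_ln greaterThan_iff)+
  hence "y : E n" by (simp add: E_def)
  thus "y : (\<Union>n. E n)" by blast
 qed (auto simp: E_def intro: less_le_trans[OF exp_gt_zero])
 have cancel: "ennreal (1 / exp l) * t * ennreal (exp l) = t" for l t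
  using ennreal_mult[of "1 / exp l" "exp l"] by (simp add: mult.commute[of _ t] mult.assoc)
 have piece: "(\<integral>\<^sup>+y. ennreal (1 / y) * h y * indicator (E n) y \<partial>lborel) = (\<integral>\<^sup>+l. h (exp l) * indicator (A n) l \<partial>lborel)" for n
 proof -
  have "(\<integral>\<^sup>+y. ennreal (1 / y) * h y * indicator (E n) y \<partial>lborel)
    = (\<integral>\<^sup>+l. ennreal (1 / exp l) * h (exp l) * ennreal (exp l) * indicator (A n) l \<partial>lborel)"
   unfolding E_def A_def by (rule nn_integral_substitution_aux) (auto intro!: derivative_eq_intros continuous_intros)
  thus ?thesis by (simp only: cancel)
 qed
 have "(\<integral>\<^sup>+y. indicator {0<..} y * ennreal (1 / y) * h y \<partial>lborel) = (\<integral>\<^sup>+y. ennreal (1 / y) * h y * indicator (\<Union>n. E n) y \<partial>lborel)"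
  by (simp add: UN_E mult_ac)
 also have "... = (SUP n. \<integral>\<^sup>+y. ennreal (1 / y) * h y * indicator (E n) y \<partial>lborel)"
  by (rule nn_integral_incseq_indicator) (auto simp: E_def incseq_def)
 also have "... = (\<integral>\<^sup>+l. h (exp l) * indicator (\<Union>n. A n) l \<partial>lborel)"
  unfolding piece by (rule nn_integral_incseq_indicator[symmetric]) (auto simp: A_def incseq_def)
 finally show ?thesis by (simp add: UN_A)
qed

lemma nn_integral_hyp_polar:
 assumes [measurable]: "P : borel_measurable borel"
 shows "nn_integral hyp_measure P = (\<integral>\<^sup>+l. \<integral>\<^sup>+m. P (Complex (exp l * m) (exp l)) \<partial>lborel \<partial>lborel)"
proof -
 have scale: "indicator {0<..} y * ennreal (1 / y^2) * (\<integral>\<^sup>+x. P (Complex x y) \<partial>lborel)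
    = indicator {0<..} y * ennreal (1 / y) * (\<integral>\<^sup>+m. P (Complex (y * m) y) \<partial>lborel)" for y
 proof (cases "y > 0")
  case True
  have "(\<integral>\<^sup>+x. P (Complex x y) \<partial>lborel) = ennreal (abs y) * (\<integral>\<^sup>+m. P (Complex (0 + y * m) y) \<partial>lborel)"
   by (rule nn_integral_real_affine) (use True in auto)
  moreover have "ennreal (1 / y^2) * ennreal y = ennreal (1 / y)"
   using True by (subst ennreal_mult[symmetric]) (auto simp: power2_eq_square)
  ultimately show ?thesis using True by (simp add: mult.assoc[symmetric])
 qed simp
 have "nn_integral hyp_measure P = (\<integral>\<^sup>+y. indicator {0<..} y * ennreal (1 / y) * (\<integral>\<^sup>+m. P (Complex (y * m) y) \<partial>lborel) \<partial>lborel)"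
  by (simp only: nn_integral_hyp[OF assms] scale)
 also have "... = (\<integral>\<^sup>+l. \<integral>\<^sup>+m. P (Complex (exp l * m) (exp l)) \<partial>lborel \<partial>lborel)"
  by (rule nn_integral_exp) measurable
 finally show ?thesis .
qed

lemma nn_integral_lborel_reflect:
 fixes h :: "real => ennreal"
 assumes "h : borel_measurable borel"
 shows "(\<integral>\<^sup>+x. h (t - x) \<partial>lborel) = nn_integral lborel h" "(\<integral>\<^sup>+x. h (x + t) \<partial>lborel) = nn_integral lborel h"
 using nn_integral_real_affine[OF assms, of "-1" t] nn_integral_real_affine[OF assms, of 1 t]
 by (simp_all add: add.commute)

lemma hyp_translate:
 assumes [measurable]: "P : borel_measurable borel"
 shows "(\<integral>\<^sup>+z. P (z + of_real b) \<partial>hyp_measure) = nn_integral hyp_measure P"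
proof -
 have "Complex x y + of_real b = Complex (x + b) y" for x y by (simp add: complex_eq_iff)
 thus ?thesis
  by (simp add: nn_integral_hyp nn_integral_lborel_reflect(2)[of "%x. P (Complex x _)"])
qed

lemma hyp_scale:
 assumes [measurable]: "P : borel_measurable borel" and "k > 0"
 shows "(\<integral>\<^sup>+z. P (of_real k * z) \<partial>hyp_measure) = nn_integral hyp_measure P"
proof -
 have "of_real k * Complex (exp l * m) (exp l) = Complex (exp (l + ln k) * m) (exp (l + ln k))" for l m
  using assms(2) by (simp add: complex_eq_iff exp_add)
 thus ?thesis
  by (simp add: nn_integral_hyp_polar nn_integral_lborel_reflect(2)[of "%l. \<integral>\<^sup>+m. P (Complex (exp l * m) (exp l)) \<partial>lborel"])
qed

lemma inversion_polar:
 defines "l' == %m l. - ln (1 + m^2) - l"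
 shows "- 1 / Complex (exp l * m) (exp l) = Complex (exp (l' m l) * (- m)) (exp (l' m l))"
proof -
 have pos: "1 + m^2 > 0" by (simp add: add_pos_nonneg)
 hence exp: "exp (l' m l) = 1 / ((1 + m^2) * exp l)"
  by (simp add: l'_def exp_diff exp_minus field_simps)
 have norm: "(exp l * m)^2 + (exp l)^2 = exp l * (exp l * (1 + m^2))" by (simp add: algebra_simps power2_eq_square)
 have "exp l * m / (exp l * (exp l * (1 + m^2))) = m / ((1 + m^2) * exp l)"
  "exp l / (exp l * (exp l * (1 + m^2))) = 1 / ((1 + m^2) * exp l)"
  using pos by simp_all
 thus ?thesis unfolding exp by (simp add: complex_eq_iff Re_divide Im_divide norm)
qed

text \<open>In the coordinates \<open>z = e\<^sup>l (m + i)\<close> the inversion is the shear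
  \<open>(m, l) \<mapsto> (-m, -l - ln (1 + m\<^sup>2))\<close>.\<close>
lemma hyp_inversion:
 assumes [measurable]: "P : borel_measurable borel"
 shows "(\<integral>\<^sup>+z. P (- 1 / z) \<partial>hyp_measure) = nn_integral hyp_measure P"
proof -
 define H where "H = (%m l. P (Complex (exp l * m) (exp l)))"
 have [measurable]: "H m : borel_measurable borel" "(%m. \<integral>\<^sup>+l. H m l \<partial>lborel) : borel_measurable borel" for m
  unfolding H_def by measurable
 have "(\<integral>\<^sup>+z. P (- 1 / z) \<partial>hyp_measure) = (\<integral>\<^sup>+l. \<integral>\<^sup>+m. H (-m) (- ln (1 + m^2) - l) \<partial>lborel \<partial>lborel)"
  by (subst nn_integral_hyp_polar) (measurable, simp only: inversion_polar H_def)
 also have "... = (\<integral>\<^sup>+m. \<integral>\<^sup>+l. H (-m) (- ln (1 + m^2) - l) \<partial>lborel \<partial>lborel)"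
  unfolding H_def by (intro lborel_pair.Fubini') measurable
 also have "... = (\<integral>\<^sup>+m. \<integral>\<^sup>+l. H (0 - m) l \<partial>lborel \<partial>lborel)"
  by (simp add: nn_integral_lborel_reflect(1))
 also have "... = (\<integral>\<^sup>+m. \<integral>\<^sup>+l. H m l \<partial>lborel \<partial>lborel)"
  by (rule nn_integral_lborel_reflect(1)[of "%m. \<integral>\<^sup>+l. H m l \<partial>lborel"]) measurable
 also have "... = (\<integral>\<^sup>+l. \<integral>\<^sup>+m. H m l \<partial>lborel \<partial>lborel)"
  unfolding H_def by (intro lborel_pair.Fubini') measurable
 also have "... = nn_integral hyp_measure P"
  by (subst nn_integral_hyp_polar) (simp_all add: H_def)
 finally show ?thesis .
qed

lemma moeb_measurable [measurable]: "moeb g : borel_measurable borel"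
 by (cases g) (simp add: moeb_def[abs_def])

lemma moeb_as_inversion:
 assumes "(a,b,c,d) : SL2Z" "c ~= 0" "z : UHP"
 shows "moeb (a,b,c,d) z = of_real (1 / (of_int c)^2) * (- 1 / (z + of_real (of_int d / of_int c))) + of_real (of_int a / of_int c)"
proof -
 have nonzero: "of_int c * z + of_int d ~= 0" "(of_int c :: complex) ~= 0"
  using jfac_nonzero[OF assms(1,3)] assms(2) by (simp_all add: jfac_def)
 have "of_real (1 / (of_int c)^2) * (- 1 / (z + of_real (of_int d / of_int c))) + of_real (of_int a / of_int c)
  = of_int a / of_int c - 1 / (of_int c * (of_int c * z + of_int d))"
  using nonzero by (simp add: power2_eq_square distrib_left)
 also have "... = (of_int a * (of_int c * z + of_int d) - 1) / (of_int c * (of_int c * z + of_int d))"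
  using nonzero by (simp add: diff_divide_distrib)
 also have "of_int a * (of_int c * z + of_int d) - 1 = of_int c * (of_int a * z + of_int b)"
  using SL2Z_det_of_int[OF assms(1), where ?'a=complex] by (simp add: algebra_simps)
 finally show ?thesis using nonzero by (simp add: moeb_def)
qed

lemma hyp_moeb:
 assumes g: "g : SL2Z" and P [measurable]: "P : borel_measurable borel"
 shows "(\<integral>\<^sup>+z. P (moeb g z) \<partial>hyp_measure) = nn_integral hyp_measure P"
proof (cases g)
 case (fields a b c d)
 show ?thesis
 proof (cases "c = 0")
  case True
  hence "a * d = 1" using g by (simp add: mem_SL2Z fields)
  hence "a = 1 & d = 1 \<or> a = -1 & d = -1" by (rule zmult_eq_1_iff[THEN iffD1])
  hence "moeb g z = z + of_real (of_int (a*b))" for z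
   using True by (auto simp: moeb_def fields)
  thus ?thesis using hyp_translate[OF P, of "of_int (a*b)"] by simp
 next
  case False
  let ?P1 = "%w. P (w + of_real (of_int a / of_int c))"
  let ?P2 = "%w. ?P1 (of_real (1 / (of_int c)^2) * w)"
  have "(\<integral>\<^sup>+z. P (moeb g z) \<partial>hyp_measure) = (\<integral>\<^sup>+z. ?P2 (- 1 / (z + of_real (of_int d / of_int c))) \<partial>hyp_measure)"
   by (rule nn_integral_hyp_cong) (use moeb_as_inversion g False fields in simp)
  also have "... = (\<integral>\<^sup>+z. ?P2 (- 1 / z) \<partial>hyp_measure)" by (rule hyp_translate) measurable
  also have "... = nn_integral hyp_measure ?P2" by (rule hyp_inversion) measurable
  also have "... = nn_integral hyp_measure ?P1" by (rule hyp_scale) (use False in auto)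
  also have "... = nn_integral hyp_measure P" by (rule hyp_translate) measurable
  finally show ?thesis .
 qed
qed

interpretation hyp_measure: sigma_finite_measure hyp_measure
 unfolding hyp_measure_def
 by (subst sigma_finite_measure.sigma_finite_iff_density_finite'[OF sigma_finite_lborel]) (auto simp: indicator_def)

interpretation hyp_pair: pair_sigma_finite hyp_measure hyp_measure ..

lemma hyp_null:
 assumes "N : null_sets lborel"
 shows "AE z in hyp_measure. z \<notin> N"
proof -
 have "AE z in lborel. z \<notin> N" using assms by (rule AE_not_in)
 thus ?thesis unfolding hyp_measure_def by (subst AE_density) (auto elim: eventually_mono)
qed

lemma hyp_null_moeb:
 assumes g: "g : SL2Z" and N: "N : null_sets lborel"
 shows "AE z in hyp_measure. moeb g z \<notin> N"
proof -
 have [measurable]: "N : sets borel" using N by (auto simp: null_sets_def)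
 have "(\<integral>\<^sup>+z. indicator N (moeb g z) \<partial>hyp_measure) = (\<integral>\<^sup>+z. indicator N z \<partial>hyp_measure)"
  by (rule hyp_moeb[OF g]) measurable
 also have "... = 0"
  by (subst nn_integral_0_iff_AE) (use hyp_null[OF N] in \<open>auto elim: eventually_mono\<close>)
 finally have "AE z in hyp_measure. indicator N (moeb g z) = (0::ennreal)"
  by (subst (asm) nn_integral_0_iff_AE) auto
 thus ?thesis by (rule eventually_mono) (auto simp: indicator_def split: if_splits)
qed

lemma nn_integral_hyp_box:
 fixes w :: "real => ennreal"
 assumes [measurable]: "w : borel_measurable borel" and X: "X0 <= X1"
 shows "(\<integral>\<^sup>+z. indicator {X0..X1} (Re z) * w (Im z) \<partial>hyp_measure)
  = ennreal (X1 - X0) * (\<integral>\<^sup>+y. indicator {0<..} y * ennreal (1 / y^2) * w y \<partial>lborel)"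
proof -
 have "(\<integral>\<^sup>+z. indicator {X0..X1} (Re z) * w (Im z) \<partial>hyp_measure)
  = (\<integral>\<^sup>+y. ennreal (X1 - X0) * (indicator {0<..} y * ennreal (1 / y^2) * w y) \<partial>lborel)"
  using X by (subst nn_integral_hyp, simp, intro nn_integral_cong, simp add: nn_integral_multc) (simp add: mult_ac)
 thus ?thesis by (simp add: nn_integral_cmult)
qed

lemma nn_integral_inverse_square_atLeast:
 assumes "Y > 0"
 shows "(\<integral>\<^sup>+y. ennreal (1 / y^2) * indicator {Y..} y \<partial>lborel) = ennreal (1 / Y)"
proof -
 have "(\<integral>\<^sup>+y. ennreal (1 / y^2) * indicator {Y..} y \<partial>lborel) = ennreal (0 - (- 1 / Y))"
 proof (rule nn_integral_FTC_atLeast)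
  show "((%y. - 1 / y) has_real_derivative 1 / y^2) (at y)" if "Y <= y" for y
   using that assms by (auto intro!: derivative_eq_intros simp: power2_eq_square)
  show "((%y::real. - 1 / y) \<longlongrightarrow> 0) at_top" by real_asymp
 qed auto
 thus ?thesis by simp
qed

lemma emeasure_strip:
 assumes "X0 <= X1" "Y > 0"
 shows "emeasure hyp_measure (strip X0 X1 Y) = ennreal ((X1 - X0) / Y)"
proof -
 have "emeasure hyp_measure (strip X0 X1 Y) = (\<integral>\<^sup>+z. indicator {X0..X1} (Re z) * indicator {Y..} (Im z) \<partial>hyp_measure)"
  by (subst nn_integral_indicator[symmetric], simp, intro nn_integral_cong) (auto simp: indicator_def strip_def)
 also have "... = ennreal (X1 - X0) * (\<integral>\<^sup>+y. indicator {0<..} y * ennreal (1 / y^2) * indicator {Y..} y \<partial>lborel)"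
  by (rule nn_integral_hyp_box) (use assms in auto)
 also have "(\<integral>\<^sup>+y. indicator {0<..} y * ennreal (1 / y^2) * indicator {Y..} y \<partial>lborel) = (\<integral>\<^sup>+y. ennreal (1 / y^2) * indicator {Y..} y \<partial>lborel)"
  using assms by (intro nn_integral_cong) (auto simp: indicator_def)
 finally show ?thesis using assms by (simp add: nn_integral_inverse_square_atLeast flip: ennreal_mult)
qed

definition hyp_ball_volume :: "real => ennreal" where
 "hyp_ball_volume \<rho> = emeasure hyp_measure (hyp_ball \<rho> \<i>)"

lemma mem_hyp_ball_measurable [measurable (raw)]:
 assumes [measurable]: "f : borel_measurable M" "g : borel_measurable M"
 shows "Measurable.pred M (%x. g x : hyp_ball \<rho> (f x))"
 unfolding hyp_ball_def mem_Collect_eq by measurable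

lemma hyp_ball_affine:
 assumes "z : UHP"
 shows "of_real (Im z) * w + of_real (Re z) : hyp_ball \<rho> z \<longleftrightarrow> w : hyp_ball \<rho> \<i>"
proof -
 have "z - (of_real (Im z) * w + of_real (Re z)) = of_real (Im z) * (\<i> - w)"
  by (simp add: complex_eq_iff algebra_simps)
 hence "(norm (z - (of_real (Im z) * w + of_real (Re z))))^2 = (Im z)^2 * (norm (\<i> - w))^2"
  by (simp add: norm_mult power_mult_distrib)
 thus ?thesis using assms by (simp add: hyp_ball_def UHP_def power2_eq_square mult.assoc)
qed

lemma nn_integral_hyp_recenter:
 assumes "z : UHP" and [measurable]: "P : borel_measurable borel"
 shows "(\<integral>\<^sup>+w. indicator (hyp_ball \<rho> z) w * P w \<partial>hyp_measure)
  = (\<integral>\<^sup>+w. indicator (hyp_ball \<rho> \<i>) w * P (of_real (Im z) * w + of_real (Re z)) \<partial>hyp_measure)"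
proof -
 let ?Q = "%w. indicator (hyp_ball \<rho> z) w * P w"
 have "nn_integral hyp_measure ?Q = (\<integral>\<^sup>+w. ?Q (of_real (Im z) * w + of_real (Re z)) \<partial>hyp_measure)"
  using hyp_scale[of "%w. ?Q (w + of_real (Re z))" "Im z"] hyp_translate[of ?Q "Re z"] assms(1) by (simp add: UHP_def)
 thus ?thesis by (simp add: indicator_def hyp_ball_affine[OF assms(1)])
qed

lemma emeasure_hyp_ball: "z : UHP ==> emeasure hyp_measure (hyp_ball \<rho> z) = hyp_ball_volume \<rho>"
 using nn_integral_hyp_recenter[of z "%_. 1" \<rho>] by (simp add: hyp_ball_volume_def)

lemma hyp_ball_ii_reflect: "Complex m (exp (- l)) : hyp_ball \<rho> \<i> \<longleftrightarrow> Complex (exp l * m) (exp l) : hyp_ball \<rho> \<i>"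
proof -
 have mem_iff: "Complex x y : hyp_ball \<rho> \<i> \<longleftrightarrow> x^2 + (1 - y)^2 < \<rho> * y" for x y
  by (simp add: hyp_ball_def cmod_power2)
 have "(m^2 + (1 - exp (-l))^2 < \<rho> * exp (-l)) \<longleftrightarrow> (exp l)^2 * (m^2 + (1 - exp (-l))^2) < (exp l)^2 * (\<rho> * exp (-l))"
  by simp
 also have "(exp l)^2 * (m^2 + (1 - exp (-l))^2) = (exp l * m)^2 + (1 - exp l)^2"
  by (simp add: power2_eq_square exp_minus field_simps)
 also have "(exp l)^2 * (\<rho> * exp (-l)) = \<rho> * exp l" by (simp add: power2_eq_square exp_minus)
 finally show ?thesis by (simp add: mem_iff)
qed

lemma nn_integral_hyp_Im:
 assumes [measurable]: "P : borel_measurable borel"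
 shows "(\<integral>\<^sup>+w. P w * ennreal (Im w) \<partial>hyp_measure) = (\<integral>\<^sup>+l. \<integral>\<^sup>+x. P (Complex x (exp l)) \<partial>lborel \<partial>lborel)"
proof -
 have "ennreal (1 / y^2) * ennreal y = ennreal (1 / y)" if "y > 0" for y
  using that by (subst ennreal_mult[symmetric]) (auto simp: power2_eq_square)
 hence Im: "indicator {0<..} y * ennreal (1 / y^2) * (t * ennreal y) = indicator {0<..} y * ennreal (1 / y) * t" for y t
  by (cases "y > 0") (simp_all add: mult.commute[of t] flip: mult.assoc)
 have "(\<integral>\<^sup>+w. P w * ennreal (Im w) \<partial>hyp_measure) = (\<integral>\<^sup>+y. indicator {0<..} y * ennreal (1 / y) * (\<integral>\<^sup>+x. P (Complex x y) \<partial>lborel) \<partial>lborel)"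
  by (subst nn_integral_hyp) (simp_all add: nn_integral_multc Im)
 also have "... = (\<integral>\<^sup>+l. \<integral>\<^sup>+x. P (Complex x (exp l)) \<partial>lborel \<partial>lborel)"
  by (rule nn_integral_exp) measurable
 finally show ?thesis .
qed

lemma hyp_ball_mean_Im_ii: "(\<integral>\<^sup>+w. indicator (hyp_ball \<rho> \<i>) w * ennreal (Im w) \<partial>hyp_measure) = hyp_ball_volume \<rho>"
proof -
 let ?Q = "%x y. indicator (hyp_ball \<rho> \<i>) (Complex x y) :: ennreal"
 have "(\<integral>\<^sup>+w. indicator (hyp_ball \<rho> \<i>) w * ennreal (Im w) \<partial>hyp_measure) = (\<integral>\<^sup>+l. \<integral>\<^sup>+x. ?Q x (exp l) \<partial>lborel \<partial>lborel)"
  by (rule nn_integral_hyp_Im) measurable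
 also have "... = (\<integral>\<^sup>+l. \<integral>\<^sup>+x. ?Q x (exp (0 - l)) \<partial>lborel \<partial>lborel)"
  by (rule nn_integral_lborel_reflect(1)[symmetric]) measurable
 also have "... = (\<integral>\<^sup>+l. \<integral>\<^sup>+m. ?Q (exp l * m) (exp l) \<partial>lborel \<partial>lborel)"
  by (simp add: indicator_def hyp_ball_ii_reflect)
 also have "... = (\<integral>\<^sup>+w. indicator (hyp_ball \<rho> \<i>) w \<partial>hyp_measure)"
  by (rule nn_integral_hyp_polar[symmetric]) simp
 finally show ?thesis by (simp add: hyp_ball_volume_def)
qed

lemma hyp_ball_mean_Im:
 assumes "z : UHP"
 shows "(\<integral>\<^sup>+w. indicator (hyp_ball \<rho> z) w * ennreal (Im w) \<partial>hyp_measure) = hyp_ball_volume \<rho> * ennreal (Im z)"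
proof -
 have "ennreal (Im (of_real (Im z) * w + of_real (Re z))) = ennreal (Im w) * ennreal (Im z)" for w
  using assms by (simp add: UHP_def ennreal_mult''[symmetric] mult.commute)
 hence "(\<integral>\<^sup>+w. indicator (hyp_ball \<rho> z) w * ennreal (Im w) \<partial>hyp_measure)
  = (\<integral>\<^sup>+w. (indicator (hyp_ball \<rho> \<i>) w * ennreal (Im w)) * ennreal (Im z) \<partial>hyp_measure)"
  by (subst nn_integral_hyp_recenter[OF assms]) (simp_all add: mult.assoc)
 also have "... = hyp_ball_volume \<rho> * ennreal (Im z)"
  by (subst nn_integral_multc) (simp_all add: hyp_ball_mean_Im_ii)
 finally show ?thesis .
qed

lemma hyp_ball_volume_finite:
 assumes "\<rho> > 0"
 shows "hyp_ball_volume \<rho> < \<infinity>"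
proof -
 have i_UHP: "\<i> : UHP" by (simp add: UHP_def)
 have "w : strip (-(2+\<rho>)) (2+\<rho>) (1/(2+\<rho>))" if "w : hyp_ball \<rho> \<i>" "w : UHP" for w
  using hyp_ball_bounds[OF that(1) i_UHP that(2) assms] assms by (auto simp: strip_def field_simps abs_le_iff)
 hence "AE w in hyp_measure. w : hyp_ball \<rho> \<i> --> w : strip (-(2+\<rho>)) (2+\<rho>) (1/(2+\<rho>))"
  using AE_hyp_UHP by (auto elim: eventually_mono)
 hence "hyp_ball_volume \<rho> <= emeasure hyp_measure (strip (-(2+\<rho>)) (2+\<rho>) (1/(2+\<rho>)))"
  unfolding hyp_ball_volume_def by (rule emeasure_mono_AE) simp
 also have "... < \<infinity>" using assms by (subst emeasure_strip) auto
 finally show ?thesis .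
qed

section \<open>Unfolding over a fundamental domain\<close>

definition orbit_sum :: "nat => (complex => ennreal) => complex => ennreal" where
 "orbit_sum q P z = (\<integral>\<^sup>+g. P (moeb g z) \<partial>count_space (Gamma0 q))"

definition ball_integral :: "real => (complex => ennreal) => complex => ennreal" where
 "ball_integral \<rho> P z = (\<integral>\<^sup>+w. indicator (hyp_ball \<rho> z) w * P w \<partial>hyp_measure)"

definition Gamma0_invariant :: "nat => (complex => 'a) => bool" where
 "Gamma0_invariant q H \<longleftrightarrow> (ALL g:Gamma0 q. ALL z:UHP. H (moeb g z) = H z)"

lemma nn_integral_count_space_measurable:
 fixes f :: "'a => 'i::countable => ennreal"
 assumes "!!g. g : I ==> (%z. f z g) : borel_measurable M"
 shows "(%z. \<integral>\<^sup>+g. f z g \<partial>count_space I) : borel_measurable M"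
proof -
 interpret c: sigma_finite_measure "count_space I"
  by (rule sigma_finite_measure_count_space_countable) simp
 have "(%(g,z). f z g) : borel_measurable (count_space I \<Otimes>\<^sub>M M)"
  by (rule measurable_pair_measure_countable1) (use assms in auto)
 from measurable_pair_swap[OF this]
 have "(%(z,g). f z g) : borel_measurable (M \<Otimes>\<^sub>M count_space I)" by simp
 from c.borel_measurable_nn_integral_fst[OF this] show ?thesis by simp
qed

lemma orbit_sum_measurable [measurable]:
 assumes [measurable]: "P : borel_measurable borel"
 shows "orbit_sum q P : borel_measurable borel"
 unfolding orbit_sum_def[abs_def] by (rule nn_integral_count_space_measurable) measurable

lemma orbit_sum_mat2_inv: "orbit_sum q P z = (\<integral>\<^sup>+g. P (moeb (mat2_inv g) z) \<partial>count_space (Gamma0 q))"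
 unfolding orbit_sum_def using nn_integral_bij_count_space[OF bij_betw_mat2_inv[of q], where f="%g. P (moeb g z)"] by simp

lemma orbit_sum_invariant: "Gamma0_invariant q (orbit_sum q P)"
 unfolding Gamma0_invariant_def
proof (intro ballI)
 fix h z assume h: "h : Gamma0 q" and z: "z : UHP"
 have "bij_betw (%g. mat2_mult g h) (Gamma0 q) (Gamma0 q)"
  by (rule bij_betwI[where g="%g. mat2_mult g (mat2_inv h)"])
   (use h Gamma0_mult Gamma0_inv SL2Z_of_Gamma0 in \<open>auto simp: mat2_mult_assoc mat2_mult_inv\<close>)
 from nn_integral_bij_count_space[OF this, where f="%g. P (moeb g z)"]
 have "orbit_sum q P z = (\<integral>\<^sup>+g. P (moeb (mat2_mult g h) z) \<partial>count_space (Gamma0 q))" by (simp add: orbit_sum_def)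
 also have "... = orbit_sum q P (moeb h z)" unfolding orbit_sum_def
  using h z by (intro nn_integral_cong) (simp add: moeb_mult SL2Z_of_Gamma0)
 finally show "orbit_sum q P (moeb h z) = orbit_sum q P z" ..
qed

lemma orbit_sum_mult_invariant:
 assumes "Gamma0_invariant q H" "z : UHP"
 shows "orbit_sum q (%z. P z * H z) z = orbit_sum q P z * H z"
proof -
 have "orbit_sum q (%z. P z * H z) z = (\<integral>\<^sup>+g. P (moeb g z) * H z \<partial>count_space (Gamma0 q))"
  unfolding orbit_sum_def using assms by (intro nn_integral_cong) (simp add: Gamma0_invariant_def)
 also have "... = orbit_sum q P z * H z" unfolding orbit_sum_def by (rule nn_integral_multc) simp
 finally show ?thesis .
qed

lemma orbit_sum_mono:
 assumes "!!z. z : UHP ==> P z <= Q z" "z : UHP"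
 shows "orbit_sum q P z <= orbit_sum q Q z"
 unfolding orbit_sum_def using assms moeb_in_UHP SL2Z_of_Gamma0 by (intro nn_integral_mono) auto

lemma orbit_sum_add: "orbit_sum q (%z. P z + Q z) z = orbit_sum q P z + orbit_sum q Q z"
 unfolding orbit_sum_def by (rule nn_integral_add) auto

lemma orbit_sum_cmult: "orbit_sum q (%z. c * P z) z = c * orbit_sum q P z"
 unfolding orbit_sum_def by (rule nn_integral_cmult) auto

lemma orbit_sum_hyp_ball_sym:
 assumes "z : UHP" "w : UHP"
 shows "orbit_sum q (indicator (hyp_ball \<rho> z)) w = orbit_sum q (indicator (hyp_ball \<rho> w)) z"
proof -
 have "moeb g w : hyp_ball \<rho> z \<longleftrightarrow> moeb (mat2_inv g) z : hyp_ball \<rho> w" if "g : Gamma0 q" for g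
  using hyp_ball_moeb[OF SL2Z_of_Gamma0[OF that] moeb_in_UHP[OF SL2Z_inv[OF SL2Z_of_Gamma0[OF that]] assms(1)] assms(2), of \<rho>]
   SL2Z_of_Gamma0[OF that] assms by (simp add: hyp_ball_sym[of w])
 hence "orbit_sum q (indicator (hyp_ball \<rho> z)) w = (\<integral>\<^sup>+g. indicator (hyp_ball \<rho> w) (moeb (mat2_inv g) z) \<partial>count_space (Gamma0 q))"
  unfolding orbit_sum_def by (intro nn_integral_cong) (simp add: indicator_def)
 thus ?thesis by (simp add: orbit_sum_mat2_inv)
qed

lemma orbit_sum_strip_bound:
 assumes z: "z : UHP" and Y: "0 < Y" "Y <= 1" and X: "X0 <= X1"
 shows "orbit_sum q (indicator (strip X0 X1 Y)) z <= ennreal (14 * (X1 - X0 + 1) / Y)"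
proof -
 let ?A = "{g\<in>SL2Z. moeb g z : strip X0 X1 Y}"
 note count = orbit_count[OF z Y X]
 have "orbit_sum q (indicator (strip X0 X1 Y)) z = (\<integral>\<^sup>+g. indicator (?A \<inter> Gamma0 q) g \<partial>count_space (Gamma0 q))"
  unfolding orbit_sum_def by (intro nn_integral_cong) (auto simp: indicator_def dest: SL2Z_of_Gamma0)
 also have "... = of_nat (card (?A \<inter> Gamma0 q))"
  using count(1) by (subst nn_integral_indicator) (auto simp: emeasure_count_space_finite)
 also have "... <= of_nat (card ?A)" using count(1) by (intro of_nat_mono card_mono) auto
 also have "... <= ennreal (14 * (X1 - X0 + 1) / Y)" using count(2) by (simp add: ennreal_of_nat_eq_real_of_nat ennreal_leI)
 finally show ?thesis .
qed

lemma ball_integral_measurable [measurable (raw)]: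
 assumes [measurable]: "(%(z,w). P z w) : borel_measurable (borel \<Otimes>\<^sub>M borel)"
 shows "(%z. ball_integral \<rho> (P z) z) : borel_measurable borel"
 unfolding ball_integral_def by measurable

lemma ball_integral_moeb:
 assumes g: "g : SL2Z" and z: "z : UHP" and [measurable]: "P : borel_measurable borel"
 shows "ball_integral \<rho> (%w. P (moeb g w)) z = ball_integral \<rho> P (moeb g z)"
proof -
 have "ball_integral \<rho> (%w. P (moeb g w)) z = (\<integral>\<^sup>+w. indicator (hyp_ball \<rho> (moeb g z)) (moeb g w) * P (moeb g w) \<partial>hyp_measure)"
  unfolding ball_integral_def by (rule nn_integral_hyp_cong) (simp add: indicator_def hyp_ball_moeb[OF g z])
 also have "... = ball_integral \<rho> P (moeb g z)" unfolding ball_integral_def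
  by (rule hyp_moeb[OF g, of "%w. indicator (hyp_ball \<rho> (moeb g z)) w * P w"]) measurable
 finally show ?thesis .
qed

lemma ball_integral_orbit_sum:
 assumes z: "z : UHP" and [measurable]: "P : borel_measurable borel"
 shows "ball_integral \<rho> (orbit_sum q P) z = orbit_sum q (ball_integral \<rho> P) z"
proof -
 have "ball_integral \<rho> (orbit_sum q P) z = (\<integral>\<^sup>+w. \<integral>\<^sup>+g. indicator (hyp_ball \<rho> z) w * P (moeb g w) \<partial>count_space (Gamma0 q) \<partial>hyp_measure)"
  unfolding ball_integral_def orbit_sum_def by (intro nn_integral_cong nn_integral_cmult[symmetric]) simp
 also have "... = (\<integral>\<^sup>+g. ball_integral \<rho> (%w. P (moeb g w)) z \<partial>count_space (Gamma0 q))"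
  unfolding ball_integral_def by (rule nn_integral_count_space_nn_integral) auto
 also have "... = orbit_sum q (ball_integral \<rho> P) z" unfolding orbit_sum_def
  by (intro nn_integral_cong ball_integral_moeb z) (auto dest: SL2Z_of_Gamma0)
 finally show ?thesis .
qed

lemma reduction_mod_Gamma0:
 assumes z: "z : UHP" and R: "R <= SL2Z" "!!g. g : SL2Z ==> EX r:R. mat2_mult g (mat2_inv r) : Gamma0 q"
 obtains r h where "r : R" "h : Gamma0 q" "moeb (mat2_inv r) (moeb h z) : strip (-1/2) (1/2) (1/2)"
proof -
 obtain s where s: "s : SL2Z" "abs (Re (moeb s z)) <= 1/2" "Im (moeb s z) >= 1/2" using reduction[OF z] by blast
 obtain r where r: "r : R" "mat2_mult (mat2_inv s) (mat2_inv r) : Gamma0 q" using R(2)[OF SL2Z_inv[OF s(1)]] by blast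
 have r_SL2Z: "r : SL2Z" using r R by blast
 define h where "h = mat2_inv (mat2_mult (mat2_inv s) (mat2_inv r))"
 have h: "h : Gamma0 q" unfolding h_def by (rule Gamma0_inv) fact
 have "h = mat2_mult r s" unfolding h_def by (cases r; cases s) (simp add: algebra_simps)
 hence "mat2_mult (mat2_inv r) h = s" using r_SL2Z by (simp add: mat2_mult_assoc[symmetric] mat2_mult_inv)
 hence "moeb (mat2_inv r) (moeb h z) = moeb s z"
  using moeb_mult[OF SL2Z_inv[OF r_SL2Z] SL2Z_of_Gamma0[OF h] z] by simp
 hence "moeb (mat2_inv r) (moeb h z) : strip (-1/2) (1/2) (1/2)" using s by (auto simp: strip_def abs_le_iff)
 thus ?thesis using that r(1) h by blast
qed

locale fundamental_domain =
 fixes q :: nat and D :: "complex set"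
 assumes q_pos: "q >= 1" and fd: "fund_domain q D"
begin

lemma D_UHP: "D <= UHP" and D_borel [measurable]: "D : sets borel"
 using fd by (auto simp: fund_domain_def)

lemma D_covers: "AE z in hyp_measure. EX g:Gamma0 q. moeb g z : D"
proof -
 have "AE z in lborel. z : UHP --> (EX g:Gamma0 q. moeb g z : D)"
  using fd by (simp add: fund_domain_def)
 hence "AE z in lborel. 0 < indicator UHP z * ennreal (1 / (Im z)^2) --> (EX g:Gamma0 q. moeb g z : D)"
  by (rule eventually_mono) (auto simp: indicator_def split: if_splits)
 thus ?thesis unfolding hyp_measure_def by (subst AE_density) auto
qed

lemma translates_almost_disjoint:
 "AE z in hyp_measure. ALL g:Gamma0 q. ALL h:Gamma0 q - {(1,0,0,1), (-1,0,0,-1)}. moeb g z \<notin> D \<inter> moeb h ` D"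
proof -
 have "AE z in hyp_measure. moeb g z \<notin> D \<inter> moeb h ` D"
  if "g : Gamma0 q" "h : Gamma0 q - {(1,0,0,1), (-1,0,0,-1)}" for g h
  by (rule hyp_null_moeb[OF SL2Z_of_Gamma0[OF that(1)]]) (use that(2) fd in \<open>simp add: fund_domain_def\<close>)
 thus ?thesis by (simp only: AE_ball_countable countableI_type) blast
qed

lemma orbit_meets_D_in_pair:
 assumes z: "z : UHP" and g0: "g0 : Gamma0 q" "moeb g0 z : D"
  and disj: "ALL h:Gamma0 q - {(1,0,0,1), (-1,0,0,-1)}. moeb g0 z \<notin> D \<inter> moeb h ` D"
 shows "{g\<in>Gamma0 q. moeb g z : D} = {g0, mat2_neg g0}"
proof (intro equalityI subsetI)
 fix g assume "g : {g\<in>Gamma0 q. moeb g z : D}"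
 hence g: "g : Gamma0 q" "moeb g z : D" by auto
 define h where "h = mat2_mult g0 (mat2_inv g)"
 have h: "h : Gamma0 q" using g g0 Gamma0_mult Gamma0_inv by (simp add: h_def)
 have mult_hg: "mat2_mult h g = g0" using SL2Z_of_Gamma0[OF g(1)] by (simp add: h_def mat2_mult_assoc mat2_mult_inv)
 have "moeb g0 z = moeb h (moeb g z)"
  using moeb_mult[OF SL2Z_of_Gamma0[OF h] SL2Z_of_Gamma0[OF g(1)] z] mult_hg by simp
 hence "moeb g0 z : D \<inter> moeb h ` D" using g0 g by blast
 hence "h = (1,0,0,1) \<or> h = (-1,0,0,-1)" using disj h by blast
 moreover have "mat2_mult (-1,0,0,-1) g = mat2_neg g" by (cases g) simp
 ultimately show "g : {g0, mat2_neg g0}" using mult_hg by auto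
qed (use g0 Gamma0_neg[OF g0(1)] in \<open>auto simp: moeb_neg\<close>)

lemma two_translates: "AE z in hyp_measure. orbit_sum q (indicator D) z = 2"
 using D_covers AE_hyp_UHP translates_almost_disjoint
proof eventually_elim
 case (elim z)
 then obtain g where g: "g : Gamma0 q" "moeb g z : D" by blast
 have "{g\<in>Gamma0 q. moeb g z : D} = {g, mat2_neg g}" using orbit_meets_D_in_pair[OF _ g] elim g by blast
 hence "orbit_sum q (indicator D) z = (\<integral>\<^sup>+h. indicator {g, mat2_neg g} h \<partial>count_space (Gamma0 q))"
  unfolding orbit_sum_def by (intro nn_integral_cong) (auto simp: indicator_def)
 also have "... = emeasure (count_space (Gamma0 q)) {g, mat2_neg g}"
  using g Gamma0_neg[OF g(1)] by (intro nn_integral_indicator) auto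
 also have "... = 2"
  using g Gamma0_neg[OF g(1)] mat2_neg_neq[OF SL2Z_of_Gamma0[OF g(1)]]
  by (subst emeasure_count_space_finite) auto
 finally show ?case .
qed

lemma unfolding_nn:
 assumes [measurable]: "P : borel_measurable borel"
 shows "(\<integral>\<^sup>+z. indicator D z * orbit_sum q P z \<partial>hyp_measure) = 2 * nn_integral hyp_measure P"
proof -
 have "(\<integral>\<^sup>+z. indicator D z * orbit_sum q P z \<partial>hyp_measure) = (\<integral>\<^sup>+z. \<integral>\<^sup>+g. indicator D z * P (moeb g z) \<partial>count_space (Gamma0 q) \<partial>hyp_measure)"
  unfolding orbit_sum_def by (intro nn_integral_cong nn_integral_cmult[symmetric]) simp
 also have "... = (\<integral>\<^sup>+g. \<integral>\<^sup>+z. indicator D z * P (moeb g z) \<partial>hyp_measure \<partial>count_space (Gamma0 q))"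
  by (rule nn_integral_count_space_nn_integral) auto
 also have "... = (\<integral>\<^sup>+g. \<integral>\<^sup>+z. indicator D (moeb (mat2_inv g) z) * P z \<partial>hyp_measure \<partial>count_space (Gamma0 q))"
 proof (rule nn_integral_cong)
  fix g assume "g : space (count_space (Gamma0 q))"
  hence g: "g : SL2Z" using SL2Z_of_Gamma0 by simp
  have "(\<integral>\<^sup>+z. indicator D z * P (moeb g z) \<partial>hyp_measure) = (\<integral>\<^sup>+z. indicator D (moeb (mat2_inv g) (moeb g z)) * P (moeb g z) \<partial>hyp_measure)"
   by (rule nn_integral_hyp_cong) (simp add: g)
  also have "... = (\<integral>\<^sup>+z. indicator D (moeb (mat2_inv g) z) * P z \<partial>hyp_measure)"
   by (rule hyp_moeb[OF g, of "%z. indicator D (moeb (mat2_inv g) z) * P z"]) measurable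
  finally show "(\<integral>\<^sup>+z. indicator D z * P (moeb g z) \<partial>hyp_measure) = (\<integral>\<^sup>+z. indicator D (moeb (mat2_inv g) z) * P z \<partial>hyp_measure)" .
 qed
 also have "... = (\<integral>\<^sup>+z. \<integral>\<^sup>+g. indicator D (moeb (mat2_inv g) z) * P z \<partial>count_space (Gamma0 q) \<partial>hyp_measure)"
  by (rule nn_integral_count_space_nn_integral[symmetric]) auto
 also have "... = (\<integral>\<^sup>+z. orbit_sum q (indicator D) z * P z \<partial>hyp_measure)"
  unfolding orbit_sum_mat2_inv by (intro nn_integral_cong nn_integral_multc) simp
 also have "... = (\<integral>\<^sup>+z. 2 * P z \<partial>hyp_measure)"
  by (rule nn_integral_cong_AE, rule eventually_mono[OF two_translates]) simp
 also have "... = 2 * nn_integral hyp_measure P" by (rule nn_integral_cmult) simp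
 finally show ?thesis .
qed

lemma unfolding_nn_invariant:
 assumes [measurable]: "P : borel_measurable borel" "H : borel_measurable borel" and "Gamma0_invariant q H"
 shows "(\<integral>\<^sup>+z. indicator D z * (orbit_sum q P z * H z) \<partial>hyp_measure) = 2 * (\<integral>\<^sup>+z. P z * H z \<partial>hyp_measure)"
proof -
 have "(\<integral>\<^sup>+z. indicator D z * (orbit_sum q P z * H z) \<partial>hyp_measure) = (\<integral>\<^sup>+z. indicator D z * orbit_sum q (%z. P z * H z) z \<partial>hyp_measure)"
  by (rule nn_integral_hyp_cong) (simp add: orbit_sum_mult_invariant[OF assms(3)])
 also have "... = 2 * (\<integral>\<^sup>+z. P z * H z \<partial>hyp_measure)"
  by (rule unfolding_nn) measurable
 finally show ?thesis .
qed

lemma nn_integral_strip_le: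
 assumes [measurable]: "H : borel_measurable borel" and "Gamma0_invariant q H"
  and Y: "0 < Y" "Y <= 1" and X: "X0 <= X1"
 shows "(\<integral>\<^sup>+z. indicator (strip X0 X1 Y) z * H z \<partial>hyp_measure)
  <= ennreal (14 * (X1 - X0 + 1) / Y) * (\<integral>\<^sup>+z. indicator D z * H z \<partial>hyp_measure)"
proof -
 let ?I = "\<integral>\<^sup>+z. indicator (strip X0 X1 Y) z * H z \<partial>hyp_measure"
 have "?I <= 2 * ?I"
  using mult_right_mono[of "1::ennreal" 2 ?I] by simp
 also have "... = (\<integral>\<^sup>+z. indicator D z * (orbit_sum q (indicator (strip X0 X1 Y)) z * H z) \<partial>hyp_measure)"
  by (rule unfolding_nn_invariant[symmetric]) (use assms in measurable)
 also have "... <= (\<integral>\<^sup>+z. ennreal (14 * (X1 - X0 + 1) / Y) * (indicator D z * H z) \<partial>hyp_measure)"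
 proof (rule nn_integral_hyp_mono)
  fix z assume "z : UHP"
  from mult_right_mono[OF orbit_sum_strip_bound[OF this Y X], of "indicator D z * H z"]
  show "indicator D z * (orbit_sum q (indicator (strip X0 X1 Y)) z * H z) <= ennreal (14 * (X1 - X0 + 1) / Y) * (indicator D z * H z)"
   by (simp add: mult_ac)
 qed
 also have "... = ennreal (14 * (X1 - X0 + 1) / Y) * (\<integral>\<^sup>+z. indicator D z * H z \<partial>hyp_measure)"
  by (rule nn_integral_cmult) measurable
 finally show ?thesis .
qed

lemma D_finite: "emeasure hyp_measure D < \<infinity>"
proof -
 obtain R where R: "finite R" "R <= SL2Z" "!!g. g : SL2Z ==> EX r:R. mat2_mult g (mat2_inv r) : Gamma0 q"
  using finite_coset_reps[OF q_pos] by blast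
 let ?F = "strip (-1/2) (1/2) (1/2)"
 define P :: "complex => ennreal" where "P = (%z. \<Sum>r\<in>R. indicator ?F (moeb (mat2_inv r) z))"
 have [measurable]: "P : borel_measurable borel" unfolding P_def by measurable
 have one_le: "1 <= orbit_sum q P z" if z: "z : UHP" for z
 proof -
  obtain r h where r: "r : R" and h: "h : Gamma0 q" "moeb (mat2_inv r) (moeb h z) : ?F"
   using reduction_mod_Gamma0[OF z R(2,3)] by blast
  have "1 = (indicator ?F (moeb (mat2_inv r) (moeb h z)) :: ennreal)" using h(2) by (simp only: indicator_simps)
  also have "... <= P (moeb h z)" unfolding P_def
   by (rule member_le_sum[OF r _ R(1)]) simp
  also have "... <= orbit_sum q P z" unfolding orbit_sum_def
   by (rule nn_integral_ge_point) (use h in simp)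
  finally show ?thesis .
 qed
 have "emeasure hyp_measure D = (\<integral>\<^sup>+z. indicator D z \<partial>hyp_measure)" by simp
 also have "... <= (\<integral>\<^sup>+z. indicator D z * orbit_sum q P z \<partial>hyp_measure)"
  using one_le by (intro nn_integral_hyp_mono) (auto simp: indicator_def)
 also have "... = 2 * nn_integral hyp_measure P" by (rule unfolding_nn) measurable
 also have "nn_integral hyp_measure P = (\<Sum>r\<in>R. \<integral>\<^sup>+z. indicator ?F (moeb (mat2_inv r) z) \<partial>hyp_measure)"
  unfolding P_def by (rule nn_integral_sum) measurable
 also have "... = (\<Sum>r\<in>R. emeasure hyp_measure ?F)"
  using R(2) SL2Z_inv hyp_moeb[of _ "indicator ?F"] by (intro sum.cong) auto
 also have "2 * (\<Sum>r\<in>R. emeasure hyp_measure ?F) < \<infinity>"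
  by (simp add: emeasure_strip ennreal_mult_less_top of_nat_less_top)
 finally show ?thesis .
qed

lemma ball_integral_self_adjoint:
 assumes [measurable]: "H : borel_measurable borel" and H: "Gamma0_invariant q H"
 shows "(\<integral>\<^sup>+z. indicator D z * ball_integral \<rho> H z \<partial>hyp_measure) = hyp_ball_volume \<rho> * (\<integral>\<^sup>+z. indicator D z * H z \<partial>hyp_measure)"
proof -
 let ?k = "%z. orbit_sum q (indicator (hyp_ball \<rho> z))"
 have [measurable]: "(%p. ?k (fst p) (snd p)) : borel_measurable (borel \<Otimes>\<^sub>M borel)"
  unfolding orbit_sum_def by (rule nn_integral_count_space_measurable) measurable
 have unfold: "2 * ball_integral \<rho> H z = (\<integral>\<^sup>+w. indicator D w * (?k z w * H w) \<partial>hyp_measure)" for z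
  unfolding ball_integral_def by (rule unfolding_nn_invariant[symmetric]) (use H in measurable)
 have swap: "indicator D z * (indicator D w * (?k z w * H w)) = (indicator D w * H w) * (indicator D z * ?k w z)" for z w
  using D_UHP orbit_sum_hyp_ball_sym[of z w q \<rho>] by (cases "z : D & w : D") (auto simp: indicator_def mult_ac subset_iff)
 have "2 * (\<integral>\<^sup>+z. indicator D z * ball_integral \<rho> H z \<partial>hyp_measure) = (\<integral>\<^sup>+z. indicator D z * (2 * ball_integral \<rho> H z) \<partial>hyp_measure)"
  by (subst nn_integral_cmult[symmetric]) (auto simp: mult_ac)
 also have "... = (\<integral>\<^sup>+z. \<integral>\<^sup>+w. indicator D z * (indicator D w * (?k z w * H w)) \<partial>hyp_measure \<partial>hyp_measure)"
  unfolding unfold by (intro nn_integral_cong nn_integral_cmult[symmetric]) measurable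
 also have "... = (\<integral>\<^sup>+w. \<integral>\<^sup>+z. indicator D z * (indicator D w * (?k z w * H w)) \<partial>hyp_measure \<partial>hyp_measure)"
  by (rule hyp_pair.Fubini'[symmetric]) measurable
 also have "... = (\<integral>\<^sup>+w. (indicator D w * H w) * (2 * hyp_ball_volume \<rho>) \<partial>hyp_measure)"
  unfolding swap by (rule nn_integral_hyp_cong) (simp add: nn_integral_cmult unfolding_nn emeasure_hyp_ball)
 also have "... = 2 * (hyp_ball_volume \<rho> * (\<integral>\<^sup>+z. indicator D z * H z \<partial>hyp_measure))"
  by (subst nn_integral_multc) (auto simp: mult_ac)
 finally show ?thesis by (simp add: ennreal_mult_cancel_left)
qed

end

section \<open>Decorrelation of invariant functions from slowly varying ones\<close>

definition slowly_varying :: "(real => real) => real => (complex => real) => bool" where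
 "slowly_varying K \<xi> v \<longleftrightarrow> (ALL \<rho>>0. ALL z:UHP. ALL w:UHP. w : hyp_ball \<rho> z --> abs (v z - v w) <= K \<rho> * (Im z + \<xi>))"

definition strip_weight :: "real => real => (complex => real) => bool" where
 "strip_weight X0 X1 v \<longleftrightarrow> v : borel_measurable borel & (ALL z. 0 <= v z & v z <= 1) & (ALL z. Re z \<notin> {X0..X1} --> v z = 0)"

definition cutoff_weight :: "real => (complex => real) => complex => real" where
 "cutoff_weight y1 v z = indicator {y1..1} (Im z) * Im z * v z"

lemma cutoff_weight_measurable [measurable]: "v : borel_measurable borel ==> cutoff_weight y1 v : borel_measurable borel"
 unfolding cutoff_weight_def[abs_def] by measurable

lemma cutoff_weight_nonneg: "strip_weight X0 X1 v ==> 0 < y1 ==> 0 <= cutoff_weight y1 v z"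
 by (auto simp: cutoff_weight_def strip_weight_def indicator_def)

lemma nn_integral_inverse_Icc:
 assumes "0 < s" "s <= t"
 shows "(\<integral>\<^sup>+y. ennreal (1 / y) * indicator {s..t} y \<partial>lborel) = ennreal (ln t - ln s)"
 using assms by (intro nn_integral_FTC_Icc) (auto intro!: derivative_eq_intros)

lemma cutoff_weight_layer_cake:
 assumes v: "strip_weight X0 X1 v" and y1: "0 < y1" "y1 <= 1"
 shows "ennreal (cutoff_weight y1 v w)
  <= ennreal y1 * indicator (strip X0 X1 y1) w + (\<integral>\<^sup>+Y. indicator {y1..1} Y * indicator (strip X0 X1 Y) w \<partial>lborel)"
proof (cases "w : strip X0 X1 y1 & Im w <= 1")
 case True
 have "(\<integral>\<^sup>+Y. indicator {y1..1} Y * indicator (strip X0 X1 Y) w \<partial>lborel) = (\<integral>\<^sup>+Y. indicator {y1..Im w} Y \<partial>lborel)"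
  using True by (intro nn_integral_cong) (auto simp: indicator_def strip_def)
 also have "... = ennreal (Im w - y1)" using True by (simp add: strip_def)
 finally have "ennreal y1 * indicator (strip X0 X1 y1) w + (\<integral>\<^sup>+Y. indicator {y1..1} Y * indicator (strip X0 X1 Y) w \<partial>lborel) = ennreal (Im w)"
  using True y1 by (simp add: strip_def ennreal_plus[symmetric] del: ennreal_plus)
 moreover have "cutoff_weight y1 v w <= Im w" using True v y1 by (simp add: cutoff_weight_def strip_weight_def strip_def mult_left_le)
 ultimately show ?thesis by (simp add: ennreal_leI)
next
 case False
 hence "cutoff_weight y1 v w = 0" using v by (auto simp: cutoff_weight_def strip_weight_def strip_def indicator_def)
 thus ?thesis by simp
qed

lemma orbit_sum_cutoff_bound:
 assumes v: "strip_weight X0 X1 v" and y1: "0 < y1" "y1 <= 1" and X: "X0 <= X1" and z: "z : UHP"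
 shows "orbit_sum q (%z. ennreal (cutoff_weight y1 v z)) z <= ennreal (14 * (X1 - X0 + 1) * (1 + ln (1 / y1)))"
proof -
 let ?C = "14 * (X1 - X0 + 1)" and ?S = "%Y. indicator (strip X0 X1 Y)"
 have C: "?C >= 0" using X by simp
 have [measurable]: "(%Y. ?S Y w :: ennreal) : borel_measurable borel" for w
 proof -
  have "?S Y w = (indicator {X0..X1} (Re w) * indicator {..Im w} Y :: ennreal)" for Y
   by (auto simp: indicator_def strip_def)
  thus ?thesis by simp
 qed
 have "orbit_sum q (%z. ennreal (cutoff_weight y1 v z)) z
   <= orbit_sum q (%w. ennreal y1 * ?S y1 w + (\<integral>\<^sup>+Y. indicator {y1..1} Y * ?S Y w \<partial>lborel)) z"
  by (rule orbit_sum_mono[OF cutoff_weight_layer_cake[OF v y1] z])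
 also have "... = ennreal y1 * orbit_sum q (?S y1) z + orbit_sum q (%w. \<integral>\<^sup>+Y. indicator {y1..1} Y * ?S Y w \<partial>lborel) z"
  by (simp add: orbit_sum_add orbit_sum_cmult)
 also have "orbit_sum q (%w. \<integral>\<^sup>+Y. indicator {y1..1} Y * ?S Y w \<partial>lborel) z = (\<integral>\<^sup>+Y. orbit_sum q (%w. indicator {y1..1} Y * ?S Y w) z \<partial>lborel)"
  unfolding orbit_sum_def by (rule nn_integral_count_space_nn_integral[symmetric]) auto
 also have "... <= (\<integral>\<^sup>+Y. ennreal ?C * (ennreal (1 / Y) * indicator {y1..1} Y) \<partial>lborel)"
 proof (rule nn_integral_mono)
  fix Y :: real
  show "orbit_sum q (%w. indicator {y1..1} Y * ?S Y w) z <= ennreal ?C * (ennreal (1 / Y) * indicator {y1..1} Y)"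
  proof (cases "Y : {y1..1}")
   case True
   hence "0 < Y" "Y <= 1" using y1 by auto
   from orbit_sum_strip_bound[OF z this X] show ?thesis using True C \<open>0 < Y\<close>
    by (simp add: orbit_sum_cmult ennreal_mult[symmetric])
  qed (simp add: orbit_sum_def)
 qed
 also have "... = ennreal ?C * ennreal (ln 1 - ln y1)"
  using y1 by (subst nn_integral_cmult) (simp_all add: nn_integral_inverse_Icc)
 also have "ennreal y1 * orbit_sum q (?S y1) z <= ennreal y1 * ennreal (?C / y1)"
  by (intro mult_left_mono orbit_sum_strip_bound[OF z y1 X]) simp
 also have "ennreal y1 * ennreal (?C / y1) = ennreal ?C"
  using y1 C by (subst ennreal_mult[symmetric]) auto
 finally have "orbit_sum q (%z. ennreal (cutoff_weight y1 v z)) z <= ennreal ?C + ennreal ?C * ennreal (ln 1 - ln y1)"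
  by (simp add: add_mono)
 also have "... = ennreal (?C * (1 + ln (1 / y1)))"
 proof -
  have "ennreal c + ennreal c * ennreal l = ennreal (c * (1 + l))" if "c >= 0" "l >= 0" for c l
   using that by (simp add: ennreal_mult distrib_left)
  from this[OF C, of "ln 1 - ln y1"] show ?thesis using y1 by (simp add: ln_div)
 qed
 finally show ?thesis .
qed

text \<open>The failure of the mean value property for a slowly varying weight cut off at heights \<open>y1\<close> and \<open>1\<close>.\<close>
definition defect_profile :: "real => real => real => real => real => real" where
 "defect_profile a k \<xi> y1 y = indicator {y1/a..a} y * k * (y + \<xi>) + indicator {y1/a..a * y1} y + indicator {1/a..a} y"

definition mean_value_defect :: "real => real => real => real => real => real => complex => real" where
 "mean_value_defect a k \<xi> y1 X0 X1 z = indicator {X0 - a^2..X1 + a^2} (Re z) * defect_profile a k \<xi> y1 (Im z)"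

lemma defect_profile_measurable [measurable]: "defect_profile a k \<xi> y1 : borel_measurable borel"
 unfolding defect_profile_def[abs_def] by measurable

lemma mean_value_defect_measurable [measurable]: "mean_value_defect a k \<xi> y1 X0 X1 : borel_measurable borel"
 unfolding mean_value_defect_def[abs_def] by measurable

lemma defect_profile_nonneg: "k >= 0 ==> \<xi> >= 0 ==> y > 0 ==> defect_profile a k \<xi> y1 y >= 0"
 by (auto simp: defect_profile_def indicator_def)

lemma mean_value_defect_nonneg: "k >= 0 ==> \<xi> >= 0 ==> z : UHP ==> mean_value_defect a k \<xi> y1 X0 X1 z >= 0"
 by (simp add: mean_value_defect_def defect_profile_nonneg UHP_def)

lemma cutoff_le_mean_value_defect:
 assumes v: "strip_weight X0 X1 v" and K: "K \<rho> >= 0" and slow: "slowly_varying K \<xi> v" and \<rho>: "\<rho> > 0" and \<xi>: "\<xi> >= 0"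
  and y1: "0 < y1" "y1 <= 1" and z: "z : UHP" and w: "w : UHP" and near: "w : hyp_ball \<rho> z"
 shows "indicator {y1..1} (Im z) * v z <= indicator {y1..1} (Im w) * v w + mean_value_defect (2 + \<rho>) (K \<rho>) \<xi> y1 X0 X1 z"
proof -
 define a where "a = 2 + \<rho>"
 have a: "a >= 1" "a > 0" using \<rho> by (auto simp: a_def)
 note ball = hyp_ball_bounds[OF near z w \<rho>, folded a_def]
 have v_range: "0 <= v z" "v z <= 1" "0 <= v w" using v by (auto simp: strip_weight_def)
 show ?thesis unfolding a_def[symmetric]
 proof (cases "Im z : {y1..1} & v z ~= 0")
  case False
  thus "indicator {y1..1} (Im z) * v z <= indicator {y1..1} (Im w) * v w + mean_value_defect a (K \<rho>) \<xi> y1 X0 X1 z"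
   using v_range mean_value_defect_nonneg[OF K \<xi> z, of a y1 X0 X1] by (auto simp: indicator_def)
 next
  case True
  hence "X0 <= Re z" "Re z <= X1" using v by (auto simp: strip_weight_def)
  hence "X0 - a^2 <= Re z" "Re z <= X1 + a^2" using zero_le_power2[of a] by linarith+
  hence defect: "mean_value_defect a (K \<rho>) \<xi> y1 X0 X1 z = defect_profile a (K \<rho>) \<xi> y1 (Im z)"
   by (simp add: mean_value_defect_def)
  have Im_z_bounds: "y1 / a <= Im z" "Im z <= a" using True a y1 frac_le[of y1 y1 1 a] by auto
  have K_nonneg: "K \<rho> * (Im z + \<xi>) >= 0" using K \<xi> z by (simp add: UHP_def)
  show "indicator {y1..1} (Im z) * v z <= indicator {y1..1} (Im w) * v w + mean_value_defect a (K \<rho>) \<xi> y1 X0 X1 z"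
  proof (cases "Im w : {y1..1}")
   case w_in: True
   have "abs (v z - v w) <= K \<rho> * (Im z + \<xi>)" using slow \<rho> z w near by (auto simp: slowly_varying_def)
   also have "... <= defect_profile a (K \<rho>) \<xi> y1 (Im z)" using Im_z_bounds by (simp add: defect_profile_def)
   finally show ?thesis using True w_in by (simp add: defect)
  next
   case False
   have "Im z <= a * y1" if "Im w < y1" using ball(2) mult_strict_left_mono[OF that a(2)] by linarith
   moreover have "1 / a <= Im z" if "1 < Im w" using ball(1) that a by (simp add: field_simps)
   ultimately have "Im z <= a * y1 \<or> 1 / a <= Im z" using False by auto
   hence "1 <= defect_profile a (K \<rho>) \<xi> y1 (Im z)" using Im_z_bounds K_nonneg by (auto simp: defect_profile_def indicator_def)
   thus ?thesis using True False v_range by (simp add: defect)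
  qed
 qed
qed

lemma cutoff_le_ball_integral:
 assumes v: "strip_weight X0 X1 v" and K: "K \<rho> >= 0" and slow: "slowly_varying K \<xi> v" and \<rho>: "\<rho> > 0" and \<xi>: "\<xi> >= 0"
  and y1: "0 < y1" "y1 <= 1" and z: "z : UHP"
 shows "hyp_ball_volume \<rho> * ennreal (cutoff_weight y1 v z) <= ball_integral \<rho> (%w. ennreal (cutoff_weight y1 v w)) z
  + hyp_ball_volume \<rho> * ennreal (Im z * mean_value_defect (2 + \<rho>) (K \<rho>) \<xi> y1 X0 X1 z)"
proof -
 define \<delta> where "\<delta> = mean_value_defect (2 + \<rho>) (K \<rho>) \<xi> y1 X0 X1 z"
 have \<delta>: "\<delta> >= 0" unfolding \<delta>_def by (rule mean_value_defect_nonneg[OF K \<xi> z])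
 have [measurable]: "v : borel_measurable borel" and v_nonneg: "!!w. v w >= 0" using v by (auto simp: strip_weight_def)
 have Im_z_pos: "Im z > 0" using z by (simp add: UHP_def)
 let ?u = "%z. indicator {y1..1} (Im z) * v z" and ?B = "indicator (hyp_ball \<rho> z)"
 have u_nonneg: "?u w >= 0" for w using v_nonneg[of w] by (simp add: indicator_def)
 have "hyp_ball_volume \<rho> * ennreal (cutoff_weight y1 v z) = hyp_ball_volume \<rho> * ennreal (Im z) * ennreal (?u z)"
  using Im_z_pos u_nonneg[of z] by (simp add: cutoff_weight_def ennreal_mult[symmetric] mult_ac)
 also have "... = (\<integral>\<^sup>+w. (?B w * ennreal (Im w)) * ennreal (?u z) \<partial>hyp_measure)"
  by (subst nn_integral_multc) (simp_all add: hyp_ball_mean_Im[OF z])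
 also have "... <= (\<integral>\<^sup>+w. ?B w * ennreal (cutoff_weight y1 v w) + (?B w * ennreal (Im w)) * ennreal \<delta> \<partial>hyp_measure)"
 proof (rule nn_integral_hyp_mono)
  fix w assume w: "w : UHP"
  have Im_w_pos: "Im w > 0" using w by (simp add: UHP_def)
  show "(?B w * ennreal (Im w)) * ennreal (?u z) <= ?B w * ennreal (cutoff_weight y1 v w) + (?B w * ennreal (Im w)) * ennreal \<delta>"
  proof (cases "w : hyp_ball \<rho> z")
   case True
   have "?u z <= ?u w + \<delta>" unfolding \<delta>_def by (rule cutoff_le_mean_value_defect[OF v K slow \<rho> \<xi> y1 z w True])
   hence "Im w * ?u z <= Im w * (?u w + \<delta>)" using Im_w_pos by simp
   hence "ennreal (Im w * ?u z) <= ennreal (cutoff_weight y1 v w + Im w * \<delta>)" by (intro ennreal_leI) (simp add: cutoff_weight_def algebra_simps)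
   thus ?thesis using True \<delta> Im_w_pos u_nonneg[of z] v_nonneg[of w] by (simp add: ennreal_mult cutoff_weight_def)
  qed simp
 qed
 also have "... = ball_integral \<rho> (%w. ennreal (cutoff_weight y1 v w)) z + hyp_ball_volume \<rho> * ennreal (Im z) * ennreal \<delta>"
  unfolding ball_integral_def by (subst nn_integral_add) (simp_all add: nn_integral_multc hyp_ball_mean_Im[OF z])
 finally show ?thesis using Im_z_pos \<delta> by (simp add: \<delta>_def ennreal_mult mult.assoc)
qed

lemma nn_integral_defect_profile:
 assumes a: "a >= 1" and k: "k >= 0" and \<xi>: "\<xi> >= 0" and y1: "0 < y1" "y1 <= 1"
 shows "(\<integral>\<^sup>+y. indicator {0<..} y * ennreal (1 / y^2) * ennreal (y * defect_profile a k \<xi> y1 y) \<partial>lborel)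
  <= ennreal (k * a + k * \<xi> * (2 * ln a + ln (1 / y1)) + 4 * ln a)"
proof -
 let ?J = "%s t y. ennreal (1 / y) * indicator {s..t} y"
 have y1_div_a: "y1 / a <= y1" "y1 / a > 0" "y1 <= a * y1" using a y1 by (auto simp: field_simps)
 have ord: "y1 / a <= a" "y1 / a <= a * y1" "1 / a <= a" "0 < 1 / a" using a y1_div_a y1 divide_le_eq_1_pos[of a 1] by (linarith, linarith, linarith, simp)
 have "indicator {0<..} y * ennreal (1 / y^2) * ennreal (y * defect_profile a k \<xi> y1 y)
   <= ennreal k * indicator {0..a} y + ennreal (k * \<xi>) * ?J (y1/a) a y + (?J (y1/a) (a * y1) y + ?J (1/a) a y)" for y
 proof (cases "y > 0")
  case True
  have "indicator {0<..} y * ennreal (1 / y^2) * ennreal (y * defect_profile a k \<xi> y1 y) = ennreal (1 / y * defect_profile a k \<xi> y1 y)"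
   using True defect_profile_nonneg[OF k \<xi> True] by (simp add: ennreal_mult[symmetric] power2_eq_square)
  also have "1 / y * defect_profile a k \<xi> y1 y
    <= k * indicator {0..a} y + k * \<xi> * (1 / y * indicator {y1/a..a} y) + (1 / y * indicator {y1/a..a * y1} y + 1 / y * indicator {1/a..a} y)"
   using True k \<xi> by (auto simp: defect_profile_def indicator_def field_simps)
  also have "ennreal ... = ennreal k * indicator {0..a} y + ennreal (k * \<xi>) * ?J (y1/a) a y + (?J (y1/a) (a * y1) y + ?J (1/a) a y)"
   using True k \<xi> ennreal_mult[of "k * \<xi>" "1 / y"] by (auto simp: ennreal_plus split: split_indicator)
  finally show ?thesis by (simp add: ennreal_leI)
 qed simp
 hence "(\<integral>\<^sup>+y. indicator {0<..} y * ennreal (1 / y^2) * ennreal (y * defect_profile a k \<xi> y1 y) \<partial>lborel)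
  <= (\<integral>\<^sup>+y. ennreal k * indicator {0..a} y + ennreal (k * \<xi>) * ?J (y1/a) a y + (?J (y1/a) (a * y1) y + ?J (1/a) a y) \<partial>lborel)"
  by (rule nn_integral_mono)
 also have "... = ennreal k * ennreal a + ennreal (k * \<xi>) * ennreal (ln a - ln (y1 / a)) + (ennreal (ln (a * y1) - ln (y1 / a)) + ennreal (ln a - ln (1 / a)))"
  using a by (simp add: nn_integral_add nn_integral_cmult nn_integral_inverse_Icc[OF y1_div_a(2) ord(1)]
    nn_integral_inverse_Icc[OF y1_div_a(2) ord(2)] nn_integral_inverse_Icc[OF ord(4,3)])
 also have "... = ennreal k * ennreal a + ennreal (k * \<xi>) * ennreal (2 * ln a + ln (1 / y1)) + (ennreal (2 * ln a) + ennreal (2 * ln a))"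
  using a y1 by (simp add: ln_div ln_mult)
 also have "... = ennreal (k * a + k * \<xi> * (2 * ln a + ln (1 / y1)) + (2 * ln a + 2 * ln a))"
 proof -
  have "0 <= k" "0 <= a" "0 <= k * \<xi>" "0 <= 2 * ln a + ln (1 / y1)" "0 <= 2 * ln a" using a k \<xi> y1 by auto
  thus ?thesis by (simp only: ennreal_mult ennreal_plus mult_nonneg_nonneg add_nonneg_nonneg)
 qed
 finally show ?thesis by (simp add: add.assoc)
qed

definition defect_const :: "real => real => real => real" where
 "defect_const a k L = (L + 2 * a^2) * (k * a + 2 * k * ln a + k + 4 * ln a)"

lemma defect_const_nonneg: "a >= 1 ==> k >= 0 ==> L >= 0 ==> defect_const a k L >= 0"
 unfolding defect_const_def by (intro mult_nonneg_nonneg add_nonneg_nonneg) auto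

lemma nn_integral_mean_value_defect:
 assumes a: "a >= 1" and k: "k >= 0" and \<xi>: "0 <= \<xi>" "\<xi> <= 1" and y1: "0 < y1" "y1 <= 1" and X: "X0 <= X1"
 shows "(\<integral>\<^sup>+z. ennreal (Im z * mean_value_defect a k \<xi> y1 X0 X1 z) \<partial>hyp_measure)
  <= ennreal (defect_const a k (X1 - X0) * (1 + \<xi> * ln (1 / y1)))"
proof -
 have T_nonneg: "0 <= ln (1 / y1)" "0 <= ln a" using y1 a by auto
 have width: "0 <= X1 - X0 + 2 * a^2" using X by simp
 have "(\<integral>\<^sup>+z. ennreal (Im z * mean_value_defect a k \<xi> y1 X0 X1 z) \<partial>hyp_measure)
   = (\<integral>\<^sup>+z. indicator {X0 - a^2..X1 + a^2} (Re z) * ennreal (Im z * defect_profile a k \<xi> y1 (Im z)) \<partial>hyp_measure)"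
  by (intro nn_integral_cong) (auto simp: mean_value_defect_def indicator_def)
 also have "... = ennreal ((X1 + a^2) - (X0 - a^2)) * (\<integral>\<^sup>+y. indicator {0<..} y * ennreal (1 / y^2) * ennreal (y * defect_profile a k \<xi> y1 y) \<partial>lborel)"
 proof (rule nn_integral_hyp_box)
  show "X0 - a^2 <= X1 + a^2" using width by simp
 qed measurable
 also have "... <= ennreal (X1 - X0 + 2 * a^2) * ennreal (k * a + k * \<xi> * (2 * ln a + ln (1 / y1)) + 4 * ln a)"
  using nn_integral_defect_profile[OF a k \<xi>(1) y1] by (intro mult_mono) (auto simp: algebra_simps)
 also have "... = ennreal ((X1 - X0 + 2 * a^2) * (k * a + k * \<xi> * (2 * ln a + ln (1 / y1)) + 4 * ln a))"
  using width T_nonneg k \<xi> a X by (intro ennreal_mult[symmetric] add_nonneg_nonneg mult_nonneg_nonneg) auto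
 also have "... <= ennreal (defect_const a k (X1 - X0) * (1 + \<xi> * ln (1 / y1)))"
 proof (rule ennreal_leI)
  have "\<xi> * (k * ln a) <= k * ln a" using \<xi> k T_nonneg by (intro mult_left_le_one_le) auto
  moreover have "0 <= (\<xi> * ln (1 / y1)) * (k * a + 2 * k * ln a + 4 * ln a)" using \<xi> T_nonneg k a by (intro mult_nonneg_nonneg add_nonneg_nonneg) auto
  ultimately have "k * a + k * \<xi> * (2 * ln a + ln (1 / y1)) + 4 * ln a <= (k * a + 2 * k * ln a + k + 4 * ln a) * (1 + \<xi> * ln (1 / y1))"
   using k by (simp add: algebra_simps)
  from mult_left_mono[OF this width] show "(X1 - X0 + 2 * a^2) * (k * a + k * \<xi> * (2 * ln a + ln (1 / y1)) + 4 * ln a)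
    <= defect_const a k (X1 - X0) * (1 + \<xi> * ln (1 / y1))" by (simp add: defect_const_def mult.assoc)
 qed
 finally show ?thesis .
qed

definition real_orbit_sum :: "nat => (complex => real) => complex => real" where
 "real_orbit_sum q p z = enn2real (orbit_sum q (%z. ennreal (p z)) z)"

lemma real_orbit_sum_measurable [measurable]:
 assumes [measurable]: "p : borel_measurable borel"
 shows "real_orbit_sum q p : borel_measurable borel"
 unfolding real_orbit_sum_def[abs_def] by measurable

lemma real_orbit_sum_invariant: "Gamma0_invariant q (real_orbit_sum q p)"
 using orbit_sum_invariant[of q] by (simp add: Gamma0_invariant_def real_orbit_sum_def)

lemma real_orbit_sum_bounds:
 assumes "orbit_sum q (%z. ennreal (p z)) z <= ennreal B" "B >= 0"
 shows "0 <= real_orbit_sum q p z" "real_orbit_sum q p z <= B"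
  "ennreal (real_orbit_sum q p z) = orbit_sum q (%z. ennreal (p z)) z"
 using assms le_less_trans[OF assms(1) ennreal_less_top] by (simp_all add: real_orbit_sum_def enn2real_leI)

definition local_variance :: "real => (complex => real) => complex => ennreal" where
 "local_variance \<rho> s z = ball_integral \<rho> (%w. ennreal ((s z - s w)^2)) z"

lemma local_variance_measurable [measurable]:
 assumes [measurable]: "s : borel_measurable borel"
 shows "local_variance \<rho> s : borel_measurable borel"
 unfolding local_variance_def[abs_def] by measurable

lemma local_variance_invariant:
 assumes [measurable]: "s : borel_measurable borel" and s: "Gamma0_invariant q s"
 shows "Gamma0_invariant q (local_variance \<rho> s)"
 unfolding Gamma0_invariant_def
proof (intro ballI)
 fix g z assume g: "g : Gamma0 q" and z: "z : UHP"
 have inv: "s (moeb g w) = s w" if "w : UHP" for w using s g that by (simp add: Gamma0_invariant_def)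
 have "local_variance \<rho> s (moeb g z) = ball_integral \<rho> (%w. ennreal ((s z - s w)^2)) (moeb g z)" by (simp add: local_variance_def inv[OF z])
 also have "... = ball_integral \<rho> (%w. ennreal ((s z - s (moeb g w))^2)) z"
  by (rule ball_integral_moeb[symmetric, OF SL2Z_of_Gamma0[OF g] z, of "%w. ennreal ((s z - s w)^2)"]) measurable
 also have "... = local_variance \<rho> s z" unfolding local_variance_def ball_integral_def
  by (rule nn_integral_hyp_cong) (simp add: inv)
 finally show "local_variance \<rho> s (moeb g z) = local_variance \<rho> s z" .
qed

lemma ennreal_square_diff:
 assumes "s >= 0" "t >= 0"
 shows "ennreal ((s - t)^2) + 2 * (ennreal s * ennreal t) = (ennreal s)^2 + (ennreal t)^2"
proof -
 have "(s - t)^2 + 2 * (s * t) = s^2 + t^2" by (simp add: power2_eq_square algebra_simps)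
 hence "ennreal ((s - t)^2) + ennreal (2 * (s * t)) = ennreal (s^2) + ennreal (t^2)" using assms by (simp flip: ennreal_plus)
 thus ?thesis using assms by (simp add: ennreal_power ennreal_mult)
qed

lemma local_variance_expand:
 assumes [measurable]: "s : borel_measurable borel" and s_nonneg: "!!z. s z >= 0" and z: "z : UHP"
 shows "local_variance \<rho> s z + 2 * (ennreal (s z) * ball_integral \<rho> (%w. ennreal (s w)) z)
  = hyp_ball_volume \<rho> * (ennreal (s z))^2 + ball_integral \<rho> (%w. (ennreal (s w))^2) z"
proof -
 let ?B = "indicator (hyp_ball \<rho> z)"
 have "local_variance \<rho> s z + 2 * (ennreal (s z) * ball_integral \<rho> (%w. ennreal (s w)) z)
   = (\<integral>\<^sup>+w. ?B w * ennreal ((s z - s w)^2) + (2 * ennreal (s z)) * (?B w * ennreal (s w)) \<partial>hyp_measure)"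
  unfolding local_variance_def ball_integral_def by (subst nn_integral_add) (simp_all add: nn_integral_cmult mult.assoc)
 also have "... = (\<integral>\<^sup>+w. ?B w * (ennreal ((s z - s w)^2) + 2 * (ennreal (s z) * ennreal (s w))) \<partial>hyp_measure)"
  by (simp add: distrib_left mult_ac)
 also have "... = (\<integral>\<^sup>+w. ?B w * (ennreal (s z))^2 + ?B w * (ennreal (s w))^2 \<partial>hyp_measure)"
  by (simp only: ennreal_square_diff[OF s_nonneg s_nonneg] distrib_left)
 also have "... = hyp_ball_volume \<rho> * (ennreal (s z))^2 + ball_integral \<rho> (%w. (ennreal (s w))^2) z"
  unfolding ball_integral_def by (subst nn_integral_add) (simp_all add: nn_integral_multc emeasure_hyp_ball[OF z])
 finally show ?thesis .
qed

definition compact_core :: "real => complex set" where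
 "compact_core N = {z. abs (Re z) <= N & 1 / N <= Im z & Im z <= N}"

lemma compact_core_borel [measurable]: "compact_core N : sets borel"
 unfolding compact_core_def by (intro borel_closed closed_Collect_conj closed_Collect_le continuous_intros)

lemma compact_core_finite: "N > 0 ==> emeasure hyp_measure (compact_core N) < \<infinity>"
proof -
 assume N: "N > 0"
 have "emeasure hyp_measure (compact_core N) <= emeasure hyp_measure (strip (-N) N (1/N))"
  by (rule emeasure_mono) (auto simp: compact_core_def strip_def abs_le_iff)
 also have "... < \<infinity>" using N by (simp add: emeasure_strip)
 finally show ?thesis .
qed

lemma mem_compact_core:
 assumes "z : UHP" "abs (Re z) + Im z + 1 / Im z <= N"
 shows "z : compact_core N"
proof -
 have y: "Im z > 0" "1 / Im z > 0" using assms by (auto simp: UHP_def)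
 hence "1 / Im z <= N" "abs (Re z) <= N" "Im z <= N" using assms(2) by linarith+
 moreover from this have "N > 0" using y by linarith
 ultimately show ?thesis using y by (simp add: compact_core_def field_simps)
qed

definition unit_box :: "complex set" where
 "unit_box = {z. -1/2 <= Re z & Re z <= 1/2 & 1/2 <= Im z & Im z <= 1}"

lemma unit_box_borel [measurable]: "unit_box : sets borel"
 unfolding unit_box_def by (intro borel_closed closed_Collect_conj closed_Collect_le continuous_intros)

lemma hyp_area_unit_box: "emeasure hyp_measure unit_box = 1"
proof -
 have "emeasure hyp_measure unit_box = (\<integral>\<^sup>+z. indicator {-1/2..1/2} (Re z) * indicator {1/2..1} (Im z) \<partial>hyp_measure)"
  by (subst nn_integral_indicator[symmetric], simp, intro nn_integral_cong) (auto simp: indicator_def unit_box_def)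
 also have "... = ennreal (1/2 - (-1/2)) * (\<integral>\<^sup>+y. indicator {0<..} y * ennreal (1 / y^2) * indicator {1/2..1} y \<partial>lborel)"
  by (rule nn_integral_hyp_box) auto
 also have "(\<integral>\<^sup>+y. indicator {0<..} y * ennreal (1 / y^2) * indicator {1/2..1} y \<partial>lborel) = (\<integral>\<^sup>+y. ennreal (1 / y^2) * indicator {1/2..1} y \<partial>lborel)"
  by (intro nn_integral_cong) (auto simp: indicator_def)
 also have "... = ennreal ((- 1 / 1) - (- 1 / (1/2)))"
  by (rule nn_integral_FTC_Icc[where F="%y. - 1 / y"])
   (auto intro!: derivative_eq_intros simp: power2_eq_square)
 finally show ?thesis by simp
qed

lemma compact_core_subset_hyp_ball:
 assumes z: "z : unit_box" and N: "N >= 1"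
 shows "compact_core N <= hyp_ball (8 * N * (N + 1)^2) z"
proof
 fix w assume w: "w : compact_core N"
 have "abs (Re w) <= N" "1 / N <= Im w" "Im w <= N" "1 / N > 0" using w N by (auto simp: compact_core_def)
 moreover have "abs (Re z) <= 1/2" "0 <= Im z" "Im z <= 1" using z by (auto simp: unit_box_def)
 ultimately have "abs (Re z - Re w) <= N + 1" "abs (Im z - Im w) <= N + 1" by linarith+
 hence "(Re z - Re w)^2 <= (N+1)^2" "(Im z - Im w)^2 <= (N+1)^2"
  using N by (metis abs_le_square_iff abs_of_nonneg add_nonneg_nonneg order_trans zero_le_one)+
 hence dist: "(norm (z - w))^2 <= 2 * (N+1)^2" by (simp add: cmod_power2)
 have "1 / 2 * (1 / N) <= Im z * Im w" using z w N by (intro mult_mono) (auto simp: compact_core_def unit_box_def)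
 hence "8 * N * (N + 1)^2 * (1 / 2 * (1 / N)) <= 8 * N * (N + 1)^2 * (Im z * Im w)" using N by (intro mult_left_mono) auto
 hence "4 * (N+1)^2 <= 8 * N * (N + 1)^2 * Im z * Im w" using N by (simp add: mult.assoc)
 moreover have "(N+1)^2 > 0" using N by simp
 ultimately show "w : hyp_ball (8 * N * (N + 1)^2) z" using dist unfolding hyp_ball_def mem_Collect_eq by linarith
qed

definition decorrelation_error :: "real => real => real => real => real" where
 "decorrelation_error \<epsilon> K \<xi> y = \<epsilon> * (1 + ln (1 / y)) + K * sqrt ((1 + ln (1 / y)) * (1 + \<xi> * ln (1 / y)))"

context fundamental_domain
begin

lemma ball_correlation_finite:
 assumes [measurable]: "s : borel_measurable borel" and s: "!!z. z : UHP ==> s z <= B" and \<rho>: "\<rho> > 0"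
 shows "(\<integral>\<^sup>+z. indicator D z * (2 * (ennreal (s z) * ball_integral \<rho> (%w. ennreal (s w)) z)) \<partial>hyp_measure) < \<infinity>"
proof -
 let ?v = "hyp_ball_volume \<rho>" and ?A = "ball_integral \<rho> (%w. ennreal (s w))"
 have s_le: "ennreal (s z) <= ennreal B" if "z : UHP" for z using s[OF that] by (rule ennreal_leI)
 have "(\<integral>\<^sup>+z. indicator D z * (2 * (ennreal (s z) * ?A z)) \<partial>hyp_measure) <= (\<integral>\<^sup>+z. 2 * (ennreal B * (?v * ennreal B)) * indicator D z \<partial>hyp_measure)"
 proof (rule nn_integral_hyp_mono)
  fix z assume z: "z : UHP"
  have "?A z <= (\<integral>\<^sup>+w. indicator (hyp_ball \<rho> z) w * ennreal B \<partial>hyp_measure)" unfolding ball_integral_def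
   by (rule nn_integral_hyp_mono) (simp add: s_le mult_left_mono)
  also have "... = ?v * ennreal B" by (subst nn_integral_multc) (simp_all add: emeasure_hyp_ball[OF z])
  finally show "indicator D z * (2 * (ennreal (s z) * ?A z)) <= 2 * (ennreal B * (?v * ennreal B)) * indicator D z"
   using s_le[OF z] by (simp add: indicator_def mult_left_mono mult_mono)
 qed
 also have "... < \<infinity>" using hyp_ball_volume_finite[OF \<rho>] D_finite by (simp add: nn_integral_cmult_indicator ennreal_mult_less_top)
 finally show ?thesis .
qed

text \<open>Ball averaging is self-adjoint on the quotient.\<close>
lemma dirichlet_form_le:
 assumes [measurable]: "s : borel_measurable borel" "r : borel_measurable borel"
  and s: "Gamma0_invariant q s" "!!z. s z >= 0" "!!z. z : UHP ==> s z <= B" and \<rho>: "\<rho> > 0"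
  and mean: "!!z. z : UHP ==> hyp_ball_volume \<rho> * ennreal (s z) <= ball_integral \<rho> (%w. ennreal (s w)) z + r z"
 shows "(\<integral>\<^sup>+z. indicator D z * local_variance \<rho> s z \<partial>hyp_measure) <= 2 * ennreal B * (\<integral>\<^sup>+z. indicator D z * r z \<partial>hyp_measure)"
proof -
 let ?I = "%f. \<integral>\<^sup>+z. indicator D z * f z \<partial>hyp_measure" and ?S = "%z. ennreal (s z)" and ?v = "hyp_ball_volume \<rho>"
 let ?A = "ball_integral \<rho> ?S" and ?X = "%z. 2 * (?S z * ball_integral \<rho> ?S z)"
 have add: "?I (%z. f z + h z) = ?I f + ?I h" if [measurable]: "f : borel_measurable borel" "h : borel_measurable borel" for f h
  by (simp add: distrib_left nn_integral_add)
 have mono: "?I f <= ?I h" if "!!z. z : UHP ==> f z <= h z" for f h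
  by (intro nn_integral_hyp_mono mult_left_mono that) auto
 have cmult: "?I (%z. c * f z) = c * ?I f" if [measurable]: "f : borel_measurable borel" for c f
  by (simp add: mult.left_commute nn_integral_cmult)
 have orbit_sum_le: "?S z <= ennreal B" if "z : UHP" for z using s(3)[OF that] by (rule ennreal_leI)
 have X: "?I ?X < \<infinity>" by (rule ball_correlation_finite[OF assms(1) s(3) \<rho>])
 have "?I ?X + ?I (local_variance \<rho> s) = ?I (%z. local_variance \<rho> s z + ?X z)"
  by (simp add: add add.commute)
 also have "... = ?I (%z. ?v * (?S z)^2 + ball_integral \<rho> (%w. (?S w)^2) z)"
  by (rule nn_integral_hyp_cong) (simp only: local_variance_expand assms)
 also have "... = ?I (%z. ?v * (?S z)^2) + ?I (ball_integral \<rho> (%w. (?S w)^2))" by (rule add) measurable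
 also have "?I (ball_integral \<rho> (%w. (?S w)^2)) = ?I (%z. ?v * (?S z)^2)"
  unfolding cmult[of "%z. (?S z)^2"] using s(1) by (subst ball_integral_self_adjoint) (auto simp: Gamma0_invariant_def cmult)
 also have "?I (%z. ?v * (?S z)^2) + ?I (%z. ?v * (?S z)^2) = ?I (%z. 2 * (?v * (?S z)^2))"
  by (simp add: mult_2 add)
 also have "... <= ?I (%z. ?X z + 2 * (ennreal B * r z))"
 proof (rule mono)
  fix z assume z: "z : UHP"
  have "?v * (?S z)^2 = ?S z * (?v * ?S z)" by (simp add: power2_eq_square mult_ac)
  also have "... <= ?S z * (?A z + r z)" by (intro mult_left_mono mean[OF z]) simp
  also have "... <= ?S z * ?A z + ennreal B * r z"
   unfolding distrib_left by (intro add_left_mono mult_right_mono orbit_sum_le[OF z]) simp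
  finally show "2 * (?v * (?S z)^2) <= ?X z + 2 * (ennreal B * r z)"
   unfolding distrib_left[symmetric] by (intro mult_left_mono) simp_all
 qed
 also have "... = ?I ?X + ?I (%z. 2 * (ennreal B * r z))" by (rule add) measurable
 finally have "?I (local_variance \<rho> s) <= ?I (%z. 2 * (ennreal B * r z))"
  using X by (auto simp: ennreal_add_left_cancel_le)
 thus ?thesis by (simp add: cmult mult.assoc)
qed

lemma cutoff_local_variance:
 assumes v: "strip_weight X0 X1 v" and K: "K \<rho> >= 0" and slow: "slowly_varying K \<xi> v" and \<rho>: "\<rho> > 0" and \<xi>: "0 <= \<xi>" "\<xi> <= 1"
  and y1: "0 < y1" "y1 <= 1" and X: "X0 <= X1" and vol: "hyp_ball_volume \<rho> = ennreal c" "c >= 0"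
 defines "B == 14 * (X1 - X0 + 1) * (1 + ln (1 / y1))"
 shows "(\<integral>\<^sup>+z. indicator D z * local_variance \<rho> (real_orbit_sum q (cutoff_weight y1 v)) z \<partial>hyp_measure)
  <= ennreal (4 * B * (c * defect_const (2 + \<rho>) (K \<rho>) (X1 - X0) * (1 + \<xi> * ln (1 / y1))))"
proof -
 define p where "p = (%z. ennreal (cutoff_weight y1 v z))"
 define r where "r = (%z. hyp_ball_volume \<rho> * ennreal (Im z * mean_value_defect (2 + \<rho>) (K \<rho>) \<xi> y1 X0 X1 z))"
 have [measurable]: "v : borel_measurable borel" using v by (simp add: strip_weight_def)
 have [measurable]: "p : borel_measurable borel" "r : borel_measurable borel" unfolding p_def r_def by measurable
 have T_nonneg: "ln (1 / y1) >= 0" using y1 by simp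
 have B: "B >= 0" using X T_nonneg by (simp add: B_def)
 have orbit_sum_le: "orbit_sum q (%z. ennreal (cutoff_weight y1 v z)) z <= ennreal B" if "z : UHP" for z
  unfolding B_def by (rule orbit_sum_cutoff_bound[OF v y1 X that])
 note s = real_orbit_sum_bounds[OF orbit_sum_le B]
 have mean: "hyp_ball_volume \<rho> * orbit_sum q p z <= ball_integral \<rho> (orbit_sum q p) z + orbit_sum q r z" if z: "z : UHP" for z
 proof -
  have "hyp_ball_volume \<rho> * orbit_sum q p z = orbit_sum q (%z. hyp_ball_volume \<rho> * p z) z" by (simp add: orbit_sum_cmult)
  also have "... <= orbit_sum q (%z. ball_integral \<rho> p z + r z) z"
   unfolding p_def r_def by (rule orbit_sum_mono[OF cutoff_le_ball_integral[OF v K slow \<rho> \<xi>(1) y1] z])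
  also have "... = ball_integral \<rho> (orbit_sum q p) z + orbit_sum q r z" using z by (simp add: orbit_sum_add ball_integral_orbit_sum)
  finally show ?thesis .
 qed
 have avg: "ball_integral \<rho> (orbit_sum q p) z = ball_integral \<rho> (%w. ennreal (real_orbit_sum q (cutoff_weight y1 v) w)) z" for z
  unfolding ball_integral_def p_def by (rule nn_integral_hyp_cong) (simp add: s)
 have "(\<integral>\<^sup>+z. indicator D z * local_variance \<rho> (real_orbit_sum q (cutoff_weight y1 v)) z \<partial>hyp_measure)
   <= 2 * ennreal B * (\<integral>\<^sup>+z. indicator D z * orbit_sum q r z \<partial>hyp_measure)"
 proof (rule dirichlet_form_le[OF _ _ real_orbit_sum_invariant _ s(2) \<rho>])
  fix z assume z: "z : UHP"
  show "hyp_ball_volume \<rho> * ennreal (real_orbit_sum q (cutoff_weight y1 v) z)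
    <= ball_integral \<rho> (%w. ennreal (real_orbit_sum q (cutoff_weight y1 v) w)) z + orbit_sum q r z"
   using mean[OF z] unfolding avg unfolding s(3)[OF z] p_def .
 qed (simp_all add: real_orbit_sum_def)
 also have "... = 4 * ennreal B * nn_integral hyp_measure r"
  using mult.assoc[of 2 2 "ennreal B * nn_integral hyp_measure r"] by (simp add: unfolding_nn mult_ac)
 also have "nn_integral hyp_measure r <= ennreal c * ennreal (defect_const (2 + \<rho>) (K \<rho>) (X1 - X0) * (1 + \<xi> * ln (1 / y1)))"
  unfolding r_def using nn_integral_mean_value_defect[of "2 + \<rho>", OF _ K \<xi> y1 X] \<rho> vol by (simp add: nn_integral_cmult mult_left_mono)
 also have "4 * ennreal B * (ennreal c * ennreal (defect_const (2 + \<rho>) (K \<rho>) (X1 - X0) * (1 + \<xi> * ln (1 / y1))))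
   = ennreal (4 * B * (c * defect_const (2 + \<rho>) (K \<rho>) (X1 - X0) * (1 + \<xi> * ln (1 / y1))))"
  using B vol defect_const_nonneg[of "2 + \<rho>" "K \<rho>" "X1 - X0"] \<rho> K X \<xi> T_nonneg by (simp add: ennreal_mult mult_ac)
 finally show ?thesis by (simp add: mult_left_mono)
qed

lemma integrable_D:
 assumes [measurable]: "k : borel_measurable borel" and "!!z. z : UHP ==> abs (k z) <= c"
 shows "integrable hyp_measure (%z. indicator D z * k z :: real)"
 by (rule integrableI_bounded_set[of D _ _ c]) (use assms(2) D_UHP D_finite in auto)

lemma unfolding_nonneg:
 assumes [measurable]: "p : borel_measurable borel" and p_nonneg: "!!z. p z >= 0"
  and orbit_sum_le: "!!z. z : UHP ==> orbit_sum q (%z. ennreal (p z)) z <= ennreal B" and B: "B >= 0"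
  and [measurable]: "k : borel_measurable borel" and k_bounds: "!!z. 0 <= k z" "!!z. k z <= c" and inv: "Gamma0_invariant q k"
 shows "integrable hyp_measure (%z. p z * k z)"
  and "(LINT z|hyp_measure. indicator D z * (real_orbit_sum q p z * k z)) = 2 * (LINT z|hyp_measure. p z * k z)"
proof -
 let ?s = "real_orbit_sum q p"
 note s = real_orbit_sum_bounds[OF orbit_sum_le B]
 have "(\<integral>\<^sup>+z. ennreal (indicator D z * (?s z * k z)) \<partial>hyp_measure) = (\<integral>\<^sup>+z. indicator D z * (orbit_sum q (%z. ennreal (p z)) z * ennreal (k z)) \<partial>hyp_measure)"
 proof (rule nn_integral_hyp_cong)
  fix z assume "z : UHP"
  from s(1,3)[OF this] show "ennreal (indicator D z * (?s z * k z)) = indicator D z * (orbit_sum q (%z. ennreal (p z)) z * ennreal (k z))"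
   using k_bounds(1)[of z] by (cases "z : D") (simp_all add: ennreal_mult)
 qed
 also have "... = 2 * (\<integral>\<^sup>+z. ennreal (p z) * ennreal (k z) \<partial>hyp_measure)"
  by (rule unfolding_nn_invariant) (use inv in \<open>auto simp: Gamma0_invariant_def\<close>)
 finally have eq: "(\<integral>\<^sup>+z. ennreal (indicator D z * (?s z * k z)) \<partial>hyp_measure) = 2 * (\<integral>\<^sup>+z. ennreal (p z * k z) \<partial>hyp_measure)"
  using p_nonneg k_bounds by (simp add: ennreal_mult)
 have "integrable hyp_measure (%z. indicator D z * (?s z * k z))"
  by (rule integrable_D[of _ "B * c"]) (use s k_bounds B in \<open>auto simp: abs_mult intro!: mult_mono\<close>)
 hence "(\<integral>\<^sup>+z. ennreal (indicator D z * (?s z * k z)) \<partial>hyp_measure) < \<infinity>"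
  using k_bounds by (subst (asm) integrable_iff_bounded) (simp add: abs_mult real_orbit_sum_def)
 hence "(\<integral>\<^sup>+z. ennreal (p z * k z) \<partial>hyp_measure) < \<infinity>" unfolding eq by (auto simp: ennreal_mult_less_top)
 thus "integrable hyp_measure (%z. p z * k z)" using p_nonneg k_bounds by (intro integrableI_nonneg) auto
 have "(LINT z|hyp_measure. indicator D z * (?s z * k z)) = enn2real (\<integral>\<^sup>+z. ennreal (indicator D z * (?s z * k z)) \<partial>hyp_measure)"
  using k_bounds by (intro integral_eq_nn_integral) (auto simp: real_orbit_sum_def)
 also have "... = 2 * enn2real (\<integral>\<^sup>+z. ennreal (p z * k z) \<partial>hyp_measure)" unfolding eq by (simp add: enn2real_mult)
 also have "enn2real (\<integral>\<^sup>+z. ennreal (p z * k z) \<partial>hyp_measure) = (LINT z|hyp_measure. p z * k z)"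
  using p_nonneg k_bounds by (intro integral_eq_nn_integral[symmetric]) auto
 finally show "(LINT z|hyp_measure. indicator D z * (?s z * k z)) = 2 * (LINT z|hyp_measure. p z * k z)" .
qed

lemma unfolding_real:
 assumes p [measurable]: "p : borel_measurable borel" and p_nonneg: "!!z. p z >= 0"
  and orbit_sum_le: "!!z. z : UHP ==> orbit_sum q (%z. ennreal (p z)) z <= ennreal B" and B: "B >= 0"
  and [measurable]: "h : borel_measurable borel" and h_bound: "!!z. abs (h z) <= Hb" and inv: "Gamma0_invariant q h"
 shows "integrable hyp_measure (%z. p z * h z)"
  and "(LINT z|hyp_measure. indicator D z * (real_orbit_sum q p z * h z)) = 2 * (LINT z|hyp_measure. p z * h z)"
proof -
 let ?s = "real_orbit_sum q p"
 note s = real_orbit_sum_bounds[OF orbit_sum_le B]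
 have Hb_nonneg: "Hb >= 0" using h_bound[of 0] by linarith
 have range: "0 <= h z + Hb" "h z + Hb <= 2 * Hb" for z using h_bound[of z] by (auto simp: abs_le_iff)
 have shifted: "integrable hyp_measure (%z. p z * (h z + Hb))"
  "(LINT z|hyp_measure. indicator D z * (?s z * (h z + Hb))) = 2 * (LINT z|hyp_measure. p z * (h z + Hb))"
  by (rule unfolding_nonneg[OF p p_nonneg orbit_sum_le B _ range]; use inv in \<open>simp add: Gamma0_invariant_def\<close>)+
 have const: "integrable hyp_measure (%z. p z * Hb)"
  "(LINT z|hyp_measure. indicator D z * (?s z * Hb)) = 2 * (LINT z|hyp_measure. p z * Hb)"
  by (rule unfolding_nonneg[OF p p_nonneg orbit_sum_le B, of _ Hb]; use Hb_nonneg in \<open>simp add: Gamma0_invariant_def\<close>)+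
 have diff: "p z * h z = p z * (h z + Hb) - p z * Hb"
  "indicator D z * (?s z * h z) = indicator D z * (?s z * (h z + Hb)) - indicator D z * (?s z * Hb)" for z by (simp_all add: algebra_simps)
 show "integrable hyp_measure (%z. p z * h z)" unfolding diff(1) using shifted const by (intro Bochner_Integration.integrable_diff) auto
 have integrable_product: "integrable hyp_measure (%z. indicator D z * (?s z * k z))"
  if "k : borel_measurable borel" "!!z. 0 <= k z" "!!z. k z <= 2 * Hb" for k
  by (rule integrable_D[of _ "B * (2 * Hb)"]) (use s that B in \<open>auto simp: abs_mult intro!: mult_mono\<close>)
 show "(LINT z|hyp_measure. indicator D z * (?s z * h z)) = 2 * (LINT z|hyp_measure. p z * h z)"
  unfolding diff using shifted const integrable_product[of "%z. h z + Hb"] integrable_product[of "%_. Hb"] range Hb_nonneg by simp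
qed

lemma D_minus_compact_core_small:
 assumes "e > 0"
 obtains N where "N >= 1" "measure hyp_measure (D - compact_core N) < e"
proof -
 define A where "A = (%n::nat. D - compact_core (real n + 1))"
 have "decseq A"
 proof (unfold decseq_def, intro allI impI)
  fix m n :: nat assume mn: "m <= n"
  have "1 / (real n + 1) <= 1 / (real m + 1)" using mn by (simp add: frac_le)
  thus "A n <= A m" using mn by (auto simp: A_def compact_core_def)
 qed
 moreover have "emeasure hyp_measure (A i) ~= \<infinity>" for i
  using emeasure_mono[of "A i" D hyp_measure] D_finite by (auto simp: A_def top_unique)
 ultimately have "(%n. measure hyp_measure (A n)) \<longlonglongrightarrow> measure hyp_measure (\<Inter>i. A i)"
  by (intro Lim_measure_decseq) (auto simp: A_def)
 moreover have "(\<Inter>i. A i) = {}"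
 proof (rule ccontr)
  assume "(\<Inter>i. A i) ~= {}"
  then obtain z where z: "!!i. z : A i" by blast
  hence z_UHP: "z : UHP" using z[of 0] D_UHP by (auto simp: A_def)
  obtain n :: nat where "abs (Re z) + Im z + 1 / Im z <= real n" using real_arch_simple by blast
  hence "z : compact_core (real n + 1)" using mem_compact_core[OF z_UHP] by simp
  thus False using z[of n] by (simp add: A_def)
 qed
 ultimately have "(%n. measure hyp_measure (A n)) \<longlonglongrightarrow> 0" by simp
 from order_tendstoD(2)[OF this assms] obtain n where "measure hyp_measure (A n) < e"
  by (auto simp: eventually_sequentially)
 thus ?thesis by (intro that[of "real n + 1"]) (simp_all add: A_def)
qed

lemma small_value_in_unit_box:
 assumes [measurable]: "Q : borel_measurable borel" and inv: "Gamma0_invariant q Q"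
  and Q: "(\<integral>\<^sup>+z. indicator D z * Q z \<partial>hyp_measure) <= ennreal A" and A: "A >= 0"
 obtains z where "z : unit_box" "Q z <= ennreal (56 * A + 1)"
proof (rule ccontr)
 assume "~ thesis"
 hence big: "Q z >= ennreal (56 * A + 1)" if "z : unit_box" for z using that \<open>!!z. z : unit_box ==> _ ==> thesis\<close> by force
 have "ennreal (56 * A + 1) = (\<integral>\<^sup>+z. ennreal (56 * A + 1) * indicator unit_box z \<partial>hyp_measure)"
  by (simp add: nn_integral_cmult_indicator hyp_area_unit_box)
 also have "... <= (\<integral>\<^sup>+z. indicator (strip (-1/2) (1/2) (1/2)) z * Q z \<partial>hyp_measure)"
  using big by (intro nn_integral_mono) (auto simp: indicator_def unit_box_def strip_def)
 also have "... <= ennreal (14 * (1/2 - (-1/2) + 1) / (1/2)) * (\<integral>\<^sup>+z. indicator D z * Q z \<partial>hyp_measure)"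
  by (rule nn_integral_strip_le[OF _ inv]) auto
 also have "... <= ennreal (14 * (1/2 - (-1/2) + 1) / (1/2)) * ennreal A" by (intro mult_left_mono Q) simp
 also have "... = ennreal (56 * A)" using A by (subst ennreal_mult[symmetric]) auto
 finally show False using A by (subst (asm) ennreal_le_iff) auto
qed

lemma abs_le_half_plus_square:
 fixes x \<sigma> :: real
 assumes "\<sigma> > 0"
 shows "abs x <= \<sigma> / 2 + 1 / (2 * \<sigma>) * x^2"
proof -
 have "0 <= (abs x - \<sigma>)^2" by simp
 hence "2 * \<sigma> * abs x <= \<sigma>^2 + x^2" by (simp add: power2_eq_square algebra_simps)
 thus ?thesis using assms by (simp add: field_simps power2_eq_square)
qed

lemma L1_deviation_le:
 assumes [measurable]: "s : borel_measurable borel" and s: "!!z. z : UHP ==> 0 <= s z & s z <= B" and m: "0 <= m" "m <= B" and N: "N >= 1"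
  and var: "(\<integral>\<^sup>+w. indicator (compact_core N) w * ennreal ((m - s w)^2) \<partial>hyp_measure) <= ennreal (\<sigma>^2)" and \<sigma>: "\<sigma> > 0"
  and e: "measure hyp_measure (D - compact_core N) <= e"
 shows "(LINT z|hyp_measure. indicator D z * abs (s z - m)) <= \<sigma> / 2 * (measure hyp_measure (compact_core N) + 1) + B * e"
proof -
 let ?K = "compact_core N" and ?\<mu> = "measure hyp_measure"
 have B: "B >= 0" and e_nonneg: "e >= 0" using m e order_trans[OF measure_nonneg] by auto
 have K: "emeasure hyp_measure ?K = ennreal (?\<mu> ?K)" using compact_core_finite[of N] N by (simp add: emeasure_eq_ennreal_measure less_top)
 have emeasure_D_minus_K: "emeasure hyp_measure (D - ?K) = ennreal (?\<mu> (D - ?K))"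
  using emeasure_mono[of "D - ?K" D hyp_measure] D_finite by (intro emeasure_eq_ennreal_measure) (auto simp: top_unique)
 have "(\<integral>\<^sup>+z. ennreal (indicator D z * abs (s z - m)) \<partial>hyp_measure)
  <= (\<integral>\<^sup>+z. ennreal (\<sigma> / 2) * indicator ?K z + ennreal (1 / (2 * \<sigma>)) * (indicator ?K z * ennreal ((m - s z)^2)) + ennreal B * indicator (D - ?K) z \<partial>hyp_measure)"
 proof (rule nn_integral_hyp_mono)
  fix z assume z: "z : UHP"
  consider "z \<notin> D" | "z : D" "z : ?K" | "z : D" "z \<notin> ?K" by blast
  thus "ennreal (indicator D z * abs (s z - m)) <= ennreal (\<sigma> / 2) * indicator ?K z + ennreal (1 / (2 * \<sigma>)) * (indicator ?K z * ennreal ((m - s z)^2)) + ennreal B * indicator (D - ?K) z"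
  proof cases
   case 2
   have "ennreal (abs (s z - m)) <= ennreal (\<sigma> / 2 + 1 / (2 * \<sigma>) * (s z - m)^2)" by (intro ennreal_leI abs_le_half_plus_square \<sigma>)
   also have "... = ennreal (\<sigma> / 2) + ennreal (1 / (2 * \<sigma>)) * ennreal ((m - s z)^2)"
    using \<sigma> by (subst ennreal_plus) (auto simp: ennreal_mult[symmetric] power2_commute[of m])
   finally show ?thesis using 2 by simp
  next
   case 3
   have "abs (s z - m) <= B" using s[OF z] m by (auto simp: abs_le_iff)
   thus ?thesis using 3 by (simp add: ennreal_leI)
  qed simp
 qed
 also have "... = ennreal (\<sigma> / 2) * emeasure hyp_measure ?K + ennreal (1 / (2 * \<sigma>)) * (\<integral>\<^sup>+w. indicator ?K w * ennreal ((m - s w)^2) \<partial>hyp_measure) + ennreal B * emeasure hyp_measure (D - ?K)"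
  by (subst nn_integral_add, measurable, subst nn_integral_add, measurable)
   (simp add: nn_integral_cmult nn_integral_cmult_indicator)
 also have "... <= ennreal (\<sigma> / 2) * ennreal (?\<mu> ?K) + ennreal (1 / (2 * \<sigma>)) * ennreal (\<sigma>^2) + ennreal B * ennreal e"
  unfolding K emeasure_D_minus_K using var e by (intro add_mono mult_left_mono order_refl ennreal_leI) auto
 also have "... = ennreal (\<sigma> / 2 * ?\<mu> ?K + \<sigma> / 2 + B * e)"
  using \<sigma> B e_nonneg by (simp add: ennreal_plus ennreal_mult[symmetric] power2_eq_square)
 finally have "enn2real (\<integral>\<^sup>+z. ennreal (indicator D z * abs (s z - m)) \<partial>hyp_measure) <= \<sigma> / 2 * ?\<mu> ?K + \<sigma> / 2 + B * e"
  using \<sigma> B e_nonneg by (intro enn2real_leI) auto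
 thus ?thesis by (subst integral_eq_nn_integral) (auto simp: algebra_simps)
qed

lemma covariance_le_L1_deviation:
 fixes h s :: "complex => real"
 assumes [measurable]: "h : borel_measurable borel" "s : borel_measurable borel" and h_bound: "!!z. abs (h z) <= Hb"
  and mean: "(LINT z|hyp_measure. indicator D z * h z) = 0" and s: "!!z. z : UHP ==> abs (s z) <= B"
 shows "abs (LINT z|hyp_measure. indicator D z * (s z * h z)) <= Hb * (LINT z|hyp_measure. indicator D z * abs (s z - m))"
proof -
 have "abs (s z * h z) <= B * Hb" if "z : UHP" for z
  using s[OF that] h_bound[of z] unfolding abs_mult by (intro mult_mono) auto
 hence int: "integrable hyp_measure (%z. indicator D z * (s z * h z))" by (intro integrable_D[of _ "B * Hb"]) auto
 have integrable_h: "integrable hyp_measure (%z. indicator D z * h z)" by (rule integrable_D[of _ Hb]) (use h_bound in auto)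
 have "abs (s z - m) <= B + abs m" if "z : UHP" for z using s[OF that] by linarith
 hence integrable_dev: "integrable hyp_measure (%z. indicator D z * abs (s z - m))" by (intro integrable_D[of _ "B + abs m"]) auto
 have "(LINT z|hyp_measure. indicator D z * (s z * h z)) = (LINT z|hyp_measure. indicator D z * (s z * h z) - m * (indicator D z * h z))"
  using int integrable_h mean by simp
 also have "abs ... <= (LINT z|hyp_measure. Hb * (indicator D z * abs (s z - m)))"
 proof (rule integral_abs_bound_integral)
  fix z
  have "abs ((s z - m) * h z) <= abs (s z - m) * Hb" using h_bound[of z] by (simp add: abs_mult mult_left_mono)
  thus "abs (indicator D z * (s z * h z) - m * (indicator D z * h z)) <= Hb * (indicator D z * abs (s z - m))"
   by (cases "z : D") (auto simp: algebra_simps)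
 qed (use int integrable_h integrable_dev in simp_all)
 finally show ?thesis by simp
qed

definition variance_const :: "(real => real) => real => real => real => real" where
 "variance_const K X0 X1 N = (let \<rho> = 8 * N * (N + 1)^2 in
  224 * (14 * (X1 - X0 + 1)) * (enn2real (hyp_ball_volume \<rho>) * defect_const (2 + \<rho>) (K \<rho>) (X1 - X0)) + 1)"

lemma variance_const_pos:
 assumes "X0 <= X1" "!!\<rho>. K \<rho> >= 0" "N >= 1"
 shows "variance_const K X0 X1 N > 0"
 using assms by (simp add: variance_const_def Let_def defect_const_nonneg add_nonneg_pos)

lemma cutoff_orbit_sum_small_variance:
 assumes v: "strip_weight X0 X1 v" and K: "!!\<rho>. K \<rho> >= 0" and slow: "slowly_varying K \<xi> v" and \<xi>: "0 <= \<xi>" "\<xi> <= 1"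
  and y: "0 < y" "y <= 1" and X: "X0 <= X1" and N: "N >= 1"
 obtains z where "z : unit_box" "local_variance (8 * N * (N + 1)^2) (real_orbit_sum q (cutoff_weight y v)) z
  <= ennreal (variance_const K X0 X1 N * ((1 + ln (1 / y)) * (1 + \<xi> * ln (1 / y))))"
proof -
 define \<rho> where "\<rho> = 8 * N * (N + 1)^2"
 have \<rho>: "\<rho> > 0" using N by (simp add: \<rho>_def)
 define c where "c = enn2real (hyp_ball_volume \<rho>)"
 have c: "hyp_ball_volume \<rho> = ennreal c" "c >= 0" using hyp_ball_volume_finite[OF \<rho>] by (auto simp: c_def)
 define T where "T = ln (1 / y)"
 have T_nonneg: "T >= 0" using y by (simp add: T_def)
 define P where "P = 14 * (X1 - X0 + 1) * (c * defect_const (2 + \<rho>) (K \<rho>) (X1 - X0)) * ((1 + T) * (1 + \<xi> * T))"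
 have P: "P >= 0" using X c \<rho> K \<xi> T_nonneg by (simp add: P_def defect_const_nonneg)
 have [measurable]: "v : borel_measurable borel" using v by (simp add: strip_weight_def)
 have s [measurable]: "real_orbit_sum q (cutoff_weight y v) : borel_measurable borel" by measurable
 have "(\<integral>\<^sup>+z. indicator D z * local_variance \<rho> (real_orbit_sum q (cutoff_weight y v)) z \<partial>hyp_measure) <= ennreal (4 * P)"
  using cutoff_local_variance[OF v K slow \<rho> \<xi> y X c] by (simp add: P_def T_def mult_ac)
 moreover have "0 <= 4 * P" using P by simp
 ultimately obtain z where z: "z : unit_box" "local_variance \<rho> (real_orbit_sum q (cutoff_weight y v)) z <= ennreal (56 * (4 * P) + 1)"
  using small_value_in_unit_box[OF local_variance_measurable[OF s] local_variance_invariant[OF s real_orbit_sum_invariant]] by blast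
 have "1 <= (1 + T) * (1 + \<xi> * T)" using T_nonneg \<xi> by (simp add: algebra_simps)
 hence "56 * (4 * P) + 1 <= variance_const K X0 X1 N * ((1 + T) * (1 + \<xi> * T))"
  by (simp add: variance_const_def Let_def P_def c_def \<rho>_def algebra_simps)
 hence "local_variance \<rho> (real_orbit_sum q (cutoff_weight y v)) z <= ennreal (variance_const K X0 X1 N * ((1 + T) * (1 + \<xi> * T)))"
  using z(2) by (meson ennreal_leI order_trans)
 thus ?thesis using z(1) that by (simp add: \<rho>_def T_def)
qed

lemma cutoff_orbit_sum_L1_deviation:
 assumes v: "strip_weight X0 X1 v" and K: "!!\<rho>. K \<rho> >= 0" and slow: "slowly_varying K \<xi> v" and \<xi>: "0 <= \<xi>" "\<xi> <= 1"
  and y: "0 < y" "y <= 1" and X: "X0 <= X1" and N: "N >= 1" "measure hyp_measure (D - compact_core N) <= e"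
 obtains m where "(LINT w|hyp_measure. indicator D w * abs (real_orbit_sum q (cutoff_weight y v) w - m))
  <= sqrt (variance_const K X0 X1 N * ((1 + ln (1 / y)) * (1 + \<xi> * ln (1 / y)))) / 2 * (measure hyp_measure (compact_core N) + 1)
   + 14 * (X1 - X0 + 1) * (1 + ln (1 / y)) * e"
proof -
 let ?s = "real_orbit_sum q (cutoff_weight y v)" and ?B = "14 * (X1 - X0 + 1) * (1 + ln (1 / y))"
 define A where "A = variance_const K X0 X1 N * ((1 + ln (1 / y)) * (1 + \<xi> * ln (1 / y)))"
 obtain z where z: "z : unit_box" and variance: "local_variance (8 * N * (N + 1)^2) ?s z <= ennreal A"
  unfolding A_def by (rule cutoff_orbit_sum_small_variance[OF v K slow \<xi> y X N(1)])
 have A: "A > 0" unfolding A_def using y \<xi> by (intro mult_pos_pos variance_const_pos X K N(1) add_pos_nonneg) auto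
 have [measurable]: "v : borel_measurable borel" using v by (simp add: strip_weight_def)
 have "?B >= 0" using X y by simp
 note s = real_orbit_sum_bounds(1,2)[OF orbit_sum_cutoff_bound[OF v y X] this]
 have z_UHP: "z : UHP" using z by (auto simp: unit_box_def UHP_def)
 have "(\<integral>\<^sup>+w. indicator (compact_core N) w * ennreal ((?s z - ?s w)^2) \<partial>hyp_measure) <= local_variance (8 * N * (N + 1)^2) ?s z"
  unfolding local_variance_def ball_integral_def using compact_core_subset_hyp_ball[OF z N(1)]
  by (intro nn_integral_mono) (auto simp: indicator_def)
 hence "(LINT w|hyp_measure. indicator D w * abs (?s w - ?s z)) <= sqrt A / 2 * (measure hyp_measure (compact_core N) + 1) + ?B * e"
  using variance N s[OF z_UHP] s A by (intro L1_deviation_le) auto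
 thus ?thesis using that by (simp add: A_def)
qed

lemma cutoff_correlation_le:
 assumes h [measurable]: "h : borel_measurable borel" and h_bound: "!!z. abs (h z) <= Hb" and inv: "Gamma0_invariant q h"
  and mean: "(LINT z|hyp_measure. indicator D z * h z) = 0"
  and v: "strip_weight X0 X1 v" and y: "0 < y" "y <= 1" and X: "X0 <= X1"
 shows "2 * abs (LINT z|hyp_measure. cutoff_weight y v z * h z)
  <= Hb * (LINT w|hyp_measure. indicator D w * abs (real_orbit_sum q (cutoff_weight y v) w - m))"
proof -
 let ?s = "real_orbit_sum q (cutoff_weight y v)"
 have [measurable]: "v : borel_measurable borel" using v by (simp add: strip_weight_def)
 have B: "14 * (X1 - X0 + 1) * (1 + ln (1 / y)) >= 0" using X y by simp
 note s = real_orbit_sum_bounds(1,2)[OF orbit_sum_cutoff_bound[OF v y X] B]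
 have "2 * (LINT z|hyp_measure. cutoff_weight y v z * h z) = (LINT z|hyp_measure. indicator D z * (?s z * h z))"
  using cutoff_weight_nonneg[OF v y(1)] by (intro unfolding_real(2)[symmetric, OF _ _ orbit_sum_cutoff_bound[OF v y X] B h h_bound inv]) auto
 also have "abs ... <= Hb * (LINT w|hyp_measure. indicator D w * abs (?s w - m))"
  using s by (intro covariance_le_L1_deviation[OF h _ h_bound mean]) auto
 finally show ?thesis by (simp add: abs_mult)
qed

lemma decorrelation:
 assumes h: "h : borel_measurable borel" and h_bound: "!!z. abs (h z) <= Hb" and inv: "Gamma0_invariant q h"
  and mean: "(LINT z|hyp_measure. indicator D z * h z) = 0"
  and X: "X0 <= X1" and K: "!!\<rho>. K \<rho> >= 0" and \<epsilon>: "\<epsilon> > 0"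
 obtains C where "C >= 0" "!!\<xi> y v. 0 <= \<xi> ==> \<xi> <= 1 ==> 0 < y ==> y <= 1 ==> strip_weight X0 X1 v ==> slowly_varying K \<xi> v ==>
  abs (LINT z|hyp_measure. cutoff_weight y v z * h z) <= decorrelation_error \<epsilon> C \<xi> y"
proof -
 have Hb_nonneg: "Hb >= 0" using h_bound[of 0] by linarith
 define L where "L = 14 * (X1 - X0 + 1)"
 have L: "L > 0" using X by (simp add: L_def)
 define e where "e = \<epsilon> / (Hb * L + 1)"
 have "Hb * L + 1 > 0" using Hb_nonneg L by (simp add: add_nonneg_pos)
 hence e: "e > 0" "Hb * L * e <= \<epsilon>" using \<epsilon> by (auto simp: e_def field_simps)
 obtain N where N: "N >= 1" "measure hyp_measure (D - compact_core N) < e" using D_minus_compact_core_small[OF e(1)] by blast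
 define A where "A = variance_const K X0 X1 N"
 have A: "A > 0" unfolding A_def by (rule variance_const_pos[OF X K N(1)])
 define \<mu> where "\<mu> = measure hyp_measure (compact_core N) + 1"
 have \<mu>: "\<mu> >= 0" by (simp add: \<mu>_def)
 show ?thesis
 proof (rule that[of "Hb * \<mu> * sqrt A"])
  show "0 <= Hb * \<mu> * sqrt A" using Hb_nonneg \<mu> A by simp
  fix \<xi> y :: real and v :: "complex => real"
  assume \<xi>: "0 <= \<xi>" "\<xi> <= 1" and y: "0 < y" "y <= 1" and v: "strip_weight X0 X1 v" and slow: "slowly_varying K \<xi> v"
  define T where "T = ln (1 / y)"
  have T_nonneg: "T >= 0" using y by (simp add: T_def)
  let ?S = "sqrt ((1 + T) * (1 + \<xi> * T))"
  obtain m where "(LINT w|hyp_measure. indicator D w * abs (real_orbit_sum q (cutoff_weight y v) w - m)) <= sqrt A * ?S / 2 * \<mu> + L * (1 + T) * e"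
   using cutoff_orbit_sum_L1_deviation[OF v K slow \<xi> y X N(1) less_imp_le[OF N(2)]] unfolding real_sqrt_mult A_def \<mu>_def L_def T_def by blast
  hence "2 * abs (LINT z|hyp_measure. cutoff_weight y v z * h z) <= Hb * (sqrt A * ?S / 2 * \<mu> + L * (1 + T) * e)"
   by (rule order_trans[OF cutoff_correlation_le[OF h h_bound inv mean v y X] mult_left_mono[OF _ Hb_nonneg]])
  also have "... = Hb * \<mu> * sqrt A * ?S / 2 + Hb * L * e * (1 + T)" by (simp add: algebra_simps)
  also have "... <= Hb * \<mu> * sqrt A * ?S / 2 + \<epsilon> * (1 + T)"
   using e(2) T_nonneg by (intro add_left_mono mult_right_mono) auto
  finally have "2 * abs (LINT z|hyp_measure. cutoff_weight y v z * h z) <= Hb * \<mu> * sqrt A * ?S / 2 + \<epsilon> * (1 + T)" .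
  moreover have "0 <= Hb * \<mu> * sqrt A * ?S" "0 <= \<epsilon> * (1 + T)"
   using Hb_nonneg \<mu> T_nonneg \<xi> \<epsilon> A by auto
  ultimately show "abs (LINT z|hyp_measure. cutoff_weight y v z * h z) <= decorrelation_error \<epsilon> (Hb * \<mu> * sqrt A) \<xi> y"
   unfolding decorrelation_error_def T_def by linarith
 qed
qed

end

section \<open>Cusp forms of weight two\<close>

lemma open_UHP: "open UHP" and convex_UHP: "convex UHP"
 unfolding UHP_def by (simp_all add: open_halfspace_Im_gt convex_halfspace_Im_gt)

lemma convex_Im_eq: "convex {z. Im z = y}"
 by (rule convexI) (simp add: distrib_right[symmetric])

lemma UHP_primitive:
 assumes "\<phi> holomorphic_on UHP"
 obtains G where "!!z. z : UHP ==> (G has_field_derivative \<phi> z) (at z)"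
 using holomorphic_convex_primitive'[OF convex_UHP open_UHP assms] at_within_open[OF _ open_UHP] by metis

locale vanishing_periodic =
 fixes \<phi> :: "complex => complex" and w :: real
 assumes holomorphic: "\<phi> holomorphic_on UHP" and w_pos: "w > 0"
  and periodic: "!!z. z : UHP ==> \<phi> (z + of_real w) = \<phi> z"
  and vanishing: "!!\<epsilon>. \<epsilon> > 0 ==> EX Y. ALL z. Im z > Y --> norm (\<phi> z) < \<epsilon>"
begin

lemma periodic_of_int: "z : UHP ==> \<phi> (z + of_int n * of_real w) = \<phi> z"
proof (induction n rule: int_induct[where k=0])
 case (step1 i)
 hence "z + of_int i * of_real w : UHP" by (simp add: UHP_def)
 from periodic[OF this] step1 show ?case by (simp add: algebra_simps)
next
 case (step2 i)
 hence "z + of_int (i - 1) * of_real w : UHP" by (simp add: UHP_def)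
 from periodic[OF this] step2 show ?case by (simp add: algebra_simps)
qed simp

lemma bounded_above_height:
 assumes y0: "y0 > 0"
 obtains K where "K >= 0" "!!z. Im z >= y0 ==> norm (\<phi> z) <= K"
proof -
 obtain Y where Y: "!!z. Im z > Y ==> norm (\<phi> z) < 1" using vanishing[of 1] by auto
 let ?S = "cbox (Complex 0 y0) (Complex w Y)"
 have "?S <= UHP" using y0 by (auto simp: in_cbox_complex_iff UHP_def)
 hence "continuous_on ?S \<phi>"
  using holomorphic_on_imp_continuous_on[OF holomorphic] continuous_on_subset by blast
 hence "bounded (\<phi> ` ?S)" by (intro compact_imp_bounded compact_continuous_image) auto
 then obtain K where K: "!!z. z : ?S ==> norm (\<phi> z) <= K" by (auto simp: bounded_iff)
 have "norm (\<phi> z) <= max K 1" if z: "Im z >= y0" for z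
 proof (cases "Im z > Y")
  case True thus ?thesis using Y[of z] by simp
 next
  case False
  define n where "n = - \<lfloor>Re z / w\<rfloor>"
  have "Re (z + of_int n * of_real w) = Re z - of_int \<lfloor>Re z / w\<rfloor> * w" by (simp add: n_def)
  moreover have "of_int \<lfloor>Re z / w\<rfloor> * w <= Re z"
   using of_int_floor_le[of "Re z / w"] w_pos by (simp only: pos_le_divide_eq)
  moreover have "Re z < (of_int \<lfloor>Re z / w\<rfloor> + 1) * w"
   using floor_correct[of "Re z / w"] w_pos by (simp only: pos_divide_less_eq of_int_add of_int_1)
  ultimately have "z + of_int n * of_real w : ?S"
   using z False by (simp add: in_cbox_complex_iff algebra_simps)
  moreover have "z : UHP" using z y0 by (simp add: UHP_def)
  ultimately show ?thesis using K periodic_of_int[of z n] by fastforce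
 qed
 thus ?thesis by (intro that[of "max K 1"]) auto
qed

lemma periodic_primitive:
 obtains G where "!!z. z : UHP ==> (G has_field_derivative \<phi> z) (at z)"
  and "!!z. z : UHP ==> G (z + of_real w) = G z"
proof -
 obtain G where G: "!!z. z : UHP ==> (G has_field_derivative \<phi> z) (at z)"
  using UHP_primitive[OF holomorphic] by blast
 have "EX c. ALL z:UHP. G (z + of_real w) - G z = c"
 proof (rule has_field_derivative_zero_constant[OF convex_UHP])
  fix z assume z: "z : UHP"
  hence z_w_UHP: "z + of_real w : UHP" by (simp add: UHP_def)
  have "((%z. G (z + of_real w) - G z) has_field_derivative \<phi> (z + of_real w) - \<phi> z) (at z)"
   by (rule DERIV_diff[OF DERIV_shift[THEN iffD1, OF G[OF z_w_UHP]] G[OF z]])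
  thus "((%z. G (z + of_real w) - G z) has_field_derivative 0) (at z within UHP)"
   by (simp add: periodic[OF z] has_field_derivative_at_within)
 qed
 then obtain c where c: "!!z. z : UHP ==> G (z + of_real w) - G z = c" by blast
 have "norm c <= \<epsilon>" if \<epsilon>: "\<epsilon> > 0" for \<epsilon>
 proof -
  obtain Y where Y: "!!z. Im z > Y ==> norm (\<phi> z) < \<epsilon> / w" using vanishing[of "\<epsilon> / w"] \<epsilon> w_pos by auto
  define S where "S = {z. Im z > max Y 0}"
  have S_UHP: "S <= UHP" by (auto simp: S_def UHP_def)
  define z where "z = Complex 0 (max Y 0 + 1)"
  have z: "z : S" "z + of_real w : S" by (auto simp: S_def z_def)
  have "norm (G (z + of_real w) - G z) <= \<epsilon> / w * norm (z + of_real w - z)"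
  proof (rule field_differentiable_bound)
   show "convex S" unfolding S_def by (rule convex_halfspace_Im_gt)
   show "(G has_field_derivative \<phi> u) (at u within S)" if "u : S" for u
    using G[of u] that S_UHP has_field_derivative_at_within by blast
   show "norm (\<phi> u) <= \<epsilon> / w" if "u : S" for u using Y[of u] that by (simp add: S_def)
  qed (use z in auto)
  thus ?thesis using c[of z] z S_UHP w_pos by auto
 qed
 hence "norm c <= 0" by (meson dense_ge)
 hence "c = 0" by simp
 with c show ?thesis by (intro that[of G] G) auto
qed

lemma norm_deriv_le:
 assumes y0: "y0 > 0" and K: "K >= 0" and bound: "!!z. Im z >= y0 ==> norm (\<phi> z) <= K / (Im z)^k"
  and u: "Im u >= 2 * y0"
 shows "norm (deriv \<phi> u) <= K / (Im u / 2)^k / (Im u / 2)"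
proof -
 define R where "R = Im u / 2"
 have R: "R > 0" using u y0 by (simp add: R_def)
 have Im_ge: "Im v >= y0 & Im v >= R" if "v : cball u R" for v
  using abs_Im_le_cmod[of "u - v"] that u unfolding R_def mem_cball dist_norm minus_complex.sel by linarith
 have cball_UHP: "cball u R <= UHP"
 proof
  fix v assume "v : cball u R"
  from Im_ge[OF this] R show "v : UHP" by (simp add: UHP_def)
 qed
 have bound_circle: "norm (\<phi> v) <= K / R^k" if "norm (u - v) = R" for v
 proof -
  have v: "Im v >= y0" "Im v >= R" using Im_ge[of v] that by (simp_all add: dist_norm)
  have "norm (\<phi> v) <= K / (Im v)^k" by (rule bound[OF v(1)])
  also have "... <= K / R^k" using v(2) R K by (intro divide_left_mono power_mono) auto
  finally show ?thesis .
 qed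
 have interior: "\<phi> holomorphic_on ball u R" using holomorphic cball_UHP holomorphic_on_subset ball_subset_cball by blast
 have boundary: "continuous_on (cball u R) \<phi>"
  using holomorphic_on_imp_continuous_on[OF holomorphic] cball_UHP continuous_on_subset by blast
 from Cauchy_inequality[OF interior boundary R bound_circle, of 1] show ?thesis by (simp add: R_def)
qed

lemma norm_horizontal_diff_le:
 assumes B: "!!u. Im u = Im z ==> norm (deriv \<phi> u) <= B" and z: "z : UHP" and u: "Im u = Im z"
 shows "norm (\<phi> u - \<phi> z) <= B * norm (u - z)"
proof (rule field_differentiable_bound[OF convex_Im_eq[of "Im z"]])
 fix v assume "v : {v. Im v = Im z}"
 hence v: "v : UHP" "Im v = Im z" using z by (auto simp: UHP_def)
 show "(\<phi> has_field_derivative deriv \<phi> v) (at v within {v. Im v = Im z})"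
  using holomorphic_derivI[OF holomorphic open_UHP v(1)] has_field_derivative_at_within by blast
 show "norm (deriv \<phi> v) <= B" by (rule B[OF v(2)])
qed (use u in auto)

text \<open>A periodic holomorphic function vanishing at \<open>i\<infinity>\<close> has mean zero over every horizontal period,
  so it is bounded by the oscillation, which Cauchy's estimate makes smaller by a factor \<open>1 / Im z\<close>.\<close>
lemma decay_step:
 assumes y0: "y0 > 0" and K: "K >= 0" and bound: "!!z. Im z >= y0 ==> norm (\<phi> z) <= K / (Im z)^k"
  and z: "Im z >= 2 * y0"
 shows "norm (\<phi> z) <= (w * 2 * K * 2^k) / (Im z)^(k+1)"
proof -
 obtain G where G: "!!z. z : UHP ==> (G has_field_derivative \<phi> z) (at z)"
  and G_periodic: "!!z. z : UHP ==> G (z + of_real w) = G z" using periodic_primitive by metis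
 have z_UHP: "z : UHP" using z y0 by (simp add: UHP_def)
 define B where "B = K / (Im z / 2)^k / (Im z / 2)"
 have B: "B >= 0" using K z y0 by (simp add: B_def)
 define S where "S = closed_segment z (z + of_real w)"
 have S: "Im u = Im z & norm (u - z) <= w" if "u : S" for u
 proof -
  obtain t where t: "0 <= t" "t <= 1" "u = (1 - t) *\<^sub>R z + t *\<^sub>R (z + of_real w)"
   using \<open>u : S\<close> by (auto simp: S_def in_segment)
  hence "u = z + of_real (t * w)" by (simp add: scaleR_conv_of_real algebra_simps)
  thus ?thesis using t w_pos by (simp add: norm_mult mult_left_le_one_le)
 qed
 have oscillation: "norm (\<phi> u - \<phi> z) <= B * w" if u: "u : S" for u
 proof -
  have "norm (deriv \<phi> v) <= B" if "Im v = Im z" for v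
   unfolding B_def using norm_deriv_le[OF y0 K bound, of v] that z by simp
  from norm_horizontal_diff_le[OF this z_UHP] have "norm (\<phi> u - \<phi> z) <= B * norm (u - z)" using S[OF u] by simp
  also have "... <= B * w" using S[OF u] B by (intro mult_left_mono) auto
  finally show ?thesis .
 qed
 let ?H = "%u. G u - \<phi> z * u"
 have "norm (?H (z + of_real w) - ?H z) <= B * w * norm (z + of_real w - z)"
 proof (rule field_differentiable_bound[where S=S and f="?H" and f'="%u. \<phi> u - \<phi> z"])
  show "(?H has_field_derivative \<phi> u - \<phi> z) (at u within S)" if "u : S" for u
  proof (rule DERIV_diff)
   have "u : UHP" using S[OF that] z_UHP by (simp add: UHP_def)
   thus "(G has_field_derivative \<phi> u) (at u within S)" using G has_field_derivative_at_within by blast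
  qed (rule DERIV_cmult_Id)
 qed (use oscillation in \<open>auto simp: S_def\<close>)
 moreover have "?H (z + of_real w) - ?H z = - \<phi> z * of_real w"
  using G_periodic[OF z_UHP] by (simp add: algebra_simps)
 ultimately have "norm (\<phi> z) * w <= B * w * w" using w_pos by (simp add: norm_mult)
 hence "norm (\<phi> z) <= B * w" by (rule mult_right_le_imp_le) (rule w_pos)
 also have "B * w = (w * 2 * K * 2^k) / (Im z)^(k+1)"
  using z_UHP by (simp add: B_def UHP_def power_divide field_simps)
 finally show ?thesis .
qed

lemma quadratic_decay: "EX C>=0. ALL z. Im z >= 1/2 --> norm (\<phi> z) <= C / (Im z)^2"
proof -
 obtain K where K: "K >= 0" "!!z. Im z >= 1/8 ==> norm (\<phi> z) <= K"
  using bounded_above_height[of "1/8"] by auto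
 define L where "L = w * 2 * K"
 have L: "L >= 0" using w_pos K by (simp add: L_def)
 have linear: "norm (\<phi> z) <= L / (Im z)^1" if "Im z >= 1/4" for z
  using decay_step[of "1/8" K 0 z] K that by (simp add: L_def)
 have "norm (\<phi> z) <= (w * 2 * L * 2) / (Im z)^2" if "Im z >= 1/2" for z
  using decay_step[OF _ L linear, of "1/4" z] that by (simp add: numeral_2_eq_2)
 thus ?thesis using w_pos L by (intro exI[of _ "w * 2 * L * 2"]) auto
qed

end

definition slash :: "(complex => complex) => mat2 => complex => complex" where
 "slash f s z = f (moeb s z) / (jfac s z)^2"

lemma moeb_deriv:
 assumes "s : SL2Z" "z : UHP"
 shows "(moeb s has_field_derivative 1 / (jfac s z)^2) (at z)"
proof (cases s)
 case (fields a b c d)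
 have nonzero: "of_int c * z + of_int d ~= 0" using jfac_nonzero[OF assms] by (simp add: jfac_def fields)
 have "((%z. (of_int a * z + of_int b) / (of_int c * z + of_int d)) has_field_derivative
   (of_int a * (of_int c * z + of_int d) - (of_int a * z + of_int b) * of_int c) / ((of_int c * z + of_int d) * (of_int c * z + of_int d))) (at z)"
  by (rule derivative_eq_intros nonzero refl | simp)+
 moreover have "of_int a * (of_int c * z + of_int d) - (of_int a * z + of_int b) * of_int c = (1::complex)"
  using SL2Z_det_of_int[of a b c d, where 'a=complex] assms(1) by (simp add: algebra_simps fields)
 ultimately show ?thesis by (simp add: moeb_def[abs_def] jfac_def fields power2_eq_square)
qed

locale cusp_form =
 fixes q :: nat and f :: "complex => complex"
 assumes level_pos: "q >= 1" and cusp_form2: "cusp_form2 q f"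
begin

lemma f_holomorphic: "f holomorphic_on UHP"
 and f_automorphic: "!!g z. g : Gamma0 q ==> z : UHP ==> f (moeb g z) = (jfac g z)^2 * f z"
 and f_vanishing: "!!g \<epsilon>. g : SL2Z ==> \<epsilon> > 0 ==> EX Y. ALL z. Im z > Y --> norm (f (moeb g z) / (jfac g z)^2) < \<epsilon>"
 using cusp_form2 by (auto simp: cusp_form2_def)

lemma slash_holomorphic: assumes "s : SL2Z" shows "slash f s holomorphic_on UHP"
proof -
 have "moeb s holomorphic_on UHP"
  using moeb_deriv[OF assms] holomorphic_on_open[OF open_UHP] by blast
 moreover have "moeb s ` UHP <= UHP" using moeb_in_UHP[OF assms] by blast
 ultimately have "(f \<circ> moeb s) holomorphic_on UHP"
  using f_holomorphic holomorphic_on_compose_gen by blast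
 moreover have "jfac s holomorphic_on UHP"
  by (cases s) (auto simp: jfac_def[abs_def] intro!: holomorphic_intros)
 ultimately show ?thesis unfolding slash_def[abs_def]
  using jfac_nonzero[OF assms] by (intro holomorphic_intros) (auto simp: o_def)
qed

lemma slash_coset:
 assumes "g : Gamma0 q" "s : SL2Z" "z : UHP"
 shows "slash f (mat2_mult g s) z = slash f s z"
proof -
 have g: "g : SL2Z" using assms SL2Z_of_Gamma0 by blast
 have sz_UHP: "moeb s z : UHP" using assms moeb_in_UHP by blast
 show ?thesis
  using jfac_nonzero[OF g sz_UHP] jfac_nonzero[OF assms(2,3)]
  by (simp add: slash_def moeb_mult[OF g assms(2,3)] jfac_mult[OF assms(2,3)] f_automorphic[OF assms(1) sz_UHP] power_mult_distrib)
qed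

lemma slash_periodic:
 assumes "s : SL2Z" "z : UHP"
 shows "slash f s (z + of_real (real q)) = slash f s z"
proof -
 define t where "t = (1::int, int q, 0::int, 1::int)"
 have t: "t : SL2Z" by (simp add: t_def SL2Z_def)
 have t_translation: "moeb t z = z + of_real (real q)" "jfac t z = 1" by (simp_all add: t_def moeb_def jfac_def)
 have st_SL2Z: "mat2_mult s t : SL2Z" using SL2Z_mult[OF assms(1) t] .
 have "bottom_row_mod q (mat2_mult s t) = bottom_row_mod q s" by (cases s) (simp add: t_def bottom_row_mod_def)
 hence g: "mat2_mult (mat2_mult s t) (mat2_inv s) : Gamma0 q" using bottom_row_mod_eq_imp_coset[OF st_SL2Z assms(1)] by simp
 have "slash f s (z + of_real (real q)) = slash f (mat2_mult s t) z"
  using moeb_mult[OF assms(1) t assms(2)] jfac_mult[OF t assms(2), of s] by (simp add: slash_def t_translation)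
 also have "mat2_mult s t = mat2_mult (mat2_mult (mat2_mult s t) (mat2_inv s)) s"
  using assms(1) by (simp add: mat2_mult_assoc mat2_mult_inv)
 also have "slash f ... z = slash f s z" by (rule slash_coset[OF g assms])
 finally show ?thesis .
qed

lemma slash_uniform_decay: "EX C>=0. ALL s:SL2Z. ALL z. Im z >= 1/2 --> norm (slash f s z) <= C / (Im z)^2"
proof -
 obtain R where R: "finite R" "R <= SL2Z" "!!g. g : SL2Z ==> EX r:R. mat2_mult g (mat2_inv r) : Gamma0 q"
  using finite_coset_reps[OF level_pos] by blast
 have "ALL r:R. EX C>=0. ALL z. Im z >= 1/2 --> norm (slash f r z) <= C / (Im z)^2"
 proof
  fix r assume "r : R"
  hence r: "r : SL2Z" using R by blast
  interpret vanishing_periodic "slash f r" "real q"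
   by unfold_locales
    (use slash_holomorphic[OF r] slash_periodic[OF r] level_pos f_vanishing[OF r] in \<open>auto simp: slash_def\<close>)
  show "EX C>=0. ALL z. Im z >= 1/2 --> norm (slash f r z) <= C / (Im z)^2" by (rule quadratic_decay)
 qed
 then obtain C where C: "!!r. r : R ==> C r >= 0 & (ALL z. Im z >= 1/2 --> norm (slash f r z) <= C r / (Im z)^2)" by metis
 show ?thesis
 proof (intro exI[of _ "\<Sum>r\<in>R. C r"] conjI ballI allI impI)
  show "(\<Sum>r\<in>R. C r) >= 0" using C by (simp add: sum_nonneg)
  fix s z assume s: "s : SL2Z" and z: "Im z >= 1/2"
  obtain r where r: "r : R" "mat2_mult s (mat2_inv r) : Gamma0 q" using R(3)[OF s] by blast
  have r_SL2Z: "r : SL2Z" and z_UHP: "z : UHP" using r R z by (auto simp: UHP_def)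
  have "s = mat2_mult (mat2_mult s (mat2_inv r)) r" using r_SL2Z by (simp add: mat2_mult_assoc mat2_mult_inv)
  hence "slash f s z = slash f r z" using slash_coset[OF r(2) r_SL2Z z_UHP] by simp
  hence "norm (slash f s z) <= C r / (Im z)^2" using C[OF r(1)] z by simp
  also have "... <= (\<Sum>r\<in>R. C r) / (Im z)^2"
   by (intro divide_right_mono member_le_sum r R) (use C in auto)
  finally show "norm (slash f s z) <= (\<Sum>r\<in>R. C r) / (Im z)^2" .
 qed
qed

end

lemma field_derivative_along_lines:
 assumes "(G has_field_derivative d) (at (Complex x y))"
 shows "((%t. G (Complex x t)) has_vector_derivative \<i> * d) (at y)"
  and "((%s. G (Complex s y)) has_vector_derivative d) (at x)"
proof -
 have "((%t. Complex x t) has_vector_derivative \<i>) (at y)" "((%s. Complex s y) has_vector_derivative 1) (at x)"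
  unfolding has_vector_derivative_complex_iff by (auto intro!: derivative_eq_intros)
 from this[THEN field_vector_diff_chain_at, OF assms]
 show "((%t. G (Complex x t)) has_vector_derivative \<i> * d) (at y)" "((%s. G (Complex s y)) has_vector_derivative d) (at x)"
  by (simp_all add: o_def)
qed

lemma vertical_deriv:
 assumes "!!z. z : UHP ==> (G has_field_derivative \<phi> z) (at z)" "t > 0"
 shows "((%t. G (Complex x t)) has_vector_derivative \<i> * \<phi> (Complex x t)) (at t)"
 by (rule field_derivative_along_lines(1), rule assms(1)) (use assms(2) in \<open>simp add: UHP_def\<close>)

lemma vertical_diff_le:
 assumes G: "!!z. z : UHP ==> (G has_field_derivative \<phi> z) (at z)"
  and u: "!!t. a <= t ==> t <= b ==> (u has_real_derivative u' t) (at t)"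
  and bound: "!!t. a < t ==> t < b ==> norm (\<phi> (Complex x t)) <= u' t" and ab: "0 < a" "a <= b"
 shows "norm (G (Complex x b) - G (Complex x a)) <= u b - u a"
proof (cases "a = b")
 case False
 hence "a < b" using ab by simp
 thus ?thesis
 proof (rule differentiable_bound_general)
  show "continuous_on {a..b} (%t. G (Complex x t))"
   by (intro continuous_at_imp_continuous_on ballI has_vector_derivative_continuous[OF vertical_deriv[OF G]]) (use ab in auto)
  show "continuous_on {a..b} u"
   by (intro continuous_at_imp_continuous_on ballI DERIV_isCont[OF u]) auto
  fix t assume t: "a < t" "t < b"
  show "((%t. G (Complex x t)) has_vector_derivative \<i> * \<phi> (Complex x t)) (at t)" using vertical_deriv[OF G] t ab by simp
  show "(u has_vector_derivative u' t) (at t)" using u[of t] t by (simp add: has_real_derivative_iff_has_vector_derivative)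
  show "norm (\<i> * \<phi> (Complex x t)) <= u' t" using bound[OF t] by (simp add: norm_mult)
 qed
qed simp

lemma primitive_vertical_diff_le:
 assumes G: "!!z. z : UHP ==> (G has_field_derivative \<phi> z) (at z)"
  and decay: "!!z. Im z >= 1/2 ==> norm (\<phi> z) <= C / (Im z)^2" and st: "1/2 <= s" "s <= t"
 shows "norm (G (Complex x t) - G (Complex x s)) <= C / s - C / t"
proof -
 have "norm (G (Complex x t) - G (Complex x s)) <= - C / t - (- C / s)"
 proof (rule vertical_diff_le[OF G, where u'="%t. C / t^2"])
  show "((%t. - C / t) has_real_derivative C / r^2) (at r)" if "s <= r" "r <= t" for r
   using that st by (auto intro!: derivative_eq_intros simp: power2_eq_square)
  show "norm (\<phi> (Complex x r)) <= C / r^2" if "s < r" "r < t" for r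
   using decay[of "Complex x r"] that st by simp
 qed (use st in auto)
 thus ?thesis by simp
qed

lemma primitive_horizontal_diff_le:
 assumes G: "!!z. z : UHP ==> (G has_field_derivative \<phi> z) (at z)"
  and decay: "!!z. Im z >= 1/2 ==> norm (\<phi> z) <= C / (Im z)^2" and t: "t >= 1/2"
 shows "norm (G (Complex x t) - G (Complex x' t)) <= C / t^2 * abs (x - x')"
proof -
 have "norm (G (Complex x t) - G (Complex x' t)) <= C / t^2 * norm (Complex x t - Complex x' t)"
 proof (rule field_differentiable_bound[OF convex_Im_eq[of t], of _ \<phi>])
  show "(G has_field_derivative \<phi> z) (at z within {z. Im z = t})" if "z : {z. Im z = t}" for z
   using G[of z] that t by (auto simp: UHP_def intro: has_field_derivative_at_within)
  show "norm (\<phi> z) <= C / t^2" if "z : {z. Im z = t}" for z using decay[of z] that t by simp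
 qed auto
 moreover have "Complex x t - Complex x' t = of_real (x - x')" by (simp add: complex_eq_iff)
 ultimately show ?thesis by (simp only: norm_of_real)
qed

lemma primitive_diff_le:
 assumes G: "!!z. z : UHP ==> (G has_field_derivative \<phi> z) (at z)" and C: "C >= 0"
  and decay: "!!z. Im z >= 1/2 ==> norm (\<phi> z) <= C / (Im z)^2" and zw: "Im z >= 1/2" "Im w >= 1/2"
 shows "norm (G z - G w) <= C / Im z + C / Im w"
proof (rule tendsto_lowerbound)
 show "((%t. C / Im z + C / Im w + C / t^2 * abs (Re z - Re w)) \<longlongrightarrow> C / Im z + C / Im w) at_top"
  by real_asymp
 show "\<forall>\<^sub>F t in at_top. norm (G z - G w) <= C / Im z + C / Im w + C / t^2 * abs (Re z - Re w)"
  using eventually_ge_at_top[of "max (Im z) (Im w)"]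
 proof eventually_elim
  case (elim t)
  define Z W where "Z = G (Complex (Re z) t)" and "W = G (Complex (Re w) t)"
  have "norm (Z - G z) <= C / Im z - C / t" "norm (W - G w) <= C / Im w - C / t"
   unfolding Z_def W_def
   using primitive_vertical_diff_le[OF G decay, of "Im z" t "Re z"] primitive_vertical_diff_le[OF G decay, of "Im w" t "Re w"] elim zw
   by simp_all
  moreover have "norm (Z - W) <= C / t^2 * abs (Re z - Re w)"
   unfolding Z_def W_def by (rule primitive_horizontal_diff_le[OF G decay]) (use elim zw in auto)
  moreover have "norm (G z - G w) <= norm (Z - W) + norm (Z - G z) + norm (W - G w)"
   using norm_triangle_ineq4[of "Z - W" "(Z - G z) - (W - G w)"] norm_triangle_ineq4[of "Z - G z" "W - G w"]
   by simp
  moreover have "C / t >= 0" using C elim zw by simp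
  ultimately show ?case by linarith
 qed
qed simp

lemma primitive_limit:
 assumes G: "!!z. z : UHP ==> (G has_field_derivative \<phi> z) (at z)" and C: "C >= 0"
  and decay: "!!z. Im z >= 1/2 ==> norm (\<phi> z) <= C / (Im z)^2"
 shows "EX L. ALL z. Im z >= 1/2 --> norm (G z - L) <= C / Im z"
proof -
 have diff_le: "norm (G z - G w) <= C / Im z + C / Im w" if "Im z >= 1/2" "Im w >= 1/2" for z w
  by (rule primitive_diff_le[OF G C decay that])
 let ?u = "%n. Complex 0 (real n + 1)"
 have "Cauchy (%n. G (?u n))"
 proof (rule CauchyI')
  fix \<epsilon> :: real assume \<epsilon>: "\<epsilon> > 0"
  obtain N :: nat where N: "2 * C / \<epsilon> < real N" using reals_Archimedean2 by blast
  have "norm (G (?u m) - G (?u n)) < \<epsilon>" if "N <= m" "m < n" for m n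
  proof -
   have "norm (G (?u m) - G (?u n)) <= C / (real m + 1) + C / (real n + 1)" using diff_le[of "?u m" "?u n"] by simp
   also have "C / (real n + 1) <= C / (real m + 1)" using C that by (intro divide_left_mono) auto
   also have "C / (real m + 1) + C / (real m + 1) = 2 * C / (real m + 1)" by simp
   also have "... < \<epsilon>"
   proof -
    have "2 * C / \<epsilon> < real m + 1" using N that by linarith
    thus ?thesis using \<epsilon> by (simp add: field_simps)
   qed
   finally show ?thesis by simp
  qed
  thus "EX N. ALL m>=N. ALL n>m. dist (G (?u m)) (G (?u n)) < \<epsilon>" unfolding dist_norm by blast
 qed
 then obtain L where L: "(%n. G (?u n)) \<longlonglongrightarrow> L" using Cauchy_convergent convergent_def by blast
 have "norm (G z - L) <= C / Im z" if z: "Im z >= 1/2" for z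
 proof (rule tendsto_le[OF sequentially_bot])
  show "(%n. C / Im z + C / (real n + 1)) \<longlonglongrightarrow> C / Im z" by real_asymp
  show "(%n. norm (G z - G (?u n))) \<longlonglongrightarrow> norm (G z - L)" by (intro tendsto_intros L)
  show "\<forall>\<^sub>F n in sequentially. norm (G z - G (?u n)) <= C / Im z + C / (real n + 1)"
  proof (rule always_eventually, rule allI)
   fix n show "norm (G z - G (?u n)) <= C / Im z + C / (real n + 1)" using diff_le[OF z, of "?u n"] by simp
  qed
 qed
 thus ?thesis by blast
qed

lemma FTC_Im_vertical:
 assumes G: "!!z. z : UHP ==> (G has_field_derivative \<phi> z) (at z)" and \<phi>: "continuous_on UHP \<phi>"
  and int: "set_integrable lborel {0<..} (%t. Im (\<phi> (Complex x t)))"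
  and zero: "((%t. G (Complex x t)) \<longlongrightarrow> L) (at_right 0)" and infinity: "((%t. G (Complex x t)) \<longlongrightarrow> 0) at_top"
 shows "(LBINT t:{0<..}. Im (\<phi> (Complex x t))) = Re L"
proof -
 have "(LBINT t=0..\<infinity>. Im (\<phi> (Complex x t))) = 0 - (- Re L)"
 proof (rule interval_integral_FTC_integrable[where F="%t. - Re (G (Complex x t))"])
  fix t assume "0 < ereal t"
  hence t: "t > 0" by simp
  from has_vector_derivative_minus[OF bounded_linear.has_vector_derivative[OF bounded_linear_Re vertical_deriv[OF G t]]]
  show "((%t. - Re (G (Complex x t))) has_vector_derivative Im (\<phi> (Complex x t))) (at t)" by simp
  have "continuous_on {0<..} (%t. \<phi> (Complex x t))"
   by (rule continuous_on_compose2[OF \<phi>]) (auto simp: Complex_eq UHP_def intro!: continuous_intros)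
  thus "isCont (%t. Im (\<phi> (Complex x t))) t"
   using t by (intro isCont_Im) (simp add: continuous_on_eq_continuous_at)
 next
  show "set_integrable lborel (einterval 0 \<infinity>) (%t. Im (\<phi> (Complex x t)))" using int by (simp add: zero_ereal_def)
  have "((%t. - Re (G (Complex x t))) \<longlongrightarrow> - Re L) (at_right 0)" by (intro tendsto_minus tendsto_Re zero)
  thus "(((%t. - Re (G (Complex x t))) \<circ> real_of_ereal) \<longlongrightarrow> - Re L) (at_right 0)"
   unfolding zero_ereal_def by (simp only: ereal_tendsto_simps1)
  have "((%t. - Re (G (Complex x t))) \<longlongrightarrow> - Re 0) at_top" by (intro tendsto_minus tendsto_Re infinity)
  thus "(((%t. - Re (G (Complex x t))) \<circ> real_of_ereal) \<longlongrightarrow> 0) (at_left \<infinity>)"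
   by (simp only: ereal_tendsto_simps1) simp
 qed simp
 thus ?thesis by (simp add: zero_ereal_def interval_integral_to_infinity_eq)
qed

lemma integral_hyp_lborel:
 assumes [measurable]: "k : borel_measurable borel"
 shows "(LINT z|hyp_measure. k z) = (LBINT z. indicator UHP z / (Im z)^2 * k z)"
proof -
 have density: "hyp_measure = density lborel (%z. ennreal (indicator UHP z / (Im z)^2))"
  unfolding hyp_measure_def by (intro density_cong) (auto simp: indicator_def)
 have "(LINT z|hyp_measure. k z) = (LBINT z. (indicator UHP z / (Im z)^2) *\<^sub>R k z)"
  unfolding density by (rule integral_density) auto
 thus ?thesis by simp
qed

lemma set_integrable_inverse_square_decay:
 fixes g :: "real => real"
 assumes g: "continuous_on {0<..} g" and K: "K >= 0" "!!t. 0 < t ==> t < 1/2 ==> abs (g t) <= K"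
  and C: "C >= 0" "!!t. t >= 1/2 ==> abs (g t) <= C / t^2"
 shows "set_integrable lborel {0<..} g"
 unfolding set_integrable_def
proof (rule Bochner_Integration.integrable_bound)
 let ?b = "%t::real. K * indicator {0..1/2} t + C * (indicator {1/2..} t * (1 / t^2))"
 have "(\<integral>\<^sup>+t. ennreal (indicator {1/2..} t * (1 / t^2)) \<partial>lborel) = (\<integral>\<^sup>+t. ennreal (1 / t^2) * indicator {1/2..} t \<partial>lborel)"
  by (intro nn_integral_cong) (auto simp: indicator_def)
 also have "... = ennreal (1 / (1/2))" by (rule nn_integral_inverse_square_atLeast) simp
 also have "... < \<infinity>" unfolding infinity_ennreal_def by (rule ennreal_less_top)
 finally have "integrable lborel (%t::real. indicator {1/2..} t * (1 / t^2))" by (intro integrableI_nonneg) auto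
 moreover have "integrable lborel (indicat_real {0..1/2::real})"
  by (rule integrable_real_indicator[OF _ emeasure_compact_finite[OF compact_Icc]]) simp
 ultimately show "integrable lborel ?b" by (intro Bochner_Integration.integrable_add integrable_mult_right)
 show "(%t. indicator {0<..} t *\<^sub>R g t) : borel_measurable lborel"
  using borel_measurable_continuous_on_indicator[OF _ g] by simp
 have "norm (indicator {0<..} t *\<^sub>R g t) <= norm (?b t)" for t
 proof -
  consider "t <= 0" | "0 < t" "t < 1/2" | "t >= 1/2" by linarith
  hence "abs (indicator {0<..} t * g t) <= ?b t"
   by cases (use K C in \<open>auto simp: indicator_def intro: add_increasing\<close>)
  thus ?thesis by simp
 qed
 thus "AE t in lborel. norm (indicator {0<..} t *\<^sub>R g t) <= norm (?b t)" by simp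
qed

definition real_symbol :: "(complex => complex) => real => real" where
 "real_symbol f r = 2 * pi * (LBINT t:{0<..}. Im (f (Complex r t)))"

lemma normalized_symbol_eq_real_symbol: "normalized_symbol K f r c = real_symbol f r / sqrt (abs K * ln (of_int c))"
proof -
 have "modsym f r = \<i> * of_real (real_symbol f r)" by (simp add: modsym_def real_symbol_def Complex_eq)
 hence "modsym f r / (\<i> * of_real (sqrt (abs K * ln (of_int c)))) = of_real (real_symbol f r / sqrt (abs K * ln (of_int c)))"
  by (simp only: mult_divide_mult_cancel_left complex_i_not_zero of_real_divide simp_thms)
 thus ?thesis unfolding normalized_symbol_def by (simp only: Re_complex_of_real)
qed

context cusp_form
begin

lemma f_continuous: "continuous_on UHP f"
 using f_holomorphic by (rule holomorphic_on_imp_continuous_on)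

lemma compose_deriv:
 assumes G: "!!z. z : UHP ==> (G has_field_derivative f z) (at z)" and s: "s : SL2Z" and z: "z : UHP"
 shows "((%z. G (moeb s z)) has_field_derivative slash f s z) (at z)"
proof -
 have "((%z. G (moeb s z)) has_field_derivative f (moeb s z) * (1 / (jfac s z)^2)) (at z)"
  by (rule DERIV_chain2[of G, OF G[OF moeb_in_UHP[OF s z]] moeb_deriv[OF s z]])
 thus ?thesis by (simp add: slash_def)
qed

lemma Im_norm_slash:
 assumes "s : SL2Z" "z : UHP"
 shows "Im z * norm (slash f s z) = Im (moeb s z) * norm (f (moeb s z))"
 using jfac_nonzero[OF assms] by (simp add: Im_moeb[OF assms] slash_def norm_divide norm_power)

lemma Im_norm_le_of_slash_decay:
 assumes C: "C >= 0" and decay: "!!s z. s : SL2Z ==> Im z >= 1/2 ==> norm (slash f s z) <= C / (Im z)^2" and z: "z : UHP"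
 shows "Im z * norm (f z) <= 2 * C"
proof -
 obtain s where s: "s : SL2Z" "Im (moeb s z) >= 1/2" using reduction[OF z] by blast
 define w where "w = moeb s z"
 have t: "mat2_inv s : SL2Z" using s SL2Z_inv by blast
 have w: "w : UHP" "Im w >= 1/2" using s z moeb_in_UHP by (auto simp: w_def)
 have "Im z * norm (f z) = Im w * norm (slash f (mat2_inv s) w)"
  using Im_norm_slash[OF t w(1)] s z by (simp add: w_def)
 also have "... <= Im w * (C / (Im w)^2)" using decay[OF t w(2)] w(2) by (intro mult_left_mono) auto
 also have "... = C / Im w" using w(2) by (simp add: power2_eq_square)
 also have "... <= C / (1/2)" using C w(2) by (intro divide_left_mono) auto
 finally show ?thesis by simp
qed

end

locale cusp_primitive = fundamental_domain q D + cusp_form q f for q D f +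
 fixes G :: "complex => complex" and B C :: real
 assumes C_nonneg: "C >= 0" and B_nonneg: "B >= 0"
  and G_deriv: "!!z. z : UHP ==> (G has_field_derivative f z) (at z)"
  and bloch: "!!z. z : UHP ==> Im z * norm (f z) <= B"
  and cusp_limit: "!!s. s : SL2Z ==> EX L. ALL z. Im z >= 1/2 --> norm (G (moeb s z) - L) <= C / Im z"
  and G_decay: "!!z. Im z >= 1/2 ==> norm (G z) <= C / Im z"
  and slash_decay: "!!s z. s : SL2Z ==> Im z >= 1/2 ==> norm (slash f s z) <= C / (Im z)^2"

lemma (in cusp_form) cusp_primitive_exists:
 assumes "fundamental_domain q D"
 obtains G B C where "cusp_primitive q D f G B C"
proof -
 interpret fundamental_domain q D by (rule assms)
 obtain C where C: "C >= 0" and decay: "!!s z. s : SL2Z ==> Im z >= 1/2 ==> norm (slash f s z) <= C / (Im z)^2"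
  using slash_uniform_decay by blast
 obtain H where H: "!!z. z : UHP ==> (H has_field_derivative f z) (at z)" using UHP_primitive[OF f_holomorphic] by blast
 have "slash f (1,0,0,1) z = f z" for z by (simp add: slash_def jfac_def)
 with decay[OF SL2Z_one] obtain L where L: "!!z. Im z >= 1/2 ==> norm (H z - L) <= C / Im z"
  using primitive_limit[OF H C] by metis
 have G: "((%z. H z - L) has_field_derivative f z) (at z)" if "z : UHP" for z
  using DERIV_diff[OF H[OF that] DERIV_const[of L]] by simp
 show ?thesis
 proof (rule that[of "%z. H z - L" "2 * C" C], unfold_locales)
  show "EX L'. ALL z. Im z >= 1/2 --> norm (H (moeb s z) - L - L') <= C / Im z" if s: "s : SL2Z" for s
   by (rule primitive_limit[OF compose_deriv[OF G s] C decay[OF s]])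
 qed (use C L G Im_norm_le_of_slash_decay[OF C decay] decay in auto)
qed

context cusp_primitive
begin

definition F :: "complex => real" where "F z = 2 * pi * Re (G z)"

lemma abs_F_diff_le:
 assumes "norm (G z - L) <= b"
 shows "abs (F z - 2 * pi * Re L) <= 2 * pi * b"
proof -
 have "abs (Re (G z - L)) <= b" using abs_Re_le_cmod assms order_trans by blast
 hence "2 * pi * abs (Re (G z - L)) <= 2 * pi * b" by (intro mult_left_mono) auto
 moreover have "F z - 2 * pi * Re L = 2 * pi * Re (G z - L)" by (simp add: F_def algebra_simps)
 ultimately show ?thesis by (simp add: abs_mult)
qed

lemma slash_bloch:
 assumes "s : SL2Z" "z : UHP"
 shows "Im z * norm (slash f s z) <= B"
 using Im_norm_slash[OF assms] bloch[OF moeb_in_UHP[OF assms]] by simp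

lemma G_vertical:
 assumes s: "s : SL2Z" and ab: "0 < a" "a <= b"
 shows "norm (G (moeb s (Complex x b)) - G (moeb s (Complex x a))) <= B * ln b - B * ln a"
proof (rule vertical_diff_le[where G="%z. G (moeb s z)", OF compose_deriv[OF G_deriv s]])
 fix t
 show "((%t. B * ln t) has_real_derivative B / t) (at t)" if "a <= t" "t <= b"
  using that ab by (auto intro!: derivative_eq_intros)
 show "norm (slash f s (Complex x t)) <= B / t" if "a < t" "t < b"
  using slash_bloch[OF s, of "Complex x t"] that ab by (simp add: UHP_def field_simps)
qed (use ab in auto)

lemma G_half_plane_lipschitz:
 assumes m: "m > 0" and zw: "Im z >= m" "Im w >= m"
 shows "norm (G z - G w) <= B / m * norm (z - w)"
proof (rule field_differentiable_bound[where S="{u. Im u >= m}" and f'=f])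
 show "convex {u. Im u >= m}" by (rule convex_halfspace_Im_ge)
 fix u assume "u : {u. Im u >= m}"
 hence u: "Im u >= m" "u : UHP" using m by (auto simp: UHP_def)
 show "(G has_field_derivative f u) (at u within {u. Im u >= m})"
  using G_deriv[OF u(2)] by (rule has_field_derivative_at_within)
 have "m * norm (f u) <= Im u * norm (f u)" using u by (intro mult_right_mono) auto
 also have "... <= B" by (rule bloch[OF u(2)])
 finally show "norm (f u) <= B / m" using m by (simp add: field_simps)
qed (use zw in auto)

lemma F_hyp_ball:
 assumes z: "z : UHP" and w: "w : UHP" and \<rho>: "\<rho> > 0" and near: "w : hyp_ball \<rho> z"
 shows "abs (F z - F w) <= 2 * pi * B * (2 + \<rho>)^2"
proof -
 note bounds = hyp_ball_bounds[OF near z w \<rho>]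
 have pos: "Im z > 0" using z by (simp add: UHP_def)
 define m where "m = Im z / (2 + \<rho>)"
 have m: "m > 0" using pos \<rho> by (simp add: m_def)
 have "Im z * 1 <= Im z * (2 + \<rho>)" using pos \<rho> by (intro mult_left_mono) auto
 hence "Im z >= m" "Im w >= m" using bounds(2) \<rho> by (simp_all add: m_def field_simps)
 hence "norm (G z - G w) <= B / m * norm (z - w)" by (rule G_half_plane_lipschitz[OF m])
 also have "... <= B / m * ((2 + \<rho>) * Im z)" using bounds(4) B_nonneg m by (intro mult_left_mono) auto
 also have "... = B * (2 + \<rho>)^2" using pos \<rho> by (simp add: m_def power2_eq_square field_simps)
 finally show ?thesis using abs_F_diff_le[of z "G w"] by (simp add: F_def mult.assoc)
qed

lemma G_near_cusp:
 assumes s: "s : SL2Z" and L: "!!z. Im z >= 1/2 ==> norm (G (moeb s z) - L) <= C / Im z"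
  and \<eta>: "0 < \<eta>" "\<eta> <= 1/2" and z: "Im z >= \<eta>"
 shows "norm (G (moeb s z) - L) <= 2 * C + B * ln (1 / \<eta>)"
proof (cases "Im z >= 1/2")
 case True
 have "norm (G (moeb s z) - L) <= C / Im z" by (rule L[OF True])
 also have "... <= C / (1/2)" using C_nonneg True by (intro divide_left_mono) auto
 also have "... <= 2 * C + B * ln (1 / \<eta>)" using B_nonneg \<eta> by simp
 finally show ?thesis .
next
 case False
 define w where "w = Complex (Re z) (1/2)"
 have "ln \<eta> <= ln (Im z)" "ln (1/2::real) <= 0" "ln (1/\<eta>) = - ln \<eta>" using z \<eta> by (simp_all add: ln_div)
 hence "ln (1/2) - ln (Im z) <= ln (1/\<eta>)" by linarith
 from mult_left_mono[OF this B_nonneg]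
 have "norm (G (moeb s w) - G (moeb s z)) <= B * ln (1 / \<eta>)"
  using G_vertical[OF s, of "Im z" "1/2" "Re z"] z False \<eta> by (simp add: w_def right_diff_distrib)
 moreover have "norm (G (moeb s w) - L) <= 2 * C" using L[of w] by (simp add: w_def)
 ultimately show ?thesis
  using norm_triangle_ineq4[of "G (moeb s w) - L" "G (moeb s w) - G (moeb s z)"] by simp
qed

lemma F_bound:
 assumes "0 < Im z" "Im z <= 1"
 shows "abs (F z) <= 2 * pi * (2 * C + B * (ln (1 / Im z) + 1))"
proof -
 have "norm (G (moeb (1,0,0,1) z) - 0) <= 2 * C + B * ln (1 / (Im z / 2))"
  by (rule G_near_cusp[OF SL2Z_one]) (use G_decay assms in auto)
 also have "ln (1 / (Im z / 2)) <= ln (1 / Im z) + 1"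
  using assms ln_le_minus_one[of 2] by (simp add: ln_div)
 finally have "norm (G z - 0) <= 2 * C + B * (ln (1 / Im z) + 1)" using B_nonneg by (simp add: mult_left_mono)
 from abs_F_diff_le[OF this] show ?thesis by simp
qed

definition antipode :: "int => int => real => complex" where
 "antipode c d t = Complex (- of_int d / of_int c) (1 / ((of_int c)^2 * t))"

lemma Im_antipode [simp]: "Im (antipode c d t) = 1 / ((of_int c)^2 * t)"
 by (simp add: antipode_def)

lemma jfac_antipode:
 assumes "c > 0" "t > 0"
 shows "jfac (a,b,c,d) (antipode c d t) = \<i> / (of_int c * of_real t)"
 using assms by (simp add: jfac_def antipode_def complex_eq_iff power2_eq_square Re_divide Im_divide)

text \<open>The vertical geodesic to \<open>a/c\<close> is the image of the one over \<open>-d/c\<close>, with \<open>t\<close> and \<open>1/(c\<^sup>2t)\<close> exchanged.\<close>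
lemma moeb_antipode:
 assumes s: "(a,b,c,d) : SL2Z" and c: "c > 0" and t: "t > 0"
 shows "moeb (a,b,c,d) (antipode c d t) = Complex (of_int a / of_int c) t"
proof -
 let ?w = "antipode c d t" and ?j = "jfac (a,b,c,d) (antipode c d t)"
 have j: "?j = \<i> / (of_int c * of_real t)" by (rule jfac_antipode[OF c t])
 hence nonzero: "?j ~= 0" "of_int c ~= (0::complex)" using c t by simp_all
 have "of_int c * (of_int a * ?w + of_int b) = of_int a * ?j - (of_int a * of_int d - of_int b * of_int c)"
  by (simp add: jfac_def algebra_simps)
 hence "of_int c * (of_int a * ?w + of_int b) = of_int a * ?j - 1" by (simp add: SL2Z_det_of_int[OF s])
 moreover have "moeb (a,b,c,d) ?w = of_int c * (of_int a * ?w + of_int b) / (of_int c * ?j)"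
  using nonzero by (simp add: moeb_def jfac_def)
 ultimately have "moeb (a,b,c,d) ?w = of_int a / of_int c - 1 / (of_int c * ?j)"
  using nonzero by (simp add: diff_divide_distrib)
 also have "1 / (of_int c * ?j) = - \<i> * of_real t" using nonzero t by (simp add: j field_simps)
 finally show ?thesis by (simp add: Complex_eq)
qed

lemma f_bound_near_rational:
 assumes s: "(a,b,c,d) : SL2Z" and c: "c > 0" and t: "t > 0"
 shows "norm (f (Complex (of_int a / of_int c) t)) <= (C + B) * (of_int c)^2"
proof (cases "t <= 2 / (of_int c)^2")
 case True
 let ?w = "antipode c d t" and ?j = "jfac (a,b,c,d) (antipode c d t)"
 have high: "Im ?w >= 1/2" using True t c by (simp add: field_simps)
 have w: "?w : UHP" using t c by (simp add: UHP_def)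
 have "norm (f (Complex (of_int a / of_int c) t)) = norm (slash f (a,b,c,d) ?w) * (norm ?j)^2"
  using jfac_nonzero[OF s w] by (simp add: moeb_antipode[OF s c t] slash_def norm_divide norm_power)
 also have "... <= C / (Im ?w)^2 * (norm ?j)^2"
  using slash_decay[OF s high] by (intro mult_right_mono) auto
 also have "... = C * (of_int c)^2"
  using c t by (simp add: jfac_antipode[OF c t] norm_divide norm_mult power2_eq_square)
 also have "... <= (C + B) * (of_int c)^2" using B_nonneg by (intro mult_right_mono) auto
 finally show ?thesis .
next
 case False
 hence "2 / (of_int c)^2 < t" by simp
 have "norm (f (Complex (of_int a / of_int c) t)) <= B / t"
  using bloch[of "Complex (of_int a / of_int c) t"] t by (simp add: UHP_def field_simps)
 also have "... <= B / (2 / (of_int c)^2)" using False t c B_nonneg by (intro divide_left_mono) auto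
 also have "... <= (C + B) * (of_int c)^2" using C_nonneg B_nonneg by (simp add: algebra_simps)
 finally show ?thesis .
qed

lemma G_limit_at_rational:
 assumes s: "(a,b,c,d) : SL2Z" and c: "c > 0"
  and L: "!!z. Im z >= 1/2 ==> norm (G (moeb (a,b,c,d) z) - L) <= C / Im z"
 shows "((%t. G (Complex (of_int a / of_int c) t)) \<longlongrightarrow> L) (at_right 0)"
proof (rule Lim_null[THEN iffD2], rule Lim_null_comparison)
 show "((%t. C * (of_int c)^2 * t) \<longlongrightarrow> 0) (at_right 0)" by (auto intro!: tendsto_eq_intros)
 have "\<forall>\<^sub>F t in at_right 0. t : {0<..<2 / (of_int c)^2::real}" using c by (intro eventually_at_right_real) auto
 thus "\<forall>\<^sub>F t in at_right 0. norm (G (Complex (of_int a / of_int c) t) - L) <= C * (of_int c)^2 * t"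
 proof eventually_elim
  case (elim t)
  hence "Im (antipode c d t) >= 1/2" using c by (simp add: field_simps)
  from L[OF this] show ?case using elim by (simp add: moeb_antipode[OF s c] mult.assoc)
 qed
qed

lemma real_symbol_eq_cusp_limit:
 assumes s: "(a,b,c,d) : SL2Z" and c: "c > 0"
  and L: "!!z. Im z >= 1/2 ==> norm (G (moeb (a,b,c,d) z) - L) <= C / Im z"
 shows "real_symbol f (of_int a / of_int c) = 2 * pi * Re L"
proof -
 let ?p = "Complex (of_int a / of_int c)"
 have "continuous_on {0<..} (%t. f (?p t))"
  by (rule continuous_on_compose2[OF f_continuous]) (auto simp: Complex_eq UHP_def intro!: continuous_intros)
 hence "continuous_on {0<..} (%t. Im (f (?p t)))" by (intro continuous_intros)
 moreover have "abs (Im (f (?p t))) <= (C + B) * (of_int c)^2" if "t > 0" for t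
  using f_bound_near_rational[OF s c that] abs_Im_le_cmod order_trans by blast
 moreover have "abs (Im (f (?p t))) <= C / t^2" if "t >= 1/2" for t
  using slash_decay[OF SL2Z_one, of "?p t"] that abs_Im_le_cmod[of "f (?p t)"] by (simp add: slash_def jfac_def)
 ultimately have int: "set_integrable lborel {0<..} (%t. Im (f (?p t)))"
  using C_nonneg B_nonneg
  by (intro set_integrable_inverse_square_decay[where K="(C + B) * (of_int c)^2" and C=C]) auto
 have infinity: "((%t. G (?p t)) \<longlongrightarrow> 0) at_top"
 proof (rule Lim_null_comparison)
  show "((%t. C / t) \<longlongrightarrow> 0) at_top" by real_asymp
  show "\<forall>\<^sub>F t in at_top. norm (G (?p t)) <= C / t"
   using eventually_ge_at_top[of "1/2"] by eventually_elim (use G_decay[of "?p _"] in simp)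
 qed
 from FTC_Im_vertical[OF G_deriv f_continuous int G_limit_at_rational[OF s c L] infinity] show ?thesis
  by (simp add: real_symbol_def)
qed

lemma F_near_rational:
 assumes "coprime a c" "c > 0" and \<eta>: "0 < \<eta>" "\<eta> <= 1/2" and z: "z : UHP"
  and near: "\<eta> * ((of_int c)^2 * (norm (z - of_real (of_int a / of_int c)))^2) <= Im z"
 shows "abs (F z - real_symbol f (of_int a / of_int c)) <= 2 * pi * (2 * C + B * ln (1 / \<eta>))"
proof -
 obtain u v where uv: "u * a + v * c = 1" using bezout_int[of a c] assms(1) by (metis coprime_iff_gcd_eq_1)
 define s where "s = (a, -v, c, u)"
 have s: "s : SL2Z" using uv by (simp add: s_def SL2Z_def algebra_simps)
 obtain L where L: "!!z. Im z >= 1/2 ==> norm (G (moeb s z) - L) <= C / Im z" using cusp_limit[OF s] by blast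
 have symbol: "real_symbol f (of_int a / of_int c) = 2 * pi * Re L"
  by (rule real_symbol_eq_cusp_limit[of a "-v" c u]) (use s L assms(2) in \<open>auto simp: s_def\<close>)
 define w where "w = moeb (mat2_inv s) z"
 have z_eq: "z = moeb s w" using s z by (simp add: w_def)
 have nonzero: "jfac (mat2_inv s) z ~= 0" by (rule jfac_nonzero[OF SL2Z_inv[OF s] z])
 have "jfac (mat2_inv s) z = - of_int c * (z - of_real (of_int a / of_int c))"
  using assms(2) by (simp add: s_def jfac_def field_simps)
 hence "(norm (jfac (mat2_inv s) z))^2 = (of_int c)^2 * (norm (z - of_real (of_int a / of_int c)))^2"
  by (simp add: norm_mult power_mult_distrib)
 hence "\<eta> * (norm (jfac (mat2_inv s) z))^2 <= Im z" using near by simp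
 moreover have "Im w = Im z / (norm (jfac (mat2_inv s) z))^2" unfolding w_def by (rule Im_moeb[OF SL2Z_inv[OF s] z])
 ultimately have "Im w >= \<eta>" using nonzero by (simp add: pos_le_divide_eq)
 from abs_F_diff_le[OF G_near_cusp[OF s L \<eta> this]] show ?thesis by (simp add: z_eq symbol)
qed

definition petersson_density :: "complex => real" where
 "petersson_density z = indicator UHP z * ((Im z)^2 * (norm (f z))^2)"

lemma petersson_density_measurable [measurable]: "petersson_density : borel_measurable borel"
proof -
 have "continuous_on UHP (%z. (Im z)^2 * (norm (f z))^2)" by (intro continuous_intros f_continuous)
 hence "(%z. indicator UHP z *\<^sub>R ((Im z)^2 * (norm (f z))^2)) : borel_measurable borel"
  by (intro borel_measurable_continuous_on_indicator) auto
 thus ?thesis by (simp add: petersson_density_def[abs_def])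
qed

lemma petersson_density_bounds: "0 <= petersson_density z" "petersson_density z <= B^2"
proof -
 show "0 <= petersson_density z" by (simp add: petersson_density_def)
 show "petersson_density z <= B^2"
 proof (cases "z : UHP")
  case True
  have "(Im z * norm (f z))^2 <= B^2" using bloch[OF True] True by (intro power_mono) (auto simp: UHP_def)
  thus ?thesis using True by (simp add: petersson_density_def power_mult_distrib)
 qed (simp add: petersson_density_def)
qed

lemma petersson_density_invariant: "Gamma0_invariant q petersson_density"
 unfolding Gamma0_invariant_def
proof (intro ballI)
 fix g z assume g: "g : Gamma0 q" and z: "z : UHP"
 note s = SL2Z_of_Gamma0[OF g]
 show "petersson_density (moeb g z) = petersson_density z"
  using z moeb_in_UHP[OF s z] jfac_nonzero[OF s z]
  by (simp add: petersson_density_def Im_moeb[OF s z] f_automorphic[OF g z] norm_mult norm_power power_mult_distrib power_divide power2_eq_square)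
qed

lemma petersson_sq_eq: "petersson_sq D f = (LINT z|hyp_measure. indicator D z * petersson_density z)"
 using D_UHP unfolding petersson_sq_def set_lebesgue_integral_def
 by (subst integral_hyp_lborel, measurable)
  (auto simp: petersson_density_def indicator_def UHP_def intro!: Bochner_Integration.integral_cong)

lemma hyp_vol_eq: "hyp_vol D = (LINT z|hyp_measure. indicator D z)"
 using D_UHP unfolding hyp_vol_def set_lebesgue_integral_def
 by (subst integral_hyp_lborel, measurable) (auto simp: indicator_def intro!: Bochner_Integration.integral_cong)

lemma petersson_sq_nonneg: "petersson_sq D f >= 0"
 unfolding petersson_sq_eq by (rule Bochner_Integration.integral_nonneg) (simp add: petersson_density_bounds)

lemma petersson_density_zero_imp_zero:
 assumes "AE z in hyp_measure. petersson_density z = 0" and z: "z : UHP"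
 shows "f z = 0"
proof (rule ccontr)
 let ?N = "{z\<in>UHP. f z ~= 0}"
 assume nonzero: "f z ~= 0"
 have "?N = UHP \<inter> f -` (- {0})" by auto
 hence op: "open ?N" using continuous_open_preimage[OF f_continuous open_UHP, of "- {0}"] by auto
 have "AE z in lborel. 0 < indicator UHP z * ennreal (1 / (Im z)^2) --> petersson_density z = 0"
  using assms(1) unfolding hyp_measure_def by (subst (asm) AE_density) auto
 hence "AE z in lborel. z \<notin> ?N"
 proof eventually_elim
  case (elim z)
  show ?case
  proof
   assume "z : ?N"
   hence "z : UHP" "Im z > 0" "f z ~= 0" by (auto simp: UHP_def)
   thus False using elim by (simp add: petersson_density_def)
  qed
 qed
 hence "?N : null_sets lborel" by (rule AE_iff_null_sets[THEN iffD2, rotated]) (use op in simp)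
 hence "negligible ?N" unfolding negligible_iff_null_sets by (rule null_sets_completionI)
 thus False using open_not_negligible[OF op] nonzero z by blast
qed

lemma petersson_sq_pos:
 assumes "EX z:UHP. f z ~= 0"
 shows "petersson_sq D f > 0"
proof (rule ccontr)
 assume "~ ?thesis"
 hence "(LINT z|hyp_measure. indicator D z * petersson_density z) = 0" using petersson_sq_nonneg by (simp add: petersson_sq_eq)
 hence "AE z in hyp_measure. indicator D z * petersson_density z = 0"
  using integral_nonneg_eq_0_iff_AE[OF integrable_D[of petersson_density "B^2"]] petersson_density_bounds by simp
 hence "AE z in hyp_measure. indicator D z * (orbit_sum q (%_. 1) z * ennreal (petersson_density z)) = 0"
  by eventually_elim (auto simp: indicator_def)
 hence "(\<integral>\<^sup>+z. indicator D z * (orbit_sum q (%_. 1) z * ennreal (petersson_density z)) \<partial>hyp_measure) = 0"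
  by (subst nn_integral_0_iff_AE) auto
 hence "(\<integral>\<^sup>+z. 1 * ennreal (petersson_density z) \<partial>hyp_measure) = 0"
  using unfolding_nn_invariant[of "%_. 1" "%z. ennreal (petersson_density z)"] petersson_density_invariant
  by (simp add: Gamma0_invariant_def)
 hence "AE z in hyp_measure. petersson_density z = 0"
  by (subst (asm) nn_integral_0_iff_AE) (auto elim!: eventually_mono simp: ennreal_eq_0_iff petersson_density_bounds intro: antisym)
 from petersson_density_zero_imp_zero[OF this] show False using assms by blast
qed

lemma hyp_vol_pos:
 assumes "EX z:UHP. f z ~= 0"
 shows "hyp_vol D > 0"
proof (rule ccontr)
 assume "~ ?thesis"
 moreover have "hyp_vol D = measure hyp_measure D" by (simp add: hyp_vol_eq)
 ultimately have "measure hyp_measure D = 0" using measure_nonneg[of hyp_measure D] by linarith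
 hence "emeasure hyp_measure D = 0" using D_finite by (auto simp: measure_def enn2real_eq_0_iff)
 hence "AE z in hyp_measure. z \<notin> D" by (intro AE_not_in) (auto simp: null_sets_def)
 hence "(LINT z|hyp_measure. indicator D z * petersson_density z) = (LINT z|hyp_measure. 0)"
  by (intro integral_cong_AE) (auto elim: eventually_mono)
 thus False using petersson_sq_pos[OF assms] by (simp add: petersson_sq_eq)
qed

end

section \<open>The equation for horocycle averages\<close>

locale smooth_weight =
 fixes \<psi> \<psi>' \<psi>'' :: "real => real" and X0 X1 K' K'' :: real
 assumes X0_le_X1: "X0 <= X1"
  and deriv_\<psi>: "!!x. (\<psi> has_real_derivative \<psi>' x) (at x)"
  and deriv_\<psi>': "!!x. (\<psi>' has_real_derivative \<psi>'' x) (at x)"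
  and continuous_\<psi>'': "continuous_on UNIV \<psi>''"
  and support: "!!x. x \<notin> {X0..X1} ==> \<psi> x = 0" "!!x. x \<notin> {X0..X1} ==> \<psi>' x = 0"
  and range: "!!x. 0 <= \<psi> x" "!!x. \<psi> x <= 1"
  and \<psi>'_le: "!!x. abs (\<psi>' x) <= K'" and \<psi>''_le: "!!x. abs (\<psi>'' x) <= K''"
begin

abbreviation "window == {X0 - 1..X1 + 1}"

lemma K'_nonneg: "K' >= 0" and K''_nonneg: "K'' >= 0"
 using \<psi>'_le[of 0] \<psi>''_le[of 0] by auto

lemma weight_continuous: "continuous_on S \<psi>" "continuous_on S \<psi>''"
 by (meson DERIV_isCont continuous_at_imp_continuous_on deriv_\<psi>) (rule continuous_on_subset[OF continuous_\<psi>'' subset_UNIV])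

lemma weight_lipschitz: "abs (\<psi> x - \<psi> y) <= K' * abs (x - y)"
 using field_differentiable_bound[where S=UNIV and f=\<psi> and f'=\<psi>' and B=K' and x=x and y=y] deriv_\<psi> \<psi>'_le by simp

lemma integral_\<psi>'': "integral window \<psi>'' = 0"
proof -
 have "(\<psi>'' has_integral \<psi>' (X1 + 1) - \<psi>' (X0 - 1)) window"
  using X0_le_X1 deriv_\<psi>' by (intro fundamental_theorem_of_calculus)
   (auto simp flip: has_real_derivative_iff_has_vector_derivative intro: has_field_derivative_at_within)
 thus ?thesis by (simp add: support integral_unique)
qed

end

lemma cis_deriv:
 assumes "(g has_real_derivative d) (at y)"
 shows "((%y. cis (\<xi> * g y)) has_vector_derivative (\<i> * of_real (\<xi> * d)) * cis (\<xi> * g y)) (at y)"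
 unfolding has_vector_derivative_complex_iff
 using assms by (auto intro!: derivative_eq_intros)

lemma cis_lipschitz: "norm (cis x - cis y) <= abs (x - y)"
proof -
 have "cis x - cis y = cis y * (cis (x - y) - 1)" by (simp add: right_diff_distrib cis_mult)
 also have "norm ... = 2 * abs (sin ((x - y) / 2))" unfolding norm_mult norm_cis cis_conv_exp dist_exp_i_1 by simp
 also have "... <= abs (x - y)" using abs_sin_x_le_abs_x[of "(x - y) / 2"] by simp
 finally show ?thesis .
qed

lemma continuous_on_horocycle: "continuous_on UHP k ==> y > 0 ==> continuous_on S (%x. k (Complex x y))"
 by (erule continuous_on_compose2) (auto simp: Complex_eq UHP_def intro!: continuous_intros)

lemma continuous_on_Complex_swap:
 assumes "continuous_on UHP k"
 shows "continuous_on ({0<..} \<times> S) (%p. k (Complex (snd p) (fst p)))"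
 by (rule continuous_on_compose2[OF assms]) (auto simp: Complex_eq UHP_def intro!: continuous_intros)

lemma taylor_second_order_integral:
 fixes g :: "real => complex"
 assumes "!!w. w : {y..1} ==> (g has_vector_derivative g' w) (at w)" "!!w. w : {y..1} ==> (g' has_vector_derivative g'' w) (at w)"
  and "y <= 1"
 shows "((%w. of_real (w - y) * g'' w) has_integral g y - g 1 + of_real (1 - y) * g' 1) {y..1}"
proof -
 have "((%w. of_real (w - y) * g' w - g w) has_vector_derivative of_real (w - y) * g'' w) (at w within {y..1})"
  if w: "w : {y..1}" for w
 proof -
  have "((%w. of_real (w - y)) has_vector_derivative (1::complex)) (at w)"
   unfolding has_vector_derivative_complex_iff by (auto intro!: derivative_eq_intros)
  from has_vector_derivative_diff[OF has_vector_derivative_mult[OF this assms(2)[OF w]] assms(1)[OF w]]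
  show ?thesis by (simp add: has_vector_derivative_at_within)
 qed
 from fundamental_theorem_of_calculus[OF assms(3) this] show ?thesis by (simp add: algebra_simps)
qed

locale weighted_cusp_primitive = cusp_primitive q D f G B C + smooth_weight \<psi> \<psi>' \<psi>'' X0 X1 K' K''
 for q D f G B C \<psi> \<psi>' \<psi>'' X0 X1 K' K''
begin

definition phase :: "real => complex => complex" where "phase \<xi> z = cis (\<xi> * F z)"

definition Fy where "Fy z = - 2 * pi * Im (f z)"
definition Fx where "Fx z = 2 * pi * Re (f z)"

lemma G_continuous: "continuous_on UHP G"
 by (meson DERIV_isCont G_deriv continuous_at_imp_continuous_on)

lemma F_continuous: "continuous_on UHP F"
 unfolding F_def[abs_def] by (intro continuous_intros G_continuous)

lemma phase_continuous: "continuous_on UHP (phase \<xi>)"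
 unfolding phase_def[abs_def] cis_conv_exp by (intro continuous_intros F_continuous)

lemma deriv_f_continuous: "continuous_on UHP (deriv f)"
 by (intro holomorphic_on_imp_continuous_on holomorphic_deriv f_holomorphic open_UHP)

lemma Fx_continuous: "continuous_on UHP Fx" and Fy_continuous: "continuous_on UHP Fy"
 unfolding Fx_def[abs_def] Fy_def[abs_def] by (intro continuous_intros f_continuous)+

lemma norm_phase [simp]: "norm (phase \<xi> z) = 1" by (simp add: phase_def)

lemma F_partial_derivs:
 assumes "y > 0"
 shows "((%t. F (Complex x t)) has_real_derivative Fy (Complex x y)) (at y)"
  and "((%s. F (Complex s y)) has_real_derivative Fx (Complex x y)) (at x)"
  and "((%t. Fy (Complex x t)) has_real_derivative - 2 * pi * Re (deriv f (Complex x y))) (at y)"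
  and "((%s. Fx (Complex s y)) has_real_derivative 2 * pi * Re (deriv f (Complex x y))) (at x)"
proof -
 have z: "Complex x y : UHP" using assms by (simp add: UHP_def)
 note G = field_derivative_along_lines[OF G_deriv[OF z], unfolded has_vector_derivative_complex_iff]
 note f = field_derivative_along_lines[OF holomorphic_derivI[OF f_holomorphic open_UHP z], unfolded has_vector_derivative_complex_iff]
 show "((%t. F (Complex x t)) has_real_derivative Fy (Complex x y)) (at y)"
  using DERIV_cmult[OF conjunct1[OF G(1)], of "2 * pi"] by (simp add: F_def Fy_def)
 show "((%s. F (Complex s y)) has_real_derivative Fx (Complex x y)) (at x)"
  using DERIV_cmult[OF conjunct1[OF G(2)], of "2 * pi"] by (simp add: F_def Fx_def)
 show "((%t. Fy (Complex x t)) has_real_derivative - 2 * pi * Re (deriv f (Complex x y))) (at y)"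
  using DERIV_cmult[OF conjunct2[OF f(1)], of "- 2 * pi"] by (simp add: Fy_def)
 show "((%s. Fx (Complex s y)) has_real_derivative 2 * pi * Re (deriv f (Complex x y))) (at x)"
  using DERIV_cmult[OF conjunct1[OF f(2)], of "2 * pi"] by (simp add: Fx_def)
qed

definition phase_dy where "phase_dy \<xi> z = (\<i> * of_real (\<xi> * Fy z)) * phase \<xi> z"
definition phase_dx where "phase_dx \<xi> z = (\<i> * of_real (\<xi> * Fx z)) * phase \<xi> z"
definition phase_dyy where
 "phase_dyy \<xi> z = (\<i> * of_real (\<xi> * Fy z)) * phase_dy \<xi> z + (\<i> * of_real (\<xi> * (- 2 * pi * Re (deriv f z)))) * phase \<xi> z"
definition phase_dxx where
 "phase_dxx \<xi> z = (\<i> * of_real (\<xi> * Fx z)) * phase_dx \<xi> z + (\<i> * of_real (\<xi> * (2 * pi * Re (deriv f z)))) * phase \<xi> z"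

lemma phase_derivs:
 assumes "y > 0"
 shows "((%t. phase \<xi> (Complex x t)) has_vector_derivative phase_dy \<xi> (Complex x y)) (at y)"
  and "((%s. phase \<xi> (Complex s y)) has_vector_derivative phase_dx \<xi> (Complex x y)) (at x)"
 unfolding phase_def phase_dy_def phase_dx_def by (rule cis_deriv, rule F_partial_derivs, rule assms)+

lemma phase_second_derivs:
 assumes y: "y > 0"
 shows "((%t. phase_dy \<xi> (Complex x t)) has_vector_derivative phase_dyy \<xi> (Complex x y)) (at y)"
  and "((%s. phase_dx \<xi> (Complex s y)) has_vector_derivative phase_dxx \<xi> (Complex x y)) (at x)"
proof -
 have coefficient: "((%y. \<i> * of_real (\<xi> * g y)) has_vector_derivative \<i> * of_real (\<xi> * d)) (at y)"
  if "(g has_real_derivative d) (at y)" for g d y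
  unfolding has_vector_derivative_complex_iff using that by (auto intro!: derivative_eq_intros)
 from has_vector_derivative_mult[OF coefficient[OF F_partial_derivs(3)[OF y]] phase_derivs(1)[OF y]]
 show "((%t. phase_dy \<xi> (Complex x t)) has_vector_derivative phase_dyy \<xi> (Complex x y)) (at y)"
  unfolding phase_dyy_def by (simp only: phase_dy_def)
 from has_vector_derivative_mult[OF coefficient[OF F_partial_derivs(4)[OF y]] phase_derivs(2)[OF y]]
 show "((%s. phase_dx \<xi> (Complex s y)) has_vector_derivative phase_dxx \<xi> (Complex x y)) (at x)"
  unfolding phase_dxx_def by (simp only: phase_dx_def)
qed

text \<open>\<open>F\<close> is harmonic, so the Laplacian of \<open>e\<^sup>i\<^sup>\<xi>\<^sup>F\<close> only sees the gradient of \<open>F\<close>.\<close>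
lemma phase_laplacian: "phase_dyy \<xi> z = - phase_dxx \<xi> z - of_real (4 * pi^2 * \<xi>^2 * (norm (f z))^2) * phase \<xi> z"
proof -
 have "\<i> * (\<i> * w) = - w" for w :: complex by (simp add: mult.assoc[symmetric])
 thus ?thesis
  unfolding phase_dyy_def phase_dxx_def phase_dy_def phase_dx_def Fx_def Fy_def cmod_power2
  by (simp add: algebra_simps power2_eq_square)
qed

lemma phase_derivs_continuous: "continuous_on UHP (phase_dy \<xi>)" "continuous_on UHP (phase_dx \<xi>)"
 unfolding phase_dy_def[abs_def] phase_dx_def[abs_def]
 by (intro continuous_intros Fx_continuous Fy_continuous phase_continuous)+

lemma phase_second_derivs_continuous: "continuous_on UHP (phase_dyy \<xi>)" "continuous_on UHP (phase_dxx \<xi>)"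
 unfolding phase_dyy_def[abs_def] phase_dxx_def[abs_def]
 by (intro continuous_intros Fx_continuous Fy_continuous phase_continuous phase_derivs_continuous deriv_f_continuous)+

definition horocycle_integral :: "(real => real) => (complex => complex) => real => complex" where
 "horocycle_integral p k y = integral window (%x. of_real (p x) * k (Complex x y))"

lemma horocycle_integrand_continuous:
 "continuous_on window p ==> continuous_on UHP k ==> y > 0 ==> continuous_on window (%x. of_real (p x) * k (Complex x y))"
 for k :: "complex => complex"
 by (intro continuous_intros continuous_on_horocycle)

lemma has_integral_horocycle_integral:
 assumes "continuous_on window p" "continuous_on UHP k" "y > 0"
 shows "((%x. of_real (p x) * k (Complex x y)) has_integral horocycle_integral p k y) window"
 unfolding horocycle_integral_def
 by (intro integrable_integral integrable_continuous_interval horocycle_integrand_continuous assms)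

lemma horocycle_integral_cong:
 "(!!x. k (Complex x y) = l (Complex x y)) ==> horocycle_integral p k y = horocycle_integral p l y"
 by (simp add: horocycle_integral_def)

lemma horocycle_integral_linear:
 assumes p: "continuous_on window p" and y: "y > 0" and k: "continuous_on UHP k" and l: "continuous_on UHP l"
 shows "horocycle_integral p (%z. c * k z - d * l z) y = c * horocycle_integral p k y - d * horocycle_integral p l y"
proof -
 have "((%x. c * (of_real (p x) * k (Complex x y)) - d * (of_real (p x) * l (Complex x y))) has_integral
   c * horocycle_integral p k y - d * horocycle_integral p l y) window"
  by (intro has_integral_diff has_integral_mult_right has_integral_horocycle_integral assms)
 from integral_unique[OF this] show ?thesis by (simp add: horocycle_integral_def algebra_simps)
qed

lemma horocycle_integrand_continuous2:
 fixes k :: "complex => complex"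
 assumes p: "continuous_on window p" and k: "continuous_on UHP k"
 shows "continuous_on ({0<..} \<times> cbox (X0 - 1) (X1 + 1)) (%(y, x). of_real (p x) * k (Complex x y))"
proof -
 have "continuous_on ({0<..} \<times> window) (%q. p (snd q))"
  by (rule continuous_on_compose2[OF p]) (auto intro!: continuous_intros)
 hence "continuous_on ({0<..} \<times> window) (%q. of_real (p (snd q)) * k (Complex (snd q) (fst q)))"
  by (intro continuous_intros continuous_on_Complex_swap k)
 thus ?thesis by (simp add: case_prod_unfold)
qed

lemma horocycle_integral_deriv:
 assumes p: "continuous_on window p" and k: "continuous_on UHP k" and k': "continuous_on UHP k'"
  and deriv: "!!x y. y > 0 ==> ((%y. k (Complex x y)) has_vector_derivative k' (Complex x y)) (at y)" and y: "y > 0"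
 shows "(horocycle_integral p k has_vector_derivative horocycle_integral p k' y) (at y)"
proof -
 have "((%y. integral (cbox (X0 - 1) (X1 + 1)) (%x. of_real (p x) * k (Complex x y))) has_vector_derivative
   integral (cbox (X0 - 1) (X1 + 1)) (%x. of_real (p x) * k' (Complex x y))) (at y within {0<..})"
 proof (rule leibniz_rule_vector_derivative)
  fix y x :: real assume "y : {0<..}"
  hence "((%y. k (Complex x y)) has_vector_derivative k' (Complex x y)) (at y within {0<..})"
   using deriv[of y x] has_vector_derivative_at_within by auto
  from has_vector_derivative_mult_right[OF this]
  show "((%y. of_real (p x) * k (Complex x y)) has_vector_derivative of_real (p x) * k' (Complex x y)) (at y within {0<..})" .
 next
  fix y :: real assume "y : {0<..}"
  thus "(%x. of_real (p x) * k (Complex x y)) integrable_on cbox (X0 - 1) (X1 + 1)"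
   using horocycle_integrand_continuous[OF p k, of y] by (intro integrable_continuous) auto
 qed (use y horocycle_integrand_continuous2[OF p k'] in auto)
 thus ?thesis using y by (simp add: horocycle_integral_def[abs_def] at_within_open[of y "{0<..}"])
qed

lemma horocycle_integral_continuous:
 assumes p: "continuous_on window p" and k: "continuous_on UHP k" and S: "S <= {0<..}"
 shows "continuous_on S (horocycle_integral p k)"
 using integral_continuous_on_param[OF horocycle_integrand_continuous2[OF p k]] S continuous_on_subset
 by (fastforce simp: horocycle_integral_def[abs_def])

lemma horocycle_integral_bound:
 assumes "continuous_on window p" "continuous_on UHP k" "y > 0"
  and "!!x. norm (of_real (p x) * k (Complex x y)) <= M"
 shows "norm (horocycle_integral p k y) <= M * (X1 - X0 + 2)"
proof -
 have "norm (horocycle_integral p k y) <= M * (X1 + 1 - (X0 - 1))"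
  unfolding horocycle_integral_def
  by (rule integral_bound) (use assms horocycle_integrand_continuous[OF assms(1-3)] X0_le_X1 in auto)
 thus ?thesis by (simp add: algebra_simps)
qed

definition phase_average where "phase_average \<xi> = horocycle_integral \<psi> (phase \<xi>)"
definition energy_average where "energy_average \<xi> = horocycle_integral \<psi> (%z. of_real (petersson_density z) * phase \<xi> z)"
definition curvature_average where "curvature_average \<xi> = horocycle_integral \<psi>'' (phase \<xi>)"

lemma petersson_density_continuous: "continuous_on UHP petersson_density"
proof -
 have "continuous_on UHP (%z. (Im z)^2 * (norm (f z))^2)" by (intro continuous_intros f_continuous)
 thus ?thesis by (rule continuous_on_eq) (simp add: petersson_density_def)
qed

lemma energy_continuous: "continuous_on UHP (%z. of_real (petersson_density z) * phase \<xi> z)"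
 by (intro continuous_intros petersson_density_continuous phase_continuous)

lemma averages_continuous:
 assumes "S <= {0<..}"
 shows "continuous_on S (phase_average \<xi>)" "continuous_on S (energy_average \<xi>)" "continuous_on S (curvature_average \<xi>)"
 unfolding phase_average_def energy_average_def curvature_average_def
 using horocycle_integral_continuous[OF _ _ assms] weight_continuous phase_continuous energy_continuous by blast+

lemma horocycle_integral_phase_dxx:
 assumes y: "y > 0"
 shows "horocycle_integral \<psi> (phase_dxx \<xi>) y = curvature_average \<xi> y"
proof -
 let ?z = "%x. Complex x y"
 let ?H = "%x. of_real (\<psi> x) * phase_dx \<xi> (?z x) - of_real (\<psi>' x) * phase \<xi> (?z x)"
 have boundary: "((%x. of_real (\<psi> x) * phase_dxx \<xi> (?z x) - of_real (\<psi>'' x) * phase \<xi> (?z x)) has_integral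
   ?H (X1 + 1) - ?H (X0 - 1)) window"
 proof (rule fundamental_theorem_of_calculus)
  fix x
  have weight: "((%x. of_real (\<psi> x)) has_vector_derivative complex_of_real (\<psi>' x)) (at x)"
    "((%x. of_real (\<psi>' x)) has_vector_derivative complex_of_real (\<psi>'' x)) (at x)"
   unfolding has_vector_derivative_complex_iff using deriv_\<psi>[of x] deriv_\<psi>'[of x] by auto
  from has_vector_derivative_diff[OF has_vector_derivative_mult[OF weight(1) phase_second_derivs(2)[OF y, of \<xi>]]
    has_vector_derivative_mult[OF weight(2) phase_derivs(2)[OF y, of \<xi>]]]
  have "(?H has_vector_derivative of_real (\<psi> x) * phase_dxx \<xi> (?z x) - of_real (\<psi>'' x) * phase \<xi> (?z x)) (at x)"
   by (rule has_vector_derivative_eq_rhs) simp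
  thus "(?H has_vector_derivative of_real (\<psi> x) * phase_dxx \<xi> (?z x) - of_real (\<psi>'' x) * phase \<xi> (?z x)) (at x within window)"
   by (rule has_vector_derivative_at_within)
 qed (use X0_le_X1 in simp)
 have "((%x. of_real (\<psi> x) * phase_dxx \<xi> (?z x) - of_real (\<psi>'' x) * phase \<xi> (?z x)) has_integral
   horocycle_integral \<psi> (phase_dxx \<xi>) y - curvature_average \<xi> y) window"
  unfolding curvature_average_def
  by (intro has_integral_diff has_integral_horocycle_integral weight_continuous phase_continuous phase_second_derivs_continuous y)
 from has_integral_unique[OF this boundary] show ?thesis by (simp add: support)
qed

lemma horocycle_integral_phase_dyy:
 assumes y: "y > 0"
 shows "horocycle_integral \<psi> (phase_dyy \<xi>) y = - curvature_average \<xi> y - of_real (4 * pi^2 * \<xi>^2 / y^2) * energy_average \<xi> y"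
proof -
 have "horocycle_integral \<psi> (phase_dyy \<xi>) y
  = horocycle_integral \<psi> (%z. - 1 * phase_dxx \<xi> z - of_real (4 * pi^2 * \<xi>^2 / y^2) * (of_real (petersson_density z) * phase \<xi> z)) y"
 proof (rule horocycle_integral_cong)
  fix x
  have "4 * pi^2 * \<xi>^2 / y^2 * petersson_density (Complex x y) = 4 * pi^2 * \<xi>^2 * (norm (f (Complex x y)))^2"
   using y by (simp add: petersson_density_def UHP_def)
  thus "phase_dyy \<xi> (Complex x y) = - 1 * phase_dxx \<xi> (Complex x y)
    - of_real (4 * pi^2 * \<xi>^2 / y^2) * (of_real (petersson_density (Complex x y)) * phase \<xi> (Complex x y))"
   unfolding phase_laplacian mult.assoc[symmetric] of_real_mult[symmetric] by simp
 qed
 also have "... = - 1 * horocycle_integral \<psi> (phase_dxx \<xi>) y - of_real (4 * pi^2 * \<xi>^2 / y^2) * energy_average \<xi> y"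
  unfolding energy_average_def
  by (intro horocycle_integral_linear weight_continuous y energy_continuous phase_second_derivs_continuous)
 finally show ?thesis by (simp add: horocycle_integral_phase_dxx[OF y])
qed

lemma phase_average_expansion:
 assumes y: "0 < y" "y <= 1"
 shows "phase_average \<xi> y = phase_average \<xi> 1 - of_real (1 - y) * horocycle_integral \<psi> (phase_dy \<xi>) 1
  - integral {y..1} (%w. of_real (w - y) * curvature_average \<xi> w)
  - of_real (4 * pi^2 * \<xi>^2) * (integral {y..1} (%w. of_real (1 / w) * energy_average \<xi> w)
   - integral {y..1} (%w. of_real (y / w^2) * energy_average \<xi> w))"
proof -
 let ?C = "%w. of_real (w - y) * curvature_average \<xi> w"
 let ?E = "%w. of_real (1 / w) * energy_average \<xi> w" and ?E' = "%w. of_real (y / w^2) * energy_average \<xi> w"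
 have S: "{y..1} <= {0<..}" using y by auto
 have taylor: "((%w. of_real (w - y) * horocycle_integral \<psi> (phase_dyy \<xi>) w) has_integral
   phase_average \<xi> y - phase_average \<xi> 1 + of_real (1 - y) * horocycle_integral \<psi> (phase_dy \<xi>) 1) {y..1}"
  unfolding phase_average_def
  by (intro taylor_second_order_integral horocycle_integral_deriv weight_continuous phase_continuous
    phase_derivs_continuous phase_second_derivs_continuous phase_derivs phase_second_derivs) (use y in auto)
 have int: "?C integrable_on {y..1}" "?E integrable_on {y..1}" "?E' integrable_on {y..1}"
  using y by (intro integrable_continuous_interval continuous_intros averages_continuous S; force)+
 have "((%w. - ?C w - of_real (4 * pi^2 * \<xi>^2) * (?E w - ?E' w)) has_integral
   - integral {y..1} ?C - of_real (4 * pi^2 * \<xi>^2) * (integral {y..1} ?E - integral {y..1} ?E')) {y..1}"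
  by (intro has_integral_diff has_integral_neg has_integral_mult_right integrable_integral int)
 hence "((%w. of_real (w - y) * horocycle_integral \<psi> (phase_dyy \<xi>) w) has_integral
   - integral {y..1} ?C - of_real (4 * pi^2 * \<xi>^2) * (integral {y..1} ?E - integral {y..1} ?E')) {y..1}"
 proof (rule has_integral_eq[rotated])
  fix w assume "w : {y..1}"
  hence w: "w > 0" using y by simp
  show "- ?C w - of_real (4 * pi^2 * \<xi>^2) * (?E w - ?E' w) = of_real (w - y) * horocycle_integral \<psi> (phase_dyy \<xi>) w"
   unfolding horocycle_integral_phase_dyy[OF w] using w by (simp add: field_simps power2_eq_square)
 qed
 from has_integral_unique[OF taylor this] show ?thesis by (simp add: algebra_simps)
qed

lemma horocycle_integral_phase_near_weight:
 assumes p: "continuous_on window p" and y: "0 < y" "y <= 1" and M: "!!x. abs (p x) <= M" and \<xi>: "\<xi> >= 0"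
 shows "norm (horocycle_integral p (phase \<xi>) y - of_real (integral window p))
  <= M * (\<xi> * (2 * pi * (2 * C + B * (ln (1 / y) + 1)))) * (X1 - X0 + 2)"
proof -
 have "(p has_integral integral window p) window" using p by (intro integrable_integral integrable_continuous_interval)
 from has_integral_linear[OF this bounded_linear_of_real[where 'a=complex]]
 have "horocycle_integral p (%_. 1) y = of_real (integral window p)"
  by (simp add: o_def horocycle_integral_def integral_unique)
 hence "horocycle_integral p (phase \<xi>) y - of_real (integral window p) = horocycle_integral p (%z. 1 * phase \<xi> z - 1 * 1) y"
  by (subst horocycle_integral_linear) (auto intro: p y phase_continuous)
 also have "norm ... <= M * (\<xi> * (2 * pi * (2 * C + B * (ln (1 / y) + 1)))) * (X1 - X0 + 2)"
 proof (rule horocycle_integral_bound[OF p _ y(1)])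
  show "continuous_on UHP (%z. 1 * phase \<xi> z - 1 * 1)" by (intro continuous_intros phase_continuous)
  fix x
  have "norm (phase \<xi> (Complex x y) - 1) <= abs (\<xi> * F (Complex x y))"
   unfolding phase_def using cis_lipschitz[of _ 0] by simp
  also have "... <= \<xi> * (2 * pi * (2 * C + B * (ln (1 / y) + 1)))"
   using F_bound[of "Complex x y"] y \<xi> by (simp add: abs_mult mult_left_mono)
  finally have "abs (p x) * norm (phase \<xi> (Complex x y) - 1) <= M * (\<xi> * (2 * pi * (2 * C + B * (ln (1 / y) + 1))))"
   using M[of x] by (intro mult_mono) auto
  thus "norm (of_real (p x) * (1 * phase \<xi> (Complex x y) - 1 * 1)) <= M * (\<xi> * (2 * pi * (2 * C + B * (ln (1 / y) + 1))))"
   by (simp add: norm_mult)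
 qed
 finally show ?thesis .
qed

lemma energy_average_bound: "y > 0 ==> norm (energy_average \<xi> y) <= B^2 * (X1 - X0 + 2)"
 unfolding energy_average_def
proof (rule horocycle_integral_bound[OF weight_continuous(1) energy_continuous])
 fix x
 show "norm (of_real (\<psi> x) * (of_real (petersson_density (Complex x y)) * phase \<xi> (Complex x y))) <= B^2"
  using mult_mono[of "\<psi> x" 1 "petersson_density (Complex x y)" "B^2"] range[of x] petersson_density_bounds[of "Complex x y"]
  by (simp add: norm_mult)
qed

lemma horocycle_integral_phase_dy_bound:
 assumes "\<xi> >= 0"
 shows "norm (horocycle_integral \<psi> (phase_dy \<xi>) 1) <= \<xi> * (2 * pi * B) * (X1 - X0 + 2)"
proof (rule horocycle_integral_bound[OF weight_continuous(1) phase_derivs_continuous(1)])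
 fix x
 have "norm (f (Complex x 1)) <= B" using bloch[of "Complex x 1"] by (simp add: UHP_def)
 hence "abs (Im (f (Complex x 1))) <= B" using abs_Im_le_cmod order_trans by blast
 hence "norm (phase_dy \<xi> (Complex x 1)) <= \<xi> * (2 * pi * B)"
  using assms by (simp add: phase_dy_def Fy_def norm_mult abs_mult mult_left_mono)
 thus "norm (of_real (\<psi> x) * phase_dy \<xi> (Complex x 1)) <= \<xi> * (2 * pi * B)"
  unfolding norm_mult norm_of_real using range[of x] mult_mono[of "abs (\<psi> x)" 1 "norm (phase_dy \<xi> (Complex x 1))" "\<xi> * (2 * pi * B)"] by simp
qed simp

lemma curvature_term_bound:
 assumes y: "0 < y" "y <= 1" and \<xi>: "\<xi> >= 0"
 shows "norm (integral {y..1} (%w. of_real (w - y) * curvature_average \<xi> w)) <= \<xi> * ((X1 - X0 + 2) * (K'' * (2 * pi * (2 * C + B))))"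
proof -
 let ?M = "\<xi> * ((X1 - X0 + 2) * (K'' * (2 * pi * (2 * C + B))))"
 have S: "{y..1} <= {0<..}" using y by auto
 have M: "?M >= 0" using \<xi> X0_le_X1 K''_nonneg C_nonneg B_nonneg by simp
 have "norm (integral {y..1} (%w. of_real (w - y) * curvature_average \<xi> w)) <= ?M * (1 - y)"
 proof (rule integral_bound[OF y(2)])
  show "continuous_on {y..1} (%w. of_real (w - y) * curvature_average \<xi> w)" by (intro continuous_intros averages_continuous S)
  fix w assume "w : {y..1}"
  hence w: "0 < w" "w <= 1" "y <= w" using y by auto
  have curvature: "norm (curvature_average \<xi> w) <= K'' * (\<xi> * (2 * pi * (2 * C + B * (ln (1 / w) + 1)))) * (X1 - X0 + 2)"
   using horocycle_integral_phase_near_weight[OF weight_continuous(2) w(1,2) \<psi>''_le \<xi>]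
   by (simp add: curvature_average_def integral_\<psi>'')
  have "w * (ln (1 / w) + 1) <= w * (1 / w)" using w ln_le_minus_one[of "1/w"] by (intro mult_left_mono) auto
  hence log: "w * (ln (1 / w) + 1) <= 1" using w by simp
  have "norm (of_real (w - y) * curvature_average \<xi> w) <= w * (K'' * (\<xi> * (2 * pi * (2 * C + B * (ln (1 / w) + 1)))) * (X1 - X0 + 2))"
   unfolding norm_mult norm_of_real using w y curvature by (intro mult_mono) auto
  also have "... = \<xi> * ((X1 - X0 + 2) * (K'' * (2 * pi * (2 * C * w + B * (w * (ln (1 / w) + 1))))))" by (simp add: algebra_simps)
  also have "... <= \<xi> * ((X1 - X0 + 2) * (K'' * (2 * pi * (2 * C * 1 + B * 1))))"
   using log w C_nonneg B_nonneg K''_nonneg \<xi> X0_le_X1 by (intro mult_left_mono add_mono) auto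
  finally show "norm (of_real (w - y) * curvature_average \<xi> w) <= ?M" by simp
 qed
 also have "... <= ?M * 1" using M y by (intro mult_left_mono) auto
 finally show ?thesis by simp
qed

lemma energy_term_bound:
 assumes y: "0 < y" "y <= 1"
 shows "norm (integral {y..1} (%w. of_real (y / w^2) * energy_average \<xi> w)) <= B^2 * (X1 - X0 + 2)"
proof -
 let ?M = "B^2 * (X1 - X0 + 2)"
 have profile: "((%w. ?M * (y / w^2)) has_integral ?M * ((- y / 1) - (- y / y))) {y..1}"
 proof (intro has_integral_mult_right fundamental_theorem_of_calculus[OF y(2)])
  fix w assume "w : {y..1}"
  hence "((%w. - y / w) has_real_derivative y / w^2) (at w)"
   using y by (auto intro!: derivative_eq_intros simp: power2_eq_square)
  thus "((%w. - y / w) has_vector_derivative y / w^2) (at w within {y..1})"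
   by (simp add: has_real_derivative_iff_has_vector_derivative has_vector_derivative_at_within)
 qed
 have "norm (integral {y..1} (%w. of_real (y / w^2) * energy_average \<xi> w)) <= integral {y..1} (%w. ?M * (y / w^2))"
 proof (rule integral_norm_bound_integral)
  show "(%w. of_real (y / w^2) * energy_average \<xi> w) integrable_on {y..1}"
   using y by (intro integrable_continuous_interval continuous_intros averages_continuous) auto
  show "(%w. ?M * (y / w^2)) integrable_on {y..1}" using profile by blast
  fix w assume "w : {y..1}"
  hence "(y / w^2) * norm (energy_average \<xi> w) <= (y / w^2) * ?M" using energy_average_bound y by (intro mult_left_mono) auto
  thus "norm (of_real (y / w^2) * energy_average \<xi> w) <= ?M * (y / w^2)"
   using y by (simp add: norm_mult norm_divide norm_power mult.commute)
 qed
 also have "... = ?M * ((- y / 1) - (- y / y))" using profile by (rule integral_unique)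
 also have "... <= ?M * 1" using y X0_le_X1 by (intro mult_left_mono) auto
 finally show ?thesis by simp
qed

definition expansion_const where
 "expansion_const = (X1 - X0 + 2) * (2 * pi * (2 * C + B) + 2 * pi * B + K'' * (2 * pi * (2 * C + B)) + 4 * pi^2 * B^2)"

lemma phase_average_integral_equation:
 assumes y: "0 < y" "y <= 1" and \<xi>: "0 <= \<xi>" "\<xi> <= 1"
 shows "norm (phase_average \<xi> y - (of_real (integral window \<psi>)
  - of_real (4 * pi^2 * \<xi>^2) * integral {y..1} (%w. of_real (1 / w) * energy_average \<xi> w))) <= \<xi> * expansion_const"
proof -
 let ?L = "X1 - X0 + 2" and ?c = "of_real (integral window \<psi>) :: complex"
 let ?E = "integral {y..1} (%w. of_real (1 / w) * energy_average \<xi> w)" and ?E' = "integral {y..1} (%w. of_real (y / w^2) * energy_average \<xi> w)"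
 let ?X = "integral {y..1} (%w. of_real (w - y) * curvature_average \<xi> w)"
 have start: "norm (phase_average \<xi> 1 - ?c) <= \<xi> * (?L * (2 * pi * (2 * C + B)))"
  unfolding phase_average_def using horocycle_integral_phase_near_weight[OF weight_continuous(1), of 1 1 \<xi>] range \<xi> by (simp add: abs_of_nonneg mult_ac)
 have slope: "norm (of_real (1 - y) * horocycle_integral \<psi> (phase_dy \<xi>) 1) <= 1 * (\<xi> * (2 * pi * B) * ?L)"
  unfolding norm_mult norm_of_real using y horocycle_integral_phase_dy_bound[OF \<xi>(1)] by (intro mult_mono) auto
 have "\<xi>^2 <= \<xi>" using \<xi> by (simp add: power2_eq_square mult_left_le)
 hence energy: "norm (of_real (4 * pi^2 * \<xi>^2) * ?E') <= (4 * pi^2 * \<xi>) * (B^2 * ?L)"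
  unfolding norm_mult norm_of_real using energy_term_bound[OF y] \<xi> by (intro mult_mono) auto
 have "phase_average \<xi> y - (?c - of_real (4 * pi^2 * \<xi>^2) * ?E)
  = ((phase_average \<xi> 1 - ?c) - of_real (1 - y) * horocycle_integral \<psi> (phase_dy \<xi>) 1) - (?X - of_real (4 * pi^2 * \<xi>^2) * ?E')"
  unfolding phase_average_expansion[OF y, of \<xi>] by (simp add: algebra_simps)
 also have "norm ... <= (\<xi> * (?L * (2 * pi * (2 * C + B))) + 1 * (\<xi> * (2 * pi * B) * ?L))
   + (\<xi> * (?L * (K'' * (2 * pi * (2 * C + B)))) + (4 * pi^2 * \<xi>) * (B^2 * ?L))"
  by (intro order_trans[OF norm_triangle_ineq4] add_mono start slope curvature_term_bound[OF y \<xi>(1)] energy)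
 also have "... = \<xi> * expansion_const" by (simp add: expansion_const_def algebra_simps)
 finally show ?thesis .
qed

end

lemma LBINT_Icc:
 fixes k :: "real => real"
 assumes "continuous_on {s..t} k"
 shows "(LBINT x. indicator {s..t} x * k x) = integral {s..t} k"
 using set_borel_integral_eq_integral(2)[OF borel_integrable_atLeastAtMost'[OF assms]]
 by (simp add: set_lebesgue_integral_def)

lemma LBINT_horocycle:
 fixes k :: "complex => real"
 assumes "continuous_on UHP k" "!!z. Re z \<notin> {X0..X1} ==> k z = 0" "y > 0"
 shows "(LBINT x. k (Complex x y)) = integral {X0 - 1..X1 + 1} (%x. k (Complex x y))"
proof -
 have "(LBINT x. k (Complex x y)) = (LBINT x. indicator {X0 - 1..X1 + 1} x * k (Complex x y))"
 proof (rule Bochner_Integration.integral_cong[OF refl])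
  fix x show "k (Complex x y) = indicator {X0 - 1..X1 + 1} x * k (Complex x y)"
   using assms(2)[of "Complex x y"] by (cases "x : {X0..X1}") auto
 qed
 also have "... = integral {X0 - 1..X1 + 1} (%x. k (Complex x y))"
  by (rule LBINT_Icc[OF continuous_on_horocycle[OF assms(1,3)]])
 finally show ?thesis .
qed

lemma integrable_truncated_strip:
 fixes k :: "complex => real"
 assumes [measurable]: "k : borel_measurable borel" and k_support: "!!z. Re z \<notin> {X0..X1} ==> k z = 0" and M: "!!z. abs (k z) <= M" and y: "0 < y1"
 shows "integrable lborel (%z. indicator {y1..1} (Im z) * (k z / Im z))"
proof (rule integrableI_bounded_set[where A="cbox (Complex X0 y1) (Complex X1 1)" and B="M / y1"])
 let ?K = "%z. indicator {y1..1} (Im z) * (k z / Im z)"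
 show "emeasure lborel (cbox (Complex X0 y1) (Complex X1 1)) < \<infinity>" by (rule emeasure_compact_finite) simp
 have M_nonneg: "M >= 0" using M[of 0] by linarith
 have "norm (?K z) <= M / y1" for z
 proof (cases "Im z : {y1..1}")
  case True
  hence "abs (k z) / Im z <= M / y1" using M[of z] y M_nonneg by (intro frac_le) auto
  thus ?thesis using True y by simp
 qed (use M_nonneg y in simp)
 thus "AE z in lborel. z : cbox (Complex X0 y1) (Complex X1 1) --> norm (?K z) <= M / y1" by simp
 have "?K z = 0" if "z \<notin> cbox (Complex X0 y1) (Complex X1 1)" for z
  using that k_support[of z] by (auto simp: in_cbox_complex_iff indicator_def)
 thus "AE z in lborel. z \<notin> cbox (Complex X0 y1) (Complex X1 1) --> ?K z = 0" by simp
qed auto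

lemma integral_hyp_truncated_strip:
 fixes k :: "complex => real"
 assumes k [measurable]: "k : borel_measurable borel" and k_continuous: "continuous_on UHP k"
  and k_support: "!!z. Re z \<notin> {X0..X1} ==> k z = 0" and M: "!!z. abs (k z) <= M" and y: "0 < y1"
 shows "(LINT z|hyp_measure. indicator {y1..1} (Im z) * Im z * k z)
  = integral {y1..1} (%w. 1 / w * integral {X0 - 1..X1 + 1} (%x. k (Complex x w)))"
proof -
 let ?I = "%w. integral {X0 - 1..X1 + 1} (%x. k (Complex x w))"
 have int: "integrable lborel (%z. indicator {y1..1} (Im z) * (k z / Im z))"
  by (rule integrable_truncated_strip[OF k k_support M y])
 have "(LINT z|hyp_measure. indicator {y1..1} (Im z) * Im z * k z) = (LBINT z. indicator {y1..1} (Im z) * (k z / Im z))"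
  using y by (subst integral_hyp_lborel, measurable)
   (auto simp: indicator_def UHP_def power2_eq_square intro!: Bochner_Integration.integral_cong)
 also have "... = (LBINT w. LBINT x. indicator {y1..1} w * (k (Complex x w) / w))"
  unfolding integral_lborel_complex[OF int] by simp
 also have "... = (LBINT w. indicator {y1..1} w * (1 / w * ?I w))"
 proof (rule Bochner_Integration.integral_cong[OF refl])
  fix w
  have "(LBINT x. k (Complex x w)) = ?I w" if "w > 0" by (rule LBINT_horocycle[OF k_continuous k_support that])
  thus "(LBINT x. indicator {y1..1} w * (k (Complex x w) / w)) = indicator {y1..1} w * (1 / w * ?I w)"
   using y by (cases "w : {y1..1}") auto
 qed
 also have "... = integral {y1..1} (%w. 1 / w * ?I w)"
 proof (rule LBINT_Icc)
  have "continuous_on ({0<..} \<times> cbox (X0 - 1) (X1 + 1)) (%(w, x). k (Complex x w))"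
   using continuous_on_Complex_swap[OF k_continuous] by (simp add: case_prod_unfold)
  from integral_continuous_on_param[OF this] have "continuous_on {y1..1} ?I"
   by (auto elim: continuous_on_subset simp: y less_le_trans[OF y])
  thus "continuous_on {y1..1} (%w. 1 / w * ?I w)" using y by (intro continuous_intros) auto
 qed
 finally show ?thesis .
qed

lemma deriv_integral_from:
 fixes P :: "real => complex"
 assumes y1: "0 < y1" and P: "continuous_on {y1..1} P" and y: "y : {y1..1}"
 shows "((%y. integral {y..1} (%w. of_real (1 / w) * P w)) has_vector_derivative - (of_real (1 / y) * P y)) (at y within {y1..1})"
proof -
 let ?g = "%w. of_real (1 / w) * P w"
 have cont: "continuous_on {y1..1} ?g" using y1 by (intro continuous_intros P) auto
 have same: "integral {x..1} ?g = integral {y1..1} ?g - integral {y1..x} ?g" if "x : {y1..1}" for x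
  using Henstock_Kurzweil_Integration.integral_combine[of y1 x 1 ?g] integrable_continuous_interval[OF cont] that
  by (simp add: algebra_simps)
 have "((%y. integral {y1..1} ?g - integral {y1..y} ?g) has_vector_derivative 0 - ?g y) (at y within {y1..1})"
  by (rule has_vector_derivative_diff[OF has_vector_derivative_const integral_has_vector_derivative[OF cont y]])
 from has_vector_derivative_transform[OF y same this] show ?thesis by simp
qed

lemma gronwall_derivative:
 fixes P E :: "real => complex"
 assumes y: "0 < y1" "y1 < 1" and k: "k >= 0" and e: "e >= 0"
  and E: "!!y. y : {y1..1} ==> (E has_vector_derivative of_real (k / y) * P y) (at y within {y1..1})"
  and P_approx: "!!y. y : {y1..1} ==> norm (P y - E y) <= e"
 shows "norm (of_real (y1 powr k) * E 1 - E y1) <= e"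
proof -
 let ?H = "%y. of_real (y powr (-k)) * E y"
 have "norm (?H 1 - ?H y1) <= (- e * 1 powr (-k)) - (- e * y1 powr (-k))"
 proof (rule differentiable_bound_general[OF y(2), where \<phi>="%y. - e * y powr (-k)" and \<phi>'="%y. e * k * y powr (-k - 1)"])
  have "continuous_on {y1..1} E"
   using E has_vector_derivative_continuous continuous_on_eq_continuous_within by blast
  thus "continuous_on {y1..1} ?H" using y by (intro continuous_intros) auto
  show "continuous_on {y1..1} (%y. - e * y powr (-k))" using y by (intro continuous_intros) auto
  fix x assume x: "y1 < x" "x < 1"
  have "at x within {y1..1} = at x" using x by (intro at_within_interior) auto
  hence "(E has_vector_derivative of_real (k / x) * P x) (at x)" using E[of x] x by simp
  moreover have "((%y. of_real (y powr (-k))) has_vector_derivative complex_of_real (- k * x powr (-k - 1))) (at x)"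
   unfolding has_vector_derivative_complex_iff using x y by (auto intro!: derivative_eq_intros)
  ultimately have "(?H has_vector_derivative of_real (x powr (-k)) * (of_real (k / x) * P x) + of_real (- k * x powr (-k - 1)) * E x) (at x)"
   by (intro has_vector_derivative_mult)
  also have "of_real (x powr (-k)) * (of_real (k / x) * P x) + of_real (- k * x powr (-k - 1)) * E x = of_real (k * x powr (-k - 1)) * (P x - E x)"
   using x y by (simp add: powr_diff algebra_simps diff_divide_distrib)
  finally show "(?H has_vector_derivative of_real (k * x powr (-k - 1)) * (P x - E x)) (at x)" .
  show "((%y. - e * y powr (-k)) has_vector_derivative e * k * x powr (-k - 1)) (at x)"
   unfolding has_real_derivative_iff_has_vector_derivative[symmetric] using x y by (auto intro!: derivative_eq_intros)
  have "k * x powr (-k - 1) * norm (P x - E x) <= k * x powr (-k - 1) * e" using P_approx[of x] x k by (intro mult_left_mono) auto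
  thus "norm (of_real (k * x powr (-k - 1)) * (P x - E x)) <= e * k * x powr (-k - 1)"
   using k by (simp add: norm_mult mult_ac)
 qed
 hence "y1 powr k * norm (?H 1 - ?H y1) <= y1 powr k * (e * (y1 powr (-k) - 1))"
  by (intro mult_left_mono) (simp_all add: algebra_simps)
 also have "... = e * (1 - y1 powr k)" using y by (simp add: algebra_simps powr_minus)
 also have "... <= e" using e by (simp add: algebra_simps)
 also have "y1 powr k * norm (?H 1 - ?H y1) = norm (of_real (y1 powr k) * (?H 1 - ?H y1))" by (simp add: norm_mult)
 also have "of_real (y1 powr k) * (?H 1 - ?H y1) = of_real (y1 powr k) * E 1 - of_real (y1 powr k * y1 powr (-k)) * E y1"
  by (simp add: algebra_simps)
 also have "y1 powr k * y1 powr (-k) = 1" using y by (simp add: powr_minus)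
 finally show ?thesis by simp
qed

lemma gronwall_logarithmic:
 fixes P :: "real => complex"
 assumes y: "0 < y1" "y1 <= 1" and k: "k >= 0" and e: "e >= 0" and P_cont: "continuous_on {y1..1} P"
  and P: "!!y. y1 <= y ==> y <= 1 ==> norm (P y - (c - of_real k * integral {y..1} (%w. of_real (1 / w) * P w))) <= e"
 shows "norm (P y1 - of_real (y1 powr k) * c) <= 2 * e"
proof (cases "y1 = 1")
 case True
 thus ?thesis using P[of 1] e by simp
next
 case False
 define E where "E = (%y. c - of_real k * integral {y..1} (%w. of_real (1 / w) * P w))"
 have "(E has_vector_derivative 0 - of_real k * (- (of_real (1 / x) * P x))) (at x within {y1..1})" if "x : {y1..1}" for x
  unfolding E_def
  by (rule has_vector_derivative_diff[OF has_vector_derivative_const has_vector_derivative_mult_right[OF deriv_integral_from[OF y(1) P_cont that]]])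
 hence "norm (of_real (y1 powr k) * E 1 - E y1) <= e"
  using False y P by (intro gronwall_derivative[of y1 k e E P] k e) (auto simp: E_def)
 moreover have "norm (P y1 - E y1) <= e" using P[of y1] y by (simp add: E_def)
 moreover have "E 1 = c" by (simp add: E_def)
 ultimately show ?thesis using norm_triangle_ineq4[of "P y1 - E y1" "of_real (y1 powr k) * c - E y1"] by simp
qed

lemma decorrelation_error_scaled:
 assumes \<xi>: "0 <= \<xi>" "\<xi> <= 1" and w: "0 < w" "w <= 1" and t: "\<xi>^2 * ln (1 / w) <= t" and \<epsilon>: "\<epsilon> >= 0" and K: "K >= 0"
 shows "\<xi>^2 * decorrelation_error \<epsilon> K \<xi> w <= (1 + t) * (\<epsilon> + K * sqrt \<xi>)"
proof -
 define T where "T = ln (1 / w)"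
 have T_nonneg: "T >= 0" using w by (simp add: T_def)
 have xi_T_le: "\<xi>^2 * T <= t" using t by (simp add: T_def)
 hence t_nonneg: "t >= 0" using T_nonneg order_trans[of 0 "\<xi>^2 * T" t] by simp
 have "\<xi>^2 <= 1" using \<xi> by (simp add: power_le_one)
 hence linear: "\<xi>^2 * (1 + T) <= 1 + t" using xi_T_le by (simp add: distrib_left)
 have "\<xi>^2 * (1 + \<xi> * T) = \<xi> * (\<xi> + \<xi>^2 * T)" by (simp add: power2_eq_square algebra_simps)
 also have "... <= \<xi> * (1 + t)" using \<xi> xi_T_le by (intro mult_left_mono add_mono) auto
 finally have cubic: "\<xi>^2 * (1 + \<xi> * T) <= \<xi> * (1 + t)" .
 have "\<xi>^2 * sqrt ((1 + T) * (1 + \<xi> * T)) = sqrt ((\<xi>^2 * (1 + T)) * (\<xi>^2 * (1 + \<xi> * T)))"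
  using \<xi> by (simp add: real_sqrt_mult power2_eq_square)
 also have "... <= sqrt ((1 + t) * (\<xi> * (1 + t)))"
  using T_nonneg \<xi> t_nonneg by (intro real_sqrt_le_mono mult_mono linear cubic) auto
 also have "... = (1 + t) * sqrt \<xi>" using t_nonneg by (simp add: real_sqrt_mult)
 finally have root: "\<xi>^2 * sqrt ((1 + T) * (1 + \<xi> * T)) <= (1 + t) * sqrt \<xi>" .
 have "\<xi>^2 * decorrelation_error \<epsilon> K \<xi> w = \<epsilon> * (\<xi>^2 * (1 + T)) + K * (\<xi>^2 * sqrt ((1 + T) * (1 + \<xi> * T)))"
  by (simp add: decorrelation_error_def T_def algebra_simps)
 also have "... <= \<epsilon> * (1 + t) + K * ((1 + t) * sqrt \<xi>)"
  using linear root \<epsilon> K by (intro add_mono mult_left_mono) auto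
 finally show ?thesis by (simp add: algebra_simps)
qed

definition (in cusp_primitive) mean_energy where "mean_energy = petersson_sq D f / hyp_vol D"

lemma (in cusp_primitive) mean_energy_nonneg: "mean_energy >= 0"
 using petersson_sq_nonneg by (simp add: mean_energy_def hyp_vol_eq)

context weighted_cusp_primitive
begin

definition energy_deviation where "energy_deviation z = petersson_density z - mean_energy"

lemma energy_deviation_measurable [measurable]: "energy_deviation : borel_measurable borel"
 unfolding energy_deviation_def[abs_def] by measurable

lemma energy_deviation_bound: "abs (energy_deviation z) <= B^2 + mean_energy"
 using petersson_density_bounds[of z] mean_energy_nonneg by (simp add: energy_deviation_def abs_le_iff)

lemma energy_deviation_invariant: "Gamma0_invariant q energy_deviation"
 using petersson_density_invariant by (simp add: Gamma0_invariant_def energy_deviation_def)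

lemma energy_deviation_mean_zero:
 assumes "hyp_vol D > 0"
 shows "(LINT z|hyp_measure. indicator D z * energy_deviation z) = 0"
proof -
 have "integrable hyp_measure (%z. indicator D z * petersson_density z)"
  by (rule integrable_D[of _ "B^2"]) (use petersson_density_bounds in auto)
 moreover have "integrable hyp_measure (%z. indicator D z * mean_energy)" by (rule integrable_D[of _ "abs mean_energy"]) auto
 ultimately have "(LINT z|hyp_measure. indicator D z * petersson_density z - indicator D z * mean_energy) = petersson_sq D f - mean_energy * hyp_vol D"
  by (simp add: petersson_sq_eq hyp_vol_eq)
 also have "... = 0" using assms by (simp add: mean_energy_def)
 finally show ?thesis by (simp add: energy_deviation_def right_diff_distrib)
qed

definition test_weight :: "(real => real) => real => complex => real" where
 "test_weight \<tau> \<xi> z = indicator UHP z * (\<psi> (Re z) * ((1 + \<tau> (\<xi> * F z)) / 2))"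

definition variation_rate where "variation_rate \<rho> = K' * (2 + abs \<rho>) + 2 * pi * B * (2 + abs \<rho>)^2"

lemma variation_rate_nonneg: "variation_rate \<rho> >= 0"
 unfolding variation_rate_def using K'_nonneg B_nonneg by (intro add_nonneg_nonneg mult_nonneg_nonneg) auto

definition contraction :: "(real => real) => bool" where
 "contraction \<tau> \<longleftrightarrow> (ALL x. abs (\<tau> x) <= 1) & (ALL x y. abs (\<tau> x - \<tau> y) <= abs (x - y))"

lemma contraction_continuous: "contraction \<tau> ==> continuous_on S \<tau>"
 by (rule lipschitz_on_continuous_on[of 1]) (simp add: contraction_def lipschitz_on_def dist_real_def)

lemma contraction_cos_sin_one: "contraction cos" "contraction sin" "contraction (%_. 1)"
proof -
 have "abs (cos x - cos y) <= abs (x - y) & abs (sin x - sin y) <= abs (x - y)" for x y :: real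
  using cis_lipschitz[of x y] abs_Re_le_cmod[of "cis x - cis y"] abs_Im_le_cmod[of "cis x - cis y"] by simp
 thus "contraction cos" "contraction sin" "contraction (%_. 1)" by (simp_all add: contraction_def)
qed

lemma test_weight_continuous:
 assumes "contraction \<tau>"
 shows "continuous_on UHP (test_weight \<tau> \<xi>)"
proof -
 have "continuous_on UHP (%z. \<psi> (Re z))"
  by (rule continuous_on_compose2[OF weight_continuous(1)[of UNIV]]) (auto intro!: continuous_intros)
 moreover have "continuous_on UHP (%z. \<tau> (\<xi> * F z))"
  by (rule continuous_on_compose2[OF contraction_continuous[OF assms, of UNIV]]) (auto intro!: continuous_intros F_continuous)
 ultimately have "continuous_on UHP (%z. \<psi> (Re z) * ((1 + \<tau> (\<xi> * F z)) / 2))" by (intro continuous_intros) auto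
 thus ?thesis by (rule continuous_on_eq) (simp add: test_weight_def)
qed

lemma test_weight_strip_weight:
 assumes \<tau>: "contraction \<tau>"
 shows "strip_weight X0 X1 (test_weight \<tau> \<xi>)"
 unfolding strip_weight_def
proof (intro conjI allI impI)
 have "(%z. indicator UHP z *\<^sub>R test_weight \<tau> \<xi> z) : borel_measurable borel"
  by (intro borel_measurable_continuous_on_indicator test_weight_continuous[OF \<tau>]) auto
 thus "test_weight \<tau> \<xi> : borel_measurable borel" by (simp add: test_weight_def[abs_def] flip: mult.assoc indicator_inter_arith)
 fix z
 have "abs (\<tau> (\<xi> * F z)) <= 1" using \<tau> by (simp add: contraction_def)
 hence half: "0 <= (1 + \<tau> (\<xi> * F z)) / 2" "(1 + \<tau> (\<xi> * F z)) / 2 <= 1" by (auto simp: abs_le_iff)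
 show "test_weight \<tau> \<xi> z >= 0" using half range[of "Re z"] by (simp add: test_weight_def)
 show "test_weight \<tau> \<xi> z <= 1"
  using half range[of "Re z"] mult_mono[of "\<psi> (Re z)" 1 "(1 + \<tau> (\<xi> * F z)) / 2" 1] by (simp add: test_weight_def indicator_def)
 show "test_weight \<tau> \<xi> z = 0" if "Re z \<notin> {X0..X1}" using support(1)[OF that] by (simp add: test_weight_def)
qed

lemma test_weight_slowly_varying:
 assumes \<tau>: "contraction \<tau>" and \<xi>: "\<xi> >= 0"
 shows "slowly_varying variation_rate \<xi> (test_weight \<tau> \<xi>)"
 unfolding slowly_varying_def
proof (intro allI impI ballI)
 fix \<rho> :: real and z w assume \<rho>: "\<rho> > 0" and z: "z : UHP" and w: "w : UHP" and near: "w : hyp_ball \<rho> z"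
 have pos: "Im z > 0" using z by (simp add: UHP_def)
 let ?T = "%z. (1 + \<tau> (\<xi> * F z)) / 2"
 have "abs (\<tau> (\<xi> * F z) - \<tau> (\<xi> * F w)) <= abs (\<xi> * F z - \<xi> * F w)" using \<tau> by (simp add: contraction_def)
 also have "... = \<xi> * abs (F z - F w)" using \<xi> by (simp add: abs_mult flip: right_diff_distrib)
 also have "... <= \<xi> * (2 * pi * B * (2 + \<rho>)^2)" using F_hyp_ball[OF z w \<rho> near] \<xi> by (rule mult_left_mono)
 finally have \<tau>_diff: "abs (\<tau> (\<xi> * F z) - \<tau> (\<xi> * F w)) <= \<xi> * (2 * pi * B * (2 + \<rho>)^2)" .
 have "abs (?T z - ?T w) = abs (\<tau> (\<xi> * F z) - \<tau> (\<xi> * F w)) / 2" by (simp add: field_simps flip: diff_divide_distrib)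
 also have "... <= abs (\<tau> (\<xi> * F z) - \<tau> (\<xi> * F w))" by simp
 finally have T_diff: "abs (?T z - ?T w) <= \<xi> * (2 * pi * B * (2 + \<rho>)^2)" using \<tau>_diff by (rule order_trans)
 have "abs (\<psi> (Re z) - \<psi> (Re w)) <= K' * abs (Re z - Re w)" by (rule weight_lipschitz)
 also have "... <= K' * ((2 + \<rho>) * Im z)" using hyp_ball_bounds(3)[OF near z w \<rho>] K'_nonneg by (rule mult_left_mono)
 finally have \<psi>: "abs (\<psi> (Re z) - \<psi> (Re w)) <= K' * ((2 + \<rho>) * Im z)" .
 have "test_weight \<tau> \<xi> z - test_weight \<tau> \<xi> w = (\<psi> (Re z) - \<psi> (Re w)) * ?T z + \<psi> (Re w) * (?T z - ?T w)"
  using z w by (simp add: test_weight_def field_simps)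
 hence "abs (test_weight \<tau> \<xi> z - test_weight \<tau> \<xi> w) <= abs (\<psi> (Re z) - \<psi> (Re w)) * abs (?T z) + abs (\<psi> (Re w)) * abs (?T z - ?T w)"
  by (simp only: abs_mult[symmetric] abs_triangle_ineq)
 also have "... <= (K' * ((2 + \<rho>) * Im z)) * 1 + 1 * (\<xi> * (2 * pi * B * (2 + \<rho>)^2))"
 proof (intro add_mono mult_mono \<psi> T_diff)
  have "abs (\<tau> (\<xi> * F z)) <= 1" using \<tau> by (simp add: contraction_def)
  thus "abs (?T z) <= 1" by (auto simp: abs_le_iff)
 qed (use range[of "Re w"] K'_nonneg \<rho> pos in auto)
 also have "... <= variation_rate \<rho> * (Im z + \<xi>)"
 proof -
  have "K' * (2 + \<rho>) * \<xi> >= 0" "2 * pi * B * (2 + \<rho>)^2 * Im z >= 0" using K'_nonneg \<rho> \<xi> B_nonneg pos by auto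
  thus ?thesis using \<rho> by (simp add: variation_rate_def algebra_simps)
 qed
 finally show "abs (test_weight \<tau> \<xi> z - test_weight \<tau> \<xi> w) <= variation_rate \<rho> * (Im z + \<xi>)" .
qed

lemma integrable_cutoff_deviation:
 assumes v: "strip_weight X0 X1 v" and y: "0 < y" "y <= 1"
 shows "integrable hyp_measure (%z. cutoff_weight y v z * energy_deviation z)"
proof (rule unfolding_real(1)[OF _ _ _ _ energy_deviation_measurable energy_deviation_bound energy_deviation_invariant])
 show "cutoff_weight y v : borel_measurable borel" using v by (intro cutoff_weight_measurable) (simp add: strip_weight_def)
 show "orbit_sum q (%z. ennreal (cutoff_weight y v z)) z <= ennreal (14 * (X1 - X0 + 1) * (1 + ln (1 / y)))" if "z : UHP" for z
  by (rule orbit_sum_cutoff_bound[OF v y X0_le_X1 that])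
qed (use cutoff_weight_nonneg[OF v y(1)] X0_le_X1 y in auto)

text \<open>The decorrelation estimate needs weights with values in \<open>[0,1]\<close>; \<open>\<psi> \<tau>(\<xi> F)\<close> is \<open>2 v\<^sub>\<tau> - v\<^sub>1\<close> for such weights.\<close>
lemma twisted_deviation_le:
 assumes E: "!!v. strip_weight X0 X1 v ==> slowly_varying variation_rate \<xi> v ==>
   abs (LINT z|hyp_measure. cutoff_weight y v z * energy_deviation z) <= E"
  and \<tau>: "contraction \<tau>" and \<xi>: "\<xi> >= 0" and y: "0 < y" "y <= 1"
 shows "abs (integral {y..1} (%w. 1 / w * integral window (%x. \<psi> x * (\<tau> (\<xi> * F (Complex x w)) * energy_deviation (Complex x w))))) <= 3 * E"
proof -
 let ?v = "test_weight \<tau> \<xi>" and ?v1 = "test_weight (%_. 1) \<xi>"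
 note v = test_weight_strip_weight[OF \<tau>, of \<xi>] and v1 = test_weight_strip_weight[OF contraction_cos_sin_one(3), of \<xi>]
 define k where "k z = 2 * (?v z * energy_deviation z) - ?v1 z * energy_deviation z" for z
 have k: "k z = indicator UHP z * (\<psi> (Re z) * (\<tau> (\<xi> * F z) * energy_deviation z))" for z
  by (simp add: k_def test_weight_def algebra_simps)
 have [measurable]: "?v : borel_measurable borel" "?v1 : borel_measurable borel" using v v1 by (auto simp: strip_weight_def)
 have k_measurable: "k : borel_measurable borel" unfolding k_def[abs_def] by measurable
 have k_continuous: "continuous_on UHP k"
  unfolding k_def[abs_def] energy_deviation_def
  by (intro continuous_intros test_weight_continuous \<tau> contraction_cos_sin_one petersson_density_continuous)
 have k_support: "k z = 0" if "Re z \<notin> {X0..X1}" for z using support(1)[OF that] by (simp add: k)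
 have k_bound: "abs (k z) <= B^2 + mean_energy" for z
 proof -
  have "abs (\<psi> (Re z)) * (abs (\<tau> (\<xi> * F z)) * abs (energy_deviation z)) <= 1 * (1 * (B^2 + mean_energy))"
   using range[of "Re z"] \<tau> energy_deviation_bound[of z] mean_energy_nonneg by (intro mult_mono) (auto simp: contraction_def)
  thus ?thesis using mean_energy_nonneg by (simp add: k abs_mult indicator_def)
 qed
 have "integral {y..1} (%w. 1 / w * integral window (%x. k (Complex x w))) = (LINT z|hyp_measure. indicator {y..1} (Im z) * Im z * k z)"
  by (rule integral_hyp_truncated_strip[OF k_measurable k_continuous k_support k_bound y(1), symmetric])
 also have "... = (LINT z|hyp_measure. 2 * (cutoff_weight y ?v z * energy_deviation z) - cutoff_weight y ?v1 z * energy_deviation z)"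
  by (intro Bochner_Integration.integral_cong) (auto simp: k_def cutoff_weight_def algebra_simps)
 also have "... = 2 * (LINT z|hyp_measure. cutoff_weight y ?v z * energy_deviation z) - (LINT z|hyp_measure. cutoff_weight y ?v1 z * energy_deviation z)"
  using integrable_cutoff_deviation[OF v y] integrable_cutoff_deviation[OF v1 y] by simp
 also have "abs ... <= 3 * E"
  using E[OF v test_weight_slowly_varying[OF \<tau> \<xi>]] E[OF v1 test_weight_slowly_varying[OF contraction_cos_sin_one(3) \<xi>]] by linarith
 also have "integral {y..1} (%w. 1 / w * integral window (%x. k (Complex x w)))
  = integral {y..1} (%w. 1 / w * integral window (%x. \<psi> x * (\<tau> (\<xi> * F (Complex x w)) * energy_deviation (Complex x w))))"
  using y by (intro integral_cong arg_cong2[where f="(*)"] refl) (auto simp: k UHP_def)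
 finally show ?thesis .
qed

lemma energy_average_minus_mean:
 assumes w: "w > 0"
 shows "energy_average \<xi> w - of_real mean_energy * phase_average \<xi> w
  = Complex (integral window (%x. \<psi> x * (cos (\<xi> * F (Complex x w)) * energy_deviation (Complex x w))))
    (integral window (%x. \<psi> x * (sin (\<xi> * F (Complex x w)) * energy_deviation (Complex x w))))" (is "?g = _")
proof -
 let ?k = "%x. of_real (\<psi> x) * (of_real (petersson_density (Complex x w)) * phase \<xi> (Complex x w)) - of_real mean_energy * (of_real (\<psi> x) * phase \<xi> (Complex x w))"
 have int: "(?k has_integral ?g) window"
  unfolding energy_average_def phase_average_def
  by (intro has_integral_diff has_integral_mult_right has_integral_horocycle_integral weight_continuous energy_continuous phase_continuous w)
 have "Re (?k x) = \<psi> x * (cos (\<xi> * F (Complex x w)) * energy_deviation (Complex x w))"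
  "Im (?k x) = \<psi> x * (sin (\<xi> * F (Complex x w)) * energy_deviation (Complex x w))" for x
  by (simp_all add: phase_def energy_deviation_def algebra_simps)
 thus ?thesis
  using has_integral_linear[OF int bounded_linear_Re] has_integral_linear[OF int bounded_linear_Im]
  by (simp add: o_def complex_eq_iff integral_unique)
qed

abbreviation energy_defect :: "real => real => complex" where
 "energy_defect \<xi> y == integral {y..1} (%w. of_real (1 / w) * (energy_average \<xi> w - of_real mean_energy * phase_average \<xi> w))"

lemma energy_decorrelation:
 assumes vol: "hyp_vol D > 0" and \<epsilon>: "\<epsilon> > 0"
 obtains K where "K >= 0" "!!\<xi> y. 0 <= \<xi> ==> \<xi> <= 1 ==> 0 < y ==> y <= 1 ==>
  norm (energy_defect \<xi> y)
   <= 6 * decorrelation_error \<epsilon> K \<xi> y"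
proof -
 obtain K where K: "K >= 0" and decorrelated: "!!\<xi> y v. 0 <= \<xi> ==> \<xi> <= 1 ==> 0 < y ==> y <= 1 ==>
   strip_weight X0 X1 v ==> slowly_varying variation_rate \<xi> v ==>
   abs (LINT z|hyp_measure. cutoff_weight y v z * energy_deviation z) <= decorrelation_error \<epsilon> K \<xi> y"
  by (rule decorrelation[OF energy_deviation_measurable energy_deviation_bound energy_deviation_invariant energy_deviation_mean_zero[OF vol]
    X0_le_X1 variation_rate_nonneg \<epsilon>]) (erule that)
 have "norm (energy_defect \<xi> y)
   <= 6 * decorrelation_error \<epsilon> K \<xi> y" (is "norm ?I <= _")
  if \<xi>: "0 <= \<xi>" "\<xi> <= 1" and y: "0 < y" "y <= 1" for \<xi> y
 proof -
  let ?part = "%\<tau> w. 1 / w * integral window (%x. \<psi> x * (\<tau> (\<xi> * F (Complex x w)) * energy_deviation (Complex x w)))"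
  have S: "{y..1} <= {0<..}" using y by auto
  have int: "(%w. of_real (1 / w) * (energy_average \<xi> w - of_real mean_energy * phase_average \<xi> w)) integrable_on {y..1}"
   using y by (intro integrable_continuous_interval continuous_intros averages_continuous S) auto
  have "Re (of_real (1 / w) * (energy_average \<xi> w - of_real mean_energy * phase_average \<xi> w)) = ?part cos w"
   "Im (of_real (1 / w) * (energy_average \<xi> w - of_real mean_energy * phase_average \<xi> w)) = ?part sin w" if "w : {y..1}" for w
   using that y by (simp_all only: energy_average_minus_mean atLeastAtMost_iff less_le_trans) simp_all
  hence components: "Re ?I = integral {y..1} (?part cos)" "Im ?I = integral {y..1} (?part sin)"
   unfolding integral_linear[OF int bounded_linear_Re, symmetric, unfolded o_def] integral_linear[OF int bounded_linear_Im, symmetric, unfolded o_def]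
   by (auto intro!: integral_cong)
  have "abs (integral {y..1} (?part \<tau>)) <= 3 * decorrelation_error \<epsilon> K \<xi> y" if "contraction \<tau>" for \<tau>
   by (rule twisted_deviation_le[OF decorrelated[OF \<xi> y] that \<xi>(1) y])
  from this[OF contraction_cos_sin_one(1)] this[OF contraction_cos_sin_one(2)]
  show ?thesis using cmod_le[of ?I] components by linarith
 qed
 with K show ?thesis by (rule that)
qed

lemma phase_average_decoupled:
 assumes \<xi>: "0 <= \<xi>" "\<xi> <= 1" and w: "0 < w" "w <= 1"
  and E: "norm (energy_defect \<xi> w) <= E"
 shows "norm (phase_average \<xi> w - (of_real (integral window \<psi>)
   - of_real (4 * pi^2 * \<xi>^2 * mean_energy) * integral {w..1} (%w. of_real (1 / w) * phase_average \<xi> w)))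
  <= \<xi> * expansion_const + 4 * pi^2 * \<xi>^2 * E"
proof -
 let ?c = "of_real (integral window \<psi>) :: complex" and ?\<kappa> = "of_real (4 * pi^2 * \<xi>^2) :: complex"
 let ?A = "integral {w..1} (%w. of_real (1 / w) * energy_average \<xi> w)" and ?P = "integral {w..1} (%w. of_real (1 / w) * phase_average \<xi> w)"
 let ?E = "energy_defect \<xi> w"
 have "(%w. of_real (1 / w) * energy_average \<xi> w) integrable_on {w..1}" "(%w. of_real (1 / w) * phase_average \<xi> w) integrable_on {w..1}"
  using w by (intro integrable_continuous_interval continuous_intros averages_continuous; force)+
 hence "((%w. of_real (1 / w) * energy_average \<xi> w - of_real mean_energy * (of_real (1 / w) * phase_average \<xi> w)) has_integral
   ?A - of_real mean_energy * ?P) {w..1}"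
  by (intro has_integral_diff has_integral_mult_right integrable_integral)
 hence "?E = ?A - of_real mean_energy * ?P" by (simp add: integral_unique algebra_simps)
 hence split: "?A = of_real mean_energy * ?P + ?E" by simp
 have "phase_average \<xi> w - (?c - of_real (4 * pi^2 * \<xi>^2 * mean_energy) * ?P) = (phase_average \<xi> w - (?c - ?\<kappa> * ?A)) - ?\<kappa> * ?E"
  unfolding split by (simp add: algebra_simps)
 also have "norm ... <= \<xi> * expansion_const + 4 * pi^2 * \<xi>^2 * E"
 proof (rule order_trans[OF norm_triangle_ineq4], rule add_mono)
  show "norm (phase_average \<xi> w - (?c - ?\<kappa> * ?A)) <= \<xi> * expansion_const" by (rule phase_average_integral_equation[OF w \<xi>])
  have "norm ?\<kappa> = 4 * pi^2 * \<xi>^2" by (simp add: norm_mult norm_power)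
  thus "norm (?\<kappa> * ?E) <= 4 * pi^2 * \<xi>^2 * E" unfolding norm_mult[of ?\<kappa>] using E by (intro mult_mono) auto
 qed
 finally show ?thesis .
qed

lemma phase_average_volterra:
 assumes \<xi>: "0 <= \<xi>" "\<xi> <= 1" and w: "0 < w" "w <= 1" and t: "\<xi>^2 * ln (1 / w) <= t" and \<delta>: "\<delta> >= 0" and K: "K >= 0"
  and decorrelated: "norm (energy_defect \<xi> w)
   <= 6 * decorrelation_error \<delta> K \<xi> w"
 shows "norm (phase_average \<xi> w - (of_real (integral window \<psi>)
   - of_real (4 * pi^2 * \<xi>^2 * mean_energy) * integral {w..1} (%w. of_real (1 / w) * phase_average \<xi> w)))
  <= \<xi> * expansion_const + 4 * pi^2 * 6 * (1 + t) * (\<delta> + K * sqrt \<xi>)"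
proof -
 have "4 * pi^2 * \<xi>^2 * (6 * decorrelation_error \<delta> K \<xi> w) = 4 * pi^2 * 6 * (\<xi>^2 * decorrelation_error \<delta> K \<xi> w)" by simp
 also have "... <= 4 * pi^2 * 6 * ((1 + t) * (\<delta> + K * sqrt \<xi>))"
  by (intro mult_left_mono decorrelation_error_scaled \<xi> w t \<delta> K) simp
 finally have "4 * pi^2 * \<xi>^2 * (6 * decorrelation_error \<delta> K \<xi> w) <= 4 * pi^2 * 6 * (1 + t) * (\<delta> + K * sqrt \<xi>)" by (simp only: mult.assoc)
 thus ?thesis using phase_average_decoupled[OF \<xi> w decorrelated] by linarith
qed

abbreviation damped_mean :: "real => complex" where
 "damped_mean \<tau> == of_real (integral window \<psi> * exp (- 4 * pi^2 * mean_energy * \<tau>))"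

lemma phase_average_limit:
 assumes vol: "hyp_vol D > 0" and \<epsilon>: "\<epsilon> > 0" and t: "t >= 0"
 obtains \<delta> where "\<delta> > 0" "!!\<xi> y. 0 <= \<xi> ==> \<xi> <= \<delta> ==> 0 < y ==> y <= 1 ==> \<xi>^2 * ln (1 / y) <= t ==>
  norm (phase_average \<xi> y - damped_mean (\<xi>^2 * ln (1 / y))) <= \<epsilon>"
proof -
 define c where "c = 4 * pi^2 * 6 * (1 + t)"
 have c: "c > 0" using t by (simp add: c_def)
 obtain K where K: "K >= 0" and decorrelated: "!!\<xi> y. 0 <= \<xi> ==> \<xi> <= 1 ==> 0 < y ==> y <= 1 ==>
   norm (energy_defect \<xi> y)
    <= 6 * decorrelation_error (\<epsilon> / (4 * c)) K \<xi> y"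
  using energy_decorrelation[OF vol, of "\<epsilon> / (4 * c)"] \<epsilon> c by auto
 have "isCont (%\<xi>. \<xi> * expansion_const + c * (\<epsilon> / (4 * c) + K * sqrt \<xi>)) 0" by (intro continuous_intros)
 from this[unfolded continuous_at_eps_delta, rule_format, of "\<epsilon> / 4"] obtain s where s: "s > 0" "!!\<xi>. abs \<xi> < s ==>
   abs (\<xi> * expansion_const + c * (\<epsilon> / (4 * c) + K * sqrt \<xi>) - c * (\<epsilon> / (4 * c))) < \<epsilon> / 4"
  using \<epsilon> by (auto simp: dist_real_def)
 have "norm (phase_average \<xi> y - damped_mean (\<xi>^2 * ln (1 / y))) <= \<epsilon>"
  if \<xi>: "0 <= \<xi>" "\<xi> <= min 1 (s / 2)" and y: "0 < y" "y <= 1" and ty: "\<xi>^2 * ln (1 / y) <= t" for \<xi> y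
 proof -
  define k where "k = 4 * pi^2 * \<xi>^2 * mean_energy"
  have "c * (\<epsilon> / (4 * c)) = \<epsilon> / 4" "abs \<xi> < s" using c s(1) \<xi> by simp_all
  hence small: "\<xi> * expansion_const + c * (\<epsilon> / (4 * c) + K * sqrt \<xi>) <= \<epsilon> / 2" using s(2)[of \<xi>] \<epsilon> by linarith
  have error: "norm (phase_average \<xi> w - (of_real (integral window \<psi>) - of_real k * integral {w..1} (%w. of_real (1 / w) * phase_average \<xi> w))) <= \<epsilon> / 2"
   if w: "y <= w" "w <= 1" for w
  proof -
   have w_pos: "0 < w" using w y by simp
   have "\<xi>^2 * ln (1 / w) <= \<xi>^2 * ln (1 / y)" using w y w_pos by (intro mult_left_mono) (auto simp: frac_le)
   hence "\<xi>^2 * ln (1 / w) <= t" using ty by linarith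
   have "0 <= \<epsilon> / (4 * c)" "\<xi> <= 1" using \<epsilon> c \<xi> by auto
   note volterra = phase_average_volterra[OF \<xi>(1) this(2) w_pos w(2) \<open>\<xi>^2 * ln (1 / w) <= t\<close> this(1) K decorrelated[OF \<xi>(1) this(2) w_pos w(2)], folded c_def k_def]
   show ?thesis by (rule order_trans[OF volterra small])
  qed
  have "norm (phase_average \<xi> y - of_real (y powr k) * of_real (integral window \<psi>)) <= 2 * (\<epsilon> / 2)"
   by (rule gronwall_logarithmic[OF y _ _ _ error])
    (use \<epsilon> y mean_energy_nonneg in \<open>auto intro!: averages_continuous simp: k_def\<close>)
  moreover have "y powr k = exp (- 4 * pi^2 * mean_energy * (\<xi>^2 * ln (1 / y)))"
   using y by (simp add: powr_def k_def ln_div mult_ac)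
  ultimately show ?thesis by (simp add: mult.commute)
 qed
 thus ?thesis using s by (intro that[of "min 1 (s / 2)"]) auto
qed

end

section \<open>Fractions in short intervals\<close>

definition num_count :: "real => real => nat => nat" where
 "num_count x y c = card {a::int. abs (real c * x - of_int a) <= real c * y}"

lemma abs_diff_of_int_le_iff: "abs (t - of_int a) <= d \<longleftrightarrow> t - d <= of_int a & of_int a <= t + d" for t d :: real
 by (auto simp: abs_le_iff)

lemma finite_close_integers: "finite {a::int. abs (t - of_int a) <= d}" for t d :: real
 unfolding abs_diff_of_int_le_iff by (rule finite_int_between)

definition block_pairs :: "nat => nat => real => real => nat => (nat \<times> int) set" where
 "block_pairs q c0 x y Q = (SIGMA j:{..<Q}. {a::int. abs (real (c0 + q * j) * x - of_int a) <= real (c0 + q * j) * y})"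

lemma card_block_pairs: "card (block_pairs q c0 x y Q) = (\<Sum>j<Q. num_count x y (c0 + q * j))"
 unfolding block_pairs_def num_count_def by (rule card_SigmaI) (auto intro: finite_close_integers)

definition block_form :: "int => nat => nat \<times> int => int" where
 "block_form p Q = (%(j, a). int j * p - a * int Q)"

lemma block_form_inj:
 assumes "coprime p (int Q)" "Q >= 1"
 shows "inj_on (block_form p Q) ({..<Q} \<times> UNIV)"
proof (rule inj_onI, clarsimp simp: block_form_def)
 fix j j' a a' assume j: "j < Q" "j' < Q" and "int j * p - a * int Q = int j' * p - a' * int Q"
 hence diff: "(int j - int j') * p = (a - a') * int Q" by (simp add: algebra_simps)
 hence "int Q dvd (int j - int j') * p" by simp
 hence dvd: "int Q dvd int j - int j'" using assms(1) by (metis coprime_commute coprime_dvd_mult_left_iff)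
 have "j = j'"
 proof (rule ccontr)
  assume "j ~= j'"
  hence "int Q <= abs (int j - int j')" using dvd dvd_imp_le_int[of "int j - int j'" "int Q"] by simp
  thus False using j by linarith
 qed
 with diff assms(2) show "j = j' & a = a'" by simp
qed

lemma block_form_surj:
 assumes "coprime p (int Q)" "Q >= 1"
 obtains j a where "j < Q" "m = block_form p Q (j, a)"
proof -
 obtain i where i: "[p * i = 1] (mod int Q)" using assms(1) cong_solve_coprime_int by blast
 define j where "j = nat ((i * m) mod int Q)"
 have j: "j < Q" "int j = (i * m) mod int Q" using assms(2) by (simp_all add: j_def nat_less_iff)
 have "[int j * p = (i * m) * p] (mod int Q)" unfolding j(2) by (simp add: cong_def mod_mult_left_eq)
 also have "(i * m) * p = (p * i) * m" by simp
 also have "[(p * i) * m = 1 * m] (mod int Q)" using i by (rule cong_mult) simp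
 finally obtain a where "int j * p - m = int Q * a" by (auto simp: cong_iff_dvd_diff dvd_def)
 hence "m = block_form p Q (j, a)" by (simp add: block_form_def algebra_simps)
 with j(1) show ?thesis by (rule that)
qed

lemma block_form_approx:
 assumes "abs (real q * x * real Q - of_int p) <= \<eta>" "j < Q"
 shows "abs ((real (c0 + q * j) * x - of_int a) * real Q - (real c0 * x * real Q + of_int (block_form p Q (j, a)))) <= \<eta> * real Q"
proof -
 have "(real (c0 + q * j) * x - of_int a) * real Q - (real c0 * x * real Q + of_int (block_form p Q (j, a))) = real j * (real q * x * real Q - of_int p)"
  by (simp add: block_form_def algebra_simps)
 also have "abs (...) = real j * abs (real q * x * real Q - of_int p)" by (simp add: abs_mult)
 also have "... <= real Q * \<eta>" using assms by (intro mult_mono) auto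
 finally show ?thesis by (simp add: mult.commute)
qed

lemma block_count_upper:
 assumes Q: "Q >= 1" and p: "coprime p (int Q)" and \<eta>: "abs (real q * x * real Q - of_int p) <= \<eta>" and y: "y >= 0"
 shows "real (\<Sum>j<Q. num_count x y (c0 + q * j)) <= 2 * real Q * (real c0 + real q * real Q) * y + 2 * real Q * \<eta> + 1"
proof -
 let ?w = "real c0 * x * real Q" and ?d = "(real c0 + real q * real Q) * y * real Q + \<eta> * real Q"
 let ?S = "{m::int. - ?w - ?d <= of_int m & of_int m <= - ?w + ?d}"
 have "block_form p Q ` block_pairs q c0 x y Q <= ?S"
 proof (clarsimp simp: block_pairs_def simp del: of_nat_add of_nat_mult)
  fix j a assume j: "j < Q" and le: "abs (real (c0 + q * j) * x - of_int a) <= real (c0 + q * j) * y"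
  have "abs ((real (c0 + q * j) * x - of_int a) * real Q) <= real (c0 + q * j) * y * real Q"
   using le Q by (simp add: abs_mult mult_right_mono)
  also have "... <= (real c0 + real q * real Q) * y * real Q" using j y by (intro mult_right_mono) (auto simp: mult_left_mono)
  finally have "abs (?w + of_int (block_form p Q (j, a))) <= ?d" using block_form_approx[OF \<eta> j, of c0 a] by linarith
  thus "- ?w - ?d <= of_int (block_form p Q (j, a)) & of_int (block_form p Q (j, a)) <= ?d - ?w" by (auto simp: abs_le_iff)
 qed
 moreover have "inj_on (block_form p Q) (block_pairs q c0 x y Q)"
  by (rule inj_on_subset[OF block_form_inj[OF p Q]]) (auto simp: block_pairs_def)
 ultimately have "card (block_pairs q c0 x y Q) <= card ?S" using card_inj_on_le finite_int_between by blast
 also have "real (card ?S) <= (- ?w + ?d) - (- ?w - ?d) + 1"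
  by (rule card_int_between_le) (use y \<eta> in \<open>auto intro: order_trans[OF abs_ge_zero]\<close>)
 finally show ?thesis unfolding card_block_pairs by (simp add: algebra_simps)
qed

lemma block_count_lower:
 assumes Q: "Q >= 1" and p: "coprime p (int Q)" and \<eta>: "abs (real q * x * real Q - of_int p) <= \<eta>" and y: "y >= 0"
 shows "real (\<Sum>j<Q. num_count x y (c0 + q * j)) >= 2 * real Q * real c0 * y - 2 * real Q * \<eta> - 1"
proof -
 let ?w = "real c0 * x * real Q" and ?d = "real c0 * y * real Q - \<eta> * real Q"
 let ?S = "{m::int. - ?w - ?d <= of_int m & of_int m <= - ?w + ?d}"
 have "?S <= block_form p Q ` block_pairs q c0 x y Q"
 proof
  fix m assume m: "m : ?S"
  obtain j a where ja: "j < Q" "m = block_form p Q (j, a)" using block_form_surj[OF p Q] .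
  have "abs (?w + of_int m) <= ?d" using m by (auto simp: abs_le_iff)
  hence "abs ((real (c0 + q * j) * x - of_int a) * real Q) <= real c0 * y * real Q" using block_form_approx[OF \<eta> ja(1), of c0 a] ja(2) by linarith
  hence "abs (real (c0 + q * j) * x - of_int a) * real Q <= real c0 * y * real Q" by (simp add: abs_mult)
  hence "abs (real (c0 + q * j) * x - of_int a) <= real c0 * y" using Q by simp
  also have "... <= real (c0 + q * j) * y" using y by (intro mult_right_mono) auto
  finally have "(j, a) : block_pairs q c0 x y Q" using ja(1) by (simp add: block_pairs_def)
  thus "m : block_form p Q ` block_pairs q c0 x y Q" using ja(2) by blast
 qed
 moreover have "finite (block_pairs q c0 x y Q)" unfolding block_pairs_def using finite_close_integers by blast
 ultimately have "card ?S <= card (block_pairs q c0 x y Q)" by (rule surj_card_le[rotated])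
 hence "real (card ?S) <= real (\<Sum>j<Q. num_count x y (c0 + q * j))" unfolding card_block_pairs by (rule of_nat_mono)
 moreover have "(- ?w + ?d) - (- ?w - ?d) - 1 <= real (card ?S)" by (rule card_int_between_ge)
 moreover have "(- ?w + ?d) - (- ?w - ?d) - 1 = 2 * real Q * real c0 * y - 2 * real Q * \<eta> - 1" by (simp add: algebra_simps)
 ultimately show ?thesis by linarith
qed

definition residue_class :: "nat => nat => nat => nat set" where
 "residue_class q r M = {c. 1 <= c & c <= M & c mod q = r}"

definition class_count :: "nat => nat => nat => real => real => real" where
 "class_count q r M y x = (\<Sum>c\<in>residue_class q r M. real (num_count x y c))"

lemma class_count_nonneg: "class_count q r M y x >= 0" by (simp add: class_count_def sum_nonneg)

lemma finite_residue_class [simp]: "finite (residue_class q r M)"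
 by (rule finite_subset[of _ "{..M}"]) (auto simp: residue_class_def)

lemma card_residue_class: "card (residue_class q r M) <= M"
proof -
 have "card (residue_class q r M) <= card {1..M}" by (rule card_mono) (auto simp: residue_class_def)
 thus ?thesis by simp
qed

definition expected_count :: "nat => nat => nat => real" where "expected_count q r M = (\<Sum>c\<in>residue_class q r M. 2 * real c)"

lemma expected_count_bound: "expected_count q r M <= 2 * (real M)^2" "expected_count q r M >= 0"
proof -
 have "expected_count q r M <= (\<Sum>c\<in>residue_class q r M. 2 * real M)" unfolding expected_count_def by (intro sum_mono) (auto simp: residue_class_def)
 also have "... = real (card (residue_class q r M)) * (2 * real M)" by simp
 also have "... <= real M * (2 * real M)" using card_residue_class[of q r M] by (intro mult_right_mono) auto
 finally show "expected_count q r M <= 2 * (real M)^2" by (simp add: power2_eq_square)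
 show "expected_count q r M >= 0" by (simp add: expected_count_def sum_nonneg)
qed

lemma residue_class_eq_image:
 assumes q: "q >= 1" and r: "1 <= r" "r <= q" "r mod q = r0"
 shows "residue_class q r0 M = (%j. r + q * j) ` {..<(if r <= M then (M - r) div q + 1 else 0)}"
proof (intro equalityI subsetI)
 fix c assume "c : residue_class q r0 M"
 hence c: "1 <= c" "c <= M" "c mod q = r mod q" using r by (auto simp: residue_class_def)
 have r_le_c: "r <= c"
 proof (cases "r = q")
  case True
  hence "q dvd c" using c by auto
  thus ?thesis using c True by (simp add: dvd_imp_le)
 next
  case False
  hence "r = c mod q" using c r by simp
  thus ?thesis by simp
 qed
 then obtain j where j: "c - r = q * j" using c(3) by (metis mod_eq_dvd_iff_nat dvd_def)
 have "q * j <= M - r" using j c by linarith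
 hence "j <= (M - r) div q" using q by (simp add: less_eq_div_iff_mult_less_eq mult.commute)
 moreover have "c = r + q * j" using j r_le_c by linarith
 ultimately show "c : (%j. r + q * j) ` {..<(if r <= M then (M - r) div q + 1 else 0)}" using r_le_c c by auto
next
 fix c assume "c : (%j. r + q * j) ` {..<(if r <= M then (M - r) div q + 1 else 0)}"
 then obtain j where j: "j < (if r <= M then (M - r) div q + 1 else 0)" "c = r + q * j" by blast
 have r_le_M: "r <= M" using j(1) by (cases "r <= M") auto
 hence "j <= (M - r) div q" using j(1) by simp
 hence "q * j <= M - r" using q by (simp add: less_eq_div_iff_mult_less_eq mult.commute)
 thus "c : residue_class q r0 M" using j(2) r_le_M r by (simp add: residue_class_def)
qed

lemma residue_class_progression:
 assumes q: "q >= 1" and r: "r < q"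
 obtains r' J where "1 <= r'" "r' <= q" "residue_class q r M = (%j. r' + q * j) ` {..<J}"
  "real q * real J <= real M + real q" "real q * real J >= real M - real q" "J <= M"
proof -
 define r' where "r' = (if r = 0 then q else r)"
 define J where "J = (if r' <= M then (M - r') div q + 1 else 0)"
 have r': "1 <= r'" "r' <= q" "r' mod q = r" using q r by (auto simp: r'_def)
 have "q * J <= M + q & M <= q * J + q & J <= M"
 proof (cases "r' <= M")
  case True
  have "q * ((M - r') div q) <= M - r'" "M - r' < q * ((M - r') div q) + q"
   using q mod_less_divisor[of q "M - r'"] mult_div_mod_eq[of q "M - r'"] by linarith+
  moreover have "q * J = q * ((M - r') div q) + q" "(M - r') div q <= M - r'" using True by (simp_all add: J_def)
  ultimately show ?thesis using True r'(1,2) unfolding J_def if_P[OF True] by linarith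
 qed (use r' in \<open>simp add: J_def\<close>)
 hence "real q * real J <= real M + real q" "real M <= real q * real J + real q" "J <= M"
  by (simp_all flip: of_nat_mult of_nat_add)
 with r' residue_class_eq_image[OF q r', of M] show ?thesis by (intro that) (auto simp: J_def)
qed

lemma sum_residue_class_progression:
 assumes "q >= 1" "residue_class q r M = (%j. r' + q * j) ` {..<J}"
 shows "(\<Sum>c\<in>residue_class q r M. h c) = (\<Sum>j<J. h (r' + q * j))"
proof -
 have "inj_on (%j. r' + q * j) {..<J}" using assms(1) by (intro inj_onI) simp
 thus ?thesis unfolding assms(2) by (simp add: sum.reindex)
qed

lemma expected_count_asymp:
 assumes q: "q >= 1" and r: "r < q"
 shows "abs (expected_count q r M - (real M)^2 / real q) <= 3 * real M + 2 * real q"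
proof -
 obtain r' J where r': "1 <= r'" "r' <= q" and eq: "residue_class q r M = (%j. r' + q * j) ` {..<J}"
  and J: "real q * real J <= real M + real q" "real q * real J >= real M - real q" "J <= M"
  using residue_class_progression[OF q r] by blast
 have "(\<Sum>j<J. 2 * real (r' + q * j)) = 2 * real r' * real J + real q * (real J * (real J - 1))"
  by (induction J) (simp_all add: algebra_simps)
 hence E: "expected_count q r M = 2 * real r' * real J + real q * (real J * (real J - 1))"
  unfolding expected_count_def sum_residue_class_progression[OF q eq] .
 define t where "t = real q * real J"
 have q_ge_one: "real q >= 1" using q by simp
 have "real q * expected_count q r M - (real M)^2 = (t - real M) * (t + real M) + t * (2 * real r' - real q)"
  unfolding E t_def by (simp add: power2_eq_square algebra_simps)
 also have "abs (...) <= abs (t - real M) * abs (t + real M) + abs t * abs (2 * real r' - real q)"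
  by (metis abs_mult abs_triangle_ineq)
 also have "... <= real q * (2 * real M + real q) + (real M + real q) * real q"
 proof (intro add_mono mult_mono)
  show "abs (t - real M) <= real q" using J by (auto simp: t_def abs_le_iff)
  have "t >= 0" by (simp add: t_def)
  thus "abs (t + real M) <= 2 * real M + real q" "abs t <= real M + real q" using J by (auto simp: t_def)
  show "abs (2 * real r' - real q) <= real q" using r' by (auto simp: abs_le_iff)
 qed auto
 also have "... = real q * (3 * real M + 2 * real q)" by (simp add: algebra_simps)
 finally have "abs (real q * expected_count q r M - (real M)^2) <= real q * (3 * real M + 2 * real q)" .
 moreover have "expected_count q r M - (real M)^2 / real q = (real q * expected_count q r M - (real M)^2) / real q" using q_ge_one by (simp add: field_simps)
 ultimately show ?thesis using q_ge_one by (simp add: abs_divide pos_divide_le_eq mult.commute)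
qed

lemma sum_lessThan_blocks:
 fixes h :: "nat => real"
 shows "sum h {..<n * Q + m} = (\<Sum>b<n. \<Sum>j<Q. h (b * Q + j)) + (\<Sum>j<m. h (n * Q + j))"
proof -
 have shift: "sum h {k..<k + l} = (\<Sum>j<l. h (k + j))" for k l
  using sum.shift_bounds_nat_ivl[of h 0 k l] by (simp add: add.commute lessThan_atLeast0)
 have "sum h {..<n * Q + m} = sum h {..<n * Q} + sum h {n * Q..<n * Q + m}"
  by (simp add: sum.atLeastLessThan_concat lessThan_atLeast0)
 also have "sum h {..<n * Q} = (\<Sum>b<n. sum h {b * Q..<b * Q + Q})" by (rule sum.nat_group[symmetric])
 finally show ?thesis by (simp only: shift)
qed

lemma abs_sum_blocks_diff_le:
 fixes u v :: "nat => real"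
 assumes uv: "!!j. u j >= 0" "!!j. v j >= 0" and m: "m <= Q"
  and block: "!!b. abs ((\<Sum>j<Q. u (b * Q + j)) - (\<Sum>j<Q. v (b * Q + j))) <= d"
  and last: "(\<Sum>j<Q. u (n * Q + j)) <= l" "(\<Sum>j<Q. v (n * Q + j)) <= l"
 shows "abs (sum u {..<n * Q + m} - sum v {..<n * Q + m}) <= real n * d + l"
proof -
 have "abs ((\<Sum>b<n. \<Sum>j<Q. u (b * Q + j)) - (\<Sum>b<n. \<Sum>j<Q. v (b * Q + j))) <= (\<Sum>b<n. d)"
  unfolding sum_subtractf[symmetric] by (rule order_trans[OF sum_abs sum_mono]) (use block in \<open>simp add: sum_subtractf\<close>)
 moreover have "0 <= (\<Sum>j<m. u (n * Q + j))" "0 <= (\<Sum>j<m. v (n * Q + j))" using uv by (auto intro: sum_nonneg)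
 moreover have "(\<Sum>j<m. u (n * Q + j)) <= (\<Sum>j<Q. u (n * Q + j))" "(\<Sum>j<m. v (n * Q + j)) <= (\<Sum>j<Q. v (n * Q + j))"
  using m uv by (intro sum_mono2; auto)+
 ultimately show ?thesis using last unfolding sum_lessThan_blocks[of u] sum_lessThan_blocks[of v] by simp
qed

lemma block_expected_bounds:
 fixes y :: real
 assumes "y >= 0"
 shows "2 * real Q * real c0 * y <= (\<Sum>j<Q. 2 * real (c0 + q * j) * y)"
  and "(\<Sum>j<Q. 2 * real (c0 + q * j) * y) <= 2 * real Q * (real c0 + real q * real Q) * y"
proof -
 have "real (card {..<Q}) * (2 * real c0 * y) <= (\<Sum>j<Q. 2 * real (c0 + q * j) * y)"
  by (rule sum_bounded_below) (use assms in \<open>auto intro!: mult_right_mono\<close>)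
 thus "2 * real Q * real c0 * y <= (\<Sum>j<Q. 2 * real (c0 + q * j) * y)" by (simp add: mult_ac)
 have "2 * real (c0 + q * j) * y <= 2 * (real c0 + real q * real Q) * y" if "j < Q" for j
  using that assms by (intro mult_right_mono) (auto simp: algebra_simps mult_right_mono)
 hence "(\<Sum>j<Q. 2 * real (c0 + q * j) * y) <= real (card {..<Q}) * (2 * (real c0 + real q * real Q) * y)"
  by (intro sum_bounded_above) auto
 thus "(\<Sum>j<Q. 2 * real (c0 + q * j) * y) <= 2 * real Q * (real c0 + real q * real Q) * y" by (simp add: mult_ac)
qed

lemma block_count_deviation:
 assumes "Q >= 1" "coprime p (int Q)" "abs (real q * x * real Q - of_int p) <= \<eta>" and y: "y >= 0"
 shows "abs ((\<Sum>j<Q. real (num_count x y (c0 + q * j))) - (\<Sum>j<Q. 2 * real (c0 + q * j) * y))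
  <= 2 * real q * (real Q)^2 * y + 2 * real Q * \<eta> + 1"
proof -
 have "2 * real Q * (real c0 + real q * real Q) * y - 2 * real Q * real c0 * y = 2 * real q * (real Q)^2 * y"
  by (simp add: algebra_simps power2_eq_square)
 thus ?thesis using block_count_upper[OF assms, of c0] block_count_lower[OF assms, of c0] block_expected_bounds[OF y, where Q=Q and q=q and ?c0.0=c0]
  unfolding of_nat_sum by linarith
qed

lemma class_count_approx:
 assumes q: "q >= 1" and r: "r < q" and Q: "Q >= 1" and p: "coprime p (int Q)"
  and \<eta>: "abs (real q * x * real Q - of_int p) <= \<eta>" and y: "y >= 0"
 shows "abs (class_count q r M y x - y * expected_count q r M)
  <= real M / real Q * (2 * real q * (real Q)^2 * y + 2 * real Q * \<eta> + 1)
   + (2 * real Q * (real M + 2 * real q + real q * real Q) * y + 2 * real Q * \<eta> + 1)"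
proof -
 obtain r' J where r': "1 <= r'" "r' <= q" and eq: "residue_class q r M = (%j. r' + q * j) ` {..<J}"
  and J: "real q * real J <= real M + real q" "real q * real J >= real M - real q" "J <= M"
  using residue_class_progression[OF q r] by blast
 let ?n = "J div Q" and ?m = "J mod Q"
 let ?start = "%b. r' + q * (b * Q)"
 let ?d = "2 * real q * (real Q)^2 * y + 2 * real Q * \<eta> + 1"
 let ?l = "2 * real Q * (real M + 2 * real q + real q * real Q) * y + 2 * real Q * \<eta> + 1"
 define u where "u j = real (num_count x y (r' + q * j))" for j
 define v where "v j = 2 * real (r' + q * j) * y" for j
 have shift: "r' + q * (b * Q + j) = ?start b + q * j" for b j by (simp add: algebra_simps)
 have \<eta>_nonneg: "real Q * \<eta> >= 0" using \<eta> by (intro mult_nonneg_nonneg) auto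
 have block: "abs ((\<Sum>j<Q. u (b * Q + j)) - (\<Sum>j<Q. v (b * Q + j))) <= ?d" for b
  using block_count_deviation[OF Q p \<eta> y, of "?start b"] by (simp only: u_def v_def shift)
 have "q * (?n * Q) <= q * J" by simp
 hence "real (q * (?n * Q)) <= real q * real J" unfolding of_nat_mult[symmetric] by (rule of_nat_mono)
 hence "real (?start ?n) <= real M + 2 * real q" using J(1) r'(2) unfolding of_nat_add by linarith
 hence "2 * real Q * (real (?start ?n) + real q * real Q) * y <= 2 * real Q * (real M + 2 * real q + real q * real Q) * y"
  using y by (intro mult_right_mono mult_left_mono) auto
 hence last: "(\<Sum>j<Q. u (?n * Q + j)) <= ?l" "(\<Sum>j<Q. v (?n * Q + j)) <= ?l"
  using block_count_upper[OF Q p \<eta> y, of "?start ?n"] block_expected_bounds(2)[OF y, where Q=Q and q=q and ?c0.0="?start ?n"] \<eta>_nonneg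
  unfolding u_def v_def shift of_nat_sum by linarith+
 have "class_count q r M y x = sum u {..<?n * Q + ?m}" "y * expected_count q r M = sum v {..<?n * Q + ?m}"
  unfolding class_count_def expected_count_def sum_residue_class_progression[OF q eq] u_def v_def
  by (simp_all add: sum_distrib_left mult_ac)
 moreover have "abs (sum u {..<?n * Q + ?m} - sum v {..<?n * Q + ?m}) <= real ?n * ?d + ?l"
  by (rule abs_sum_blocks_diff_le) (use Q y block last in \<open>auto simp: u_def[abs_def] v_def[abs_def] intro: less_imp_le\<close>)
 moreover have "real ?n * ?d <= real M / real Q * ?d"
 proof (rule mult_right_mono)
  have "real J / real Q <= real M / real Q" using J(3) by (intro divide_right_mono) auto
  thus "real ?n <= real M / real Q" using of_nat_div_le_of_nat[of J Q, where 'a=real] by linarith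
  show "?d >= 0" using y \<eta>_nonneg by (simp add: mult.assoc)
 qed
 ultimately show ?thesis by linarith
qed

lemma card_eq_sum_indicator:
 fixes s e x y :: real and c :: nat
 assumes c: "c >= 1" and x: "x : {s..e}"
 shows "real (card {a::int. T a & abs (real c * x - of_int a) <= real c * y})
  = (\<Sum>a | T a & real c * (s - y) <= of_int a & of_int a <= real c * (e + y). indicator {of_int a / real c - y..of_int a / real c + y} x)"
proof -
 let ?A = "{a::int. T a & real c * (s - y) <= of_int a & of_int a <= real c * (e + y)}"
 have c_pos: "real c > 0" using c by simp
 have "{a. T a & abs (real c * x - of_int a) <= real c * y} = {a\<in>?A. x : {of_int a / real c - y..of_int a / real c + y}}" (is "?L = ?R")
 proof (intro equalityI subsetI)
  fix a assume "a : ?L"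
  hence a: "T a" "real c * x - of_int a <= real c * y" "of_int a - real c * x <= real c * y" by (auto simp: abs_le_iff)
  have "real c * s <= real c * x" "real c * x <= real c * e" using x by (auto intro: mult_left_mono)
  hence "real c * (s - y) <= of_int a" "of_int a <= real c * (e + y)" using a by (auto simp: algebra_simps)
  moreover have "x : {of_int a / real c - y..of_int a / real c + y}" using a c_pos by (auto simp: field_simps)
  ultimately show "a : ?R" using a by simp
 next
  fix a assume "a : ?R"
  thus "a : ?L" using c_pos by (auto simp: field_simps abs_le_iff)
 qed
 thus ?thesis using finite_int_between_restrict(1) by (simp add: indicator_def sum.If_cases Int_def)
qed

lemma set_integral_sum:
 fixes g :: "'b => real => real"
 assumes "!!i. i : A ==> set_integrable M S (g i)"
 shows "set_integrable M S (%x. \<Sum>i\<in>A. g i x)" "(LINT x:S|M. \<Sum>i\<in>A. g i x) = (\<Sum>i\<in>A. LINT x:S|M. g i x)"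
 using assms unfolding set_integrable_def set_lebesgue_integral_def by (simp_all add: sum_distrib_left)

lemma set_integral_indicator_le:
 fixes S :: "real set"
 assumes "S : sets lborel" "emeasure lborel S < \<infinity>"
 shows "set_integrable lborel {s..e} (indicator S :: real => real)" "(LBINT x:{s..e}. indicator S x) <= measure lborel S"
proof -
 have int: "integrable lborel (indicator S :: real => real)" using assms by (rule integrable_real_indicator)
 have int': "integrable lborel (%x. indicator {s..e} x * indicator S x :: real)"
  using integrable_real_mult_indicator[OF _ int, of "{s..e}"] by (simp add: mult.commute)
 thus "set_integrable lborel {s..e} (indicator S :: real => real)" by (simp add: set_integrable_def)
 have "(LBINT x:{s..e}. indicator S x) <= (LBINT x. indicator S x :: real)"
  unfolding set_lebesgue_integral_def real_scaleR_def by (rule integral_mono[OF int' int]) (auto simp: indicator_def)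
 thus "(LBINT x:{s..e}. indicator S x) <= measure lborel S" by simp
qed

lemma set_integral_close_count:
 fixes s e y :: real and c :: nat
 assumes c: "c >= 1" and s_le_e: "s <= e" and y: "y >= 0"
 shows "set_integrable lborel {s..e} (%x. real (card {a::int. T a & abs (real c * x - of_int a) <= real c * y}))" (is ?integrable)
  and "(LBINT x:{s..e}. real (card {a::int. T a & abs (real c * x - of_int a) <= real c * y})) <= 2 * y * (real c * (e - s + 2 * y) + 1)" (is ?bound)
proof -
 let ?A = "{a::int. T a & real c * (s - y) <= of_int a & of_int a <= real c * (e + y)}"
 let ?B = "%a::int. {of_int a / real c - y..of_int a / real c + y}"
 let ?g = "%x. \<Sum>a\<in>?A. indicator (?B a) x :: real"
 have ball: "set_integrable lborel {s..e} (indicator (?B a) :: real => real)" "(LBINT x:{s..e}. indicator (?B a) x) <= 2 * y" for a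
  using set_integral_indicator_le[of "?B a" s e] y by (simp_all add: emeasure_lborel_Icc_eq)
 have same: "indicator {s..e} x *\<^sub>R real (card {a::int. T a & abs (real c * x - of_int a) <= real c * y}) = indicator {s..e} x *\<^sub>R ?g x" for x
  using card_eq_sum_indicator[OF c, of x s e T y] by (simp add: indicator_def)
 have "set_integrable lborel {s..e} ?g" by (rule set_integral_sum(1)) (rule ball)
 thus ?integrable unfolding set_integrable_def same .
 have "(LBINT x:{s..e}. real (card {a::int. T a & abs (real c * x - of_int a) <= real c * y})) = (LBINT x:{s..e}. ?g x)"
  unfolding set_lebesgue_integral_def same ..
 also have "... = (\<Sum>a\<in>?A. LBINT x:{s..e}. indicator (?B a) x)" by (rule set_integral_sum(2)) (rule ball)
 also have "... <= real (card ?A) * (2 * y)" by (rule sum_bounded_above) (rule ball)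
 also have "... <= (real c * (e + y) - real c * (s - y) + 1) * (2 * y)"
 proof (rule mult_right_mono[OF card_int_between_restrict_le])
  have "real c * (s - y) <= real c * (e + y)" using s_le_e y by (intro mult_left_mono) auto
  thus "real c * (s - y) <= real c * (e + y) + 1" by simp
 qed (use y in simp)
 finally show ?bound by (simp add: algebra_simps)
qed

lemma set_integral_num_count:
 assumes "c >= 1" and "s <= e" and "y >= 0"
 shows "set_integrable lborel {s..e} (%x. real (num_count x y c))"
  and "(LBINT x:{s..e}. real (num_count x y c)) <= 2 * y * (real c * (e - s + 2 * y) + 1)"
 using set_integral_close_count[OF assms, of "%_. True"] by (simp_all add: num_count_def)

lemma set_integral_class_count:
 assumes s_le_e: "s <= e" and y: "y >= 0"
 shows "set_integrable lborel {s..e} (class_count q r M y)"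
  and "(LBINT x:{s..e}. class_count q r M y x) <= y * expected_count q r M * (e - s) + 2 * y * (y * expected_count q r M) + 2 * y * real M"
proof -
 have pos: "c : residue_class q r M ==> c >= 1" for c by (simp add: residue_class_def)
 show "set_integrable lborel {s..e} (class_count q r M y)"
  unfolding class_count_def[abs_def] by (rule set_integral_sum(1)) (rule set_integral_num_count(1)[OF pos s_le_e y])
 have "(LBINT x:{s..e}. class_count q r M y x) = (\<Sum>c\<in>residue_class q r M. LBINT x:{s..e}. real (num_count x y c))"
  unfolding class_count_def by (rule set_integral_sum(2)) (rule set_integral_num_count(1)[OF pos s_le_e y])
 also have "... <= (\<Sum>c\<in>residue_class q r M. 2 * y * (real c * (e - s + 2 * y) + 1))"
  by (rule sum_mono) (rule set_integral_num_count(2)[OF pos s_le_e y])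
 also have "... = (\<Sum>c\<in>residue_class q r M. (y * (e - s + 2 * y)) * (2 * real c) + 2 * y)" by (rule sum.cong) (auto simp: algebra_simps)
 also have "... = y * expected_count q r M * (e - s + 2 * y) + 2 * y * real (card (residue_class q r M))"
  by (simp only: sum.distrib expected_count_def sum_distrib_left[symmetric]) (simp add: mult_ac)
 also have "... <= y * expected_count q r M * (e - s + 2 * y) + 2 * y * real M" using y card_residue_class[of q r M] by (simp add: mult_left_mono)
 finally show "(LBINT x:{s..e}. class_count q r M y x) <= y * expected_count q r M * (e - s) + 2 * y * (y * expected_count q r M) + 2 * y * real M"
  by (simp add: algebra_simps)
qed

definition near_fractions :: "nat => real => real => nat => nat => real set" where
 "near_fractions q s e N Q = (\<Union>p\<in>{p::int. real q * real Q * s - 1 <= of_int p & of_int p <= real q * real Q * e + 1}.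
  {of_int p / (real q * real Q) - 1 / (real q * real Q * real N)..of_int p / (real q * real Q) + 1 / (real q * real Q * real N)})"

definition rational_neighbourhoods :: "nat => real => real => nat => real => real set" where
 "rational_neighbourhoods q s e N b = (\<Union>Q\<in>{Q. 1 <= Q & real Q < b}. near_fractions q s e N Q)"

lemma finite_nats_below: "finite {Q::nat. 1 <= Q & real Q < b}"
 by (rule finite_subset[of _ "{..nat \<lceil>b\<rceil>}"]) (auto simp: le_nat_iff, linarith)

lemma near_fractions_borel: "near_fractions q s e N Q : sets lborel"
 unfolding near_fractions_def using finite_int_between by (intro sets.finite_UN) auto

lemma measure_near_fractions:
 assumes q: "q >= 1" and N: "N >= 1" and Q: "Q >= 1" and s_le_e: "s <= e"
 shows "measure lborel (near_fractions q s e N Q) <= (2 * (e - s) + 6) / real N"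
proof -
 let ?P = "{p::int. real q * real Q * s - 1 <= of_int p & of_int p <= real q * real Q * e + 1}"
 have qQ_ge_one: "real q * real Q >= 1" using q Q by (metis of_nat_mono of_nat_1 of_nat_mult mult_le_mono mult_1)
 have "measure lborel (near_fractions q s e N Q) <= (\<Sum>p\<in>?P. measure lborel
   {of_int p / (real q * real Q) - 1 / (real q * real Q * real N)..of_int p / (real q * real Q) + 1 / (real q * real Q * real N)})"
  unfolding near_fractions_def by (rule measure_UNION_le) (use finite_int_between in auto)
 also have "... = real (card ?P) * (2 / (real q * real Q * real N))" by simp
 also have "... <= (real q * real Q * (e - s) + 3) * (2 / (real q * real Q * real N))"
 proof (rule mult_right_mono)
  have "real q * real Q * s <= real q * real Q * e" using s_le_e by (intro mult_left_mono) auto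
  hence "real (card ?P) <= (real q * real Q * e + 1) - (real q * real Q * s - 1) + 1" by (intro card_int_between_le) simp
  thus "real (card ?P) <= real q * real Q * (e - s) + 3" by (simp add: algebra_simps)
 qed simp
 also have "... <= (real q * real Q * (e - s + 3)) * (2 / (real q * real Q * real N))"
  using qQ_ge_one by (intro mult_right_mono) (auto simp: algebra_simps)
 also have "... = (2 * (e - s) + 6) / real N" using qQ_ge_one N q Q by (simp add: field_simps)
 finally show ?thesis .
qed

lemma measure_rational_neighbourhoods:
 assumes q: "q >= 1" and N: "N >= 1" and b: "b >= 0" and s_le_e: "s <= e"
 shows "rational_neighbourhoods q s e N b : sets lborel" "emeasure lborel (rational_neighbourhoods q s e N b) < \<infinity>"
  "measure lborel (rational_neighbourhoods q s e N b) <= b * (2 * (e - s) + 6) / real N"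
proof -
 show "rational_neighbourhoods q s e N b : sets lborel"
  unfolding rational_neighbourhoods_def by (intro sets.finite_UN finite_nats_below near_fractions_borel)
 have "bounded (rational_neighbourhoods q s e N b)"
  unfolding rational_neighbourhoods_def near_fractions_def using finite_nats_below finite_int_between
  by (intro bounded_UN ballI bounded_closed_interval) auto
 thus "emeasure lborel (rational_neighbourhoods q s e N b) < \<infinity>" by (rule emeasure_bounded_finite)
 have "measure lborel (rational_neighbourhoods q s e N b) <= (\<Sum>Q\<in>{Q. 1 <= Q & real Q < b}. measure lborel (near_fractions q s e N Q))"
  unfolding rational_neighbourhoods_def by (rule measure_UNION_le[OF finite_nats_below near_fractions_borel])
 also have "... <= real (card {Q::nat. 1 <= Q & real Q < b}) * ((2 * (e - s) + 6) / real N)"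
  by (rule sum_bounded_above) (use measure_near_fractions[OF q N _ s_le_e] in auto)
 also have "... <= b * ((2 * (e - s) + 6) / real N)"
 proof (rule mult_right_mono)
  have "card {Q::nat. 1 <= Q & real Q < b} <= card {1..nat \<lfloor>b\<rfloor>}"
   by (rule card_mono) (auto simp: le_nat_floor)
  thus "real (card {Q::nat. 1 <= Q & real Q < b}) <= b" using b by simp linarith
 qed (use s_le_e in simp)
 finally show "measure lborel (rational_neighbourhoods q s e N b) <= b * (2 * (e - s) + 6) / real N" by simp
qed

lemma approximation_off_rational_neighbourhoods:
 assumes q: "q >= 1" and N: "N >= 1" and x: "x : {s..e}" and far: "x \<notin> rational_neighbourhoods q s e N b"
 obtains p Q where "Q >= 1" "Q <= N" "b <= real Q" "coprime p (int Q)" "abs (real q * x * real Q - of_int p) <= 1 / real N"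
proof -
 obtain h k where hk: "coprime h k" "0 < k" "k <= int N" "abs (of_int k * (real q * x) - of_int h) < 1 / real N"
  using Dirichlet_approx_coprime[of N "real q * x"] N by auto
 define Q where "Q = nat k"
 have Q: "k = int Q" "Q >= 1" "Q <= N" using hk by (auto simp: Q_def)
 have approx: "abs (real q * x * real Q - of_int h) <= 1 / real N" using hk(4) by (simp add: Q mult_ac)
 have "b <= real Q"
 proof (rule ccontr)
  assume small: "~ b <= real Q"
  have inverse_N_le: "1 / real N <= 1" using N by simp
  let ?qQ = "real q * real Q"
  have pos: "?qQ > 0" using q Q by simp
  have "?qQ * s <= ?qQ * x" "?qQ * x <= ?qQ * e" using x pos by (auto intro: mult_left_mono)
  moreover have close: "abs (?qQ * x - of_int h) <= 1 / real N" using approx by (simp add: mult_ac)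
  ultimately have range: "?qQ * s - 1 <= of_int h" "of_int h <= ?qQ * e + 1" using inverse_N_le by linarith+
  have "x - of_int h / ?qQ = (?qQ * x - of_int h) / ?qQ" using q Q by (simp add: diff_divide_distrib)
  hence "abs (x - of_int h / ?qQ) = abs (?qQ * x - of_int h) / ?qQ" using pos by (simp only: abs_divide abs_of_pos)
  also have "... <= (1 / real N) / ?qQ" using close pos by (intro divide_right_mono) auto
  also have "... = 1 / (?qQ * real N)" by (simp add: mult_ac)
  finally have "x : {of_int h / ?qQ - 1 / (?qQ * real N)..of_int h / ?qQ + 1 / (?qQ * real N)}" by (auto simp: abs_le_iff)
  hence "x : near_fractions q s e N Q" unfolding near_fractions_def using range by blast
  thus False using far small Q unfolding rational_neighbourhoods_def by auto
 qed
 with Q hk(1) approx show ?thesis by (intro that[of Q h]) auto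
qed

definition farey_error :: "nat => nat => real => nat => real => real" where
 "farey_error q M y N b = 2 * real q * real M * real N * y + 2 * real M / real N + real M / b
   + 2 * real N * (real M + 2 * real q + real q * real N) * y + 3"

lemma farey_error_nonneg: "y >= 0 ==> b > 0 ==> farey_error q M y N b >= 0"
 by (simp add: farey_error_def)

lemma class_count_approx_off_rational_neighbourhoods:
 assumes q: "q >= 1" and r: "r < q" and y: "y >= 0" and N: "N >= 1" and b: "b > 0"
  and x: "x : {s..e}" "x \<notin> rational_neighbourhoods q s e N b"
 shows "abs (class_count q r M y x - y * expected_count q r M) <= farey_error q M y N b"
proof -
 obtain p Q where Q: "Q >= 1" "Q <= N" "b <= real Q" and p: "coprime p (int Q)" "abs (real q * x * real Q - of_int p) <= 1 / real N"
  using approximation_off_rational_neighbourhoods[OF q N x] .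
 have "real M / real Q * (2 * real q * (real Q)^2 * y + 2 * real Q * (1 / real N) + 1)
  = 2 * real q * real M * real Q * y + 2 * real M / real N + real M / real Q"
  using Q N by (simp add: field_simps power2_eq_square)
 hence "abs (class_count q r M y x - y * expected_count q r M) <= 2 * real q * real M * real Q * y + 2 * real M / real N + real M / real Q
  + (2 * real Q * (real M + 2 * real q + real q * real Q) * y + 2 * real Q * (1 / real N) + 1)"
  using class_count_approx[OF q r Q(1) p y, of M] by simp
 moreover have "2 * real q * real M * real Q * y <= 2 * real q * real M * real N * y"
  using Q y by (intro mult_right_mono mult_left_mono) auto
 moreover have "real M / real Q <= real M / b" using Q b by (intro divide_left_mono) auto
 moreover have "2 * real Q * (real M + 2 * real q + real q * real Q) * y <= 2 * real N * (real M + 2 * real q + real q * real N) * y"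
  using Q y by (intro mult_right_mono mult_mono add_mono mult_left_mono) auto
 moreover have "2 * real Q * (1 / real N) <= 2" using Q N by (simp add: field_simps)
 ultimately show ?thesis unfolding farey_error_def by linarith
qed

text \<open>On the exceptional set the trivial lower bound \<open>\<nu> \<ge> 0\<close> suffices: since the total mass of \<open>\<nu>\<close> is known,
  the upper bound there comes for free.\<close>
lemma L1_distance_le:
 fixes \<nu> :: "real => real"
 assumes int: "set_integrable lborel {s..e} \<nu>" and \<nu>: "!!x. \<nu> x >= 0" and s_le_e: "s <= e" and A: "A >= 0" and E: "E >= 0"
  and total: "(LBINT x:{s..e}. \<nu> x) <= A * (e - s) + \<delta>"
  and close: "!!x. x : {s..e} ==> x \<notin> S ==> abs (\<nu> x - A) <= E"
  and S: "S : sets lborel" "emeasure lborel S < \<infinity>" "measure lborel S <= m"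
 shows "(LBINT x:{s..e}. abs (\<nu> x - A)) <= \<delta> + 2 * A * m + 2 * (e - s) * E"
proof -
 note const = borel_integrable_atLeastAtMost'[OF continuous_on_const, of s e]
 note ind = set_integral_indicator_le[OF S(1,2), of s e]
 have "abs (\<nu> x - A) <= \<nu> x + (2 * E - A) + 2 * A * indicator S x" if "x : {s..e}" for x
  using close[OF that] \<nu>[of x] A E by (cases "x : S") (auto simp: abs_le_iff)
 hence "(LBINT x:{s..e}. abs (\<nu> x - A)) <= (LBINT x:{s..e}. \<nu> x + (2 * E - A) + 2 * A * indicator S x)"
  by (intro set_integral_mono set_integrable_abs set_integral_diff(1) set_integral_add(1) set_integrable_mult_right int const ind)
 also have "... = (LBINT x:{s..e}. \<nu> x) + (e - s) * (2 * E - A) + 2 * A * (LBINT x:{s..e}. indicator S x)"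
  using s_le_e by (simp add: set_integral_add(2) int const ind set_integral_add(1) set_integrable_mult_right) (simp add: set_lebesgue_integral_def right_diff_distrib)
 also have "... <= (A * (e - s) + \<delta>) + (e - s) * (2 * E - A) + 2 * A * m"
  using total ind(2) S(3) A s_le_e by (intro add_mono mult_left_mono) auto
 finally show ?thesis by (simp add: algebra_simps)
qed

abbreviation class_count_L1_distance :: "nat => nat => nat => real => real => real => real" where
 "class_count_L1_distance q r M y s e == (LBINT x:{s..e}. abs (class_count q r M y x - y * expected_count q r M))"

lemma class_count_L1_explicit:
 assumes q: "q >= 1" and r: "r < q" and s_le_e: "s <= e" and y: "y >= 0" and N: "N >= 1" and b: "b > 0"
 shows "class_count_L1_distance q r M y s e
  <= (2 * y * (y * expected_count q r M) + 2 * y * real M) + 2 * (y * expected_count q r M) * (b * (2 * (e - s) + 6) / real N)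
   + 2 * (e - s) * farey_error q M y N b"
proof (rule L1_distance_le[where S="rational_neighbourhoods q s e N b"])
 show "(LBINT x:{s..e}. class_count q r M y x)
  <= y * expected_count q r M * (e - s) + (2 * y * (y * expected_count q r M) + 2 * y * real M)"
  using set_integral_class_count(2)[OF s_le_e y, of q r M] by simp
 show "abs (class_count q r M y x - y * expected_count q r M) <= farey_error q M y N b"
  if "x : {s..e}" "x \<notin> rational_neighbourhoods q s e N b" for x
  by (rule class_count_approx_off_rational_neighbourhoods[OF q r y N b that])
qed (use measure_rational_neighbourhoods[OF q N less_imp_le[OF b] s_le_e] set_integral_class_count(1)[OF s_le_e y] s_le_e y
   class_count_nonneg expected_count_bound farey_error_nonneg[OF y b] in auto)

definition farey_bound :: "nat => real => real => real => real => real" where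
 "farey_bound q L R \<eta> u = 4 * R^2 * u^2 + 2 * R * u + 4 * R * \<eta> * (2 * L + 6)
   + 2 * L * (2 * real q * (\<eta> + u) * R + 2 / \<eta> + 1 / \<eta>^2 + 2 * (\<eta> + u) * (1 + 2 * real q * u + real q * (\<eta> + u)) * R + 3)"

lemma class_count_L1_le_farey_bound:
 assumes q: "q >= 1" and r: "r < q" and s_le_e: "s <= e" and \<eta>: "\<eta> > 0" and R: "R >= 0" and M: "M >= 1" and m: "m <= M"
 shows "class_count_L1_distance q r m (R / (real M)^2) s e
  <= farey_bound q (e - s) R \<eta> (1 / real M)"
proof -
 define y u N where "y = R / (real M)^2" and "u = 1 / real M" and "N = nat \<lceil>\<eta> * real M\<rceil>"
 have M_pos: "real M > 0" and m_le_M: "real m <= real M" using M m by auto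
 have pos: "\<eta> * real M > 0" "u > 0" using \<eta> M_pos by (simp_all add: u_def)
 have N: "N >= 1" "\<eta> * real M <= real N" "real N <= \<eta> * real M + 1" using pos(1) unfolding N_def by linarith+
 have N_u_le: "real N * u <= \<eta> + u" using N(3) M_pos by (simp add: u_def field_simps)
 have y: "y >= 0" "y * real M = R * u" "y = R * u^2" using R M_pos by (simp_all add: y_def u_def power2_eq_square)
 have mu: "real m * u <= 1" using m_le_M M_pos by (simp add: u_def)
 have "y * expected_count q r m <= y * (2 * (real M)^2)"
  using expected_count_bound(1)[of q r m] m_le_M y by (intro mult_left_mono order_trans[OF expected_count_bound(1)]) auto
 hence E: "y * expected_count q r m <= 2 * R" using M_pos by (simp add: y_def)
 have "2 * y * (y * expected_count q r m) <= 2 * y * (2 * R)" using E y by (intro mult_left_mono) auto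
 hence mass: "2 * y * (y * expected_count q r m) <= 4 * R^2 * u^2" by (simp add: y(3) power2_eq_square)
 have ends: "2 * y * real m <= 2 * R * u" using mult_left_mono[OF m_le_M y(1)] y(2) by simp
 have "\<eta>^2 * real M / real N <= \<eta>" using mult_left_mono[OF N(2), of \<eta>] \<eta> N(1) by (simp add: pos_divide_le_eq power2_eq_square)
 hence "\<eta>^2 * real M * (2 * (e - s) + 6) / real N <= \<eta> * (2 * (e - s) + 6)"
  using s_le_e mult_right_mono[of "\<eta>^2 * real M / real N" \<eta> "2 * (e - s) + 6"] by (simp add: mult_ac)
 hence "2 * (y * expected_count q r m) * (\<eta>^2 * real M * (2 * (e - s) + 6) / real N) <= 2 * (2 * R) * (\<eta> * (2 * (e - s) + 6))"
  by (rule mult_mono[rotated]) (use E R \<eta> s_le_e y(1) in auto)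
 hence bad: "2 * (y * expected_count q r m) * (\<eta>^2 * real M * (2 * (e - s) + 6) / real N) <= 4 * R * \<eta> * (2 * (e - s) + 6)" by simp
 have "2 * real q * (real m * u) * (real N * u) * R <= 2 * real q * 1 * (\<eta> + u) * R"
  using mu N_u_le R \<eta> pos by (intro mult_right_mono mult_mono mult_left_mono) auto
 hence slope: "2 * real q * real m * real N * y <= 2 * real q * (\<eta> + u) * R" by (simp add: y(3) power2_eq_square mult_ac)
 have "2 * real m / real N <= 2 * real M / (\<eta> * real M)" using m_le_M N pos by (intro frac_le) auto
 hence short: "2 * real m / real N <= 2 / \<eta>" using M_pos by simp
 have "real m / (\<eta>^2 * real M) <= real M / (\<eta>^2 * real M)" using m_le_M pos \<eta> by (intro divide_right_mono) auto
 hence inverse: "real m / (\<eta>^2 * real M) <= 1 / \<eta>^2" using M_pos by simp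
 have "2 * (real N * u) * (real m * u + 2 * real q * u + real q * (real N * u)) * R <= 2 * (\<eta> + u) * (1 + 2 * real q * u + real q * (\<eta> + u)) * R"
  using mu N_u_le R \<eta> pos by (intro mult_right_mono mult_mono mult_left_mono add_mono) auto
 hence final_block: "2 * real N * (real m + 2 * real q + real q * real N) * y <= 2 * (\<eta> + u) * (1 + 2 * real q * u + real q * (\<eta> + u)) * R"
  by (simp add: y(3) power2_eq_square algebra_simps)
 have "(e - s) * farey_error q m y N (\<eta>^2 * real M) <= (e - s) * (2 * real q * (\<eta> + u) * R + 2 / \<eta> + 1 / \<eta>^2
   + 2 * (\<eta> + u) * (1 + 2 * real q * u + real q * (\<eta> + u)) * R + 3)"
  unfolding farey_error_def using slope short inverse final_block s_le_e by (intro mult_left_mono add_mono) auto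
 moreover have "\<eta>^2 * real M > 0" using \<eta> M_pos by simp
 ultimately show ?thesis
  using class_count_L1_explicit[OF q r s_le_e y(1) N(1), of "\<eta>^2 * real M" m] mass ends bad
  unfolding farey_bound_def y_def[symmetric] u_def[symmetric] by linarith
qed

text \<open>With \<open>R = 1 / \<eta>\<^sup>3\<close> every term of the limiting bound is \<open>O(\<eta> R)\<close>.\<close>
lemma farey_bound_limit:
 assumes L: "L >= 0" and \<epsilon>: "\<epsilon> > 0"
 obtains \<eta> R where "\<eta> > 0" "R >= 1" "\<forall>\<^sub>F M in sequentially. farey_bound q L R \<eta> (1 / real M) <= \<epsilon> * R"
proof -
 define c where "c = 4 * (2 * L + 6) + 2 * L * (4 * real q + 8)"
 have c: "c > 0" using L by (simp add: c_def add_pos_nonneg)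
 define \<eta> where "\<eta> = min 1 (\<epsilon> / (2 * c))"
 have \<eta>: "0 < \<eta>" "\<eta> <= 1" using \<epsilon> c by (auto simp: \<eta>_def)
 define R where "R = 1 / \<eta>^3"
 have R: "R >= 1" using \<eta> by (simp add: R_def power_le_one)
 have "(%M. farey_bound q L R \<eta> (1 / real M)) \<longlonglongrightarrow> farey_bound q L R \<eta> 0"
  unfolding farey_bound_def by (intro tendsto_intros lim_1_over_n) 
 moreover have "farey_bound q L R \<eta> 0 < \<epsilon> * R"
 proof -
  have powers: "2 / \<eta> + 1 / \<eta>^2 + 3 = (2 * \<eta>^2 + \<eta> + 3 * \<eta>^3) * R"
   using \<eta> by (simp add: R_def field_simps power2_eq_square power3_eq_cube)
  have small: "\<eta>^2 <= \<eta>" "\<eta>^3 <= \<eta>" using \<eta> power_decreasing[of 1 2 \<eta>] power_decreasing[of 1 3 \<eta>] by auto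
  have "2 * real q * \<eta> + 2 * \<eta>^2 + \<eta> + 2 * \<eta> * (1 + real q * \<eta>) + 3 * \<eta>^3 <= (4 * real q + 8) * \<eta>"
   using small mult_left_mono[OF small(1), of "real q"] by (simp add: algebra_simps power2_eq_square)
  hence "2 * L * (2 * real q * \<eta> + 2 * \<eta>^2 + \<eta> + 2 * \<eta> * (1 + real q * \<eta>) + 3 * \<eta>^3) <= 2 * L * ((4 * real q + 8) * \<eta>)"
   using L by (intro mult_left_mono) auto
  hence "4 * \<eta> * (2 * L + 6) + 2 * L * (2 * real q * \<eta> + 2 * \<eta>^2 + \<eta> + 2 * \<eta> * (1 + real q * \<eta>) + 3 * \<eta>^3) <= c * \<eta>"
   by (simp add: c_def algebra_simps)
  also have "... <= c * (\<epsilon> / (2 * c))" using c by (intro mult_left_mono) (auto simp: \<eta>_def)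
  also have "... < \<epsilon>" using c \<epsilon> by simp
  finally have "(4 * \<eta> * (2 * L + 6) + 2 * L * (2 * real q * \<eta> + 2 * \<eta>^2 + \<eta> + 2 * \<eta> * (1 + real q * \<eta>) + 3 * \<eta>^3)) * R < \<epsilon> * R"
   using R by simp
  moreover have "farey_bound q L R \<eta> 0 = 4 * R * \<eta> * (2 * L + 6)
    + 2 * L * (2 * real q * \<eta> * R + 2 * \<eta> * (1 + real q * \<eta>) * R + (2 / \<eta> + 1 / \<eta>^2 + 3))"
   by (simp add: farey_bound_def)
  ultimately show ?thesis unfolding powers by (simp add: algebra_simps)
 qed
 ultimately have "\<forall>\<^sub>F M in sequentially. farey_bound q L R \<eta> (1 / real M) <= \<epsilon> * R"
  by (auto dest!: order_tendstoD(2) elim!: eventually_mono)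
 with \<eta> R show ?thesis by (intro that)
qed

lemma class_count_L1:
 assumes q: "q >= 1" and s_le_e: "s <= e" and \<epsilon>: "\<epsilon> > 0"
 obtains R where "R >= 1" "\<forall>\<^sub>F M in sequentially. ALL r<q. ALL m<=M.
  class_count_L1_distance q r m (R / (real M)^2) s e <= \<epsilon> * R"
proof -
 obtain \<eta> R where \<eta>: "\<eta> > 0" and R: "R >= 1" and small: "\<forall>\<^sub>F M in sequentially. farey_bound q (e - s) R \<eta> (1 / real M) <= \<epsilon> * R"
  using farey_bound_limit[of "e - s" \<epsilon> q] s_le_e \<epsilon> by auto
 have "\<forall>\<^sub>F M in sequentially. ALL r<q. ALL m<=M.
  class_count_L1_distance q r m (R / (real M)^2) s e <= \<epsilon> * R"
  using small eventually_ge_at_top[of 1]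
 proof eventually_elim
  case (elim M)
  show ?case
  proof (intro allI impI)
   fix r m assume "r < q" "m <= M"
   from class_count_L1_le_farey_bound[OF q this(1) s_le_e \<eta> _ elim(2) this(2), of R] R
   show "class_count_L1_distance q r m (R / (real M)^2) s e <= \<epsilon> * R"
    using elim(1) by linarith
  qed
 qed
 with R show ?thesis by (rule that)
qed

section \<open>Reduced fractions\<close>

lemma prod_primes_dvd_iff:
 fixes g :: nat
 assumes "finite S" "!!p. p : S ==> prime p"
 shows "\<Prod>S dvd g \<longleftrightarrow> (ALL p:S. p dvd g)"
 using assms
proof (induction S rule: finite_induct)
 case (insert p S)
 have "coprime p (\<Prod>S)" using insert by (intro prod_coprime_right) (metis insertCI primes_coprime)
 hence "p * \<Prod>S dvd g \<longleftrightarrow> p dvd g & \<Prod>S dvd g" by (metis divides_mult dvd_mult_left dvd_mult_right)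
 thus ?case using insert by simp
qed simp

lemma sieve_identity:
 fixes g :: nat
 assumes "finite Z" "!!p. p : Z ==> prime p"
 shows "(\<Sum>S\<in>Pow Z. (-1) ^ card S * of_bool (\<Prod>S dvd g)) = (of_bool (ALL p:Z. ~ p dvd g) :: real)"
proof -
 have "(\<Prod>p\<in>Z. - of_bool (p dvd g) + 1) = (\<Sum>S\<in>Pow Z. (\<Prod>p\<in>S. - of_bool (p dvd g)) * (\<Prod>p\<in>Z - S. 1 :: real))"
  by (rule prod_add[OF assms(1)])
 also have "... = (\<Sum>S\<in>Pow Z. (-1) ^ card S * of_bool (\<Prod>S dvd g))"
 proof (rule sum.cong[OF refl])
  fix S assume "S : Pow Z"
  hence S: "finite S" "!!p. p : S ==> prime p" using assms finite_subset by auto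
  have "(\<Prod>p\<in>S. of_bool (p dvd g) :: real) = of_bool (\<Prod>S dvd g)"
   using prod_primes_dvd_iff[OF S, of g] S(1) by (cases "ALL p:S. p dvd g") (auto intro!: prod.neutral)
  thus "(\<Prod>p\<in>S. - of_bool (p dvd g)) * (\<Prod>p\<in>Z - S. 1) = (-1) ^ card S * (of_bool (\<Prod>S dvd g) :: real)"
   by (simp add: prod_uminus)
 qed
 also have "(\<Prod>p\<in>Z. - of_bool (p dvd g) + 1) = (of_bool (ALL p:Z. ~ p dvd g) :: real)"
  using assms(1) by (auto simp: of_bool_def)
 finally show ?thesis by simp
qed

lemma sieve_error:
 fixes n c z M :: nat
 assumes c: "1 <= c" "c <= M"
 shows "abs (of_bool (coprime n c) - of_bool (ALL p:{p. prime p & p <= z}. ~ p dvd gcd n c)) <= (\<Sum>k\<in>{z<..M}. of_bool (k dvd gcd n c) :: real)"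
proof (cases "coprime n c")
 case True
 hence "gcd n c = 1" by (rule coprime_imp_gcd_eq_1)
 hence "ALL p:{p. prime p & p <= z}. ~ p dvd gcd n c" using not_prime_unit by fastforce
 thus ?thesis using True by (simp only: of_bool_eq) (simp add: sum_nonneg)
next
 case False
 then obtain p where p: "prime p" "p dvd gcd n c" using prime_factor_nat coprime_iff_gcd_eq_1 by metis
 show ?thesis
 proof (cases "p <= z")
  case True
  hence "~ (ALL p:{p. prime p & p <= z}. ~ p dvd gcd n c)" using p by blast
  thus ?thesis using False by (simp only: of_bool_eq) (simp add: sum_nonneg)
 next
  case large: False
  have "p <= c" using p c by (auto dest: dvd_imp_le)
  hence "of_bool (p dvd gcd n c) <= (\<Sum>k\<in>{z<..M}. of_bool (k dvd gcd n c) :: real)" using large c by (intro member_le_sum) auto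
  thus ?thesis using False p by (auto simp: of_bool_def)
 qed
qed

definition gcd_class :: "nat => nat => nat => nat set" where
 "gcd_class q d M = {c. 1 <= c & c <= M & gcd c q = d}"

lemma finite_gcd_class [simp]: "finite (gcd_class q d M)"
 by (rule finite_subset[of _ "{..M}"]) (auto simp: gcd_class_def)

lemma card_gcd_class: "card (gcd_class q d M) <= M"
proof -
 have "card (gcd_class q d M) <= card {1..M}" by (rule card_mono) (auto simp: gcd_class_def)
 thus ?thesis by simp
qed

abbreviation close_numerators :: "real => real => nat => int set" where
 "close_numerators x y c == {a. abs (real c * x - of_int a) <= real c * y}"

definition coprime_num_count :: "real => real => nat => nat" where
 "coprime_num_count x y c = card {a::int. coprime a (int c) & abs (real c * x - of_int a) <= real c * y}"

definition reduced_count :: "nat => nat => nat => real => real => real" where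
 "reduced_count q d M y x = (\<Sum>c\<in>gcd_class q d M. real (coprime_num_count x y c))"

lemma card_multiples:
 assumes k: "k >= (1::nat)"
 shows "card {a\<in>close_numerators x y (k * c). int k dvd a} = num_count x y c"
proof -
 have k_pos: "real k > 0" using k by simp
 have scale: "abs (real (k * c) * x - of_int (int k * a)) <= real (k * c) * y \<longleftrightarrow> abs (real c * x - of_int a) <= real c * y" for a
 proof -
  have "real (k * c) * x - of_int (int k * a) = real k * (real c * x - of_int a)" by (simp add: algebra_simps)
  hence "abs (real (k * c) * x - of_int (int k * a)) = real k * abs (real c * x - of_int a)" using k_pos by (simp add: abs_mult)
  thus ?thesis using k_pos by (simp add: mult.assoc)
 qed
 have "{a\<in>close_numerators x y (k * c). int k dvd a} = (*) (int k) ` close_numerators x y c"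
  unfolding dvd_def using scale by auto
 moreover have "inj_on ((*) (int k)) A" for A using k by (auto simp: inj_on_def)
 ultimately show ?thesis unfolding num_count_def by (simp add: card_image)
qed

lemma sum_multiples:
 fixes g :: "nat => real"
 assumes k: "k >= 1"
 shows "(\<Sum>c | 1 <= c & c <= M & P c & k dvd c. g c) = (\<Sum>c | 1 <= c & c <= M div k & P (k * c). g (k * c))"
proof -
 have "{c. 1 <= c & c <= M & P c & k dvd c} = (*) k ` {c. 1 <= c & c <= M div k & P (k * c)}" (is "?A = ?B")
 proof (intro equalityI subsetI)
  fix c assume "c : ?A"
  then obtain j where j: "c = k * j" "1 <= c" "c <= M" "P c" by (auto simp: dvd_def)
  thus "c : ?B" using k by (auto simp: less_eq_div_iff_mult_less_eq mult.commute intro!: image_eqI[of _ _ j] Suc_leI)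
 next
  fix c assume "c : ?B"
  then obtain j where "c = k * j" "1 <= j" "j <= M div k" "P (k * j)" by auto
  thus "c : ?A" using k by (auto simp: less_eq_div_iff_mult_less_eq mult.commute)
 qed
 moreover have "inj_on ((*) k) A" for A using k by (auto simp: inj_on_def)
 ultimately show ?thesis by (simp add: sum.reindex)
qed

definition sieve_residues :: "nat => nat => nat => nat set" where "sieve_residues q d k = {r. r < q & gcd (k * r) q = d}"

lemma finite_sieve_residues [simp]: "finite (sieve_residues q d k)" and card_sieve_residues: "card (sieve_residues q d k) <= q"
proof -
 have "sieve_residues q d k <= {..<q}" by (auto simp: sieve_residues_def)
 thus "finite (sieve_residues q d k)" "card (sieve_residues q d k) <= q"
  using finite_subset card_mono[of "{..<q}"] by auto
qed

lemma sum_common_divisor: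
 assumes q: "q >= 1" and k: "k >= 1"
 shows "(\<Sum>c\<in>gcd_class q d M. \<Sum>a\<in>close_numerators x y c. of_bool (k dvd gcd (nat \<bar>a\<bar>) c)) = (\<Sum>r\<in>sieve_residues q d k. class_count q r (M div k) y x)"
proof -
 have dvd: "k dvd gcd (nat \<bar>a\<bar>) c \<longleftrightarrow> k dvd c & int k dvd a" for a c
  unfolding gcd_greatest_iff dvd_nat_abs_iff by blast
 have inner: "(\<Sum>a\<in>close_numerators x y c. of_bool (k dvd gcd (nat \<bar>a\<bar>) c)) = (if k dvd c then real (card {a\<in>close_numerators x y c. int k dvd a}) else 0)" for c
  using finite_close_integers[of "real c * x" "real c * y"] by (simp add: dvd of_bool_def sum.If_cases Int_def del: gcd_nat_abs_left_eq)
 have "(\<Sum>c\<in>gcd_class q d M. \<Sum>a\<in>close_numerators x y c. of_bool (k dvd gcd (nat \<bar>a\<bar>) c))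
   = (\<Sum>c\<in>{c\<in>gcd_class q d M. k dvd c}. real (card {a\<in>close_numerators x y c. int k dvd a}))"
  unfolding inner by (rule sum.inter_filter[symmetric]) simp
 also have "{c\<in>gcd_class q d M. k dvd c} = {c. 1 <= c & c <= M & gcd c q = d & k dvd c}" by (auto simp: gcd_class_def)
 also have "(\<Sum>c\<in>\<dots>. real (card {a\<in>close_numerators x y c. int k dvd a}))
   = (\<Sum>c | 1 <= c & c <= M div k & gcd (k * c) q = d. real (num_count x y c))"
  unfolding sum_multiples[OF k] card_multiples[OF k] ..
 also have "{c. 1 <= c & c <= M div k & gcd (k * c) q = d} = (\<Union>r\<in>sieve_residues q d k. residue_class q r (M div k))"
 proof -
  have "gcd (k * c) q = gcd (k * (c mod q)) q" for c by (metis gcd.commute gcd_red_nat mod_mult_right_eq)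
  thus ?thesis using q by (auto simp: sieve_residues_def residue_class_def)
 qed
 also have "(\<Sum>c\<in>\<dots>. real (num_count x y c)) = (\<Sum>r\<in>sieve_residues q d k. class_count q r (M div k) y x)"
  unfolding class_count_def by (rule sum.UNION_disjoint) (auto simp: residue_class_def)
 finally show ?thesis .
qed

lemma sum_class_count_le:
 "(\<Sum>r\<in>sieve_residues q d k. class_count q r m y x) <= (\<Sum>c\<in>{1..m}. real (num_count x y c))"
proof -
 have "(\<Sum>r\<in>sieve_residues q d k. class_count q r m y x) = (\<Sum>c\<in>(\<Union>r\<in>sieve_residues q d k. residue_class q r m). real (num_count x y c))"
  unfolding class_count_def by (rule sum.UNION_disjoint[symmetric]) (auto simp: residue_class_def)
 also have "... <= (\<Sum>c\<in>{1..m}. real (num_count x y c))" by (rule sum_mono2) (auto simp: residue_class_def)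
 finally show ?thesis .
qed

abbreviation sieved_count :: "nat => nat => nat set => nat => real => real => real" where
 "sieved_count q d Z M y x == \<Sum>S\<in>Pow Z. (-1) ^ card S * (\<Sum>r\<in>sieve_residues q d (\<Prod>S). class_count q r (M div \<Prod>S) y x)"

lemma sieve_main_term:
 assumes q: "q >= 1" and Z: "finite Z" "Z <= {p. prime p}"
 shows "sieved_count q d Z M y x
  = (\<Sum>c\<in>gcd_class q d M. \<Sum>a\<in>close_numerators x y c. of_bool (ALL p:Z. ~ p dvd gcd (nat \<bar>a\<bar>) c))"
proof -
 have "\<Prod>S >= 1" if "S : Pow Z" for S
 proof -
  have "\<Prod>S > 0" using that Z(2) by (intro prod_pos) (auto simp: prime_gt_0_nat)
  thus ?thesis by simp
 qed
 hence "sieved_count q d Z M y x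
   = (\<Sum>S\<in>Pow Z. \<Sum>c\<in>gcd_class q d M. \<Sum>a\<in>close_numerators x y c. (-1) ^ card S * of_bool (\<Prod>S dvd gcd (nat \<bar>a\<bar>) c))"
  using sum_common_divisor[OF q, symmetric] by (intro sum.cong) (auto simp: sum_distrib_left)
 also have "... = (\<Sum>c\<in>gcd_class q d M. \<Sum>S\<in>Pow Z. \<Sum>a\<in>close_numerators x y c. (-1) ^ card S * of_bool (\<Prod>S dvd gcd (nat \<bar>a\<bar>) c))"
  by (rule sum.swap)
 also have "... = (\<Sum>c\<in>gcd_class q d M. \<Sum>a\<in>close_numerators x y c. \<Sum>S\<in>Pow Z. (-1) ^ card S * of_bool (\<Prod>S dvd gcd (nat \<bar>a\<bar>) c))"
  by (intro sum.cong refl) (rule sum.swap)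
 finally show ?thesis using sieve_identity[OF Z(1)] Z(2) by (auto simp: subset_iff intro!: sum.cong)
qed

definition tail_count :: "nat => nat => real => real => real" where
 "tail_count z M y x = (\<Sum>k\<in>{z<..M}. \<Sum>c\<in>{1..M div k}. real (num_count x y c))"

lemma reduced_count_sieve:
 assumes q: "q >= 1" and Z: "Z = {p. prime p & p <= z}"
 shows "abs (reduced_count q d M y x - sieved_count q d Z M y x) <= tail_count z M y x"
proof -
 have Z_primes: "finite Z" "Z <= {p. prime p}" unfolding Z by (auto intro: finite_subset[of _ "{..z}"])
 have count: "real (coprime_num_count x y c) = (\<Sum>a\<in>close_numerators x y c. of_bool (coprime (nat \<bar>a\<bar>) c))" for c
  unfolding coprime_num_count_def using finite_close_integers[of "real c * x" "real c * y"]
  by (simp add: of_bool_def sum.If_cases Int_def coprime_nat_abs_left_iff conj_commute)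
 have "abs (reduced_count q d M y x - (\<Sum>c\<in>gcd_class q d M. \<Sum>a\<in>close_numerators x y c. of_bool (ALL p:Z. ~ p dvd gcd (nat \<bar>a\<bar>) c)))
  <= (\<Sum>c\<in>gcd_class q d M. \<Sum>a\<in>close_numerators x y c. \<Sum>k\<in>{z<..M}. of_bool (k dvd gcd (nat \<bar>a\<bar>) c))"
  unfolding reduced_count_def count sum_subtractf[symmetric] Z
  by (intro order_trans[OF sum_abs] sum_mono sieve_error) (auto simp: gcd_class_def)
 also have "... = (\<Sum>c\<in>gcd_class q d M. \<Sum>k\<in>{z<..M}. \<Sum>a\<in>close_numerators x y c. of_bool (k dvd gcd (nat \<bar>a\<bar>) c))" by (intro sum.cong refl) (rule sum.swap)
 also have "... = (\<Sum>k\<in>{z<..M}. \<Sum>c\<in>gcd_class q d M. \<Sum>a\<in>close_numerators x y c. of_bool (k dvd gcd (nat \<bar>a\<bar>) c))" by (rule sum.swap)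
 also have "... <= tail_count z M y x" unfolding tail_count_def
 proof (rule sum_mono)
  fix k assume "k : {z<..M}"
  hence "k >= 1" by auto
  from sum_common_divisor[OF q this] sum_class_count_le
  show "(\<Sum>c\<in>gcd_class q d M. \<Sum>a\<in>close_numerators x y c. of_bool (k dvd gcd (nat \<bar>a\<bar>) c)) <= (\<Sum>c\<in>{1..M div k}. real (num_count x y c))"
   by (rule ord_eq_le_trans)
 qed
 finally show ?thesis unfolding sieve_main_term[OF q Z_primes] .
qed

lemma sum_inverse_squares_tail:
 assumes "z >= 1"
 shows "(\<Sum>k\<in>{z<..M}. 1 / (real k)^2) <= 1 / real z"
proof (cases "z <= M")
 case True
 have "(\<Sum>k\<in>{z<..M}. 1 / (real k)^2) <= 1 / real z - 1 / real M"
  using True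
 proof (induction M rule: dec_induct)
  case (step n)
  have pos: "n >= 1" using step assms by simp
  have "{z<..Suc n} = insert (Suc n) {z<..n}" using step by auto
  hence "(\<Sum>k\<in>{z<..Suc n}. 1 / (real k)^2) = (\<Sum>k\<in>{z<..n}. 1 / (real k)^2) + 1 / (real (Suc n))^2" by simp
  also have "1 / (real (Suc n))^2 <= 1 / real n - 1 / real (Suc n)"
  proof -
   have "1 / real n - 1 / real (Suc n) = 1 / (real n * real (Suc n))" using pos by (simp add: field_simps)
   moreover have "1 / (real (Suc n))^2 <= 1 / (real n * real (Suc n))"
    unfolding power2_eq_square using pos by (intro divide_left_mono mult_right_mono) auto
   ultimately show ?thesis by linarith
  qed
  finally show ?case using step by linarith
 qed (simp add: sum_nonneg)
 thus ?thesis by (smt (verit) divide_nonneg_nonneg of_nat_0_le_iff)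
qed simp

lemma expected_count_div:
 assumes q: "q >= 1" and r: "r < q" and k: "k >= 1" and M: "M >= 1"
 shows "abs (expected_count q r (M div k) - (real M / real k)^2 / real q) <= (5 + 2 * real q) * real M"
proof -
 let ?m = "real (M div k)" and ?t = "real M / real k"
 have m: "?m <= real M" "?m <= ?t" "?t - 1 <= ?m"
  using of_nat_div_le_of_nat[of M k] floor_correct[of ?t] by (simp_all add: floor_divide_of_nat_eq)
 have t: "?t <= real M" using k by (simp add: divide_le_eq mult_le_cancel_left1)
 have "?m^2 - ?t^2 = (?m - ?t) * (?m + ?t)" by (simp add: power2_eq_square algebra_simps)
 also have "abs (...) <= 1 * (2 * real M)" unfolding abs_mult using m t by (intro mult_mono) (auto simp: abs_le_iff)
 finally have "abs (?m^2 - ?t^2) <= 2 * real M" by simp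
 moreover have "abs (?m^2 / real q - ?t^2 / real q) = abs (?m^2 - ?t^2) / real q"
  by (simp add: diff_divide_distrib[symmetric] abs_divide)
 moreover have "abs (?m^2 - ?t^2) / real q <= abs (?m^2 - ?t^2)" using q by (simp add: divide_le_eq mult_le_cancel_left1)
 moreover have "real q <= real q * real M" using M mult_left_mono[of 1 "real M" "real q"] by simp
 moreover have "(5 + 2 * real q) * real M = 5 * real M + 2 * (real q * real M)" by (simp add: algebra_simps)
 ultimately show ?thesis using expected_count_asymp[OF q r, of "M div k"] m(1) by linarith
qed

lemma expected_count_div_scaled:
 assumes "q >= 1" "r < q" "k >= 1" "M >= 1" and R: "R >= 0"
 shows "abs (R / (real M)^2 * expected_count q r (M div k) - R / (real q * (real k)^2)) <= R * (5 + 2 * real q) / real M"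
proof -
 let ?y = "R / (real M)^2"
 have "abs (?y * expected_count q r (M div k) - ?y * ((real M / real k)^2 / real q)) = ?y * abs (expected_count q r (M div k) - (real M / real k)^2 / real q)"
  using R by (simp only: right_diff_distrib[symmetric] abs_mult abs_of_nonneg divide_nonneg_nonneg zero_le_power2)
 also have "... <= ?y * ((5 + 2 * real q) * real M)"
  using R by (intro mult_left_mono expected_count_div assms) auto
 finally show ?thesis using assms by (simp add: power2_eq_square field_simps)
qed

lemma set_integral_num_count_le:
 assumes "c : {1..m}" and s_le_e: "s <= e" and y: "0 <= y" "y <= 1"
 shows "(LBINT x:{s..e}. real (num_count x y c)) <= 2 * y * (real m * (e - s + 3))"
proof -
 have "(LBINT x:{s..e}. real (num_count x y c)) <= 2 * y * (real c * (e - s + 2 * y) + 1)"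
  using assms by (intro set_integral_num_count(2)) auto
 also have "... <= 2 * y * (real m * (e - s + 3))"
 proof (rule mult_left_mono)
  have "real c * (e - s + 2 * y) <= real m * (e - s + 2)" using assms by (intro mult_mono) auto
  moreover have "1 <= real m" using assms by (auto intro: order_trans)
  ultimately show "real c * (e - s + 2 * y) + 1 <= real m * (e - s + 3)" by (simp add: algebra_simps)
 qed (use y in simp)
 finally show ?thesis .
qed

lemma set_integral_tail_count:
 assumes s_le_e: "s <= e" and y: "0 <= y" "y <= 1" and z: "z >= 1"
 shows "set_integrable lborel {s..e} (tail_count z M y)"
  and "(LBINT x:{s..e}. tail_count z M y x) <= 2 * (e - s + 3) / real z * (y * (real M)^2)"
proof -
 have int: "set_integrable lborel {s..e} (%x. real (num_count x y c))" if "c : {1..m}" for c m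
  using that by (intro set_integral_num_count(1)[OF _ s_le_e y(1)]) simp
 show "set_integrable lborel {s..e} (tail_count z M y)"
  unfolding tail_count_def[abs_def] by (intro set_integral_sum(1)) (rule int)
 have "(LBINT x:{s..e}. tail_count z M y x) = (\<Sum>k\<in>{z<..M}. LBINT x:{s..e}. (\<Sum>c\<in>{1..M div k}. real (num_count x y c)))"
  unfolding tail_count_def by (rule set_integral_sum(2)) (rule set_integral_sum(1)[OF int])
 also have "... = (\<Sum>k\<in>{z<..M}. \<Sum>c\<in>{1..M div k}. LBINT x:{s..e}. real (num_count x y c))"
  by (intro sum.cong refl set_integral_sum(2)) (rule int)
 also have "... <= (\<Sum>k\<in>{z<..M}. (2 * (e - s + 3) * (y * (real M)^2)) * (1 / (real k)^2))"
 proof (rule sum_mono)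
  fix k
  have "(\<Sum>c\<in>{1..M div k}. LBINT x:{s..e}. real (num_count x y c)) <= (\<Sum>c\<in>{1..M div k}. 2 * y * (real (M div k) * (e - s + 3)))"
   by (intro sum_mono set_integral_num_count_le s_le_e y)
  also have "... = 2 * (e - s + 3) * y * (real (M div k))^2" by (simp add: power2_eq_square)
  also have "... <= 2 * (e - s + 3) * y * (real M / real k)^2"
   using y s_le_e by (intro mult_left_mono power_mono of_nat_div_le_of_nat) auto
  finally show "(\<Sum>c\<in>{1..M div k}. LBINT x:{s..e}. real (num_count x y c)) <= (2 * (e - s + 3) * (y * (real M)^2)) * (1 / (real k)^2)"
   by (simp add: power_divide)
 qed
 also have "... = (2 * (e - s + 3) * (y * (real M)^2)) * (\<Sum>k\<in>{z<..M}. 1 / (real k)^2)" by (rule sum_distrib_left[symmetric])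
 also have "... <= (2 * (e - s + 3) * (y * (real M)^2)) * (1 / real z)" using y s_le_e by (intro mult_left_mono sum_inverse_squares_tail z) auto
 finally show "(LBINT x:{s..e}. tail_count z M y x) <= 2 * (e - s + 3) / real z * (y * (real M)^2)" by simp
qed

lemma set_integrable_reduced_count:
 assumes "s <= e" "y >= 0"
 shows "set_integrable lborel {s..e} (reduced_count q d M y)"
 unfolding reduced_count_def[abs_def] coprime_num_count_def
 by (rule set_integral_sum(1)) (rule set_integral_close_count(1)[OF _ assms], simp add: gcd_class_def)

definition sieve_density :: "nat => nat => nat set => real" where
 "sieve_density q d Z = (\<Sum>S\<in>Pow Z. (-1) ^ card S * (\<Sum>r\<in>sieve_residues q d (\<Prod>S). 1 / (real q * (real (\<Prod>S))^2)))"

definition class_deviation :: "nat => nat => nat => real => nat => real => real" where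
 "class_deviation q M k R r x = abs (class_count q r (M div k) (R / (real M)^2) x - R / (real M)^2 * expected_count q r (M div k)) + R * (5 + 2 * real q) / real M"

lemma reduced_count_deviation:
 assumes q: "q >= 1" and Z: "Z = {p. prime p & p <= z}" and M: "M >= 1" and R: "R >= 0"
 shows "abs (reduced_count q d M (R / (real M)^2) x - sieve_density q d Z * R)
  <= (\<Sum>S\<in>Pow Z. \<Sum>r\<in>sieve_residues q d (\<Prod>S). class_deviation q M (\<Prod>S) R r x) + tail_count z M (R / (real M)^2) x"
proof -
 let ?y = "R / (real M)^2"
 have k: "\<Prod>S >= 1" if "S : Pow Z" for S
 proof -
  have "\<Prod>S > 0" using that Z by (intro prod_pos) (auto simp: prime_gt_0_nat)
  thus ?thesis by simp
 qed
 let ?main = "sieved_count q d Z M ?y x"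
 have split: "?main - sieve_density q d Z * R = (\<Sum>S\<in>Pow Z. (-1) ^ card S * (\<Sum>r\<in>sieve_residues q d (\<Prod>S). class_count q r (M div \<Prod>S) ?y x - R / (real q * (real (\<Prod>S))^2)))"
  unfolding sieve_density_def sum_distrib_right sum_subtractf[symmetric]
  by (intro sum.cong refl) (simp add: sum_subtractf right_diff_distrib)
 have main_deviation: "abs (?main - sieve_density q d Z * R) <= (\<Sum>S\<in>Pow Z. \<Sum>r\<in>sieve_residues q d (\<Prod>S). class_deviation q M (\<Prod>S) R r x)"
  unfolding split
 proof (rule order_trans[OF sum_abs sum_mono])
  fix S assume S: "S : Pow Z"
  have "abs ((-1) ^ card S * (\<Sum>r\<in>sieve_residues q d (\<Prod>S). class_count q r (M div \<Prod>S) ?y x - R / (real q * (real (\<Prod>S))^2)))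
   = abs (\<Sum>r\<in>sieve_residues q d (\<Prod>S). class_count q r (M div \<Prod>S) ?y x - R / (real q * (real (\<Prod>S))^2))" by (simp add: abs_mult power_abs)
  also have "... <= (\<Sum>r\<in>sieve_residues q d (\<Prod>S). class_deviation q M (\<Prod>S) R r x)"
  proof (rule order_trans[OF sum_abs sum_mono])
   fix r assume "r : sieve_residues q d (\<Prod>S)"
   hence "r < q" by (simp add: sieve_residues_def)
   from expected_count_div_scaled[OF q this k[OF S] M R]
   show "abs (class_count q r (M div \<Prod>S) ?y x - R / (real q * (real (\<Prod>S))^2)) <= class_deviation q M (\<Prod>S) R r x"
    unfolding class_deviation_def by linarith
  qed
  finally show "abs ((-1) ^ card S * (\<Sum>r\<in>sieve_residues q d (\<Prod>S). class_count q r (M div \<Prod>S) ?y x - R / (real q * (real (\<Prod>S))^2)))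
   <= (\<Sum>r\<in>sieve_residues q d (\<Prod>S). class_deviation q M (\<Prod>S) R r x)" .
 qed
 from norm_triangle_mono[OF main_deviation[folded real_norm_def] reduced_count_sieve[OF q Z, of d M ?y x, folded real_norm_def]]
 show ?thesis by (simp add: algebra_simps)
qed

lemma set_integral_class_deviation:
 assumes s_le_e: "s <= e" and R: "R >= 0"
 shows "set_integrable lborel {s..e} (class_deviation q M k R r)"
  and "(LBINT x:{s..e}. class_deviation q M k R r x) = class_count_L1_distance q r (M div k) (R / (real M)^2) s e
    + (e - s) * (R * (5 + 2 * real q) / real M)"
proof -
 note const = borel_integrable_atLeastAtMost'[OF continuous_on_const, of s e]
 have int: "set_integrable lborel {s..e} (%x. abs (class_count q r (M div k) (R / (real M)^2) x - R / (real M)^2 * expected_count q r (M div k)))"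
  using R by (intro set_integrable_abs set_integral_diff(1) set_integral_class_count(1) s_le_e const) auto
 show "set_integrable lborel {s..e} (class_deviation q M k R r)"
  unfolding class_deviation_def[abs_def] by (intro set_integral_add(1) int const)
 show "(LBINT x:{s..e}. class_deviation q M k R r x) = class_count_L1_distance q r (M div k) (R / (real M)^2) s e
   + (e - s) * (R * (5 + 2 * real q) / real M)"
  unfolding class_deviation_def set_integral_add(2)[OF int const] using s_le_e by (simp add: set_lebesgue_integral_def)
qed

lemma reduced_count_L1_le:
 assumes q: "q >= 1" and s_le_e: "s <= e" and z: "z >= 1" and Z: "Z = {p. prime p & p <= z}" and M: "M >= 1" and R: "0 <= R" "R <= (real M)^2"
  and counts: "!!r m. r < q ==> m <= M ==>
   class_count_L1_distance q r m (R / (real M)^2) s e <= \<delta>"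
 shows "(LBINT x:{s..e}. abs (reduced_count q d M (R / (real M)^2) x - sieve_density q d Z * R))
  <= real (card (Pow Z)) * (real q * (\<delta> + (e - s) * (R * (5 + 2 * real q) / real M))) + 2 * (e - s + 3) / real z * R"
proof -
 let ?y = "R / (real M)^2" and ?b = "\<delta> + (e - s) * (R * (5 + 2 * real q) / real M)"
 let ?main = "%x. \<Sum>S\<in>Pow Z. \<Sum>r\<in>sieve_residues q d (\<Prod>S). class_deviation q M (\<Prod>S) R r x"
 have y: "0 <= ?y" "?y <= 1" "?y * (real M)^2 = R" using R M by (auto simp: divide_le_eq)
 note const = borel_integrable_atLeastAtMost'[OF continuous_on_const, of s e]
 note dev = set_integral_class_deviation[OF s_le_e R(1)]
 note tail = set_integral_tail_count[OF s_le_e y(1,2) z, of M, unfolded y(3)]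
 have main_integrable: "set_integrable lborel {s..e} ?main" by (intro set_integral_sum(1) dev)
 have bound: "(LBINT x:{s..e}. class_deviation q M (\<Prod>S) R r x) <= ?b" if "r : sieve_residues q d (\<Prod>S)" for S r
  using counts[of r "M div \<Prod>S"] that unfolding dev(2) by (simp add: sieve_residues_def)
 have "0 <= class_count_L1_distance q 0 M ?y s e"
  unfolding set_lebesgue_integral_def by (rule Bochner_Integration.integral_nonneg) simp
 hence \<delta>: "\<delta> >= 0" using counts[of 0 M] q by simp
 have "(LBINT x:{s..e}. abs (reduced_count q d M ?y x - sieve_density q d Z * R)) <= (LBINT x:{s..e}. ?main x + tail_count z M ?y x)"
  by (intro set_integral_mono set_integrable_abs set_integral_diff(1) set_integral_add(1) set_integrable_reduced_count s_le_e y const main_integrable tail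
    reduced_count_deviation[OF q Z M R(1)])
 also have "... = (\<Sum>S\<in>Pow Z. \<Sum>r\<in>sieve_residues q d (\<Prod>S). LBINT x:{s..e}. class_deviation q M (\<Prod>S) R r x) + (LBINT x:{s..e}. tail_count z M ?y x)"
  by (simp only: set_integral_add(2)[OF main_integrable tail(1)] set_integral_sum(2)[OF set_integral_sum(1)[OF dev(1)]] set_integral_sum(2)[OF dev(1)])
 also have "... <= (\<Sum>S\<in>Pow Z. real q * ?b) + 2 * (e - s + 3) / real z * R"
 proof (intro add_mono sum_mono tail(2))
  fix S
  have "(\<Sum>r\<in>sieve_residues q d (\<Prod>S). LBINT x:{s..e}. class_deviation q M (\<Prod>S) R r x) <= real (card (sieve_residues q d (\<Prod>S))) * ?b"
   by (rule sum_bounded_above) (rule bound)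
  also have "... <= real q * ?b" using \<delta> s_le_e R card_sieve_residues[of q d "\<Prod>S"] by (intro mult_right_mono) auto
  finally show "(\<Sum>r\<in>sieve_residues q d (\<Prod>S). LBINT x:{s..e}. class_deviation q M (\<Prod>S) R r x) <= real q * ?b" .
 qed
 finally show ?thesis by simp
qed

lemma reduced_count_L1:
 assumes q: "q >= 1" and s_le_e: "s <= e" and \<epsilon>: "\<epsilon> > 0"
 obtains \<kappa> R where "R >= 1" "\<forall>\<^sub>F M in sequentially. (LBINT x:{s..e}. abs (reduced_count q d M (R / (real M)^2) x - \<kappa> * R)) <= \<epsilon> * R"
proof -
 define z where "z = nat \<lceil>4 * (e - s + 3) / \<epsilon>\<rceil> + 1"
 define Z where "Z = {p. prime p & p <= z}"
 have z: "z >= 1" by (simp add: z_def)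
 have "4 * (e - s + 3) / \<epsilon> <= real z" unfolding z_def by linarith
 hence tail: "2 * (e - s + 3) / real z <= \<epsilon> / 2" using \<epsilon> z by (simp add: field_simps)
 define n where "n = real (card (Pow Z)) * real q"
 have "finite Z" unfolding Z_def by (rule finite_subset[of _ "{..z}"]) auto
 hence n: "n > 0" using q by (simp add: n_def card_Pow)
 obtain R where R: "R >= 1" and counts: "\<forall>\<^sub>F M in sequentially. ALL r<q. ALL m<=M.
  class_count_L1_distance q r m (R / (real M)^2) s e <= \<epsilon> / (4 * n) * R"
  using class_count_L1[OF q s_le_e, of "\<epsilon> / (4 * n)"] \<epsilon> n by auto
 have "(%M. n * ((e - s) * (R * (5 + 2 * real q) / real M))) \<longlonglongrightarrow> 0" by real_asymp
 hence "\<forall>\<^sub>F M in sequentially. n * ((e - s) * (R * (5 + 2 * real q) / real M)) < \<epsilon> / 4 * R"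
  by (rule order_tendstoD(2)) (use \<epsilon> R in simp)
 moreover have "\<forall>\<^sub>F M in sequentially. real M >= R" by real_asymp
 ultimately have "\<forall>\<^sub>F M in sequentially. (LBINT x:{s..e}. abs (reduced_count q d M (R / (real M)^2) x - sieve_density q d Z * R)) <= \<epsilon> * R"
  using counts
 proof eventually_elim
  case (elim M)
  have M: "M >= 1" using elim(2) R by simp
  have "real M <= (real M)^2" by (rule self_le_power) (use M in auto)
  hence R_le: "R <= (real M)^2" using elim(2) by linarith
  have "(LBINT x:{s..e}. abs (reduced_count q d M (R / (real M)^2) x - sieve_density q d Z * R))
   <= real (card (Pow Z)) * (real q * (\<epsilon> / (4 * n) * R + (e - s) * (R * (5 + 2 * real q) / real M))) + 2 * (e - s + 3) / real z * R"
   using R elim(3) by (intro reduced_count_L1_le q s_le_e z Z_def M R_le) auto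
  also have "... = n * (\<epsilon> / (4 * n) * R) + n * ((e - s) * (R * (5 + 2 * real q) / real M)) + 2 * (e - s + 3) / real z * R"
   by (simp add: n_def algebra_simps)
  also have "n * (\<epsilon> / (4 * n) * R) = \<epsilon> / 4 * R" using n by simp
  finally show ?case using elim(1) mult_right_mono[OF tail, of R] R by linarith
 qed
 with R show ?thesis by (rule that)
qed

section \<open>Weighted exponential sums over reduced fractions\<close>

lemma interval_average_approx:
 fixes k :: "real => complex"
 assumes k: "continuous_on {r - y..r + y} k" and y: "y >= 0" and close: "!!x. abs (x - r) <= y ==> norm (w - k x) <= L"
 shows "norm (of_real (2 * y) * w - (LBINT x:{r - y..r + y}. k x)) <= 2 * y * L"
proof -
 have "(LBINT x:{r - y..r + y}. k x) = integral {r - y..r + y} k"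
  using set_borel_integral_eq_integral(2)[OF borel_integrable_atLeastAtMost'[OF k]] .
 moreover have "integral {r - y..r + y} (%x. w - k x) = of_real (2 * y) * w - integral {r - y..r + y} k"
  using y by (subst integral_diff) (auto intro: integrable_continuous_interval k simp: scaleR_conv_of_real)
 moreover have "norm (integral {r - y..r + y} (%x. w - k x)) <= L * (r + y - (r - y))"
  by (rule integral_bound) (use y close in \<open>auto intro!: continuous_intros k simp: abs_le_iff\<close>)
 ultimately show ?thesis by (simp add: mult.commute)
qed

lemma set_integrable_mult_bounded:
 fixes k :: "real => complex"
 assumes v: "set_integrable lborel S v" and k: "k : borel_measurable borel" "!!x. norm (k x) <= 1"
 shows "set_integrable lborel S (%x. of_real (v x) * k x)"
proof -
 have v': "integrable lborel (%x. indicator S x * v x)" using v by (simp add: set_integrable_def)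
 have "integrable lborel (%x. of_real (indicator S x * v x) * k x)"
 proof (rule Bochner_Integration.integrable_bound[OF v'])
  have "(%x. indicator S x * v x) : borel_measurable lborel" using v' by (rule borel_measurable_integrable)
  thus "(%x. of_real (indicator S x * v x) * k x) : borel_measurable lborel" using k(1) by measurable
  show "AE x in lborel. norm (of_real (indicator S x * v x) * k x) <= norm (indicator S x * v x)"
   unfolding norm_mult using k(2) by (intro AE_I2) (simp add: mult_left_le abs_mult norm_mult del: of_real_mult)
 qed
 thus ?thesis by (simp add: set_integrable_def scaleR_conv_of_real mult.assoc)
qed

lemma norm_weighted_integral_diff_le:
 fixes k :: "real => complex"
 assumes \<nu>: "set_integrable lborel {a..b} \<nu>" and k: "k : borel_measurable borel" "!!x. norm (k x) <= 1"
 shows "norm ((LBINT x:{a..b}. of_real (\<nu> x) * k x) - of_real m * (LBINT x:{a..b}. k x)) <= (LBINT x:{a..b}. abs (\<nu> x - m))"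
proof -
 have const: "set_integrable lborel {a..b} (%_. m)" by (rule borel_integrable_atLeastAtMost') simp
 note int = set_integrable_mult_bounded[OF _ k]
 have diff: "set_integrable lborel {a..b} (%x. \<nu> x - m)" by (rule set_integral_diff(1)[OF \<nu> const])
 have "(LBINT x:{a..b}. of_real (\<nu> x) * k x) - of_real m * (LBINT x:{a..b}. k x) = (LBINT x:{a..b}. of_real (\<nu> x - m) * k x)"
  using set_integral_diff(2)[OF int[OF \<nu>] int[OF const]] by (simp add: left_diff_distrib)
 also have "norm ... <= (LBINT x:{a..b}. norm (of_real (\<nu> x - m) * k x))" by (rule set_integral_norm_bound[OF int[OF diff]])
 also have "... <= (LBINT x:{a..b}. abs (\<nu> x - m))"
  by (rule set_integral_mono[OF set_integrable_norm[OF int[OF diff]] set_integrable_abs[OF diff]])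
   (use k(2) in \<open>simp add: norm_mult mult_left_le del: of_real_diff of_real_mult\<close>)
 finally show ?thesis .
qed

abbreviation (in cusp_primitive) symbol_phase :: "real => nat => int => complex" where
 "symbol_phase \<xi> c n == cis (\<xi> * real_symbol f (of_int n / real c))"

lemma (in cusp_primitive) symbol_near_horocycle:
 assumes R: "R >= 1" and M: "M >= 1" and y: "y = R / (real M)^2" and c: "1 <= c" "c <= M"
  and n: "coprime n (int c)" and x: "abs (x - of_int n / real c) <= y"
 shows "abs (F (Complex x y) - real_symbol f (of_int n / real c)) <= 2 * pi * (2 * C + B * ln (2 * R))"
proof -
 let ?r = "of_int n / real c"
 have y_pos: "y > 0" using R M by (simp add: y)
 have "(norm (Complex x y - of_real ?r))^2 = (x - ?r)^2 + y^2" by (simp add: cmod_power2)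
 also have "... <= 2 * y^2" using power_mono[OF x, of 2] by simp
 finally have "(real c)^2 * (norm (Complex x y - of_real ?r))^2 <= (real M)^2 * (2 * y^2)"
  using c by (intro mult_mono power_mono) auto
 also have "... = 2 * R * y" using M by (simp add: y power2_eq_square field_simps)
 finally have "1 / (2 * R) * ((real c)^2 * (norm (Complex x y - of_real ?r))^2) <= 1 / (2 * R) * (2 * R * y)"
  by (rule mult_left_mono) (use R in simp)
 hence "1 / (2 * R) * ((of_int (int c))^2 * (norm (Complex x y - of_real (of_int n / of_int (int c))))^2) <= Im (Complex x y)"
  using R by simp
 hence "abs (F (Complex x y) - real_symbol f (of_int n / of_int (int c))) <= 2 * pi * (2 * C + B * ln (1 / (1 / (2 * R))))"
  using R c y_pos by (intro F_near_rational n) (auto simp: UHP_def)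
 thus ?thesis by simp
qed

abbreviation fraction_numerators :: "real => real => nat => int set" where
 "fraction_numerators a b c == {n. coprime n (int c) & real c * a <= of_int n & of_int n <= real c * b}"

context weighted_cusp_primitive
begin

abbreviation weighted_term :: "real => nat => int => complex" where
 "weighted_term \<xi> c n == of_real (\<psi> (of_int n / real c)) * symbol_phase \<xi> c n"

definition weighted_exp_sum :: "nat => real => nat => complex" where
 "weighted_exp_sum d \<xi> M = (\<Sum>c\<in>gcd_class q d M. \<Sum>n\<in>fraction_numerators X0 X1 c.
  weighted_term \<xi> c n)"

definition horocycle_weight :: "real => real => real => complex" where
 "horocycle_weight \<xi> y x = of_real (\<psi> x) * phase \<xi> (Complex x y)"

lemma horocycle_weight_continuous: "y > 0 ==> continuous_on S (horocycle_weight \<xi> y)"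
 unfolding horocycle_weight_def[abs_def] by (intro continuous_intros weight_continuous continuous_on_horocycle[OF phase_continuous])

lemma norm_horocycle_weight_le: "norm (horocycle_weight \<xi> y x) <= 1"
 using range[of x] by (simp add: horocycle_weight_def norm_mult)

lemma phase_average_eq_LBINT: "y > 0 ==> phase_average \<xi> y = (LBINT x:window. horocycle_weight \<xi> y x)"
 using set_borel_integral_eq_integral(2)[OF borel_integrable_atLeastAtMost'[OF horocycle_weight_continuous]]
 by (simp add: phase_average_def horocycle_integral_def horocycle_weight_def[abs_def])

definition window_numerators :: "nat => int set" where
 "window_numerators c = fraction_numerators (X0 - 1) (X1 + 1) c"

lemma finite_window_numerators: "finite (window_numerators c)"
 unfolding window_numerators_def by (rule finite_int_between_restrict)

lemma card_window_numerators:
 assumes "1 <= c" "c <= M"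
 shows "real (card (window_numerators c)) <= real M * (X1 - X0 + 3)"
proof -
 have "real c * (X0 - 1) <= real c * (X1 + 1)" using X0_le_X1 by (intro mult_left_mono) auto
 hence "real (card (window_numerators c)) <= real c * (X1 + 1) - real c * (X0 - 1) + 1"
  unfolding window_numerators_def by (intro card_int_between_restrict_le) simp
 also have "... = real c * (X1 - X0 + 2) + 1" by (simp add: algebra_simps)
 also have "... <= real M * (X1 - X0 + 2) + real M" using assms X0_le_X1 by (intro add_mono mult_right_mono) auto
 finally show ?thesis by (simp add: algebra_simps)
qed

lemma symbol_term_near_horocycle:
 assumes R: "R >= 1" and M: "M >= 1" and y: "y = R / (real M)^2" and c: "1 <= c" "c <= M"
  and n: "coprime n (int c)" and x: "abs (x - of_int n / real c) <= y" and \<xi>: "\<xi> >= 0"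
 shows "norm (weighted_term \<xi> c n - horocycle_weight \<xi> y x)
  <= K' * y + \<xi> * (2 * pi * (2 * C + B * ln (2 * R)))"
proof -
 let ?r = "of_int n / real c" and ?Z = "symbol_phase \<xi> c n"
 have "abs (\<psi> ?r - \<psi> x) <= K' * abs (?r - x)" by (rule weight_lipschitz)
 also have "... <= K' * y" using x K'_nonneg by (intro mult_left_mono) (auto simp: abs_minus_commute)
 finally have weight: "abs (\<psi> ?r - \<psi> x) <= K' * y" .
 have "norm (?Z - phase \<xi> (Complex x y)) <= abs (\<xi> * real_symbol f ?r - \<xi> * F (Complex x y))"
  unfolding phase_def by (rule cis_lipschitz)
 also have "... = \<xi> * abs (F (Complex x y) - real_symbol f ?r)"
  using \<xi> by (simp only: right_diff_distrib[symmetric] abs_mult abs_of_nonneg abs_minus_commute)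
 also have "... <= \<xi> * (2 * pi * (2 * C + B * ln (2 * R)))" using symbol_near_horocycle[OF R M y c n x] \<xi> by (rule mult_left_mono)
 finally have "abs (\<psi> x) * norm (?Z - phase \<xi> (Complex x y)) <= 1 * (\<xi> * (2 * pi * (2 * C + B * ln (2 * R))))"
  using range[of x] by (intro mult_mono) auto
 moreover have "of_real (\<psi> ?r) * ?Z - horocycle_weight \<xi> y x = of_real (\<psi> ?r - \<psi> x) * ?Z + of_real (\<psi> x) * (?Z - phase \<xi> (Complex x y))"
  by (simp add: horocycle_weight_def algebra_simps)
 moreover have "norm (of_real (\<psi> ?r - \<psi> x) * ?Z + of_real (\<psi> x) * (?Z - phase \<xi> (Complex x y)))
   <= abs (\<psi> ?r - \<psi> x) + abs (\<psi> x) * norm (?Z - phase \<xi> (Complex x y))"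
  by (rule order_trans[OF norm_triangle_ineq]) (simp add: norm_mult del: of_real_diff)
 ultimately show ?thesis using weight by simp
qed

lemma integral_reduced_count_horocycle_weight:
 assumes y: "0 < y" "y <= 1"
 shows "(LBINT x:window. of_real (reduced_count q d M y x) * horocycle_weight \<xi> y x)
  = (\<Sum>c\<in>gcd_class q d M. \<Sum>n\<in>window_numerators c. LBINT x:{of_int n / real c - y..of_int n / real c + y}. horocycle_weight \<xi> y x)"
proof -
 let ?I = "%c n. {of_int n / real c - y..of_int n / real c + y}"
 have count: "real (coprime_num_count x y c) = (\<Sum>n\<in>window_numerators c. indicator (?I c n) x)" if "x : {X0..X1}" "c : gcd_class q d M" for x c
 proof -
  have c: "c >= 1" using that(2) by (simp add: gcd_class_def)
  have "real (coprime_num_count x y c) = (\<Sum>n | coprime n (int c) & real c * (X0 - y) <= of_int n & of_int n <= real c * (X1 + y). indicator (?I c n) x)"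
   unfolding coprime_num_count_def by (rule card_eq_sum_indicator[OF c that(1)])
  also have "... = (\<Sum>n\<in>window_numerators c. indicator (?I c n) x)"
  proof (rule sum.mono_neutral_left[OF finite_window_numerators])
   have "real c * (X0 - 1) <= real c * (X0 - y)" "real c * (X1 + y) <= real c * (X1 + 1)" using y by (auto intro!: mult_left_mono)
   thus "fraction_numerators (X0 - y) (X1 + y) c <= window_numerators c"
    by (auto simp: window_numerators_def)
   show "ALL n:window_numerators c - fraction_numerators (X0 - y) (X1 + y) c. indicator (?I c n) x = (0::real)"
   proof (rule ballI, rule ccontr)
    fix n assume n: "n : window_numerators c - fraction_numerators (X0 - y) (X1 + y) c"
     and "indicator (?I c n) x ~= (0::real)"
    hence "of_int n / real c <= X1 + y" "X0 - y <= of_int n / real c" using that(1) by (auto simp: indicator_def split: if_splits)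
    hence "of_int n <= real c * (X1 + y)" "real c * (X0 - y) <= of_int n" using c by (simp_all add: pos_divide_le_eq pos_le_divide_eq mult.commute)
    thus False using n by (auto simp: window_numerators_def)
   qed
  qed
  finally show ?thesis .
 qed
 have "indicator window x *\<^sub>R (of_real (reduced_count q d M y x) * horocycle_weight \<xi> y x)
  = (\<Sum>c\<in>gcd_class q d M. \<Sum>n\<in>window_numerators c. indicator (?I c n) x *\<^sub>R horocycle_weight \<xi> y x)" for x
 proof (cases "x : {X0..X1}")
  case True
  hence "indicator window x = (1::real)" by simp
  thus ?thesis unfolding reduced_count_def using count[OF True]
   by (simp add: sum_distrib_right scaleR_conv_of_real)
 next
  case False
  thus ?thesis by (simp add: horocycle_weight_def support(1))
 qed
 moreover have "set_integrable lborel (?I c n) (horocycle_weight \<xi> y)" for c n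
  by (rule borel_integrable_atLeastAtMost'[OF horocycle_weight_continuous[OF y(1)]])
 ultimately show ?thesis unfolding set_lebesgue_integral_def set_integrable_def by simp
qed

lemma weighted_exp_sum_window:
 "weighted_exp_sum d \<xi> M = (\<Sum>c\<in>gcd_class q d M. \<Sum>n\<in>window_numerators c.
  weighted_term \<xi> c n)"
 unfolding weighted_exp_sum_def
proof (rule sum.cong[OF refl], rule sum.mono_neutral_left[OF finite_window_numerators])
 fix c assume "c : gcd_class q d M"
 hence c: "real c > 0" by (simp add: gcd_class_def)
 let ?I = "fraction_numerators X0 X1 c"
 have "real c * (X0 - 1) <= real c * X0" "real c * X1 <= real c * (X1 + 1)" using c by (auto intro!: mult_left_mono)
 thus "?I <= window_numerators c" by (auto simp: window_numerators_def)
 show "ALL n:window_numerators c - ?I. weighted_term \<xi> c n = 0"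
  using c support(1) by (auto simp: window_numerators_def field_simps)
qed

definition transfer_error where
 "transfer_error R y \<xi> = 2 * R * (X1 - X0 + 3) * (K' * y + \<xi> * (2 * pi * (2 * C + B * ln (2 * R))))"

lemma weighted_exp_sum_vs_integral:
 assumes R: "R >= 1" and M: "M >= 1" and y: "y = R / (real M)^2" "y <= 1" and \<xi>: "\<xi> >= 0"
 shows "norm (of_real (2 * y) * weighted_exp_sum d \<xi> M - (LBINT x:window. of_real (reduced_count q d M y x) * horocycle_weight \<xi> y x))
  <= transfer_error R y \<xi>"
proof -
 define L where "L = K' * y + \<xi> * (2 * pi * (2 * C + B * ln (2 * R)))"
 have y_pos: "y > 0" using R M by (simp add: y)
 have L: "L >= 0" using R y_pos \<xi> K'_nonneg C_nonneg B_nonneg by (simp add: L_def)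
 have "norm (of_real (2 * y) * weighted_exp_sum d \<xi> M - (LBINT x:window. of_real (reduced_count q d M y x) * horocycle_weight \<xi> y x))
  <= (\<Sum>c\<in>gcd_class q d M. \<Sum>n\<in>window_numerators c. 2 * y * L)"
  unfolding integral_reduced_count_horocycle_weight[OF y_pos y(2)] weighted_exp_sum_window sum_distrib_left sum_subtractf[symmetric]
 proof (intro sum_norm_le)
  fix c n assume c: "c : gcd_class q d M" and n: "n : window_numerators c"
  show "norm (of_real (2 * y) * weighted_term \<xi> c n
   - (LBINT x:{of_int n / real c - y..of_int n / real c + y}. horocycle_weight \<xi> y x)) <= 2 * y * L"
   unfolding L_def
   by (intro interval_average_approx horocycle_weight_continuous y_pos symbol_term_near_horocycle[OF R M y(1)] \<xi> less_imp_le[OF y_pos])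
    (use c n in \<open>auto simp: gcd_class_def window_numerators_def\<close>)
 qed
 also have "... <= (\<Sum>c\<in>gcd_class q d M. (real M * (X1 - X0 + 3)) * (2 * y * L))"
 proof (rule sum_mono)
  fix c assume "c : gcd_class q d M"
  hence "real (card (window_numerators c)) <= real M * (X1 - X0 + 3)" by (intro card_window_numerators) (auto simp: gcd_class_def)
  thus "(\<Sum>n\<in>window_numerators c. 2 * y * L) <= (real M * (X1 - X0 + 3)) * (2 * y * L)"
   unfolding sum_constant using y_pos L by (intro mult_right_mono) auto
 qed
 also have "... = real (card (gcd_class q d M)) * ((real M * (X1 - X0 + 3)) * (2 * y * L))" by (rule sum_constant)
 also have "... <= real M * ((real M * (X1 - X0 + 3)) * (2 * y * L))"
  using y_pos L X0_le_X1 card_gcd_class[of q d M] by (intro mult_right_mono) auto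
 also have "... = 2 * ((real M)^2 * y) * (X1 - X0 + 3) * L" by (simp add: power2_eq_square)
 also have "(real M)^2 * y = R" using M by (simp add: y)
 finally show ?thesis unfolding transfer_error_def L_def .
qed

lemma weighted_exp_sum_vs_phase_average:
 assumes R: "R >= 1" and M: "M >= 1" and y: "y = R / (real M)^2" "y <= 1" and \<xi>: "\<xi> >= 0"
  and L1: "(LBINT x:window. abs (reduced_count q d M y x - \<kappa> * R)) <= \<epsilon> * R"
 shows "norm (of_real (2 * y) * weighted_exp_sum d \<xi> M - of_real (\<kappa> * R) * phase_average \<xi> y) <= \<epsilon> * R + transfer_error R y \<xi>"
proof -
 have y_pos: "y > 0" using R M by (simp add: y)
 have "norm ((LBINT x:window. of_real (reduced_count q d M y x) * horocycle_weight \<xi> y x) - of_real (\<kappa> * R) * phase_average \<xi> y)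
   <= (LBINT x:window. abs (reduced_count q d M y x - \<kappa> * R))"
  unfolding phase_average_eq_LBINT[OF y_pos] using X0_le_X1 y_pos
  by (intro norm_weighted_integral_diff_le set_integrable_reduced_count borel_measurable_continuous_onI
    horocycle_weight_continuous norm_horocycle_weight_le) auto
 from norm_triangle_mono[OF weighted_exp_sum_vs_integral[OF R M y \<xi>, of d] order_trans[OF this L1]]
 show ?thesis by (simp add: add.commute)
qed

lemma phase_average_tendsto:
 assumes vol: "hyp_vol D > 0" and \<xi>: "!!M. \<xi> M >= 0" "\<xi> \<longlonglongrightarrow> 0" and y: "\<forall>\<^sub>F M in sequentially. 0 < y M & y M <= 1"
  and \<tau>: "(%M. (\<xi> M)^2 * ln (1 / y M)) \<longlonglongrightarrow> \<tau>"
 shows "(%M. phase_average (\<xi> M) (y M)) \<longlonglongrightarrow> damped_mean \<tau>"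
proof -
 let ?E = "%M. damped_mean ((\<xi> M)^2 * ln (1 / y M))"
 have "(%M. phase_average (\<xi> M) (y M) - ?E M) \<longlonglongrightarrow> 0"
 proof (rule tendstoI)
  fix \<epsilon> :: real assume \<epsilon>: "\<epsilon> > 0"
  obtain \<delta> where \<delta>: "\<delta> > 0" and limit: "!!\<xi> y. 0 <= \<xi> ==> \<xi> <= \<delta> ==> 0 < y ==> y <= 1 ==> \<xi>^2 * ln (1 / y) <= \<bar>\<tau>\<bar> + 1 ==>
    norm (phase_average \<xi> y - damped_mean (\<xi>^2 * ln (1 / y))) <= \<epsilon> / 2"
   by (rule phase_average_limit[OF vol, of "\<epsilon> / 2" "\<bar>\<tau>\<bar> + 1"]) (use \<epsilon> in auto)
  have "\<forall>\<^sub>F M in sequentially. (\<xi> M)^2 * ln (1 / y M) < \<bar>\<tau>\<bar> + 1" by (rule order_tendstoD(2)[OF \<tau>]) auto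
  thus "\<forall>\<^sub>F M in sequentially. dist (phase_average (\<xi> M) (y M) - ?E M) 0 < \<epsilon>"
   using order_tendstoD(2)[OF \<xi>(2) \<delta>] y
  proof eventually_elim
   case (elim M)
   hence "norm (phase_average (\<xi> M) (y M) - ?E M) <= \<epsilon> / 2" using \<xi>(1) by (intro limit) auto
   thus ?case using \<epsilon> by (simp only: dist_0_norm dist_commute)
  qed
 qed
 moreover have "?E \<longlonglongrightarrow> damped_mean \<tau>" by (intro tendsto_intros \<tau>)
 ultimately show ?thesis using tendsto_add by fastforce
qed

lemma weighted_exp_sum_limit:
 assumes vol: "hyp_vol D > 0" and \<epsilon>: "\<epsilon> > 0" and R: "R >= 1"
  and L1: "\<forall>\<^sub>F M in sequentially. (LBINT x:window. abs (reduced_count q d M (R / (real M)^2) x - \<kappa> * R)) <= \<epsilon> / 4 * R"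
  and \<xi>: "!!M. \<xi> M >= 0" "\<xi> \<longlonglongrightarrow> 0" and \<tau>: "(%M. (\<xi> M)^2 * ln (1 / (R / (real M)^2))) \<longlonglongrightarrow> \<tau>"
 shows "\<forall>\<^sub>F M in sequentially. norm (of_real (2 * (R / (real M)^2)) * weighted_exp_sum d (\<xi> M) M
  - of_real (\<kappa> * R) * damped_mean \<tau>) < \<epsilon> * R"
proof -
 let ?y = "%M::nat. R / (real M)^2" and ?l = "damped_mean \<tau>"
 have y: "?y \<longlonglongrightarrow> 0" by real_asymp
 have y_pos: "\<forall>\<^sub>F M in sequentially. 0 < ?y M & ?y M <= 1"
  using order_tendstoD(2)[OF y zero_less_one] eventually_ge_at_top[of 1] by eventually_elim (use R in auto)
 have "(%M. norm (of_real (\<kappa> * R) * phase_average (\<xi> M) (?y M) - of_real (\<kappa> * R) * ?l)) \<longlonglongrightarrow> norm (of_real (\<kappa> * R) * ?l - of_real (\<kappa> * R) * ?l)"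
  by (intro tendsto_intros phase_average_tendsto vol \<xi> y_pos \<tau>)
 hence "\<forall>\<^sub>F M in sequentially. norm (of_real (\<kappa> * R) * phase_average (\<xi> M) (?y M) - of_real (\<kappa> * R) * ?l) < \<epsilon> / 4 * R"
  by (rule order_tendstoD(2)) (use \<epsilon> R in simp)
 moreover have "(%M. transfer_error R (?y M) (\<xi> M)) \<longlonglongrightarrow> transfer_error R 0 0"
  unfolding transfer_error_def by (intro tendsto_intros y \<xi>)
 hence "\<forall>\<^sub>F M in sequentially. transfer_error R (?y M) (\<xi> M) < \<epsilon> / 4 * R"
  by (rule order_tendstoD(2)) (use \<epsilon> R in \<open>simp add: transfer_error_def\<close>)
 ultimately show ?thesis using L1 y_pos eventually_ge_at_top[of 1]
 proof eventually_elim
  case (elim M)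
  have "norm (of_real (2 * ?y M) * weighted_exp_sum d (\<xi> M) M - of_real (\<kappa> * R) * phase_average (\<xi> M) (?y M))
   <= \<epsilon> / 4 * R + transfer_error R (?y M) (\<xi> M)"
   by (rule weighted_exp_sum_vs_phase_average[OF R elim(5) refl _ \<xi>(1) elim(3)]) (use elim(4) in simp)
  hence "norm (of_real (2 * ?y M) * weighted_exp_sum d (\<xi> M) M - of_real (\<kappa> * R) * ?l)
   <= (\<epsilon> / 4 * R + transfer_error R (?y M) (\<xi> M)) + norm (of_real (\<kappa> * R) * phase_average (\<xi> M) (?y M) - of_real (\<kappa> * R) * ?l)"
   by (rule norm_diff_triangle_le[OF _ order_refl])
  also have "... < (\<epsilon> / 4 * R + \<epsilon> / 4 * R) + \<epsilon> / 4 * R" using elim(1,2) by (intro add_strict_mono add_strict_left_mono)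
  also have "... <= \<epsilon> * R" using \<epsilon> R by simp
  finally show ?case .
 qed
qed

lemma dampened_frequency_limit:
 assumes "R >= 1"
 shows "(%M. (t / sqrt (ln (real M)))^2 * ln (1 / (R / (real M)^2))) \<longlonglongrightarrow> 2 * t^2"
proof (rule Lim_transform_eventually)
 show "(%M::nat. t^2 * (2 - ln R / ln (real M))) \<longlonglongrightarrow> 2 * t^2" by real_asymp
 show "\<forall>\<^sub>F M in sequentially. t^2 * (2 - ln R / ln (real M)) = (t / sqrt (ln (real M)))^2 * ln (1 / (R / (real M)^2))"
  using eventually_ge_at_top[of 2]
 proof eventually_elim
  case (elim M)
  hence pos: "ln (real M) > 0" by simp
  have "ln (1 / (R / (real M)^2)) = 2 * ln (real M) - ln R" using assms elim by (simp add: ln_div ln_realpow)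
  moreover have "(t / sqrt (ln (real M)))^2 = t^2 / ln (real M)" using pos by (simp add: power_divide)
  ultimately show ?case using pos by (simp only:) (simp add: field_simps)
 qed
qed

text \<open>The unknown density \<open>\<kappa>\<close> of the reduced fractions cancels in the comparison with the sum at frequency zero.\<close>
lemma weighted_exp_sum_asymp:
 assumes vol: "hyp_vol D > 0" and t: "t >= 0" and \<epsilon>: "\<epsilon> > 0"
 shows "\<forall>\<^sub>F M in sequentially. norm (weighted_exp_sum d (t / sqrt (ln (real M))) M
  - of_real (exp (- 8 * pi^2 * mean_energy * t^2)) * weighted_exp_sum d 0 M) <= \<epsilon> * (real M)^2"
proof -
 obtain \<kappa> R where R: "R >= 1" and L1: "\<forall>\<^sub>F M in sequentially. (LBINT x:window. abs (reduced_count q d M (R / (real M)^2) x - \<kappa> * R)) <= \<epsilon> / 4 * R"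
  by (rule reduced_count_L1[OF q_pos, of "X0 - 1" "X1 + 1" "\<epsilon> / 4"]) (use X0_le_X1 \<epsilon> in auto)
 define \<theta> where "\<theta> = exp (- 8 * pi^2 * mean_energy * t^2)"
 have \<theta>: "0 <= \<theta>" "\<theta> <= 1" using mean_energy_nonneg by (auto simp: \<theta>_def)
 let ?y = "%M. R / (real M)^2" and ?\<xi> = "%M::nat. t / sqrt (ln (real M))"
 let ?l = "%\<tau>. of_real (\<kappa> * R) * damped_mean \<tau>"
 have "(%M. (?\<xi> M)^2 * ln (1 / ?y M)) \<longlonglongrightarrow> 2 * t^2" by (rule dampened_frequency_limit[OF R])
 moreover have "?\<xi> \<longlonglongrightarrow> 0" by real_asymp
 moreover have "?\<xi> M >= 0" for M using t ln_ge_zero[of "real M"] by (cases "M = 0") auto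
 ultimately have "\<forall>\<^sub>F M in sequentially. norm (of_real (2 * ?y M) * weighted_exp_sum d (?\<xi> M) M - ?l (2 * t^2)) < \<epsilon> * R"
  by (intro weighted_exp_sum_limit vol \<epsilon> R L1)
 moreover have "\<forall>\<^sub>F M in sequentially. norm (of_real (2 * ?y M) * weighted_exp_sum d 0 M - ?l 0) < \<epsilon> * R"
  by (rule weighted_exp_sum_limit[OF vol \<epsilon> R L1]) auto
 ultimately show ?thesis using eventually_ge_at_top[of 1]
 proof eventually_elim
  case (elim M)
  let ?W = "weighted_exp_sum d (?\<xi> M) M - of_real \<theta> * weighted_exp_sum d 0 M"
  have "of_real (2 * ?y M) * ?W = (of_real (2 * ?y M) * weighted_exp_sum d (?\<xi> M) M - ?l (2 * t^2))
   - of_real \<theta> * (of_real (2 * ?y M) * weighted_exp_sum d 0 M - ?l 0)"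
   by (simp add: \<theta>_def algebra_simps)
  also have "norm ... <= \<epsilon> * R + \<epsilon> * R"
  proof (rule norm_triangle_le_diff, rule add_mono)
   have "norm (of_real \<theta> * (of_real (2 * ?y M) * weighted_exp_sum d 0 M - ?l 0)) <= norm (of_real (2 * ?y M) * weighted_exp_sum d 0 M - ?l 0)"
    unfolding norm_mult[of "of_real \<theta>"] norm_of_real using \<theta> by (intro mult_left_le_one_le) auto
   thus "norm (of_real \<theta> * (of_real (2 * ?y M) * weighted_exp_sum d 0 M - ?l 0)) <= \<epsilon> * R" using elim(2) by linarith
  qed (use elim(1) in linarith)
  finally have "2 * ?y M * norm ?W <= 2 * (\<epsilon> * R)" using R by (simp add: norm_mult norm_divide norm_power mult.commute[of \<epsilon>])
  hence "R * norm ?W <= R * (\<epsilon> * (real M)^2)" using elim(3) by (simp add: field_simps)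
  thus ?case using R by (simp add: \<theta>_def)
 qed
qed

end

section \<open>Counting reduced fractions in an interval\<close>

definition reduced_fractions :: "nat => nat => real => real => nat => (nat \<times> int) set" where
 "reduced_fractions q d x0 x1 M = {(c,n). c : gcd_class q d M & coprime n (int c) & real c * x0 < of_int n & of_int n < real c * x1}"

lemma reduced_fractions_eq_Sigma:
 "reduced_fractions q d x0 x1 M = (SIGMA c:gcd_class q d M. {n. coprime n (int c) & real c * x0 < of_int n & of_int n < real c * x1})"
 by (auto simp: reduced_fractions_def)

lemma finite_reduced_fractions [simp]: "finite (reduced_fractions q d x0 x1 M)"
 unfolding reduced_fractions_eq_Sigma by (intro finite_SigmaI finite_gcd_class finite_int_between_restrict)

lemma card_scaled_interval_le:
 assumes c: "c : gcd_class q d M" and x: "x0 <= x1" "x1 - x0 <= 1"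
 shows "real (card {n::int. P n & real c * x0 <= of_int n & of_int n <= real c * x1}) <= 2 * real M"
proof -
 have c_bounds: "1 <= real c" "real c <= real M" using c by (auto simp: gcd_class_def)
 have "real c * x0 <= real c * x1" using x by (intro mult_left_mono) auto
 hence "real (card {n::int. P n & real c * x0 <= of_int n & of_int n <= real c * x1}) <= real c * x1 - real c * x0 + 1"
  by (intro card_int_between_restrict_le) simp
 also have "... = real c * (x1 - x0) + 1" by (simp add: algebra_simps)
 also have "... <= real c * 1 + 1" using x by (intro add_right_mono mult_left_mono) auto
 finally show ?thesis using c_bounds by simp
qed

lemma card_reduced_fractions_le:
 assumes x: "x0 <= x1" "x1 - x0 <= 1"
 shows "real (card (reduced_fractions q d x0 x1 M)) <= 2 * (real M)^2"
proof -
 have row: "card {n. coprime n (int c) & real c * x0 < of_int n & of_int n < real c * x1} <= 2 * M" if "c : gcd_class q d M" for c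
 proof -
  have "card {n. coprime n (int c) & real c * x0 < of_int n & of_int n < real c * x1}
   <= card {n. coprime n (int c) & real c * x0 <= of_int n & of_int n <= real c * x1}"
   by (rule card_mono[OF finite_int_between_restrict(1)]) auto
  thus ?thesis using card_scaled_interval_le[OF that x, of "%n. coprime n (int c)"] by linarith
 qed
 have "card (reduced_fractions q d x0 x1 M) = (\<Sum>c\<in>gcd_class q d M. card {n. coprime n (int c) & real c * x0 < of_int n & of_int n < real c * x1})"
  unfolding reduced_fractions_eq_Sigma by (rule card_SigmaI) (auto intro: finite_int_between_restrict)
 also have "... <= card (gcd_class q d M) * (2 * M)" using sum_bounded_above[OF row] by simp
 also have "... <= M * (2 * M)" by (intro mult_right_mono card_gcd_class) simp
 finally have "real (card (reduced_fractions q d x0 x1 M)) <= real (M * (2 * M))" by (rule of_nat_mono)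
 thus ?thesis by (simp add: power2_eq_square)
qed

lemma card_reduced_fractions_mono: "m <= M ==> card (reduced_fractions q d x0 x1 m) <= card (reduced_fractions q d x0 x1 M)"
 by (rule card_mono[OF finite_reduced_fractions]) (auto simp: reduced_fractions_def gcd_class_def)

lemma card_int_strictly_between_ge: "b - a - 1 <= real (card {n::int. a < of_int n & of_int n < b})" for a b :: real
proof -
 have "{n::int. a < of_int n & of_int n < b} = {\<lfloor>a\<rfloor><..<\<lceil>b\<rceil>}" by (auto simp: floor_less_iff less_ceiling_iff)
 thus ?thesis by simp linarith
qed

text \<open>The numbers \<open>1 + qj\<close> are prime to \<open>q\<close>, so dividing \<open>dn\<close> and \<open>1 + qj\<close> by their greatest common divisor
  preserves the condition \<open>gcd c q = d\<close> on the denominator when \<open>n \<equiv> 1\<close> modulo \<open>q\<close>.\<close>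
definition progression_pairs :: "nat => nat => real => real => nat => (nat \<times> int) set" where
 "progression_pairs q d x0 x1 M = (SIGMA n:residue_class q (1 mod q) (M div d).
  {j. (real (d * n) * x0 - 1) / real q < of_int j & of_int j < (real (d * n) * x1 - 1) / real q})"

lemma half_le_of_nat_div:
 assumes "1 <= d" "d <= M"
 shows "real M / (2 * real d) <= real (M div d)"
proof -
 have "M < d * (M div d) + d" using mult_div_mod_eq[of d M] mod_less_divisor[of d M] assms(1) by linarith
 moreover have "d <= d * (M div d)" using assms by (simp add: Suc_le_eq div_greater_zero_iff)
 ultimately have "M <= 2 * (d * (M div d))" by linarith
 hence "real M <= real (2 * (d * (M div d)))" by (rule of_nat_mono)
 thus ?thesis using assms(1) by (simp add: pos_divide_le_eq mult_ac)
qed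

lemma card_progression_pairs_ge:
 assumes q: "q >= 1" and d: "1 <= d" "d <= M" and x: "x0 <= x1"
 shows "real d * (x1 - x0) / (2 * real q) * ((real M)^2 / (4 * (real d)^2 * real q) - 3 * real M - 2 * real q) - real M
  <= real (card (progression_pairs q d x0 x1 M))"
proof -
 define m where "m = M div d"
 let ?R = "residue_class q (1 mod q) m" and ?\<beta> = "real d * (x1 - x0) / (2 * real q)"
 let ?J = "%n. {j::int. (real (d * n) * x0 - 1) / real q < of_int j & of_int j < (real (d * n) * x1 - 1) / real q}"
 have m_le: "real m <= real M" by (simp add: m_def)
 have "(real M / (2 * real d))^2 <= (real m)^2" using half_le_of_nat_div[OF d] by (intro power_mono) (auto simp: m_def)
 hence "(real M / (2 * real d))^2 / real q <= (real m)^2 / real q" by (rule divide_right_mono) simp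
 hence "(real M)^2 / (4 * (real d)^2 * real q) <= (real m)^2 / real q" by (simp add: power_divide power_mult_distrib)
 moreover have "1 mod q < q" using q by (intro mod_less_divisor) simp
 ultimately have "(real M)^2 / (4 * (real d)^2 * real q) - 3 * real M - 2 * real q <= expected_count q (1 mod q) m"
  using expected_count_asymp[OF q, of "1 mod q" m] m_le by linarith
 hence "?\<beta> * ((real M)^2 / (4 * (real d)^2 * real q) - 3 * real M - 2 * real q) - real M <= ?\<beta> * expected_count q (1 mod q) m - real (card ?R)"
  using x m_le card_residue_class[of q "1 mod q" m] by (intro diff_mono mult_left_mono) auto
 also have "... = (\<Sum>n\<in>?R. ?\<beta> * (2 * real n) - 1)"
  by (simp add: expected_count_def sum_subtractf sum_distrib_left)
 also have "... <= (\<Sum>n\<in>?R. real (card (?J n)))"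
 proof (rule sum_mono)
  fix n
  have "?\<beta> * (2 * real n) = (real (d * n) * x1 - 1) / real q - (real (d * n) * x0 - 1) / real q"
   using q by (simp add: field_simps)
  thus "?\<beta> * (2 * real n) - 1 <= real (card (?J n))" by (simp only: card_int_strictly_between_ge)
 qed
 also have "... = real (card (progression_pairs q d x0 x1 M))"
  unfolding progression_pairs_def m_def using finite_int_between_restrict(2)[of "%_. True"] by (subst card_SigmaI) auto
 finally show ?thesis .
qed

definition cancel_gcd :: "nat \<times> int => nat \<times> nat \<times> int" where
 "cancel_gcd = (%(c,n). let g = nat (gcd n (int c)) in (g, c div g, n div int g))"

lemma cancel_gcdE:
 assumes "c >= 1"
 obtains g c' n' where "cancel_gcd (c,n) = (g, c', n')" "c = g * c'" "n = int g * n'" "coprime n' (int c')"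
proof -
 define g where "g = nat (gcd n (int c))"
 have g: "int g = gcd n (int c)" by (simp add: g_def)
 hence dvd: "int g dvd n" "int g dvd int c" by auto
 have "coprime (n div int g) (int c div int g)" unfolding g using assms by (intro div_gcd_coprime) simp
 thus ?thesis using dvd by (intro that[of g "c div g" "n div int g"]) (auto simp: cancel_gcd_def g[symmetric] zdiv_int)
qed

lemma inj_on_cancel_gcd: "inj_on cancel_gcd {(c,n). c >= 1}"
proof (rule inj_onI, clarify)
 fix c n c' n' assume "1 <= c" "1 <= c'" "cancel_gcd (c,n) = cancel_gcd (c',n')"
 thus "c = c' & n = n'" using cancel_gcdE[of c n] cancel_gcdE[of c' n'] by (metis prod.inject)
qed

lemma gcd_cofactor_eq:
 fixes c d g n q :: nat
 assumes d: "d dvd q" and n: "n mod q = 1 mod q" and c: "d * n = g * c" and g: "int g dvd 1 + int q * j"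
 shows "gcd c q = d"
proof -
 have "coprime (int g) (int q)"
 proof (rule coprimeI)
  fix u assume "u dvd int g" "u dvd int q"
  hence "u dvd 1 + int q * j" "u dvd int q * j" using g dvd_trans by auto
  thus "is_unit u" by (simp add: dvd_add_left_iff)
 qed
 hence "gcd c q = gcd (g * c) q" by (simp add: gcd_mult_left_left_cancel coprime_commute)
 also have "... = gcd d q"
 proof -
  have "gcd n q = gcd (1 mod q) q" using n gcd_red_nat[of n q] by (metis gcd.commute)
  hence "coprime n q" using gcd_red_nat[of 1 q] by (simp add: coprime_iff_gcd_eq_1 gcd.commute)
  thus ?thesis unfolding c[symmetric] by (simp add: gcd_mult_left_right_cancel coprime_commute)
 qed
 finally show ?thesis using d by (simp add: gcd_proj1_iff)
qed

lemma reduced_fraction_cofactors: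
 assumes j: "(real (g * c) * x0 - 1) / real q < of_int j" "of_int j < (real (g * c) * x1 - 1) / real q"
  and k: "1 + int q * j = int g * k" and g: "real g > 0" and q: "real q > 0"
 shows "real c * x0 < of_int k" "of_int k < real c * x1"
proof -
 have "real q * of_int j = real g * of_int k - 1"
  using arg_cong[OF k, of real_of_int] by simp
 hence "real g * (real c * x0) < real g * of_int k" "real g * of_int k < real g * (real c * x1)"
  using j q by (simp_all add: pos_divide_less_eq pos_less_divide_eq mult_ac)
 thus "real c * x0 < of_int k" "of_int k < real c * x1" using g by simp_all
qed

lemma cancel_gcd_progression:
 assumes q: "q >= 1" and d: "d dvd q" and nj: "(n,j) : progression_pairs q d x0 x1 M"
 shows "cancel_gcd (d * n, 1 + int q * j) : (SIGMA g:{1..M}. reduced_fractions q d x0 x1 (M div g))"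
proof -
 have d_pos: "d >= 1" using d q by (cases d) auto
 have n: "n >= 1" "n <= M div d" "n mod q = 1 mod q" and j: "(real (d * n) * x0 - 1) / real q < of_int j" "of_int j < (real (d * n) * x1 - 1) / real q"
  using nj by (auto simp: progression_pairs_def residue_class_def)
 have dn: "1 <= d * n" "d * n <= M" using n d_pos by (auto simp: less_eq_div_iff_mult_less_eq mult.commute Suc_le_eq)
 obtain g c k where eq: "cancel_gcd (d * n, 1 + int q * j) = (g, c, k)" "d * n = g * c" "1 + int q * j = int g * k" "coprime k (int c)"
  by (rule cancel_gcdE[OF dn(1)])
 have pos: "1 <= g" "1 <= c" using dn(1) unfolding eq(2) by (auto simp: Suc_le_eq)
 have "g * c <= M" using dn(2) by (simp only: eq(2))
 hence "c <= M div g" using pos by (simp add: less_eq_div_iff_mult_less_eq mult.commute)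
 moreover have "g <= M" using \<open>g * c <= M\<close> mult_le_mono2[OF pos(2), of g] by linarith
 moreover have "gcd c q = d" by (rule gcd_cofactor_eq[OF d n(3) eq(2), of j]) (simp add: eq(3))
 moreover have "real c * x0 < of_int k" "of_int k < real c * x1"
  using reduced_fraction_cofactors[OF j[unfolded eq(2)] eq(3)] pos q by auto
 ultimately show ?thesis using pos eq(4) by (simp add: eq(1) reduced_fractions_def gcd_class_def)
qed

lemma card_progression_pairs_le:
 assumes q: "q >= 1" and d: "d dvd q"
 shows "card (progression_pairs q d x0 x1 M) <= (\<Sum>g\<in>{1..M}. card (reduced_fractions q d x0 x1 (M div g)))"
proof -
 let ?P = "progression_pairs q d x0 x1 M" and ?pair = "%(n,j). (d * n, 1 + int q * j)"
 have d_pos: "d >= 1" using d q by (cases d) auto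
 have "inj_on ?pair ?P" using d_pos q by (auto simp: inj_on_def)
 moreover have "?pair ` ?P <= {(c,n). c >= 1}" using d_pos by (auto simp: progression_pairs_def residue_class_def)
 ultimately have "inj_on (cancel_gcd \<circ> ?pair) ?P" using inj_on_cancel_gcd by (blast intro: comp_inj_on inj_on_subset)
 moreover have "(cancel_gcd \<circ> ?pair) z : (SIGMA g:{1..M}. reduced_fractions q d x0 x1 (M div g))" if "z : ?P" for z
  using cancel_gcd_progression[OF q d] that by (cases z) (simp only: comp_apply case_prod_conv)
 hence "(cancel_gcd \<circ> ?pair) ` ?P <= (SIGMA g:{1..M}. reduced_fractions q d x0 x1 (M div g))" by (rule image_subsetI)
 ultimately have "card ?P <= card (SIGMA g:{1..M}. reduced_fractions q d x0 x1 (M div g))" by (rule card_inj_on_le) simp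
 thus ?thesis by (subst (asm) card_SigmaI) auto
qed

lemma sum_card_reduced_fractions_le:
 assumes x: "x0 <= x1" "x1 - x0 <= 1" and G: "1 <= G" "G <= M"
 shows "(\<Sum>g\<in>{1..M}. real (card (reduced_fractions q d x0 x1 (M div g))))
  <= real G * real (card (reduced_fractions q d x0 x1 M)) + 2 / real G * (real M)^2"
proof -
 let ?n = "%g. real (card (reduced_fractions q d x0 x1 (M div g)))"
 have "{1..M} = {1..G} \<union> {G<..M}" using G by auto
 hence "(\<Sum>g\<in>{1..M}. ?n g) = (\<Sum>g\<in>{1..G}. ?n g) + (\<Sum>g\<in>{G<..M}. ?n g)"
  by (simp only:) (rule sum.union_disjoint, auto)
 moreover have "(\<Sum>g\<in>{1..G}. ?n g) <= real (card {1..G}) * real (card (reduced_fractions q d x0 x1 M))"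
  by (rule sum_bounded_above) (simp add: card_reduced_fractions_mono)
 moreover have "(\<Sum>g\<in>{G<..M}. ?n g) <= (\<Sum>g\<in>{G<..M}. 2 * (real M)^2 * (1 / (real g)^2))"
 proof (rule sum_mono)
  fix g
  have "?n g <= 2 * (real (M div g))^2" by (rule card_reduced_fractions_le[OF x])
  also have "... <= 2 * (real M / real g)^2" by (intro mult_left_mono power_mono of_nat_div_le_of_nat) auto
  finally show "?n g <= 2 * (real M)^2 * (1 / (real g)^2)" by (simp add: power_divide)
 qed
 moreover have "(\<Sum>g\<in>{G<..M}. 2 * (real M)^2 * (1 / (real g)^2)) <= 2 * (real M)^2 * (1 / real G)"
  unfolding sum_distrib_left[symmetric] by (intro mult_left_mono sum_inverse_squares_tail G) auto
 ultimately show ?thesis by simp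
qed

lemma card_reduced_fractions_lower:
 assumes q: "q >= 1" and d: "d dvd q" and x: "x0 < x1" "x1 - x0 <= 1"
 obtains \<kappa> where "\<kappa> > 0" "\<forall>\<^sub>F M in sequentially. \<kappa> * (real M)^2 <= real (card (reduced_fractions q d x0 x1 M))"
proof -
 have d_pos: "d >= 1" using d q by (cases d) auto
 define \<beta> where "\<beta> = real d * (x1 - x0) / (2 * real q)"
 define \<gamma> where "\<gamma> = 1 / (4 * (real d)^2 * real q)"
 define w where "w = \<beta> * \<gamma> / 4"
 have w_pos: "w > 0" using d_pos q x by (simp add: w_def \<beta>_def \<gamma>_def)
 define G where "G = nat \<lceil>2 / w\<rceil>"
 have G: "1 <= G" "2 / w <= real G" using w_pos by (auto simp: G_def Suc_le_eq)
 hence tail: "2 / real G <= w" using w_pos by (simp add: field_simps)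
 have "\<forall>\<^sub>F M in sequentially. (3 * \<beta> + 1) * real M + 2 * real q * \<beta> <= w * (real M)^2" using w_pos by real_asymp
 hence "\<forall>\<^sub>F M in sequentially. w / real G * (real M)^2 <= real (card (reduced_fractions q d x0 x1 M))"
  using eventually_ge_at_top[of "d + G"]
 proof eventually_elim
  case (elim M)
  have "\<beta> * (\<gamma> * (real M)^2 - 3 * real M - 2 * real q) - real M <= real (card (progression_pairs q d x0 x1 M))"
   using card_progression_pairs_ge[OF q d_pos, of M x0 x1] x(1) elim(2) by (simp add: \<beta>_def \<gamma>_def)
  also have "... <= (\<Sum>g\<in>{1..M}. real (card (reduced_fractions q d x0 x1 (M div g))))"
   using card_progression_pairs_le[OF q d, of x0 x1 M] by (simp only: of_nat_sum[symmetric] of_nat_le_iff)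
  also have "... <= real G * real (card (reduced_fractions q d x0 x1 M)) + 2 / real G * (real M)^2"
   using x elim(2) by (intro sum_card_reduced_fractions_le G) auto
  also have "... <= real G * real (card (reduced_fractions q d x0 x1 M)) + w * (real M)^2"
   using tail by (intro add_left_mono mult_right_mono) auto
  finally have "\<beta> * (\<gamma> * (real M)^2 - 3 * real M - 2 * real q) - real M <= real G * real (card (reduced_fractions q d x0 x1 M)) + w * (real M)^2" .
  moreover have "\<beta> * (\<gamma> * (real M)^2 - 3 * real M - 2 * real q) - real M = 4 * (w * (real M)^2) - ((3 * \<beta> + 1) * real M + 2 * real q * \<beta>)"
   by (simp add: w_def algebra_simps)
  moreover have "w * (real M)^2 >= 0" using w_pos by simp
  ultimately have "w * (real M)^2 <= real G * real (card (reduced_fractions q d x0 x1 M))" using elim(1) by linarith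
  thus ?case using G(1) by (simp add: pos_divide_le_eq mult.commute)
 qed
 thus ?thesis using w_pos G(1) by (intro that[of "w / real G"]) auto
qed

section \<open>Removing the smooth weight\<close>

lemma has_real_derivative_If_le:
 assumes f: "!!x. (f has_real_derivative f' x) (at x)" and g: "!!x. (g has_real_derivative g' x) (at x)"
  and eq: "f a = g a" "f' a = g' a"
 shows "((%x. if x <= a then f x else g x) has_real_derivative (if x <= a then f' x else g' x)) (at x)"
proof -
 have "((%x. if x : {..a} then f x else g x) has_vector_derivative (if x : {..a} then f' x else g' x)) (at x within UNIV)"
 proof (rule has_vector_derivative_If_within_closures)
  show "UNIV = {..a} \<union> {a..}" by auto
 qed (use f g eq in \<open>auto simp flip: has_real_derivative_iff_has_vector_derivative intro: has_field_derivative_at_within\<close>)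
 thus ?thesis by (simp add: has_real_derivative_iff_has_vector_derivative)
qed

definition smoothstep :: "real => real" where
 "smoothstep x = (if x <= 0 then 0 else if x <= 1 then 10 * x^3 - 15 * x^4 + 6 * x^5 else 1)"

definition smoothstep' :: "real => real" where
 "smoothstep' x = (if x <= 0 then 0 else if x <= 1 then 30 * x^2 * (1 - x)^2 else 0)"

definition smoothstep'' :: "real => real" where
 "smoothstep'' x = (if x <= 0 then 0 else if x <= 1 then 60 * x * (1 - x) * (1 - 2 * x) else 0)"

lemma DERIV_smoothstep: "(smoothstep has_real_derivative smoothstep' x) (at x)"
 unfolding smoothstep_def[abs_def] smoothstep'_def
 by (intro has_real_derivative_If_le) (auto intro!: derivative_eq_intros simp: power2_eq_square power3_eq_cube power4_eq_xxxx algebra_simps)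

lemma DERIV_smoothstep': "(smoothstep' has_real_derivative smoothstep'' x) (at x)"
 unfolding smoothstep'_def[abs_def] smoothstep''_def
 by (intro has_real_derivative_If_le) (auto intro!: derivative_eq_intros simp: power2_eq_square algebra_simps)

lemma smoothstep''_eq: "smoothstep'' x = (let u = min 1 (max 0 x) in 60 * u * (1 - u) * (1 - 2 * u))"
 by (simp add: smoothstep''_def min_def max_def)

lemma continuous_on_smoothstep'': "continuous_on UNIV smoothstep''"
 unfolding smoothstep''_eq[abs_def] Let_def by (intro continuous_intros)

lemma smoothstep'_bounds: "0 <= smoothstep' x" "smoothstep' x <= 30"
proof -
 have "x^2 * (1 - x)^2 <= 1 * 1" if "0 <= x" "x <= 1" using that by (intro mult_mono power_le_one) auto
 thus "0 <= smoothstep' x" "smoothstep' x <= 30" by (auto simp: smoothstep'_def)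
qed

lemma abs_smoothstep''_le: "abs (smoothstep'' x) <= 60"
proof -
 have "abs x * abs (1 - x) * abs (1 - 2 * x) <= 1 * 1 * 1" if "0 <= x" "x <= 1" using that by (intro mult_mono) (auto simp: abs_le_iff)
 thus ?thesis by (simp add: smoothstep''_def abs_mult mult.assoc)
qed

lemma smoothstep_mono: "x <= y ==> smoothstep x <= smoothstep y"
 by (rule DERIV_nonneg_imp_nondecreasing) (use DERIV_smoothstep smoothstep'_bounds(1) in blast)+

lemma smoothstep_range: "0 <= smoothstep x" "smoothstep x <= 1"
 using smoothstep_mono[of "min x 0" x] smoothstep_mono[of x "max x 1"] by (auto simp: smoothstep_def)

lemma DERIV_smoothstep_difference:
 assumes S: "!!x. (S has_real_derivative S' x) (at x)"
 shows "((%x. S ((x - a) / h) - S ((x - b) / h)) has_real_derivative (S' ((x - a) / h) - S' ((x - b) / h)) / h) (at x)"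
proof -
 have "((%x. S ((x - c) / h)) has_real_derivative S' ((x - c) / h) * (1 / h)) (at x)" for c
  by (rule DERIV_chain2[OF S DERIV_cdivide]) (auto intro!: derivative_eq_intros)
 from DERIV_diff[OF this[of a] this[of b]] show ?thesis by (simp add: diff_divide_distrib)
qed

lemma smooth_weight_exists:
 assumes h: "h > 0" "h <= x1 - x0"
 obtains \<psi> \<psi>' \<psi>'' K' K'' where "smooth_weight \<psi> \<psi>' \<psi>'' x0 x1 K' K''" "ALL x:{x0 + h..x1 - h}. \<psi> x = 1"
proof -
 let ?a = "%x. (x - x0) / h" and ?b = "%x. (x - (x1 - h)) / h"
 define \<psi> where "\<psi> = (%x. smoothstep (?a x) - smoothstep (?b x))"
 define \<psi>' where "\<psi>' = (%x. (smoothstep' (?a x) - smoothstep' (?b x)) / h)"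
 define \<psi>'' where "\<psi>'' = (%x. (smoothstep'' (?a x) - smoothstep'' (?b x)) / h / h)"
 have b_le_a: "?b x <= ?a x" for x using h by (intro divide_right_mono) auto
 have "smooth_weight \<psi> \<psi>' \<psi>'' x0 x1 (30 / h) (120 / h / h)"
 proof
  show "(\<psi> has_real_derivative \<psi>' x) (at x)" for x unfolding \<psi>_def \<psi>'_def by (rule DERIV_smoothstep_difference[OF DERIV_smoothstep])
  show "(\<psi>' has_real_derivative \<psi>'' x) (at x)" for x
   unfolding \<psi>'_def \<psi>''_def by (rule DERIV_cdivide[OF DERIV_smoothstep_difference[OF DERIV_smoothstep']])
  show "continuous_on UNIV \<psi>''" unfolding \<psi>''_def by (intro continuous_intros continuous_on_compose2[OF continuous_on_smoothstep'']) (use h in auto)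
  show "\<psi> x = 0" "\<psi>' x = 0" if "x \<notin> {x0..x1}" for x
  proof -
   have "?a x <= 0 & ?b x <= 0 \<or> ?a x > 1 & ?b x > 1" using that h by (auto simp: divide_le_0_iff less_divide_eq)
   thus "\<psi> x = 0" "\<psi>' x = 0" by (auto simp: \<psi>_def \<psi>'_def smoothstep_def smoothstep'_def)
  qed
  show "0 <= \<psi> x" for x using smoothstep_mono[OF b_le_a, of x] by (simp add: \<psi>_def)
  show "\<psi> x <= 1" for x using smoothstep_range[of "?a x"] smoothstep_range[of "?b x"] by (simp add: \<psi>_def)
  show "abs (\<psi>' x) <= 30 / h" for x using smoothstep'_bounds[of "?a x"] smoothstep'_bounds[of "?b x"] h
   by (simp add: \<psi>'_def abs_le_iff divide_right_mono)
  show "abs (\<psi>'' x) <= 120 / h / h" for x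
  proof -
   have "abs (smoothstep'' (?a x) - smoothstep'' (?b x)) <= 120"
    using abs_triangle_ineq4[of "smoothstep'' (?a x)" "smoothstep'' (?b x)"] abs_smoothstep''_le[of "?a x"] abs_smoothstep''_le[of "?b x"] by linarith
   thus ?thesis using h by (simp add: \<psi>''_def abs_divide divide_right_mono)
  qed
 qed (use h in auto)
 moreover have "\<psi> x = 1" if "x : {x0 + h..x1 - h}" for x
 proof -
  have "?a x >= 1" "?b x <= 0" using that h by (auto simp: divide_le_0_iff le_divide_eq)
  thus ?thesis by (auto simp: \<psi>_def smoothstep_def)
 qed
 ultimately show ?thesis using that by blast
qed

context cusp_primitive
begin

lemma real_symbol_bound:
 assumes "coprime n (int c)" "c >= 1"
 shows "abs (real_symbol f (of_int n / real c)) <= 2 * pi * (4 * C + 2 * B * (ln (real c) + 1))"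
proof -
 let ?r = "of_int n / real c" and ?y = "1 / (real c)^2"
 have "abs (F (Complex ?r ?y) - real_symbol f ?r) <= 2 * pi * (2 * C + B * ln (2 * 1))"
  by (rule symbol_near_horocycle[of 1 c ?y c]) (use assms in auto)
 also have "... <= 2 * pi * (2 * C + B * 1)"
  using B_nonneg ln_le_minus_one[of 2] by (intro mult_left_mono add_left_mono) auto
 finally have "abs (F (Complex ?r ?y) - real_symbol f ?r) <= 2 * pi * (2 * C + B * 1)" .
 moreover have "abs (F (Complex ?r ?y)) <= 2 * pi * (2 * C + B * (2 * ln (real c) + 1))"
  using F_bound[of "Complex ?r ?y"] assms(2) by (simp add: ln_realpow divide_le_eq_1)
 ultimately have "abs (real_symbol f ?r) <= 2 * pi * (2 * C + B * (2 * ln (real c) + 1)) + 2 * pi * (2 * C + B * 1)"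
  by linarith
 thus ?thesis by (simp add: algebra_simps)
qed

abbreviation fraction_exp_sum :: "nat => real => real => real => nat => complex" where
 "fraction_exp_sum d x0 x1 \<tau> M == (\<Sum>(c,n)\<in>reduced_fractions q d x0 x1 M. symbol_phase (\<tau> / sqrt (ln (real c))) c n)"

definition frequency_error :: "real => real => nat => real" where
 "frequency_error \<tau> h M = \<tau> * (2 * pi * (4 * C + 2 * B * (ln (real M) + 1))) * (1 / sqrt (ln (h * real M)) - 1 / sqrt (ln (real M)))"

lemma frequency_error_limit: "h > 0 ==> frequency_error \<tau> h \<longlonglongrightarrow> 0"
 unfolding frequency_error_def by real_asymp

lemma frequency_error_nonneg:
 assumes "h <= 1" "1 < h * real M" "\<tau> >= 0"
 shows "0 <= frequency_error \<tau> h M"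
proof -
 have "h * real M <= 1 * real M" using assms by (intro mult_right_mono) auto
 hence logs: "0 < ln (h * real M)" "ln (h * real M) <= ln (real M)" using assms by auto
 hence "1 / sqrt (ln (real M)) <= 1 / sqrt (ln (h * real M))" by (simp add: frac_le)
 thus ?thesis using logs assms(3) B_nonneg C_nonneg by (simp add: frequency_error_def)
qed

lemma norm_cis_frequency_diff_le:
 assumes n: "coprime n (int c)" and c: "1 <= c" "c <= M" "h * real M < real c" and hM: "1 < h * real M" and \<tau>: "\<tau> >= 0"
 shows "norm (symbol_phase (\<tau> / sqrt (ln (real c))) c n - symbol_phase (\<tau> / sqrt (ln (real M))) c n)
  <= frequency_error \<tau> h M"
proof -
 let ?s = "real_symbol f (of_int n / real c)" and ?\<delta> = "1 / sqrt (ln (real c)) - 1 / sqrt (ln (real M))"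
 have logs: "0 < ln (h * real M)" "ln (h * real M) <= ln (real c)" "ln (real c) <= ln (real M)" using hM c by auto
 have \<delta>: "0 <= ?\<delta>" "?\<delta> <= 1 / sqrt (ln (h * real M)) - 1 / sqrt (ln (real M))" using logs by (simp_all add: frac_le)
 have s: "abs ?s <= 2 * pi * (4 * C + 2 * B * (ln (real M) + 1))"
 proof (rule order_trans[OF real_symbol_bound[OF n c(1)]])
  show "2 * pi * (4 * C + 2 * B * (ln (real c) + 1)) <= 2 * pi * (4 * C + 2 * B * (ln (real M) + 1))"
   using logs B_nonneg by (intro mult_left_mono add_left_mono add_right_mono) auto
 qed
 have "\<tau> / sqrt (ln (real c)) * ?s - \<tau> / sqrt (ln (real M)) * ?s = \<tau> * ?s * ?\<delta>" by (simp add: right_diff_distrib)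
 hence "norm (cis (\<tau> / sqrt (ln (real c)) * ?s) - cis (\<tau> / sqrt (ln (real M)) * ?s)) <= abs (\<tau> * ?s * ?\<delta>)" by (metis cis_lipschitz)
 also have "... = \<tau> * abs ?s * ?\<delta>" by (simp only: abs_mult abs_of_nonneg[OF \<delta>(1)] abs_of_nonneg[OF \<tau>])
 also have "... <= frequency_error \<tau> h M"
  unfolding frequency_error_def by (intro mult_mono mult_left_mono s \<delta> \<tau> mult_nonneg_nonneg abs_ge_zero order_trans[OF abs_ge_zero s])
 finally show ?thesis .
qed

end

lemma sum_gcd_class_if_le:
 assumes "x >= 0" "B >= 0"
 shows "(\<Sum>c\<in>gcd_class q d M. if real c <= x then B else 0) <= x * B"
proof -
 have "card (gcd_class q d M \<inter> {c. real c <= x}) <= card {1..nat \<lfloor>x\<rfloor>}"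
  by (rule card_mono) (auto simp: gcd_class_def le_nat_floor)
 hence "real (card (gcd_class q d M \<inter> {c. real c <= x})) <= x" using assms(1) by simp linarith
 thus ?thesis using assms(2) by (simp add: sum.If_cases mult_right_mono)
qed

context weighted_cusp_primitive
begin

definition reduced_term :: "real => nat => int => complex" where
 "reduced_term \<tau> c n = (if real c * X0 < of_int n & of_int n < real c * X1
  then symbol_phase (\<tau> / sqrt (ln (real c))) c n else 0)"

definition edge_numerators :: "real => nat => int set" where
 "edge_numerators h c = {n. real c * X0 <= of_int n & of_int n <= real c * (X0 + h)} \<union> {n. real c * (X1 - h) <= of_int n & of_int n <= real c * X1}"

lemma finite_edge_numerators: "finite (edge_numerators h c)"
 unfolding edge_numerators_def by (intro finite_UnI finite_int_between)

lemma sum_reduced_fractions_eq: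
 "fraction_exp_sum d X0 X1 \<tau> M
  = (\<Sum>c\<in>gcd_class q d M. \<Sum>n\<in>fraction_numerators X0 X1 c. reduced_term \<tau> c n)"
proof -
 have "(\<Sum>n | coprime n (int c) & real c * X0 < of_int n & of_int n < real c * X1. symbol_phase (\<tau> / sqrt (ln (real c))) c n)
  = (\<Sum>n\<in>fraction_numerators X0 X1 c. reduced_term \<tau> c n)" for c
  by (rule sum.mono_neutral_cong_left[OF finite_int_between_restrict(1)]) (auto simp: reduced_term_def)
 thus ?thesis unfolding reduced_fractions_eq_Sigma by (subst sum.Sigma[symmetric]) (auto intro: finite_int_between_restrict)
qed

lemma norm_term_diff_le:
 assumes h: "0 < h" "h < 1" and one: "ALL x:{X0 + h..X1 - h}. \<psi> x = 1" and \<tau>: "\<tau> >= 0"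
  and c: "c : gcd_class q d M" and hM: "1 < h * real M"
  and n: "coprime n (int c)" "real c * X0 <= of_int n" "of_int n <= real c * X1"
 shows "norm (reduced_term \<tau> c n - weighted_term (\<tau> / sqrt (ln (real M))) c n)
  <= 2 * indicator (edge_numerators h c) n + (if real c <= h * real M then 2 else 0) + frequency_error \<tau> h M"
proof (cases "n : edge_numerators h c \<or> real c <= h * real M")
 case True
 have "norm (weighted_term (\<tau> / sqrt (ln (real M))) c n) <= 1" using range[of "of_int n / real c"] by (simp add: norm_mult)
 moreover have "norm (reduced_term \<tau> c n) <= 1" by (simp add: reduced_term_def)
 ultimately have "norm (reduced_term \<tau> c n - weighted_term (\<tau> / sqrt (ln (real M))) c n) <= 2"
  using norm_triangle_ineq4[of "reduced_term \<tau> c n"] by (smt (verit))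
 thus ?thesis using True frequency_error_nonneg[OF less_imp_le[OF h(2)] hM \<tau>] by (auto simp: indicator_def)
next
 case False
 have c_bounds: "1 <= c" "c <= M" and c_pos: "real c > 0" using c by (auto simp: gcd_class_def)
 have inner: "real c * (X0 + h) < of_int n" "of_int n < real c * (X1 - h)" and large: "h * real M < real c"
  using False n by (auto simp: edge_numerators_def)
 have "real c * X0 < real c * (X0 + h)" "real c * (X1 - h) < real c * X1" using c_pos h by (auto intro!: mult_strict_left_mono)
 hence "reduced_term \<tau> c n = symbol_phase (\<tau> / sqrt (ln (real c))) c n" using inner by (simp add: reduced_term_def)
 moreover have "\<psi> (of_int n / real c) = 1" using inner c_pos by (intro bspec[OF one]) (auto simp: field_simps)
 hence "weighted_term (\<tau> / sqrt (ln (real M))) c n = symbol_phase (\<tau> / sqrt (ln (real M))) c n" by simp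
 ultimately show ?thesis using norm_cis_frequency_diff_le[OF n(1) c_bounds large hM \<tau>] False by simp
qed

lemma card_edge_numerators_le:
 assumes h: "h >= 0" and c: "c <= M"
 shows "real (card (edge_numerators h c)) <= 2 * (h * real M + 1)"
proof -
 have edges: "real c * X0 <= real c * (X0 + h) + 1" "real c * (X1 - h) <= real c * X1 + 1" using h by (auto simp: algebra_simps)
 have "card (edge_numerators h c) <= card {n::int. real c * X0 <= of_int n & of_int n <= real c * (X0 + h)}
  + card {n::int. real c * (X1 - h) <= of_int n & of_int n <= real c * X1}"
  unfolding edge_numerators_def by (rule card_Un_le)
 hence "real (card (edge_numerators h c)) <= 2 * (real c * h + 1)"
  using card_int_between_le[OF edges(1)] card_int_between_le[OF edges(2)] by (simp add: algebra_simps)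
 also have "real c * h <= real M * h" using h c by (intro mult_right_mono) auto
 finally show ?thesis by (simp add: mult.commute)
qed

lemma row_error_le:
 assumes h: "h >= 0" and \<epsilon>: "\<epsilon> >= 0" and c: "c : gcd_class q d M" and X: "X1 - X0 <= 1"
 shows "(\<Sum>n\<in>fraction_numerators X0 X1 c.
   2 * indicator (edge_numerators h c) n + (if real c <= h * real M then 2 else 0) + \<epsilon>)
  <= (4 * (h * real M + 1) + \<epsilon> * (2 * real M)) + (if real c <= h * real M then 4 * real M else 0)"
proof -
 let ?I = "fraction_numerators X0 X1 c"
 have I: "real (card ?I) <= 2 * real M" by (rule card_scaled_interval_le[OF c X0_le_X1 X])
 have "(\<Sum>n\<in>?I. indicator (edge_numerators h c) n :: real) = real (card (?I \<inter> edge_numerators h c))"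
  by (simp add: finite_int_between_restrict indicator_def sum.If_cases)
 also have "... <= real (card (edge_numerators h c))" by (intro of_nat_mono card_mono finite_edge_numerators) auto
 also have "... <= 2 * (h * real M + 1)" using c by (intro card_edge_numerators_le h) (auto simp: gcd_class_def)
 finally have edge: "(\<Sum>n\<in>?I. indicator (edge_numerators h c) n :: real) <= 2 * (h * real M + 1)" .
 have "(\<Sum>n\<in>?I. 2 * indicator (edge_numerators h c) n + (if real c <= h * real M then 2 else 0) + \<epsilon>)
  = 2 * (\<Sum>n\<in>?I. indicator (edge_numerators h c) n) + (if real c <= h * real M then 2 else 0) * real (card ?I) + \<epsilon> * real (card ?I)"
  by (simp add: sum.distrib sum_distrib_left)
 also have "... <= 2 * (2 * (h * real M + 1)) + (if real c <= h * real M then 2 else 0) * (2 * real M) + \<epsilon> * (2 * real M)"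
  using edge I \<epsilon> by (intro add_mono mult_left_mono) auto
 also have "... = (4 * (h * real M + 1) + \<epsilon> * (2 * real M)) + (if real c <= h * real M then 4 * real M else 0)" by simp
 finally show ?thesis .
qed

lemma norm_reduced_fractions_sum_diff_le:
 assumes h: "0 < h" "h < 1" and one: "ALL x:{X0 + h..X1 - h}. \<psi> x = 1" and X: "X1 - X0 <= 1" and \<tau>: "\<tau> >= 0" and hM: "1 < h * real M"
 shows "norm (fraction_exp_sum d X0 X1 \<tau> M
   - weighted_exp_sum d (\<tau> / sqrt (ln (real M))) M)
  <= real M * (4 * (h * real M + 1) + frequency_error \<tau> h M * (2 * real M)) + h * real M * (4 * real M)"
proof -
 let ?I = "%c. fraction_numerators X0 X1 c" and ?\<epsilon> = "frequency_error \<tau> h M"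
 have \<epsilon>: "0 <= ?\<epsilon>" by (rule frequency_error_nonneg[OF less_imp_le[OF h(2)] hM \<tau>])
 have "norm (fraction_exp_sum d X0 X1 \<tau> M
   - weighted_exp_sum d (\<tau> / sqrt (ln (real M))) M)
  <= (\<Sum>c\<in>gcd_class q d M. \<Sum>n\<in>?I c. 2 * indicator (edge_numerators h c) n + (if real c <= h * real M then 2 else 0) + ?\<epsilon>)"
  unfolding sum_reduced_fractions_eq weighted_exp_sum_def sum_subtractf[symmetric]
  by (intro sum_norm_le norm_term_diff_le[OF h one \<tau> _ hM]) auto
 also have "... <= (\<Sum>c\<in>gcd_class q d M. (4 * (h * real M + 1) + ?\<epsilon> * (2 * real M)) + (if real c <= h * real M then 4 * real M else 0))"
  using h(1) by (intro sum_mono row_error_le \<epsilon> X) auto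
 also have "... <= real M * (4 * (h * real M + 1) + ?\<epsilon> * (2 * real M)) + h * real M * (4 * real M)"
  unfolding sum.distrib[of "%_. 4 * (h * real M + 1) + ?\<epsilon> * (2 * real M)"] sum_constant using card_gcd_class[of q d M] h(1) \<epsilon>
  by (intro add_mono sum_gcd_class_if_le mult_right_mono) auto
 finally show ?thesis .
qed

lemma reduced_fractions_sum_vs_weighted:
 assumes h: "0 < h" "h < 1" and one: "ALL x:{X0 + h..X1 - h}. \<psi> x = 1" and X: "X1 - X0 <= 1" and \<tau>: "\<tau> >= 0"
 shows "\<forall>\<^sub>F M in sequentially. norm (fraction_exp_sum d X0 X1 \<tau> M
   - weighted_exp_sum d (\<tau> / sqrt (ln (real M))) M) <= 11 * h * (real M)^2"
proof -
 have "\<forall>\<^sub>F M in sequentially. 1 < h * real M" "\<forall>\<^sub>F M in sequentially. 4 * real M <= h * (real M)^2" using h by real_asymp+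
 thus ?thesis using order_tendstoD(2)[OF frequency_error_limit[OF h(1), of \<tau>] h(1)]
 proof eventually_elim
  case (elim M)
  have "real M * (4 * (h * real M + 1) + frequency_error \<tau> h M * (2 * real M)) + h * real M * (4 * real M)
   = 8 * h * (real M)^2 + 4 * real M + frequency_error \<tau> h M * (2 * (real M)^2)" by (simp add: power2_eq_square algebra_simps)
  also have "... <= 8 * h * (real M)^2 + h * (real M)^2 + h * (2 * (real M)^2)"
   using elim(2,3) h(1) by (intro add_mono mult_right_mono) auto
  finally show ?case using norm_reduced_fractions_sum_diff_le[OF h one X \<tau> elim(1), of d] by simp
 qed
qed

end

section \<open>Convergence in distribution\<close>

lemma (in cusp_form) real_symbol_periodic: "real_symbol f (r + of_int k) = real_symbol f r"
proof -
 have "f (Complex (r + of_int k) t) = f (Complex r t)" if "t > 0" for t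
 proof -
  have "Complex (r + of_int k) t = moeb (1,k,0,1) (Complex r t)" by (simp add: moeb_def complex_eq_iff)
  moreover have "(1,k,0,1) : Gamma0 q" by (simp add: Gamma0_def SL2Z_def)
  ultimately show ?thesis using f_automorphic[of "(1,k,0,1)" "Complex r t"] that by (simp add: UHP_def jfac_def)
 qed
 hence "(LBINT t:{0<..}. Im (f (Complex (r + of_int k) t))) = (LBINT t:{0<..}. Im (f (Complex r t)))"
  by (intro set_lebesgue_integral_cong) auto
 thus ?thesis by (simp add: real_symbol_def)
qed

definition mod_one :: "nat \<times> int => int \<times> int" where "mod_one = (%(c,n). (n mod int c, int c))"

lemma of_int_divide_mod: "c >= 1 ==> of_int n / real c = of_int (n mod int c) / real c + of_int (n div int c)"
proof -
 assume "c >= 1"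
 have "real_of_int n = of_int (n div int c) * real c + of_int (n mod int c)"
  by (metis div_mult_mod_eq of_int_add of_int_mult of_int_of_nat_eq)
 thus ?thesis using \<open>c >= 1\<close> by (simp add: field_simps)
qed

lemma finite_QdI [simp]: "finite (QdI q d J M)"
 by (rule finite_subset[of _ "{0..int M} \<times> {0..int M}"]) (auto simp: QdI_def)

lemma mod_eq_imp_eq_int:
 fixes n n' c :: int
 assumes "abs (n - n') < c" "n mod c = n' mod c"
 shows "n = n'"
proof (rule ccontr)
 assume "n ~= n'"
 moreover have "c dvd n - n'" using assms(2) by (simp add: mod_eq_dvd_iff)
 ultimately have "abs c <= abs (n - n')" by (intro dvd_imp_le_int) auto
 thus False using assms(1) by linarith
qed

lemma inj_on_mod_one:
 assumes "x1 - x0 <= 1"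
 shows "inj_on mod_one (reduced_fractions q d x0 x1 M)"
proof (rule inj_onI, clarify)
 fix c n c' n' assume cn: "(c,n) : reduced_fractions q d x0 x1 M" "(c',n') : reduced_fractions q d x0 x1 M" and eq: "mod_one (c,n) = mod_one (c',n')"
 have c: "c = c'" and residue: "n mod int c = n' mod int c" using eq by (auto simp: mod_one_def)
 have between: "real c * x0 < of_int n" "of_int n < real c * x1" "real c * x0 < of_int n'" "of_int n' < real c * x1"
  using cn by (auto simp: c reduced_fractions_def)
 have "real c * (x1 - x0) <= real c * 1" using assms by (intro mult_left_mono) auto
 hence "real c * x1 - real c * x0 <= real c" by (simp add: algebra_simps)
 hence "real_of_int (abs (n - n')) < real_of_int (int c)" using between by (simp add: abs_less_iff)
 hence "abs (n - n') < int c" by (simp only: of_int_less_iff)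
 from mod_eq_imp_eq_int[OF this residue] c show "c = c' & n = n'" by simp
qed

lemma mod_one_in_QdI:
 assumes J: "{x0<..<x1} <= J" and cn: "(c,n) : reduced_fractions q d x0 x1 M"
 shows "mod_one (c,n) : QdI q d J M"
proof -
 have c: "1 <= c" "c <= M" "gcd c q = d" "coprime n (int c)" and n: "real c * x0 < of_int n" "of_int n < real c * x1"
  using cn by (auto simp: reduced_fractions_def gcd_class_def)
 have "of_int n / real c : {x0<..<x1}" using c(1) n by (auto simp: field_simps)
 hence "of_int (n mod int c) / of_int (int c) + of_int (n div int c) : J" using J of_int_divide_mod[OF c(1), of n] by auto
 hence "EX k::int. of_int (n mod int c) / of_int (int c) + of_int k : J" by blast
 moreover have "gcd (n mod int c) (int c) = 1" using c(4) by (metis coprime_iff_gcd_eq_1 gcd.commute gcd_red_int)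
 moreover have "gcd (int c) (int q) = int d" using c(3) by simp
 ultimately show ?thesis using c(1,2) by (simp add: mod_one_def QdI_def)
qed

definition QdI_at :: "nat => nat => real set => nat => real => (int \<times> int) set" where
 "QdI_at q d J M x = {(a,c) : QdI q d J M. EX k::int. of_int a / of_int c + of_int k = x}"

lemma finite_QdI_at: "finite (QdI_at q d J M x)"
 by (rule finite_subset[OF _ finite_QdI]) (auto simp: QdI_at_def)

lemma card_QdI_at_le: "card (QdI_at q d J M x) <= M"
proof -
 have "inj_on snd (QdI_at q d J M x)"
 proof (rule inj_onI, clarsimp)
  fix a c a' assume ac: "(a,c) : QdI_at q d J M x" "(a',c) : QdI_at q d J M x"
  have c: "1 <= c" "0 <= a" "a < c" "0 <= a'" "a' < c" using ac by (auto simp: QdI_at_def QdI_def)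
  obtain k k' :: int where "of_int a / of_int c + of_int k = x" "of_int a' / of_int c + of_int k' = x" using ac by (auto simp: QdI_at_def)
  hence "of_int a / of_int c + of_int k = of_int a' / of_int c + real_of_int k'" by simp
  hence "real_of_int (a + k * c) = real_of_int (a' + k' * c)" using c(1) by (simp add: field_simps)
  hence "(a + k * c) mod c = (a' + k' * c) mod c" by (simp only: of_int_eq_iff)
  thus "a = a'" using c by simp
 qed
 moreover have "snd ` QdI_at q d J M x <= {1..int M}" by (auto simp: QdI_at_def QdI_def)
 ultimately have "card (QdI_at q d J M x) <= card {1..int M}" by (rule card_inj_on_le) simp
 thus ?thesis by simp
qed

lemma QdI_cases:
 assumes J: "J <= {x0..x1}" and w: "w : QdI q d J M"
 shows "w : mod_one ` reduced_fractions q d x0 x1 M \<union> QdI_at q d J M x0 \<union> QdI_at q d J M x1"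
proof -
 obtain a c where w_eq: "w = (a, int c)" and ac: "1 <= c" "c <= M" "0 <= a" "a < int c" "gcd a (int c) = 1" "gcd c q = d"
  using w by (cases w) (auto simp: QdI_def elim!: zero_le_imp_eq_int[OF order_trans[OF zero_le_one], THEN exE])
 obtain k :: int where "of_int a / of_int (int c) + of_int k : J" using w by (auto simp: w_eq QdI_def)
 moreover have eq: "of_int a / of_int (int c) + of_int k = of_int (a + k * int c) / real c" using ac(1) by (simp add: field_simps)
 ultimately have "of_int (a + k * int c) / real c : {x0..x1}" using J by auto
 then consider "of_int (a + k * int c) / real c : {x0, x1}" | "of_int (a + k * int c) / real c : {x0<..<x1}" by fastforce
 thus ?thesis
 proof cases
  case 1
  thus ?thesis using w eq unfolding QdI_at_def w_eq by auto
 next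
  case 2
  hence "real c * x0 < of_int (a + k * int c)" "of_int (a + k * int c) < real c * x1" using ac(1) by (simp_all add: field_simps)
  moreover have "coprime (a + k * int c) (int c)" using ac(5) by (metis coprime_iff_gcd_eq_1 gcd.commute gcd_add_mult add.commute mult.commute)
  ultimately have "(c, a + k * int c) : reduced_fractions q d x0 x1 M" using ac by (simp add: reduced_fractions_def gcd_class_def)
  moreover have "mod_one (c, a + k * int c) = w" using ac by (simp add: mod_one_def w_eq)
  ultimately show ?thesis by force
 qed
qed

lemma norm_sum_QdI_diff_le:
 fixes g :: "int \<times> int => complex"
 assumes x: "x1 - x0 <= 1" and J: "{x0<..<x1} <= J" "J <= {x0..x1}" and g: "!!w. norm (g w) <= 1"
 shows "norm (sum g (QdI q d J M) - (\<Sum>z\<in>reduced_fractions q d x0 x1 M. g (mod_one z))) <= 2 * real M"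
proof -
 let ?Q = "QdI q d J M" and ?I = "mod_one ` reduced_fractions q d x0 x1 M"
 have "?I <= ?Q" using mod_one_in_QdI[OF J(1)] by auto
 hence "sum g (?Q - ?I) = sum g ?Q - sum g ?I" by (rule sum_diff[OF finite_QdI])
 moreover have "sum g ?I = (\<Sum>z\<in>reduced_fractions q d x0 x1 M. g (mod_one z))" by (simp add: sum.reindex[OF inj_on_mod_one[OF x]])
 moreover have "norm (sum g (?Q - ?I)) <= of_nat (card (?Q - ?I)) * 1" using g by (rule sum_norm_bound)
 moreover have "?Q - ?I <= QdI_at q d J M x0 \<union> QdI_at q d J M x1" using QdI_cases[OF J(2)] by blast
 hence "card (?Q - ?I) <= card (QdI_at q d J M x0 \<union> QdI_at q d J M x1)" by (intro card_mono) (simp_all add: finite_QdI_at)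
 hence "card (?Q - ?I) <= 2 * M"
  using card_Un_le[of "QdI_at q d J M x0" "QdI_at q d J M x1"] card_QdI_at_le[of q d J M x0] card_QdI_at_le[of q d J M x1] by linarith
 ultimately show ?thesis by simp
qed

lemma card_reduced_fractions_le_QdI:
 assumes "x1 - x0 <= 1" "{x0<..<x1} <= J"
 shows "card (reduced_fractions q d x0 x1 M) <= card (QdI q d J M)"
 using mod_one_in_QdI[OF assms(2)] by (intro card_inj_on_le[OF inj_on_mod_one[OF assms(1)]]) auto

context cusp_primitive
begin

lemma cis_normalized_symbol_mod_one:
 assumes "c >= 1"
 shows "(case mod_one (c,n) of (a,c) => cis (t * normalized_symbol K f (of_int a / of_int c) c))
  = symbol_phase (t / sqrt (abs K) / sqrt (ln (real c))) c n"
proof -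
 have "real_symbol f (of_int n / real c) = real_symbol f (of_int (n mod int c) / real c)"
  by (subst of_int_divide_mod[OF assms]) (rule real_symbol_periodic)
 thus ?thesis by (simp add: mod_one_def normalized_symbol_eq_real_symbol real_sqrt_mult)
qed

lemma reduced_fractions_exp_sum_asymp:
 assumes vol: "hyp_vol D > 0" and x: "x0 < x1" "x1 - x0 <= 1" and \<tau>: "\<tau> >= 0" and \<epsilon>: "\<epsilon> > 0"
 shows "\<forall>\<^sub>F M in sequentially. norm (fraction_exp_sum d x0 x1 \<tau> M
  - of_real (exp (- 8 * pi^2 * mean_energy * \<tau>^2)) * of_nat (card (reduced_fractions q d x0 x1 M))) <= \<epsilon> * (real M)^2"
proof -
 let ?\<theta> = "exp (- 8 * pi^2 * mean_energy * \<tau>^2)"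
 define h where "h = min (1 / 2) (min (x1 - x0) (\<epsilon> / 23))"
 have h: "0 < h" "h < 1" "h <= x1 - x0" "23 * h <= \<epsilon>" using x \<epsilon> by (auto simp: h_def min_def)
 have \<theta>: "0 <= ?\<theta>" "?\<theta> <= 1" using mean_energy_nonneg by auto
 obtain \<psi> \<psi>' \<psi>'' K' K'' where weight: "smooth_weight \<psi> \<psi>' \<psi>'' x0 x1 K' K''" and one: "ALL x:{x0 + h..x1 - h}. \<psi> x = 1"
  using smooth_weight_exists[OF h(1,3)] by blast
 interpret weighted_cusp_primitive q D f G B C \<psi> \<psi>' \<psi>'' x0 x1 K' K''
  using weight by (intro weighted_cusp_primitive.intro cusp_primitive_axioms)
 show ?thesis using weighted_exp_sum_asymp[OF vol \<tau> h(1), of d] reduced_fractions_sum_vs_weighted[OF h(1,2) one x(2) \<tau>, of d]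
  reduced_fractions_sum_vs_weighted[OF h(1,2) one x(2) order_refl, of d]
 proof eventually_elim
  case (elim M)
  let ?S = "reduced_fractions q d x0 x1 M" and ?W = "weighted_exp_sum d (\<tau> / sqrt (ln (real M))) M" and ?Z = "weighted_exp_sum d 0 M"
  let ?E = "fraction_exp_sum d x0 x1 \<tau> M"
  have "norm (of_nat (card ?S) - ?Z) <= 11 * h * (real M)^2" using elim(3) by (simp add: case_prod_unfold)
  hence damped: "norm (of_real ?\<theta> * (?Z - of_nat (card ?S)) :: complex) <= 11 * h * (real M)^2"
   unfolding norm_mult norm_of_real norm_minus_commute[of ?Z] using \<theta> by (intro order_trans[OF mult_left_le_one_le]) auto
  have decomposition: "?E - of_real ?\<theta> * of_nat (card ?S) = (?E - ?W) + (?W - of_real ?\<theta> * ?Z) + of_real ?\<theta> * (?Z - of_nat (card ?S))"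
   by (simp add: algebra_simps)
  have "norm (?E - of_real ?\<theta> * of_nat (card ?S)) <= 11 * h * (real M)^2 + h * (real M)^2 + 11 * h * (real M)^2"
   unfolding decomposition by (intro norm_triangle_mono elim(1,2) damped)
  also have "... = 23 * h * (real M)^2" by simp
  also have "... <= \<epsilon> * (real M)^2" using h(4) by (rule mult_right_mono) simp
  finally show ?case .
 qed
qed

lemma variance_normalization:
 assumes pet: "petersson_sq D f > 0" and vol: "hyp_vol D > 0"
 shows "8 * pi^2 * mean_energy * (t / sqrt (abs (C_const D f)))^2 = t^2 / 2"
proof -
 have "abs (C_const D f) = 16 * pi^2 * mean_energy" using pet vol by (simp add: C_const_def mean_energy_def abs_mult)
 moreover have "mean_energy > 0" using pet vol by (simp add: mean_energy_def)
 ultimately show ?thesis by (simp add: power_divide)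
qed

lemma QdI_exp_sum_asymp:
 assumes pet: "petersson_sq D f > 0" and vol: "hyp_vol D > 0" and x: "x0 < x1" "x1 - x0 <= 1"
  and J: "{x0<..<x1} <= J" "J <= {x0..x1}" and t: "t >= 0" and \<epsilon>: "\<epsilon> > 0"
 shows "\<forall>\<^sub>F M in sequentially. norm ((\<Sum>(a,c)\<in>QdI q d J M. cis (t * normalized_symbol (C_const D f) f (of_int a / of_int c) c))
  - of_real (exp (- (t^2) / 2)) * of_nat (card (QdI q d J M))) <= \<epsilon> * (real M)^2"
proof -
 let ?g = "%(a,c). cis (t * normalized_symbol (C_const D f) f (of_int a / of_int c) c)" and ?\<theta> = "exp (- (t^2) / 2)"
 define \<tau> where "\<tau> = t / sqrt (abs (C_const D f))"
 have \<tau>: "\<tau> >= 0" using t by (simp add: \<tau>_def)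
 have \<theta>: "- 8 * pi^2 * mean_energy * \<tau>^2 = - (t^2) / 2" using variance_normalization[OF pet vol, of t] by (simp add: \<tau>_def)
 have "\<forall>\<^sub>F M in sequentially. 4 * real M <= \<epsilon> / 2 * (real M)^2" using \<epsilon> by real_asymp
 thus ?thesis using reduced_fractions_exp_sum_asymp[OF vol x \<tau> half_gt_zero[OF \<epsilon>], of d, unfolded \<theta>]
 proof eventually_elim
  case (elim M)
  let ?Q = "QdI q d J M" and ?S = "reduced_fractions q d x0 x1 M"
  have terms: "(\<Sum>z\<in>?S. ?g (mod_one z)) = fraction_exp_sum d x0 x1 \<tau> M"
   by (rule sum.cong) (auto simp: \<tau>_def reduced_fractions_def gcd_class_def cis_normalized_symbol_mod_one)
  have "norm (sum ?g ?Q - (\<Sum>z\<in>?S. ?g (mod_one z))) <= 2 * real M" by (rule norm_sum_QdI_diff_le[OF x(2) J]) (simp add: case_prod_unfold)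
  moreover have "norm (of_nat (card ?Q) - of_nat (card ?S) :: complex) <= 2 * real M" using norm_sum_QdI_diff_le[OF x(2) J, of "%_. 1"] by simp
  hence "norm (of_real ?\<theta> * (of_nat (card ?S) - of_nat (card ?Q)) :: complex) <= 2 * real M"
   unfolding norm_mult norm_of_real norm_minus_commute[of "of_nat (card ?S)"] by (intro order_trans[OF mult_left_le_one_le]) auto
  moreover have "sum ?g ?Q - of_real ?\<theta> * of_nat (card ?Q) = (sum ?g ?Q - (\<Sum>z\<in>?S. ?g (mod_one z)))
   + ((\<Sum>z\<in>?S. ?g (mod_one z)) - of_real ?\<theta> * of_nat (card ?S)) + of_real ?\<theta> * (of_nat (card ?S) - of_nat (card ?Q))"
   by (simp add: algebra_simps)
  ultimately have "norm (sum ?g ?Q - of_real ?\<theta> * of_nat (card ?Q)) <= 2 * real M + \<epsilon> / 2 * (real M)^2 + 2 * real M"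
   using elim(2) unfolding terms by (simp only:) (intro norm_triangle_mono)
  thus ?case using elim(1) by linarith
 qed
qed

lemma QdI_mean_exp_limit:
 assumes pet: "petersson_sq D f > 0" and vol: "hyp_vol D > 0" and d: "d dvd q" and x: "x0 < x1" "x1 - x0 <= 1"
  and J: "{x0<..<x1} <= J" "J <= {x0..x1}" and t: "t >= 0"
 shows "(%M. (\<Sum>(a,c)\<in>QdI q d J M. cis (t * normalized_symbol (C_const D f) f (of_int a / of_int c) c)) / of_nat (card (QdI q d J M)))
  \<longlonglongrightarrow> of_real (exp (- (t^2) / 2))"
proof (rule tendstoI)
 fix \<epsilon> :: real assume \<epsilon>: "\<epsilon> > 0"
 let ?\<theta> = "of_real (exp (- (t^2) / 2)) :: complex"
 let ?E = "%M. \<Sum>(a,c)\<in>QdI q d J M. cis (t * normalized_symbol (C_const D f) f (of_int a / of_int c) c)" and ?n = "%M. card (QdI q d J M)"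
 obtain \<kappa> where \<kappa>: "\<kappa> > 0" and lower: "\<forall>\<^sub>F M in sequentially. \<kappa> * (real M)^2 <= real (card (reduced_fractions q d x0 x1 M))"
  by (rule card_reduced_fractions_lower[OF q_pos d x])
 have "\<forall>\<^sub>F M in sequentially. norm (?E M - ?\<theta> * of_nat (?n M)) <= \<epsilon> * \<kappa> / 2 * (real M)^2"
  by (rule QdI_exp_sum_asymp[OF pet vol x J t]) (use \<epsilon> \<kappa> in simp)
 thus "\<forall>\<^sub>F M in sequentially. dist (?E M / of_nat (?n M)) ?\<theta> < \<epsilon>"
  using lower eventually_ge_at_top[of 1]
 proof eventually_elim
  case (elim M)
  have "real (card (reduced_fractions q d x0 x1 M)) <= real (?n M)" using card_reduced_fractions_le_QdI[OF x(2) J(1)] by simp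
  hence n: "\<kappa> * (real M)^2 <= real (?n M)" using elim(2) by linarith
  moreover have "\<kappa> * (real M)^2 > 0" using \<kappa> elim(3) by simp
  ultimately have n_pos: "real (?n M) > 0" by linarith
  have "norm (?E M - ?\<theta> * of_nat (?n M)) <= \<epsilon> / 2 * (\<kappa> * (real M)^2)" using elim(1) by simp
  also have "... <= \<epsilon> / 2 * real (?n M)" using n \<epsilon> by (intro mult_left_mono) auto
  also have "... < \<epsilon> * real (?n M)" using \<epsilon> n_pos by simp
  finally have "norm (?E M - ?\<theta> * of_nat (?n M)) < \<epsilon> * real (?n M)" .
  moreover have "?E M / of_nat (?n M) - ?\<theta> = (?E M - ?\<theta> * of_nat (?n M)) / of_nat (?n M)" using n_pos by (simp add: diff_divide_distrib card_gt_0_iff)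
  ultimately show ?case using n_pos unfolding dist_norm by (simp add: norm_divide pos_divide_less_eq)
 qed
qed

end

lemma frontier_ereal_interval:
 fixes a0 b0 :: ereal
 defines "A \<equiv> {t::real. a0 <= ereal t & ereal t <= b0}"
 shows "A : sets borel" "frontier A <= {real_of_ereal a0, real_of_ereal b0}"
proof -
 have "closed A" unfolding A_def by (intro closed_Collect_conj closed_Collect_le continuous_intros)
 thus "A : sets borel" by (rule borel_closed)
 have "open {t::real. a0 < ereal t & ereal t < b0}" by (intro open_Collect_conj open_Collect_less continuous_intros)
 moreover have "{t::real. a0 < ereal t & ereal t < b0} <= A" by (auto simp: A_def)
 ultimately have inner: "{t::real. a0 < ereal t & ereal t < b0} <= interior A" by (rule interior_maximal[rotated])
 show "frontier A <= {real_of_ereal a0, real_of_ereal b0}"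
 proof
  fix t assume "t : frontier A"
  hence boundary: "t : A" "t \<notin> interior A" using \<open>closed A\<close> by (auto simp: frontier_def)
  hence "~ (a0 < ereal t & ereal t < b0)" using inner by blast
  hence "a0 = ereal t \<or> b0 = ereal t" using boundary(1) by (auto simp: A_def)
  thus "t : {real_of_ereal a0, real_of_ereal b0}" by auto
 qed
qed

lemma std_normal_null: "finite S ==> emeasure std_normal_distribution S = 0"
 by (simp add: emeasure_density finite_imp_null_set_lborel nn_integral_null_set borel_closed finite_imp_closed)

lemma std_normal_measure:
 assumes [measurable]: "A : sets borel"
 shows "measure std_normal_distribution A = (LBINT t:A. exp (- (t\<^sup>2) / 2)) / sqrt (2 * pi)"
proof -
 interpret real_distribution std_normal_distribution by (rule real_dist_normal_dist)
 have "measure std_normal_distribution A = (LINT x|std_normal_distribution. indicator A x)" by simp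
 also have "... = (LBINT x. std_normal_density x * indicator A x)"
  by (subst integral_density) auto
 also have "... = (LBINT x. (indicator A x *\<^sub>R exp (- (x\<^sup>2) / 2)) / sqrt (2 * pi))"
  by (rule Bochner_Integration.integral_cong) (simp_all add: std_normal_density_def)
 finally show ?thesis by (simp add: set_lebesgue_integral_def)
qed

definition uniform_distr :: "'a set => ('a => real) => real measure" where
 "uniform_distr S X = distr (measure_pmf (pmf_of_set S)) borel X"

lemma real_distribution_uniform_distr: "real_distribution (uniform_distr S X)"
 unfolding uniform_distr_def real_distribution_def real_distribution_axioms_def by (auto intro!: measure_pmf.prob_space_distr)

lemma char_uniform_distr:
 assumes S: "finite S" "S ~= {}"
 shows "char (uniform_distr S X) t = (\<Sum>p\<in>S. cis (t * X p)) / of_nat (card S)"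
proof -
 have "char (uniform_distr S X) t = (CLINT p|measure_pmf (pmf_of_set S). cis (t * X p))"
  unfolding char_def uniform_distr_def by (subst integral_distr) (auto simp: cis_conv_exp)
 also have "... = (\<Sum>p\<in>S. pmf (pmf_of_set S) p *\<^sub>R cis (t * X p))"
  by (rule integral_measure_pmf[OF S(1)]) (use S in \<open>simp add: set_pmf_of_set\<close>)
 also have "... = (\<Sum>p\<in>S. cis (t * X p) / of_nat (card S))"
  by (rule sum.cong) (use S in \<open>auto simp: scaleR_conv_of_real\<close>)
 finally show ?thesis by (simp add: sum_divide_distrib)
qed

lemma measure_uniform_distr:
 assumes S: "finite S" "S ~= {}" and A: "A : sets borel"
 shows "measure (uniform_distr S X) A = real (card {p\<in>S. X p : A}) / real (card S)"
proof -
 have "measure (uniform_distr S X) A = measure (measure_pmf (pmf_of_set S)) (X -` A)"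
  unfolding uniform_distr_def using A by (subst measure_distr) auto
 also have "... = real (card (S \<inter> X -` A)) / real (card S)" by (rule measure_pmf_of_set[OF S(2,1)])
 also have "S \<inter> X -` A = {p\<in>S. X p : A}" by auto
 finally show ?thesis .
qed

lemma mean_exp_limit_even:
 assumes "(%M. (\<Sum>p\<in>S M. cis (t * X p)) / of_nat (card (S M))) \<longlonglongrightarrow> of_real (exp (- (t^2) / 2))"
 shows "(%M. (\<Sum>p\<in>S M. cis (- t * X p)) / of_nat (card (S M))) \<longlonglongrightarrow> of_real (exp (- ((- t)^2) / 2))"
 using tendsto_cnj[OF assms] by (simp add: cis_cnj)

lemma proportion_tendsto_std_normal:
 fixes X :: "'a => real"
 assumes fin: "!!M. finite (S M)"
  and mean: "!!t. t >= 0 ==> (%M. (\<Sum>p\<in>S M. cis (t * X p)) / of_nat (card (S M))) \<longlonglongrightarrow> of_real (exp (- (t^2) / 2))"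
  and A: "A : sets borel" "emeasure std_normal_distribution (frontier A) = 0"
 shows "(%M. real (card {p\<in>S M. X p : A}) / real (card (S M))) \<longlonglongrightarrow> (LBINT t:A. exp (- (t^2) / 2)) / sqrt (2 * pi)"
proof -
 have nonempty: "\<forall>\<^sub>F M in sequentially. S M ~= {}"
  using tendsto_imp_eventually_ne[OF mean[of 0], of 0] by (auto elim!: eventually_mono)
 have "weak_conv_m (%M. uniform_distr (S M) X) std_normal_distribution"
 proof (rule levy_continuity[OF real_distribution_uniform_distr real_dist_normal_dist])
  fix t
  have "(%M. (\<Sum>p\<in>S M. cis (t * X p)) / of_nat (card (S M))) \<longlonglongrightarrow> of_real (exp (- (t^2) / 2))"
   using mean[of t] mean_exp_limit_even[OF mean[of "- t"]] by (cases "t >= 0") auto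
  moreover have "\<forall>\<^sub>F M in sequentially. (\<Sum>p\<in>S M. cis (t * X p)) / of_nat (card (S M)) = char (uniform_distr (S M) X) t"
   using nonempty by eventually_elim (simp add: char_uniform_distr fin)
  ultimately show "(%M. char (uniform_distr (S M) X) t) \<longlonglongrightarrow> char std_normal_distribution t"
   unfolding char_std_normal_distribution by (rule Lim_transform_eventually)
 qed
 hence "(%M. measure (uniform_distr (S M) X) A) \<longlonglongrightarrow> measure std_normal_distribution A"
  by (intro weak_conv_imp_continuity_set_conv[OF real_distribution_uniform_distr real_dist_normal_dist] A)
 moreover have "\<forall>\<^sub>F M in sequentially. measure (uniform_distr (S M) X) A = real (card {p\<in>S M. X p : A}) / real (card (S M))"
  using nonempty by eventually_elim (simp add: measure_uniform_distr fin A(1))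
 ultimately show ?thesis unfolding std_normal_measure[OF A(1)] by (rule Lim_transform_eventually)
qed

theorem theorem1p6:
  fixes q d :: nat and f :: "complex \<Rightarrow> complex" and D :: "complex set"
    and J :: "real set" and x0 x1 :: real and a0 b0 :: ereal
  assumes "q \<ge> 1" and "squarefree q"
    and "cusp_form2 q f" and "\<exists>z\<in>UHP. f z \<noteq> 0"
    and "fund_domain q D"
    and "d dvd q"
    and "x0 < x1" and "x1 - x0 \<le> 1" and "{x0<..<x1} \<subseteq> J" and "J \<subseteq> {x0..x1}"
    and "a0 \<le> b0"
  shows "(\<lambda>M. real (card {(a,c) \<in> QdI q d J M.
                 ereal (normalized_symbol (C_const D f) f (real_of_int a / real_of_int c) c) \<in> {a0..b0}})
              / real (card (QdI q d J M)))
         \<longlonglongrightarrow> (LINT t:{t. a0 \<le> ereal t \<and> ereal t \<le> b0}|lborel. (exp (- (t\<^sup>2) / 2))) / sqrt (2 * pi)"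
proof -
 interpret fundamental_domain q D using assms by (simp add: fundamental_domain_def)
 interpret cusp_form q f using assms by (simp add: cusp_form_def)
 obtain G B C where "cusp_primitive q D f G B C" by (rule cusp_primitive_exists[OF fundamental_domain_axioms])
 then interpret cusp_primitive q D f G B C .
 define X where "X = (%(a,c). normalized_symbol (C_const D f) f (of_int a / of_int c) c)"
 let ?A = "{t. a0 <= ereal t & ereal t <= b0}"
 have "(%M. (\<Sum>w\<in>QdI q d J M. cis (t * X w)) / of_nat (card (QdI q d J M))) \<longlonglongrightarrow> of_real (exp (- (t^2) / 2))" if "t >= 0" for t
  using QdI_mean_exp_limit[OF petersson_sq_pos hyp_vol_pos] assms that by (simp add: X_def case_prod_unfold)
 moreover have "emeasure std_normal_distribution (frontier ?A) = 0"
  by (rule std_normal_null, rule finite_subset[OF frontier_ereal_interval(2)]) simp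
 ultimately have "(%M. real (card {w\<in>QdI q d J M. X w : ?A}) / real (card (QdI q d J M))) \<longlonglongrightarrow> (LBINT t:?A. exp (- (t^2) / 2)) / sqrt (2 * pi)"
  by (intro proportion_tendsto_std_normal frontier_ereal_interval(1) finite_QdI)
 thus ?thesis by (simp add: X_def case_prod_unfold)
qed

end
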